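(* Let constants $a,b>0$ satisfy $a+b<\tfrac12$. Then there is a constant $\varepsilon=\varepsilon(a,b)>0$ such that the following holds. Let $(\mathcal{D},\mathcal{D}')$ be a pair of probability spaces on $I_{m,n}$ in one of the following cases: (a) $(m,n,p)$ is $(a,\varepsilon)$-acceptable and $(\mathcal{D},\mathcal{D}')=(\mathcal{G}_p,\mathcal{V}_p)$; (b) $m=n$, $(n,n,p)$ is $(a,\varepsilon)$-acceptable and $(\mathcal{D},\mathcal{D}')=(\vec{\mathcal{G}}_p,\vec{\mathcal{V}}_p)$; (c) $(m,n,k/(mn))$ is $(a,\varepsilon)$-acceptable and $(\mathcal{D},\mathcal{D}')=(\mathcal{G}_k,\mathcal{B}_k)$; (d) $m=n$, $(n,n,k/n^2)$ is $(a,\varepsilon)$-acceptable and $(\mathcal{D},\mathcal{D}')=(\vec{\mathcal{G}}_k,\vec{\mathcal{B}}_k)$. Then there is an event $B=B(\mathcal{D})\subseteq I_{m,n}$ with $\operatorname{Prob}_{\mathcal{D}}(B)=\tilde{o}(1)$ such that, uniformly for $(\boldsymbol{s},\boldsymbol{t})\in I_{m,n}\setminus B$, \[ \operatorname{Prob}_{\mathcal{D}}(\boldsymbol{S}=\boldsymbol{s}\wedge\boldsymbol{T}=\boldsymbol{t})=\bigl(1+O(n^{-b})\bigr)\operatorname{Prob}_{\mathcal{D}'}(\boldsymbol{S}=\boldsymbol{s}\wedge\boldsymbol{T}=\boldsymbol{t}). \] Moreover, for any random variable $X:I_{m,n}\to\mathbb{R}$ and any event $E\subseteq I_{m,n}$,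 \begin{align*} \operatorname{Prob}_{\mathcal{D}}(E)&=\bigl(1+O(n^{-b})\bigr)\operatorname{Prob}_{\mathcal{D}'}(E)+\tilde{o}(1),\\ \mathbb{E}_{\mathcal{D}}(X)&=\mathbb{E}_{\mathcal{D}'}(X)+O(n^{-b})\,\mathbb{E}_{\mathcal{D}'}(|X|)+\tilde{o}(1)\max_{(\boldsymbol{s},\boldsymbol{t})\in I_{m,n}}|X|,\\ \operatorname{Var}_{\mathcal{D}}(X)&=\bigl(1+O(n^{-b})\bigr)\operatorname{Var}_{\mathcal{D}'}(X)+\tilde{o}(1)\max_{(\boldsymbol{s},\boldsymbol{t})\in I_{m,n}}X^2. \end{align*}
   Context: Asymptotics: $m,n,p,k$ are functions of an index $\ell\to\infty$; all $O(\cdot),o(\cdot)$ refer to $\ell\to\infty$. $\tilde{o}(1)$ denotes any quantity of magnitude $O(e^{-n^c})$ for some constant $c>0$ (possibly different at each occurrence). $q=1-p$. Setting: $U=\{u_1,\dots,u_m\}$, $V=\{v_1,\dots,v_n\}$. For a bipartite graph on $U\cup V$, $S_i$ is the degree of $u_i$ and $T_j$ the degree of $v_j$; $\boldsymbol{S}=(S_1,\dots,S_m)$, $\boldsymbol{T}=(T_1,\dots,T_n)$. $I_n=\{0,\dots,n\}$, $I_{m,n}=I_n^m\times I_m^n$. Models (distributions of $(\boldsymbol{S},\boldsymbol{T})$ on $I_{m,n}$): - $\mathcal{G}_p$: each of the $mn$ edges $u_iv_j$ present independently with probability $p$. $\vec{\mathcal{G}}_p$ ($m=n$): edges $u_iv_i$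 forbidden, the other $n^2-n$ edges present independently with probability $p$ (equivalently, loop-free digraphs with in/out-degrees). - $\mathcal{G}_k$: uniform over bipartite graphs on $U\cup V$ with exactly $k$ edges; $\vec{\mathcal{G}}_k$ ($m=n$): uniform over such graphs with $k$ edges none of the form $u_iv_i$. - $\mathcal{I}_p$: $S_i\sim\mathrm{Bin}(n,p)$, $T_j\sim\mathrm{Bin}(m,p)$, all independent; $\vec{\mathcal{I}}_p$ ($m=n$): all $2n$ components independent $\mathrm{Bin}(n-1,p)$. - $\mathcal{B}_p$ (resp. $\vec{\mathcal{B}}_p$): $\mathcal{I}_p$ (resp. $\vec{\mathcal{I}}_p$) conditioned on $\sum_iS_i=\sum_jT_j$. - $\mathcal{B}_k$: $\operatorname{Prob}(\boldsymbol{S}=\boldsymbol{s}\wedge\boldsymbol{T}=\boldsymbol{t})=\binom{mn}{k}^{-2}\prod_{i}\binom{n}{s_i}\prod_j\binom{m}{t_j}$ if $\sum_is_i=\sum_jt_j=k$ and $0$ otherwise (i.e. $\mathcal{I}_p$ conditioned on both sums equal to $k$). $\vec{\mathcal{B}}_k$ ($m=n$): same with $\binom{n^2-n}{k}^{-2}\prod_i\binom{n-1}{s_i}\prod_j\binom{n-1}{t_j}$. - $\mathcal{V}_p$: with $K_p(p')=(mn/(\pi pq))^{1/2}\exp(-\frac{mn}{pq}(p'-p)^2)$ and $V(p)=\int_0^1K_p(p')dp'$, $\operatorname{Prob}_{\mathcal{V}_p}(\boldsymbol{S}=\boldsymbol{s}\wedge\boldsymbol{T}=\boldsymbol{t})=V(p)^{-1}\int_0^1K_p(p')\operatorname{Prob}_{\mathcal{B}_{p'}}(\boldsymbol{S}=\boldsymbol{s}\wedge\boldsymbol{T}=\boldsymbol{t})\,dp'$;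 $\vec{\mathcal{V}}_p$ ($m=n$) is defined the same way with $\vec{\mathcal{B}}_{p'}$ in place of $\mathcal{B}_{p'}$. Acceptability: for constants $a,\varepsilon>0$, $(m,n,x)$ with $x\in(0,1)$ is $(a,\varepsilon)$-acceptable if $m,n\to\infty$ with $m=o(n^{1+\varepsilon})$, $n=o(m^{1+\varepsilon})$, and $\frac{(1-2x)^2}{4x(1-x)}\bigl(1+\frac{5m}{6n}+\frac{5n}{6m}\bigr)<a\log n$. *)

theory Defs
  imports "HOL-Probability.Probability" "HOL-Library.Landau_Symbols"
    "HOL-Computational_Algebra.Polynomial"
begin

text \<open>
  A pair of degree sequences is a pair of functions on the naturals, indexed from \<open>0\<close> and equal
  to \<open>0\<close> outside the index ranges \<open>{..<m}\<close> and \<open>{..<n}\<close> (the convention of \<^const>\<open>Pi_pmf\<close>).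
\<close>

type_synonym degrees = "(nat \<Rightarrow> nat) \<times> (nat \<Rightarrow> nat)"

definition deg_space :: "nat \<Rightarrow> nat \<Rightarrow> degrees set" where
  "deg_space m n = PiE_dflt {..<m} 0 (\<lambda>_. {..n}) \<times> PiE_dflt {..<n} 0 (\<lambda>_. {..m})"

section \<open>Random bipartite graphs\<close>

definition bip_edges :: "nat \<Rightarrow> nat \<Rightarrow> (nat \<times> nat) set" where
  "bip_edges m n = {..<m} \<times> {..<n}"

definition dir_edges :: "nat \<Rightarrow> (nat \<times> nat) set" where
  "dir_edges n = {(i, j). i < n \<and> j < n \<and> i \<noteq> j}"

definition degrees_of :: "(nat \<times> nat) set \<Rightarrow> degrees" where
  "degrees_of E = ((\<lambda>i. card {j. (i, j) \<in> E}), (\<lambda>j. card {i. (i, j) \<in> E}))"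

definition edge_indep :: "(nat \<times> nat) set \<Rightarrow> real \<Rightarrow> degrees pmf" where
  "edge_indep W p =
     map_pmf (\<lambda>x. degrees_of {e \<in> W. x e}) (Pi_pmf W False (\<lambda>_. bernoulli_pmf p))"

definition edge_unif :: "(nat \<times> nat) set \<Rightarrow> nat \<Rightarrow> degrees pmf" where
  "edge_unif W k = map_pmf degrees_of (pmf_of_set {E. E \<subseteq> W \<and> card E = k})"

definition G_p :: "nat \<Rightarrow> nat \<Rightarrow> real \<Rightarrow> degrees pmf" where
  "G_p m n p = edge_indep (bip_edges m n) p"

definition G_p_dir :: "nat \<Rightarrow> real \<Rightarrow> degrees pmf" where
  "G_p_dir n p = edge_indep (dir_edges n) p"

definition G_k :: "nat \<Rightarrow> nat \<Rightarrow> nat \<Rightarrow> degrees pmf" where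
  "G_k m n k = edge_unif (bip_edges m n) k"

definition G_k_dir :: "nat \<Rightarrow> nat \<Rightarrow> degrees pmf" where
  "G_k_dir n k = edge_unif (dir_edges n) k"

section \<open>Binomial models\<close>

definition binom_indep :: "nat \<Rightarrow> nat \<Rightarrow> nat \<Rightarrow> nat \<Rightarrow> real \<Rightarrow> degrees pmf" where
  "binom_indep m d n e p =
     pair_pmf (Pi_pmf {..<m} 0 (\<lambda>_. binomial_pmf d p)) (Pi_pmf {..<n} 0 (\<lambda>_. binomial_pmf e p))"

definition I_p :: "nat \<Rightarrow> nat \<Rightarrow> real \<Rightarrow> degrees pmf" where
  "I_p m n p = binom_indep m n n m p"

definition I_p_dir :: "nat \<Rightarrow> real \<Rightarrow> degrees pmf" where
  "I_p_dir n p = binom_indep n (n - 1) n (n - 1) p"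

definition equal_sums :: "nat \<Rightarrow> nat \<Rightarrow> degrees set" where
  "equal_sums m n = {(s, t). (\<Sum>i<m. s i) = (\<Sum>j<n. t j)}"

definition B_p :: "nat \<Rightarrow> nat \<Rightarrow> real \<Rightarrow> degrees pmf" where
  "B_p m n p = cond_pmf (I_p m n p) (equal_sums m n)"

definition B_p_dir :: "nat \<Rightarrow> real \<Rightarrow> degrees pmf" where
  "B_p_dir n p = cond_pmf (I_p_dir n p) (equal_sums n n)"

definition B_k :: "nat \<Rightarrow> nat \<Rightarrow> nat \<Rightarrow> degrees pmf" where
  "B_k m n k = embed_pmf (\<lambda>(s, t).
     if (s, t) \<in> deg_space m n \<and> (\<Sum>i<m. s i) = k \<and> (\<Sum>j<n. t j) = k
     then (\<Prod>i<m. real (n choose s i)) * (\<Prod>j<n. real (m choose t j)) / real ((m * n) choose k) ^ 2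
     else 0)"

definition B_k_dir :: "nat \<Rightarrow> nat \<Rightarrow> degrees pmf" where
  "B_k_dir n k = embed_pmf (\<lambda>(s, t).
     if (s, t) \<in> deg_space n n \<and> (\<Sum>i<n. s i) = k \<and> (\<Sum>j<n. t j) = k
     then (\<Prod>i<n. real ((n - 1) choose s i)) * (\<Prod>j<n. real ((n - 1) choose t j))
            / real ((n ^ 2 - n) choose k) ^ 2
     else 0)"

section \<open>Gaussian mixtures of the conditioned binomial models\<close>

definition K_p :: "nat \<Rightarrow> nat \<Rightarrow> real \<Rightarrow> real \<Rightarrow> real" where
  "K_p m n p p' = sqrt (real (m * n) / (pi * p * (1 - p))) *
                  exp (- (real (m * n) / (p * (1 - p))) * (p' - p) ^ 2)"

definition V_norm :: "nat \<Rightarrow> nat \<Rightarrow> real \<Rightarrow> real" where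
  "V_norm m n p = integral {0..1} (K_p m n p)"

definition V_p :: "nat \<Rightarrow> nat \<Rightarrow> real \<Rightarrow> degrees pmf" where
  "V_p m n p = embed_pmf (\<lambda>\<omega>.
     inverse (V_norm m n p) * integral {0..1} (\<lambda>p'. K_p m n p p' * pmf (B_p m n p') \<omega>))"

definition V_p_dir :: "nat \<Rightarrow> real \<Rightarrow> degrees pmf" where
  "V_p_dir n p = embed_pmf (\<lambda>\<omega>.
     inverse (V_norm n n p) * integral {0..1} (\<lambda>p'. K_p n n p p' * pmf (B_p_dir n p') \<omega>))"

section \<open>Asymptotics\<close>

definition tilde_o :: "(nat \<Rightarrow> nat) \<Rightarrow> (nat \<Rightarrow> real) \<Rightarrow> bool" where
  "tilde_o n f \<longleftrightarrow> (\<exists>c>0. f \<in> O(\<lambda>l. exp (- (real (n l) powr c))))"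

text \<open>
  Here \<open>m\<close>, \<open>n\<close>, \<open>x\<close> are functions of the index tending to infinity. The pointwise
  conditions are imposed for all sufficiently large indices only, which is all that an asymptotic
  conclusion can depend on.
\<close>

definition acceptable ::
  "real \<Rightarrow> real \<Rightarrow> (nat \<Rightarrow> nat) \<Rightarrow> (nat \<Rightarrow> nat) \<Rightarrow> (nat \<Rightarrow> real) \<Rightarrow> bool" where
  "acceptable a \<epsilon> m n x \<longleftrightarrow>
     (\<forall>\<^sub>F l in sequentially. 0 < x l \<and> x l < 1) \<and>
     filterlim m at_top sequentially \<and> filterlim n at_top sequentially \<and>
     (\<lambda>l. real (m l)) \<in> o(\<lambda>l. real (n l) powr (1 + \<epsilon>)) \<and>
     (\<lambda>l. real (n l)) \<in> o(\<lambda>l. real (m l) powr (1 + \<epsilon>)) \<and>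
     (\<forall>\<^sub>F l in sequentially.
        (1 - 2 * x l) ^ 2 / (4 * x l * (1 - x l)) *
        (1 + 5 * real (m l) / (6 * real (n l)) + 5 * real (n l) / (6 * real (m l)))
        < a * ln (real (n l)))"

section \<open>Well-definedness of the models given by point probabilities\<close>

text \<open>
  \<^const>\<open>embed_pmf\<close> is only meaningful for nonnegative functions of total mass \<open>1\<close>; the lemmas
  \<open>pmf_B_k\<close>, \<open>pmf_B_k_dir\<close>, \<open>pmf_V_p\<close> and \<open>pmf_V_p_dir\<close> show that this is the case here.
\<close>

lemma pmf_embed_finite:
  fixes f :: "'a \<Rightarrow> real"
  assumes "finite A" "\<And>x. f x \<ge> 0" "\<And>x. x \<notin> A \<Longrightarrow> f x = 0" "sum f A = 1"
  shows "pmf (embed_pmf f) x = f x"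
proof (rule pmf_embed_pmf)
  have "(\<integral>\<^sup>+x. ennreal (f x) \<partial>count_space UNIV) = (\<Sum>x\<in>A. ennreal (f x))"
    by (rule nn_integral_count_space'[OF assms(1)]) (use assms in auto)
  also have "\<dots> = ennreal (sum f A)"
    by (rule sum_ennreal) (use assms in auto)
  finally show "(\<integral>\<^sup>+x. ennreal (f x) \<partial>count_space UNIV) = 1"
    using assms(4) by simp
qed (use assms in auto)

lemma prod_monom: "(\<Prod>i\<in>A. monom (c i) (s i)) = monom (\<Prod>i\<in>A. c i) (\<Sum>i\<in>A. s i)"
  for c :: "'b \<Rightarrow> 'a :: comm_semiring_1"
  by (induction A rule: infinite_finite_induct) (auto simp: mult_monom)

lemma binomial_poly: "[:1, 1:] ^ d = (\<Sum>j\<le>d. monom (real (d choose j)) j)"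
proof (rule poly_eqI)
  fix i
  have "degree ([:1, 1::real:] ^ d) \<le> d"
    by (rule order_trans[OF degree_power_le]) auto
  then show "coeff ([:1, 1:] ^ d) i = coeff (\<Sum>j\<le>d. monom (real (d choose j)) j) i"
    by (cases "i \<le> d") (auto simp: coeff_linear_poly_power coeff_sum coeff_eq_0)
qed

lemma sum_prod_binomial:
  "(\<Sum>s | s \<in> PiE_dflt {..<m} 0 (\<lambda>_. {..d}) \<and> (\<Sum>i<m. s i) = k. \<Prod>i<m. real (d choose s i))
     = real ((m * d) choose k)"
proof -
  let ?P = "PiE_dflt {..<m} (0::nat) (\<lambda>_. {..d})"
  have fin: "finite ?P" by (intro finite_PiE_dflt) auto
  have inj: "inj_on (\<lambda>h. restrict h {..<m}) ?P"
  proof (rule inj_onI, rule ext)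
    fix f g x
    assume fg: "f \<in> ?P" "g \<in> ?P" and eq: "restrict f {..<m} = restrict g {..<m}"
    show "f x = g x"
      using fg fun_cong[OF eq, of x] by (cases "x < m") (auto simp: PiE_dflt_def)
  qed
  have "[:1, 1::real:] ^ (m * d) = (\<Prod>i<m. \<Sum>j\<le>d. monom (real (d choose j)) j)"
    by (simp add: power_mult[symmetric] mult.commute flip: binomial_poly)
  also have "\<dots> = (\<Sum>g\<in>PiE {..<m} (\<lambda>_. {..d}). \<Prod>i<m. monom (real (d choose g i)) (g i))"
    by (rule prod_sum_PiE) auto
  also have "\<dots> = (\<Sum>g\<in>?P. \<Prod>i<m. monom (real (d choose g i)) (g i))"
    unfolding restrict_PiE_dflt[of "{..<m}" 0, symmetric]
    by (subst sum.reindex[OF inj]) (auto intro!: sum.cong prod.cong)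
  also have "\<dots> = (\<Sum>g\<in>?P. monom (\<Prod>i<m. real (d choose g i)) (\<Sum>i<m. g i))"
    by (simp add: prod_monom)
  finally have "coeff ([:1, 1::real:] ^ (m * d)) k =
      (\<Sum>g\<in>?P. if (\<Sum>i<m. g i) = k then \<Prod>i<m. real (d choose g i) else 0)"
    by (simp add: coeff_sum)
  also have "\<dots> = (\<Sum>g | g \<in> ?P \<and> (\<Sum>i<m. g i) = k. \<Prod>i<m. real (d choose g i))"
    by (simp add: sum.inter_filter[OF fin])
  finally show ?thesis
    by (auto simp: binomial_poly coeff_sum not_le split: if_splits)
qed

lemma finite_deg_space: "finite (deg_space m n)"
  unfolding deg_space_def by (intro finite_cartesian_product finite_PiE_dflt) auto

lemma sum_fixed_sum:
  assumes "d \<le> n" "e \<le> m" "m * d = N" "n * e = N" "k \<le> N"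
  shows "(\<Sum>(s, t)\<in>deg_space m n. if (s, t) \<in> deg_space m n \<and> (\<Sum>i<m. s i) = k \<and> (\<Sum>j<n. t j) = k
     then (\<Prod>i<m. real (d choose s i)) * (\<Prod>j<n. real (e choose t j)) / real (N choose k) ^ 2
     else 0) = 1"
proof -
  have ext: "(\<Sum>s\<in>PiE_dflt {..<m} 0 (\<lambda>_. {..n}). if (\<Sum>i<m. s i) = k then \<Prod>i<m. real (d choose s i) else 0)
      = real ((m * d) choose k)" if "d \<le> n" for m d n :: nat
  proof -
    have fin: "finite (PiE_dflt {..<m} (0::nat) (\<lambda>_. {..d}))" for d
      by (intro finite_PiE_dflt) auto
    have "(\<Sum>s\<in>PiE_dflt {..<m} 0 (\<lambda>_. {..n}). if (\<Sum>i<m. s i) = k then \<Prod>i<m. real (d choose s i) else 0)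
       = (\<Sum>s\<in>PiE_dflt {..<m} 0 (\<lambda>_. {..d}). if (\<Sum>i<m. s i) = k then \<Prod>i<m. real (d choose s i) else 0)"
    proof (rule sum.mono_neutral_right[OF fin])
      show "PiE_dflt {..<m} (0::nat) (\<lambda>_. {..d}) \<subseteq> PiE_dflt {..<m} 0 (\<lambda>_. {..n})"
        using that by (fastforce simp: PiE_dflt_def)
      show "\<forall>s\<in>PiE_dflt {..<m} 0 (\<lambda>_. {..n}) - PiE_dflt {..<m} 0 (\<lambda>_. {..d}).
          (if (\<Sum>i<m. s i) = k then \<Prod>i<m. real (d choose s i) else 0) = 0"
      proof
        fix s assume "s \<in> PiE_dflt {..<m} (0::nat) (\<lambda>_. {..n}) - PiE_dflt {..<m} 0 (\<lambda>_. {..d})"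
        then obtain i where "i < m" "d < s i" by (auto simp: PiE_dflt_def not_le)
        then have "(\<Prod>i<m. real (d choose s i)) = 0"
          by (intro prod_zero) (auto intro!: bexI[of _ i])
        then show "(if (\<Sum>i<m. s i) = k then \<Prod>i<m. real (d choose s i) else 0) = 0" by simp
      qed
    qed
    also have "\<dots> = real ((m * d) choose k)"
      by (simp add: sum_prod_binomial flip: sum.inter_filter[OF fin])
    finally show ?thesis .
  qed
  let ?S = "PiE_dflt {..<m} (0::nat) (\<lambda>_. {..n})" and ?T = "PiE_dflt {..<n} (0::nat) (\<lambda>_. {..m})"
  let ?f = "\<lambda>s. if (\<Sum>i<m. s i) = k then \<Prod>i<m. real (d choose s i) else 0"
  let ?g = "\<lambda>t. if (\<Sum>i<n. t i) = k then \<Prod>i<n. real (e choose t i) else 0"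
  have "(\<Sum>(s, t)\<in>deg_space m n. if (s, t) \<in> deg_space m n \<and> (\<Sum>i<m. s i) = k \<and> (\<Sum>j<n. t j) = k
     then (\<Prod>i<m. real (d choose s i)) * (\<Prod>j<n. real (e choose t j)) / real (N choose k) ^ 2
     else 0) = (\<Sum>(s, t)\<in>deg_space m n. ?f s * ?g t / real (N choose k) ^ 2)"
    by (intro sum.cong) auto
  also have "\<dots> = (\<Sum>s\<in>?S. \<Sum>t\<in>?T. ?f s * ?g t / real (N choose k) ^ 2)"
    unfolding deg_space_def by (rule sum.cartesian_product[symmetric])
  also have "\<dots> = (\<Sum>s\<in>?S. ?f s) * (\<Sum>t\<in>?T. ?g t) / real (N choose k) ^ 2"
    by (simp only: sum_product sum_divide_distrib)
  also have "\<dots> = 1"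
    using assms by (simp only: ext) (simp add: power2_eq_square)
  finally show ?thesis .
qed

lemma pmf_B_k:
  assumes "k \<le> m * n"
  shows "pmf (B_k m n k) (s, t) =
    (if (s, t) \<in> deg_space m n \<and> (\<Sum>i<m. s i) = k \<and> (\<Sum>j<n. t j) = k
     then (\<Prod>i<m. real (n choose s i)) * (\<Prod>j<n. real (m choose t j)) / real ((m * n) choose k) ^ 2
     else 0)"
  unfolding B_k_def
  by (subst pmf_embed_finite[OF finite_deg_space[of m n]])
     (use assms in \<open>auto simp: sum_fixed_sum intro!: prod_nonneg mult_nonneg_nonneg divide_nonneg_nonneg\<close>)

lemma pmf_B_k_dir:
  assumes "k \<le> n ^ 2 - n"
  shows "pmf (B_k_dir n k) (s, t) =
    (if (s, t) \<in> deg_space n n \<and> (\<Sum>i<n. s i) = k \<and> (\<Sum>j<n. t j) = k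
     then (\<Prod>i<n. real ((n - 1) choose s i)) * (\<Prod>j<n. real ((n - 1) choose t j))
            / real ((n ^ 2 - n) choose k) ^ 2
     else 0)"
proof -
  have "n * (n - 1) = n ^ 2 - n"
    by (simp add: power2_eq_square diff_mult_distrib2)
  then show ?thesis
    unfolding B_k_dir_def
    by (subst pmf_embed_finite[OF finite_deg_space[of n n]])
       (use assms in \<open>auto simp: sum_fixed_sum intro!: prod_nonneg mult_nonneg_nonneg divide_nonneg_nonneg\<close>)
qed

lemma pmf_binom_indep:
  assumes "p \<in> {0..1}"
  shows "pmf (binom_indep m d n e p) (s, t) =
    (if (\<forall>i\<ge>m. s i = 0) \<and> (\<forall>j\<ge>n. t j = 0)
     then (\<Prod>i<m. real (d choose s i) * p ^ s i * (1 - p) ^ (d - s i)) *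
          (\<Prod>j<n. real (e choose t j) * p ^ t j * (1 - p) ^ (e - t j)) else 0)"
  using assms by (auto simp: binom_indep_def pmf_pair pmf_Pi not_less)

lemma set_binom_indep:
  assumes "p \<in> {0..1}" "d \<le> n" "e \<le> m"
  shows "set_pmf (binom_indep m d n e p) \<subseteq> deg_space m n"
  using assms
  by (fastforce simp: binom_indep_def set_Pi_pmf PiE_dflt_def deg_space_def set_pmf_binomial_eq
        split: if_splits)

lemma equal_sums_possible:
  assumes "p \<in> {0..1}" "m * d = n * e"
  shows "set_pmf (binom_indep m d n e p) \<inter> equal_sums m n \<noteq> {}"
proof (cases "p = 1")
  case True
  then have "((\<lambda>i. if i < m then d else 0), (\<lambda>j. if j < n then e else 0))
      \<in> set_pmf (binom_indep m d n e p) \<inter> equal_sums m n"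
    using assms by (auto simp: binom_indep_def set_Pi_pmf PiE_dflt_def equal_sums_def)
  then show ?thesis by blast
next
  case False
  then have "((\<lambda>i. 0), (\<lambda>j. 0)) \<in> set_pmf (binom_indep m d n e p) \<inter> equal_sums m n"
    using assms
    by (auto simp: binom_indep_def set_Pi_pmf PiE_dflt_def equal_sums_def set_pmf_binomial_eq)
  then show ?thesis by blast
qed

lemma continuous_on_binom_indep:
  "continuous_on {0..1} (\<lambda>p. pmf (binom_indep m d n e p) \<omega>)"
proof (cases \<omega>)
  case (Pair s t)
  have "continuous_on {0..1} (\<lambda>p::real. if b
     then (\<Prod>i<m. real (d choose s i) * p ^ s i * (1 - p) ^ (d - s i)) *
          (\<Prod>j<n. real (e choose t j) * p ^ t j * (1 - p) ^ (e - t j)) else 0)" for b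
    by (cases b) (auto intro!: continuous_intros)
  then show ?thesis
    by (rule continuous_on_eq) (simp add: Pair pmf_binom_indep)
qed

lemma continuous_on_cond_binom:
  assumes "d \<le> n" "e \<le> m" "m * d = n * e"
  shows "continuous_on {0..1} (\<lambda>p. pmf (cond_pmf (binom_indep m d n e p) (equal_sums m n)) \<omega>)"
proof -
  let ?I = "binom_indep m d n e" and ?A = "deg_space m n \<inter> equal_sums m n"
  have prob: "measure_pmf.prob (?I p) (equal_sums m n) = (\<Sum>\<omega>\<in>?A. pmf (?I p) \<omega>)"
    if "p \<in> {0..1}" for p
  proof -
    have "measure_pmf.prob (?I p) (equal_sums m n) = measure_pmf.prob (?I p) ?A"
      by (rule measure_prob_cong_0)
         (use set_binom_indep[OF that assms(1,2)] in \<open>auto simp: set_pmf_iff\<close>)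
    then show ?thesis
      by (simp add: measure_measure_pmf_finite finite_deg_space)
  qed
  have nz: "(\<Sum>\<omega>\<in>?A. pmf (?I p) \<omega>) \<noteq> 0" if "p \<in> {0..1}" for p
    using equal_sums_possible[OF that assms(3)] prob[OF that]
    by (metis Int_commute measure_pmf_zero_iff)
  have "continuous_on {0..1}
      (\<lambda>p. if \<omega> \<in> equal_sums m n then pmf (?I p) \<omega> / (\<Sum>\<omega>\<in>?A. pmf (?I p) \<omega>) else 0)"
    using nz by (cases "\<omega> \<in> equal_sums m n")
      (auto intro!: continuous_intros continuous_on_binom_indep)
  then show ?thesis
    by (rule continuous_on_eq)
       (simp add: pmf_cond[OF equal_sums_possible[OF _ assms(3)]] prob)
qed

lemma V_norm_pos:
  assumes "0 < p" "p < 1" "m > 0" "n > 0"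
  shows "V_norm m n p > 0"
proof -
  have cont: "continuous_on {0..1} (K_p m n p)"
    unfolding K_p_def using assms by (intro continuous_intros) auto
  have pos: "K_p m n p x > 0" for x
    unfolding K_p_def using assms by (auto intro!: mult_pos_pos divide_pos_pos)
  have "V_norm m n p \<ge> 0"
    unfolding V_norm_def by (rule integral_nonneg)
      (use cont pos in \<open>auto intro: integrable_continuous_real less_imp_le\<close>)
  moreover have "V_norm m n p \<noteq> 0"
  proof -
    have "V_norm m n p = 0 \<longleftrightarrow> (\<forall>x\<in>{0..1}. K_p m n p x = 0)"
      unfolding V_norm_def by (rule integral_eq_0_iff[OF cont]) (auto simp: pos less_imp_le)
    also have "\<dots> \<longleftrightarrow> False"
      using pos[of 0] by (auto intro!: bexI[of _ 0])
    finally show ?thesis by simp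
  qed
  ultimately show ?thesis by simp
qed

lemma pmf_mixture:
  assumes p: "0 < p" "p < 1" "m > 0" "n > 0"
    and cont: "\<And>\<omega>. continuous_on {0..1} (\<lambda>p'. pmf (B p') \<omega>)"
    and supp: "\<And>p'. p' \<in> {0..1} \<Longrightarrow> set_pmf (B p') \<subseteq> deg_space m n"
  shows "pmf (embed_pmf (\<lambda>\<omega>. inverse (V_norm m n p) *
      integral {0..1} (\<lambda>p'. K_p m n p p' * pmf (B p') \<omega>))) \<omega> =
    inverse (V_norm m n p) * integral {0..1} (\<lambda>p'. K_p m n p p' * pmf (B p') \<omega>)"
proof (rule pmf_embed_finite[OF finite_deg_space[of m n]])
  have K: "continuous_on {0..1} (K_p m n p)"
    unfolding K_p_def using p by (intro continuous_intros) auto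
  have int: "(\<lambda>p'. K_p m n p p' * pmf (B p') \<omega>) integrable_on {0..1}" for \<omega>
    by (intro integrable_continuous_real continuous_intros K cont)
  have Knn: "K_p m n p x \<ge> 0" for x
    unfolding K_p_def using p by auto
  show "inverse (V_norm m n p) * integral {0..1} (\<lambda>p'. K_p m n p p' * pmf (B p') \<omega>) \<ge> 0" for \<omega>
    using V_norm_pos[OF p] by (intro mult_nonneg_nonneg integral_nonneg int) (auto simp: Knn)
  show "inverse (V_norm m n p) * integral {0..1} (\<lambda>p'. K_p m n p p' * pmf (B p') \<omega>) = 0"
    if "\<omega> \<notin> deg_space m n" for \<omega>
  proof -
    have "integral {0..1} (\<lambda>p'. K_p m n p p' * pmf (B p') \<omega>) = integral {0..1::real} (\<lambda>_. 0 :: real)"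
    proof (rule Henstock_Kurzweil_Integration.integral_cong)
      fix p' :: real assume "p' \<in> {0..1}"
      then have "\<omega> \<notin> set_pmf (B p')" using supp that by blast
      then show "K_p m n p p' * pmf (B p') \<omega> = 0" by (simp add: set_pmf_iff)
    qed
    then show ?thesis by simp
  qed
  have "(\<Sum>\<omega>\<in>deg_space m n. integral {0..1} (\<lambda>p'. K_p m n p p' * pmf (B p') \<omega>)) =
      integral {0..1} (\<lambda>p'. \<Sum>\<omega>\<in>deg_space m n. K_p m n p p' * pmf (B p') \<omega>)"
    by (rule integral_sum[symmetric]) (auto simp: finite_deg_space int)
  also have "\<dots> = V_norm m n p"
    unfolding V_norm_def
    by (intro Henstock_Kurzweil_Integration.integral_cong)
       (simp add: sum_pmf_eq_1[OF finite_deg_space supp] flip: sum_distrib_left)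
  finally show "(\<Sum>\<omega>\<in>deg_space m n. inverse (V_norm m n p) *
      integral {0..1} (\<lambda>p'. K_p m n p p' * pmf (B p') \<omega>)) = 1"
    using V_norm_pos[OF p] by (simp flip: sum_distrib_left)
qed

lemma pmf_V_p:
  assumes "0 < p" "p < 1" "m > 0" "n > 0"
  shows "pmf (V_p m n p) \<omega> =
    inverse (V_norm m n p) * integral {0..1} (\<lambda>p'. K_p m n p p' * pmf (B_p m n p') \<omega>)"
  unfolding V_p_def
proof (rule pmf_mixture[OF assms])
  show "continuous_on {0..1} (\<lambda>p'. pmf (B_p m n p') \<omega>)" for \<omega>
    unfolding B_p_def I_p_def by (rule continuous_on_cond_binom) auto
  show "set_pmf (B_p m n p') \<subseteq> deg_space m n" if "p' \<in> {0..1}" for p'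
    using set_binom_indep[OF that, of n n m m] unfolding B_p_def I_p_def
    by (subst set_cond_pmf[OF equal_sums_possible[OF that]]) auto
qed

lemma pmf_V_p_dir:
  assumes "0 < p" "p < 1" "n > 0"
  shows "pmf (V_p_dir n p) \<omega> =
    inverse (V_norm n n p) * integral {0..1} (\<lambda>p'. K_p n n p p' * pmf (B_p_dir n p') \<omega>)"
  unfolding V_p_dir_def
proof (rule pmf_mixture[OF assms(1,2,3,3)])
  show "continuous_on {0..1} (\<lambda>p'. pmf (B_p_dir n p') \<omega>)" for \<omega>
    unfolding B_p_dir_def I_p_dir_def by (rule continuous_on_cond_binom) auto
  show "set_pmf (B_p_dir n p') \<subseteq> deg_space n n" if "p' \<in> {0..1}" for p'
    using set_binom_indep[OF that, of "n - 1" n "n - 1" n] unfolding B_p_dir_def I_p_dir_def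
    by (subst set_cond_pmf[OF equal_sums_possible[OF that]]) auto
qed

end

theory Submission
  imports Defs
begin

text \<open>
  Fix the number \<open>k\<close> of edges and let \<open>f\<close> be the ratio of the two point probabilities. Moving one
  edge between two rows changes the row sequence by one unit, and a switching argument evaluates the
  change of \<open>f\<close> up to a relative error of order \<open>n\<^bsup>-3/2+o(1)\<^esup>\<close>: the conditional codegrees of two rows
  are determined by the degrees. For a fixed column sequence, \<open>\<surd>f\<close> is therefore a function on the
  \<open>k\<close>-subsets of the cells with tiny swap energy. The Poincare inequality on slices, applied to
  truncations of \<open>\<surd>f\<close>, gives concentration of \<open>f\<close> around \<open>1\<close> under both measures.
  For independent edges both sides are mixtures over \<open>k\<close>. With \<open>b\<^sub>x\<close> the binomial weights and \<open>p\<close> the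
  edge probability, the integrands
  \<open>e\<^bsup>-mn(x-p)\<^sup>2/pq\<^esup> b\<^sub>x(k)\<^sup>2 / (b\<^sub>p(k) \<Sum>\<^sub>j b\<^sub>x(j)\<^sup>2)\<close> for \<open>k\<close> and \<open>k+1\<close> almost agree after the
  shift \<open>x \<mapsto> x + 1/(2N)\<close>, so that the mixing weights are proportional to \<open>b\<^sub>p\<close> up to a small relative
  error, and normalisation fixes the factor.
\<close>


section \<open>A Poincare inequality on slices\<close>

text \<open>Why square roots: if \<open>h\<^sup>2\<close> is a density and a swap changes
  \<open>h\<close> by a relative amount \<open>\<delta>\<close>, the swap energy is at most about
  \<open>N\<^sup>2 * \<delta>\<^sup>2\<close> times the mass, and the spectral gap leaves variance
  about \<open>N * \<delta>\<^sup>2\<close>, where \<open>N\<close> is about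
  \<open>n\<^sup>2\<close>. Codegree concentration alone yields \<open>\<delta>\<close> of order
  1/n, which is useless; averaged codegrees must be known up to powers of \<open>K\<close> to reach
  n^(-3/2) and variance about 1/n. Variance alone gives polynomial tails. Exponential ones come from
  truncating at a rising level: each rise by \<open>\<sigma> = K ^ 10 / sqrt n\<close> halves the
  remaining mass, and about \<open>K\<close> rises fit below the permitted error
  \<open>K ^ 12 / sqrt n\<close>. Here \<open>K\<close> is a small power of \<open>n\<close>, fixed
  by making this error at most n^(-b). Why the shift is 1/(2N): as functions of \<open>x\<close>,
  the kernel and \<open>b\<^sub>x(k)\<^sup>2\<close> are nearly Gaussian of equal width with centres
  \<open>p\<close> and \<open>k/N\<close>. Their product is a Gaussian centred halfway between,
  times \<open>exp (- (k - N * p)\<^sup>2 / (2 * N * p * q))\<close>, the profile of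
  \<open>b\<^sub>p\<close>.\<close>

definition slice :: "'a set \<Rightarrow> nat \<Rightarrow> 'a set set" where
  "slice W k = {A. A \<subseteq> W \<and> card A = k}"

text \<open>Twice the Dirichlet form of the Johnson graph on \<open>k\<close>-subsets: every swap is
  counted from both of its ends, which is the origin of the factor 2 in
  \<open>slice_poincare\<close>.\<close>

definition swap_energy :: "'a set \<Rightarrow> nat \<Rightarrow> ('a set \<Rightarrow> real) \<Rightarrow> real" where
  "swap_energy W k F =
     (\<Sum>A\<in>slice W k. \<Sum>x\<in>A. \<Sum>y\<in>W - A. (F A - F (insert y (A - {x})))\<^sup>2)"

lemma finite_slice [simp]: "finite W \<Longrightarrow> finite (slice W k)"
  unfolding slice_def by (rule finite_subset[of _ "Pow W"]) auto

lemma card_slice: "finite W \<Longrightarrow> card (slice W k) = card W choose k"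
  unfolding slice_def by (rule n_subsets)

lemma slice_insert_bij:
  assumes "finite W" "x \<in> W" "k \<ge> 1"
  shows "bij_betw (insert x) (slice (W - {x}) (k - 1)) {A \<in> slice W k. x \<in> A}"
proof (rule bij_betw_byWitness[where f' = "\<lambda>A. A - {x}"])
  show "insert x ` slice (W - {x}) (k - 1) \<subseteq> {A \<in> slice W k. x \<in> A}"
  proof (clarsimp simp: slice_def, intro conjI)
    fix A assume A: "A \<subseteq> W - {x}" "card A = k - Suc 0"
    then have "finite A" "x \<notin> A" using assms finite_subset[of A W] by auto
    then show "x \<in> W" "card (insert x A) = k" using A assms by auto
  qed (use assms in auto)
  show "(\<lambda>A. A - {x}) ` {A \<in> slice W k. x \<in> A} \<subseteq> slice (W - {x}) (k - 1)"
  proof clarsimp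
    fix A assume A: "A \<in> slice W k" "x \<in> A"
    then have "finite A" using assms finite_subset[of A W] by (auto simp: slice_def)
    then show "A - {x} \<in> slice (W - {x}) (k - Suc 0)" using A by (auto simp: slice_def)
  qed
qed (auto simp: slice_def)

lemma slice_notin: "{A \<in> slice W k. x \<notin> A} = slice (W - {x}) k"
  by (auto simp: slice_def)

lemma card_slice_mem:
  assumes "finite W" "x \<in> W" "k \<ge> 1"
  shows "card {A \<in> slice W k. x \<in> A} = (card W - 1) choose (k - 1)"
  using bij_betw_same_card[OF slice_insert_bij[OF assms]] assms by (simp add: card_slice)

lemma card_slice_mem_notin:
  assumes "finite W" "x \<in> W" "y \<in> W" "x \<noteq> y" "k \<ge> 1"
  shows "card {A \<in> slice W k. x \<in> A \<and> y \<notin> A} = (card W - 2) choose (k - 1)"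
proof -
  have "{A \<in> slice W k. x \<in> A \<and> y \<notin> A} = {A \<in> slice (W - {y}) k. x \<in> A}"
    by (auto simp: slice_def)
  then show ?thesis using card_slice_mem[of "W - {y}" x k] assms
    by (simp add: numeral_2_eq_2)
qed

text \<open>Let \<open>G A\<close> be the sum of \<open>a\<close> over \<open>A\<close>. Counting
  shows that the inner product of \<open>F\<close> and \<open>G\<close> is the sum of the squares of
  \<open>a\<close> and, because \<open>a\<close> sums to zero, that the squared norm of
  \<open>G\<close> is a fixed multiple of the same sum; Cauchy-Schwarz finishes. The bound controls
  what is lost when the mean of \<open>F\<close> is taken separately over the sets with and without
  a given point.\<close>

lemma slice_linear_part:
  fixes F :: "'a set \<Rightarrow> real"
  assumes W: "finite W" and k: "k \<ge> 1" and F0: "(\<Sum>A\<in>slice W k. F A) = 0"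
  defines "a \<equiv> \<lambda>x. \<Sum>A | A \<in> slice W k \<and> x \<in> A. F A"
  shows "(\<Sum>x\<in>W. (a x)\<^sup>2) \<le> real ((card W - 2) choose (k - 1)) * (\<Sum>A\<in>slice W k. (F A)\<^sup>2)"
proof -
  let ?S = "slice W k"
  define G where "G = (\<lambda>A. \<Sum>x\<in>A. a x)"
  have fS: "finite ?S" using W by simp
  have sub: "A \<subseteq> W" "card A = k" if "A \<in> ?S" for A using that by (auto simp: slice_def)
  have fin: "finite A" if "A \<in> ?S" for A using sub[OF that] W finite_subset by blast
  have swap: "(\<Sum>x\<in>W. \<Sum>A | A \<in> ?S \<and> x \<in> A. g x A) = (\<Sum>A\<in>?S. \<Sum>x\<in>A. g x A)" for g :: "'a \<Rightarrow> 'a set \<Rightarrow> real"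
  proof -
    have "(\<Sum>x\<in>W. \<Sum>A | A \<in> ?S \<and> x \<in> A. g x A) = (\<Sum>A\<in>?S. \<Sum>x | x \<in> W \<and> x \<in> A. g x A)"
      by (rule sum.swap_restrict[OF W fS])
    also have "\<dots> = (\<Sum>A\<in>?S. \<Sum>x\<in>A. g x A)"
      by (intro sum.cong) (use sub in auto)
    finally show ?thesis .
  qed
  have a0: "(\<Sum>x\<in>W. a x) = 0"
  proof -
    have "(\<Sum>x\<in>W. a x) = (\<Sum>A\<in>?S. \<Sum>x\<in>A. F A)" unfolding a_def by (rule swap)
    also have "\<dots> = real k * (\<Sum>A\<in>?S. F A)" using sub by (simp add: sum_distrib_left)
    finally show ?thesis using F0 by simp
  qed
  have FG: "(\<Sum>x\<in>W. (a x)\<^sup>2) = (\<Sum>A\<in>?S. F A * G A)"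
  proof -
    have "(\<Sum>x\<in>W. (a x)\<^sup>2) = (\<Sum>x\<in>W. \<Sum>A | A \<in> ?S \<and> x \<in> A. a x * F A)"
      by (simp add: a_def power2_eq_square sum_distrib_left)
    also have "\<dots> = (\<Sum>A\<in>?S. \<Sum>x\<in>A. a x * F A)" by (rule swap)
    finally show ?thesis by (simp add: G_def sum_distrib_left mult.commute)
  qed
  define c1 where "c1 = real ((card W - 1) choose (k - 1))"
  define c where "c = real ((card W - 2) choose (k - 1))"
  have cnt: "real (card {A \<in> ?S. x \<in> A \<and> y \<in> A}) = (if x = y then c1 else c1 - c)"
    if "x \<in> W" "y \<in> W" for x y
  proof (cases "x = y")
    case True
    then show ?thesis using card_slice_mem[OF W that(1) k] by (simp add: c1_def)
  next
    case False
    have "{A \<in> ?S. x \<in> A} = {A \<in> ?S. x \<in> A \<and> y \<in> A} \<union> {A \<in> ?S. x \<in> A \<and> y \<notin> A}" by auto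
    then have "card {A \<in> ?S. x \<in> A} = card {A \<in> ?S. x \<in> A \<and> y \<in> A} + card {A \<in> ?S. x \<in> A \<and> y \<notin> A}"
      using fS by (simp only:) (rule card_Un_disjoint, auto)
    then show ?thesis using card_slice_mem[OF W that(1) k] card_slice_mem_notin[OF W that False k] False
      by (simp add: c1_def c_def)
  qed
  \<comment> \<open>Two distinct points share \<open>c1 - c\<close> sets whatever the points are, so
    the off-diagonal part is a multiple of the square of the sum of \<open>a\<close>, which
    vanishes; only the diagonal excess \<open>c\<close> survives.\<close>
  have G2: "(\<Sum>A\<in>?S. (G A)\<^sup>2) = c * (\<Sum>x\<in>W. (a x)\<^sup>2)"
  proof -
    have "(\<Sum>A\<in>?S. (G A)\<^sup>2) = (\<Sum>A\<in>?S. \<Sum>x\<in>A. \<Sum>y\<in>A. a x * a y)"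
      by (simp add: G_def power2_eq_square sum_product)
    also have "\<dots> = (\<Sum>x\<in>W. \<Sum>A | A \<in> ?S \<and> x \<in> A. \<Sum>y\<in>A. a x * a y)" by (rule swap[symmetric])
    also have "\<dots> = (\<Sum>x\<in>W. \<Sum>A | A \<in> ?S \<and> x \<in> A. \<Sum>y | y \<in> W \<and> y \<in> A. a x * a y)"
      by (intro sum.cong) (use sub in auto)
    also have "\<dots> = (\<Sum>x\<in>W. \<Sum>y\<in>W. \<Sum>A | A \<in> {A. A \<in> ?S \<and> x \<in> A} \<and> y \<in> A. a x * a y)"
      using W fS by (intro sum.cong refl sum.swap_restrict[symmetric]) auto
    also have "\<dots> = (\<Sum>x\<in>W. \<Sum>y\<in>W. (a x * a y) * (if x = y then c1 else c1 - c))"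
      using cnt by (intro sum.cong refl) (simp add: conj_assoc)
    also have "\<dots> = (\<Sum>x\<in>W. \<Sum>y\<in>W. (c1 - c) * (a x * a y) + (if y = x then c * (a x)\<^sup>2 else 0))"
      by (intro sum.cong refl) (auto simp: power2_eq_square algebra_simps)
    also have "\<dots> = (c1 - c) * (\<Sum>x\<in>W. a x)\<^sup>2 + c * (\<Sum>x\<in>W. (a x)\<^sup>2)"
      using W by (simp add: sum.distrib power2_eq_square sum_product)
        (simp add: sum_distrib_left sum_distrib_right mult_ac)
    finally show ?thesis using a0 by simp
  qed
  let ?X = "\<Sum>x\<in>W. (a x)\<^sup>2"
  have "(\<Sum>A\<in>?S. F A * G A)\<^sup>2 \<le> (\<Sum>A\<in>?S. (F A)\<^sup>2) * (\<Sum>A\<in>?S. (G A)\<^sup>2)"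
    by (rule Cauchy_Schwarz_ineq_sum)
  then have "?X * ?X \<le> (c * (\<Sum>A\<in>?S. (F A)\<^sup>2)) * ?X"
    unfolding FG[symmetric] G2 by (simp add: power2_eq_square mult_ac)
  moreover have "?X \<ge> 0" by (intro sum_nonneg) auto
  ultimately have "?X = 0 \<or> ?X \<le> c * (\<Sum>A\<in>?S. (F A)\<^sup>2)"
    by (metis antisym_conv2 mult_le_cancel_right_pos)
  moreover have "0 \<le> c * (\<Sum>A\<in>?S. (F A)\<^sup>2)" by (intro mult_nonneg_nonneg sum_nonneg) (auto simp: c_def)
  ultimately show ?thesis unfolding c_def by auto
qed

text \<open>A swap that does not involve \<open>x\<close> leaves the membership of \<open>x\<close>
  alone, so it is a swap inside one of the two slices over \<open>W - {x}\<close>; for sets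
  containing \<open>x\<close> the point is removed, which lowers the level to
  \<open>k - 1\<close>.\<close>

lemma swap_energy_split:
  fixes F :: "'a set \<Rightarrow> real"
  assumes W: "finite W" and k: "k \<ge> 1" "x \<in> W"
  shows "swap_energy (W - {x}) k F + swap_energy (W - {x}) (k - 1) (\<lambda>A. F (insert x A)) =
    (\<Sum>A\<in>slice W k. \<Sum>u\<in>A. \<Sum>v\<in>W - A. if x = u \<or> x = v then 0 else (F A - F (insert v (A - {u})))\<^sup>2)"
  (is "_ = (\<Sum>A\<in>_. ?h A)")
proof -
  have fin: "finite A" if "A \<in> slice W k" for A using that W finite_subset by (auto simp: slice_def)
  have "(\<Sum>A\<in>slice W k. ?h A) = (\<Sum>A\<in>{A\<in>slice W k. x \<notin> A}. ?h A) + (\<Sum>A\<in>{A\<in>slice W k. x \<in> A}. ?h A)"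
    using W by (subst sum.union_disjoint[symmetric]) (auto intro!: sum.cong)
  also have "(\<Sum>A\<in>{A\<in>slice W k. x \<notin> A}. ?h A) = swap_energy (W - {x}) k F"
    unfolding swap_energy_def slice_notin
  proof (rule sum.cong[OF refl], rule sum.cong[OF refl])
    fix A u assume A: "A \<in> slice (W - {x}) k" and u: "u \<in> A"
    then have x: "x \<notin> A" by (auto simp: slice_def)
    show "(\<Sum>v\<in>W - A. if x = u \<or> x = v then 0 else (F A - F (insert v (A - {u})))\<^sup>2) =
       (\<Sum>v\<in>W - {x} - A. (F A - F (insert v (A - {u})))\<^sup>2)"
      using x u W by (intro sum.mono_neutral_cong_right) auto
  qed
  also have "(\<Sum>A\<in>{A\<in>slice W k. x \<in> A}. ?h A) = (\<Sum>A\<in>slice (W - {x}) (k - 1). ?h (insert x A))"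
    by (rule sum.reindex_bij_betw[symmetric]) (rule slice_insert_bij[OF W k(2,1)])
  also have "\<dots> = swap_energy (W - {x}) (k - 1) (\<lambda>A. F (insert x A))"
    unfolding swap_energy_def
  proof (rule sum.cong[OF refl])
    fix A assume A: "A \<in> slice (W - {x}) (k - 1)"
    then have x: "x \<notin> A" and fA: "finite A" using W finite_subset[of A W] by (auto simp: slice_def)
    have "?h (insert x A) = (\<Sum>u\<in>A. \<Sum>v\<in>W - insert x A. if x = u \<or> x = v then 0 else (F (insert x A) - F (insert v (insert x A - {u})))\<^sup>2)"
      using x fA by simp
    also have "\<dots> = (\<Sum>u\<in>A. \<Sum>v\<in>W - {x} - A. (F (insert x A) - F (insert x (insert v (A - {u}))))\<^sup>2)"
    proof (intro sum.cong refl)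
      fix u v assume "u \<in> A" "v \<in> W - {x} - A"
      moreover from this have "insert v (insert x A - {u}) = insert x (insert v (A - {u}))" using x by auto
      ultimately show "(if x = u \<or> x = v then 0 else (F (insert x A) - F (insert v (insert x A - {u})))\<^sup>2) =
         (F (insert x A) - F (insert x (insert v (A - {u}))))\<^sup>2" using x by auto
    qed auto
    finally show "?h (insert x A) = (\<Sum>u\<in>A. \<Sum>v\<in>W - {x} - A. (F (insert x A) - F (insert x (insert v (A - {u}))))\<^sup>2)" .
  qed
  finally show ?thesis by simp
qed

lemma swap_energy_nonneg: "swap_energy W k F \<ge> 0"
  unfolding swap_energy_def by (intro sum_nonneg) auto

text \<open>\<open>card W\<close> is the spectral gap of the Johnson graph for
  \<open>0 < k < card W\<close>. Induction on the ground set, averaged over the deleted point: a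
  given swap survives the deletion of any of the \<open>card W - 2\<close> other points, and the
  separate means of the two smaller slices cost terms \<open>(a x)\<^sup>2\<close> that
  \<open>slice_linear_part\<close> bounds. The constants close without loss.\<close>

lemma slice_poincare:
  fixes F :: "'a set \<Rightarrow> real"
  assumes "finite W" "k \<le> card W"
  shows "2 * real (card W) * ((\<Sum>A\<in>slice W k. (F A)\<^sup>2) - (\<Sum>A\<in>slice W k. F A)\<^sup>2 / real (card W choose k))
     \<le> swap_energy W k F"
  using assms
proof (induction "card W" arbitrary: W k F rule: less_induct)
  case less
  note W = \<open>finite W\<close>
  let ?N = "card W" and ?S = "slice W k"
  show ?case
  proof (cases "k = 0 \<or> k = ?N")
    case True
    have "\<exists>A. ?S = {A}"
    proof (cases "k = 0")
      case True
      then have "?S = {{}}" using W finite_subset by (fastforce simp: slice_def)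
      then show ?thesis by blast
    next
      case False
      then have "?S = {W}" using True W card_subset_eq by (auto simp: slice_def)
      then show ?thesis by blast
    qed
    then obtain A where "?S = {A}" by blast
    moreover have "card W choose k = 1" using True by auto
    ultimately show ?thesis using swap_energy_nonneg[of W k F] by simp
  next
    case False
    then have k: "k \<ge> 1" "k < ?N" using less.prems by auto
    define M where "M = real (?N choose k)"
    have M0: "M > 0" using k by (simp add: M_def)
    define c where "c = (\<Sum>A\<in>?S. F A) / M"
    define H where "H = (\<lambda>A. F A - c)"
    have fS: "finite ?S" using W by simp
    have cS: "real (card ?S) = M" using W by (simp add: card_slice M_def)
    have H0: "(\<Sum>A\<in>?S. H A) = 0" using M0 cS by (simp add: H_def sum_subtractf c_def)
    have "(\<Sum>A\<in>?S. (H A)\<^sup>2) = (\<Sum>A\<in>?S. (F A)\<^sup>2 - 2 * c * F A + c\<^sup>2)"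
      by (intro sum.cong) (auto simp: H_def power2_eq_square algebra_simps)
    also have "\<dots> = (\<Sum>A\<in>?S. (F A)\<^sup>2) - 2 * c * (\<Sum>A\<in>?S. F A) + M * c\<^sup>2"
      using cS by (simp add: sum.distrib sum_subtractf sum_distrib_left)
    also have "\<dots> = (\<Sum>A\<in>?S. (F A)\<^sup>2) - (\<Sum>A\<in>?S. F A)\<^sup>2 / M"
      using M0 by (simp add: c_def power2_eq_square field_simps)
    finally have HF: "(\<Sum>A\<in>?S. (H A)\<^sup>2) = (\<Sum>A\<in>?S. (F A)\<^sup>2) - (\<Sum>A\<in>?S. F A)\<^sup>2 / M" .
    have EH: "swap_energy W k H = swap_energy W k F" by (simp add: swap_energy_def H_def)
    define X where "X = (\<Sum>A\<in>?S. (H A)\<^sup>2)"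
    have "2 * real ?N * X \<le> swap_energy W k H"
    \<comment> \<open>The averaged inequality has the factor \<open>?N - 2\<close> in front of the
      energy and degenerates for two points.\<close>
    proof (cases "?N = 2")
      case True
      then have k1: "k = 1" using k by auto
      obtain x y where xy: "W = {x, y}" "x \<noteq> y" using True by (meson card_2_iff)
      have S: "?S = {{x}, {y}}"
        using xy k1 by (auto simp: slice_def card_1_singleton_iff)
      have "H {x} + H {y} = 0" using H0 xy unfolding S by simp
      then have "H {y} = - H {x}" by simp
      moreover have "W - {x} = {y}" "W - {y} = {x}" using xy by auto
      ultimately show ?thesis using True xy unfolding X_def swap_energy_def S
        by (simp add: power2_eq_square algebra_simps)
    next
      case N: False
      then have N3: "?N \<ge> 3" using k by auto
      define a where "a = (\<lambda>x. \<Sum>A | A \<in> ?S \<and> x \<in> A. H A)"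
      define M1 where "M1 = real ((?N - 1) choose (k - 1))"
      define M0 where "M0 = real ((?N - 1) choose k)"
      have Mp: "M1 > 0" "M0 > 0" using k by (auto simp: M1_def M0_def)
      have step: "2 * (real ?N - 1) * (X - (a x)\<^sup>2 / M0 - (a x)\<^sup>2 / M1) \<le>
        (\<Sum>A\<in>?S. \<Sum>u\<in>A. \<Sum>v\<in>W - A. if x = u \<or> x = v then 0 else (H A - H (insert v (A - {u})))\<^sup>2)"
        if x: "x \<in> W" for x
      proof -
        have cx: "card (W - {x}) = ?N - 1" using W x by simp
        have i1: "2 * real (?N - 1) * ((\<Sum>A\<in>slice (W - {x}) k. (H A)\<^sup>2) - (\<Sum>A\<in>slice (W - {x}) k. H A)\<^sup>2 / M0)
             \<le> swap_energy (W - {x}) k H"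
          using less.hyps[of "W - {x}" k H] W k cx by (simp add: M0_def)
        have i2: "2 * real (?N - 1) * ((\<Sum>A\<in>slice (W - {x}) (k - 1). (H (insert x A))\<^sup>2) - (\<Sum>A\<in>slice (W - {x}) (k - 1). H (insert x A))\<^sup>2 / M1)
             \<le> swap_energy (W - {x}) (k - 1) (\<lambda>A. H (insert x A))"
          using less.hyps[of "W - {x}" "k - 1" "\<lambda>A. H (insert x A)"] W k cx by (simp add: M1_def)
        have re: "(\<Sum>A\<in>slice (W - {x}) (k - 1). g (insert x A)) = (\<Sum>A\<in>{A\<in>?S. x \<in> A}. g A)" for g :: "'a set \<Rightarrow> real"
          by (rule sum.reindex_bij_betw) (rule slice_insert_bij[OF W x k(1)])
        have sp: "(\<Sum>A\<in>?S. g A) = (\<Sum>A\<in>slice (W - {x}) k. g A) + (\<Sum>A\<in>{A\<in>?S. x \<in> A}. g A)" for g :: "'a set \<Rightarrow> real"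
          unfolding slice_notin[symmetric] using fS
          by (subst sum.union_disjoint[symmetric]) (auto intro!: sum.cong)
        have ax: "(\<Sum>A\<in>{A\<in>?S. x \<in> A}. H A) = a x" by (simp add: a_def)
        \<comment> \<open>\<open>H\<close> has mean zero, so both halves contribute the same squared
          sum \<open>(a x)\<^sup>2\<close>.\<close>
        have "(\<Sum>A\<in>slice (W - {x}) k. H A) = - a x" using sp[of H] H0 ax by simp
        then have "2 * real (?N - 1) * ((\<Sum>A\<in>slice (W - {x}) k. (H A)\<^sup>2) - (a x)\<^sup>2 / M0) +
           2 * real (?N - 1) * ((\<Sum>A\<in>{A\<in>?S. x \<in> A}. (H A)\<^sup>2) - (a x)\<^sup>2 / M1)
             \<le> (\<Sum>A\<in>?S. \<Sum>u\<in>A. \<Sum>v\<in>W - A. if x = u \<or> x = v then 0 else (H A - H (insert v (A - {u})))\<^sup>2)"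
          using i1 i2 re[of "\<lambda>A. (H A)\<^sup>2"] re[of H] ax
          unfolding swap_energy_split[OF W k(1) x, symmetric] by simp
        then show ?thesis using k sp[of "\<lambda>A. (H A)\<^sup>2"] unfolding X_def
          by (simp add: algebra_simps of_nat_diff)
      qed
      have fA: "finite A" "A \<subseteq> W" if "A \<in> ?S" for A using that W finite_subset by (auto simp: slice_def)
      have "(\<Sum>x\<in>W. \<Sum>A\<in>?S. \<Sum>u\<in>A. \<Sum>v\<in>W - A. if x = u \<or> x = v then 0 else (H A - H (insert v (A - {u})))\<^sup>2)
         = (\<Sum>A\<in>?S. \<Sum>u\<in>A. \<Sum>v\<in>W - A. \<Sum>x\<in>W. if x = u \<or> x = v then 0 else (H A - H (insert v (A - {u})))\<^sup>2)"
        by (simp add: sum.swap[of _ _ W])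
      also have "\<dots> = (\<Sum>A\<in>?S. \<Sum>u\<in>A. \<Sum>v\<in>W - A. (real ?N - 2) * (H A - H (insert v (A - {u})))\<^sup>2)"
      proof (intro sum.cong refl)
        fix A u v assume *: "A \<in> ?S" "u \<in> A" "v \<in> W - A"
        then have uv: "u \<in> W" "v \<in> W" "u \<noteq> v" using fA by auto
        have "(\<Sum>x\<in>W. if x = u \<or> x = v then 0 else (H A - H (insert v (A - {u})))\<^sup>2)
           = (\<Sum>x\<in>W - {u, v}. (H A - H (insert v (A - {u})))\<^sup>2)"
          using W by (intro sum.mono_neutral_cong_right) auto
        also have "\<dots> = real (card (W - {u, v})) * (H A - H (insert v (A - {u})))\<^sup>2" by simp
        also have "card (W - {u, v}) = ?N - 2" using W uv by (simp add: card_Diff_subset)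
        finally show "(\<Sum>x\<in>W. if x = u \<or> x = v then 0 else (H A - H (insert v (A - {u})))\<^sup>2) =
           (real ?N - 2) * (H A - H (insert v (A - {u})))\<^sup>2" using N3 by (simp add: of_nat_diff)
      qed
      also have "\<dots> = (real ?N - 2) * swap_energy W k H" by (simp add: swap_energy_def sum_distrib_left)
      finally have tot: "(\<Sum>x\<in>W. 2 * (real ?N - 1) * (X - (a x)\<^sup>2 / M0 - (a x)\<^sup>2 / M1)) \<le> (real ?N - 2) * swap_energy W k H"
        by (subst (asm) eq_commute) (simp only:, rule sum_mono, rule step)
      define A2 where "A2 = (\<Sum>x\<in>W. (a x)\<^sup>2)"
      have tot': "2 * (real ?N - 1) * (real ?N * X - A2 / M0 - A2 / M1) \<le> (real ?N - 2) * swap_energy W k H"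
        using tot by (simp add: A2_def sum_subtractf sum_divide_distrib flip: sum_distrib_left)
      have A2le: "A2 \<le> real ((?N - 2) choose (k - 1)) * X"
        using slice_linear_part[OF W k(1) H0] by (simp add: A2_def a_def X_def)
      have kN: "real k > 0" "real k < real ?N" using k by auto
      obtain N' where N': "?N = Suc (Suc N')" using N3 by (metis Suc_diff_Suc Suc_1 less_eq_Suc_le numeral_3_eq_3 diff_zero nat.exhaust not_less_eq_eq zero_le)
      obtain k' where k': "k = Suc k'" using k by (cases k) auto
      let ?C = "real ((?N - 2) choose (k - 1))"
      have e1: "real k * M0 = (real ?N - real k) * M1"
      proof -
        have "Suc k' * (Suc N' choose Suc k') = (Suc N' - k') * (Suc N' choose k')"
          using binomial_absorb_comp[of "Suc N'" k'] Suc_times_binomial_eq[of N' k'] by simp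
        then have "real (Suc k') * real (Suc N' choose Suc k') = real (Suc N' - k') * real (Suc N' choose k')"
          by (metis of_nat_mult)
        moreover have "real (Suc N' - k') = real ?N - real k" using k N' k' by (simp add: of_nat_diff)
        ultimately show ?thesis by (simp add: M0_def M1_def N' k')
      qed
      have e2: "(real ?N - 1) * ?C = (real ?N - real k) * M1"
      proof -
        have "(Suc N' - k') * (Suc N' choose k') = Suc N' * (N' choose k')"
          using binomial_absorb_comp[of "Suc N'" k'] by simp
        then have "real (Suc N' - k') * real (Suc N' choose k') = real (Suc N') * real (N' choose k')"
          by (metis of_nat_mult)
        moreover have "real (Suc N' - k') = real ?N - real k" using k N' k' by (simp add: of_nat_diff)
        ultimately show ?thesis by (simp add: M1_def N' k')
      qed
      \<comment> \<open>The identity that makes the induction lossless: the two means together cost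
        at most \<open>2 * ?N * X\<close>, and
        \<open>2 * (?N - 1) * ?N - 2 * ?N = 2 * ?N * (?N - 2)\<close> copies of \<open>X\<close>
        remain against \<open>?N - 2\<close> copies of the energy.\<close>
      have e3: "(real ?N - 1) * (?C / M0 + ?C / M1) = real ?N"
      proof -
        have "(real ?N - 1) * (?C / M0) = real k"
          using e1 e2 Mp by (simp add: field_simps)
        moreover have "(real ?N - 1) * (?C / M1) = real ?N - real k"
          using e2 Mp by (simp add: field_simps)
        ultimately show ?thesis by (simp add: distrib_left)
      qed
      have gen: "2 * c * (Y - u - v) = 2 * c * Y - 2 * (c * (u + v))" for c Y u v :: real
        by (simp add: algebra_simps)
      have X0: "X \<ge> 0" unfolding X_def by (intro sum_nonneg) auto
      have "A2 / M0 + A2 / M1 \<le> (?C * X) / M0 + (?C * X) / M1"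
        using A2le Mp by (intro add_mono divide_right_mono) auto
      then have "(real ?N - 1) * (A2 / M0 + A2 / M1) \<le> (real ?N - 1) * ((?C * X) / M0 + (?C * X) / M1)"
        using N3 by (intro mult_left_mono) auto
      also have "\<dots> = (real ?N - 1) * (?C / M0 + ?C / M1) * X" by (simp add: algebra_simps)
      also have "\<dots> = real ?N * X" using e3 by simp
      finally have "(real ?N - 1) * (A2 / M0 + A2 / M1) \<le> real ?N * X" .
      then have "2 * (real ?N - 1) * (real ?N * X) - 2 * (real ?N * X) \<le>
          2 * (real ?N - 1) * (real ?N * X) - 2 * ((real ?N - 1) * (A2 / M0 + A2 / M1))"
        by (intro diff_left_mono mult_left_mono) auto
      then have "(real ?N - 2) * (2 * real ?N * X) \<le> 2 * (real ?N - 1) * (real ?N * X - A2 / M0 - A2 / M1)"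
        unfolding gen by (simp add: algebra_simps)
      also note tot'
      finally show ?thesis using N3 by (simp add: mult_le_cancel_left_pos)
    qed
    then show ?thesis using HF EH unfolding X_def M_def by simp
  qed
qed

section \<open>Densities on a slice that change little under swaps\<close>

lemma sum_swaps_reindex:
  fixes g :: "'a set \<Rightarrow> real"
  assumes "finite W"
  shows "(\<Sum>A\<in>slice W k. \<Sum>x\<in>A. \<Sum>y\<in>W - A. g (insert y (A - {x}))) =
         (\<Sum>A\<in>slice W k. \<Sum>x\<in>A. \<Sum>y\<in>W - A. g A)"
proof -
  have fin: "finite A" if "A \<in> slice W k" for A using that assms finite_subset by (auto simp: slice_def)
  let ?T = "SIGMA A:slice W k. SIGMA x:A. (W - A)"
  let ?f = "\<lambda>(A, x, y). (insert y (A - {x}), y, x)"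
  have "(\<Sum>A\<in>slice W k. \<Sum>x\<in>A. \<Sum>y\<in>W - A. g (insert y (A - {x}))) =
      (\<Sum>(A, x, y)\<in>?T. g (insert y (A - {x})))"
    using assms fin by (simp add: sum.Sigma sum.cartesian_product del: sum_constant)
  also have "\<dots> = (\<Sum>(A, x, y)\<in>?T. g A)"
  proof (rule sum.reindex_bij_witness[of _ ?f ?f])
    fix z assume "z \<in> ?T"
    then obtain A x y where z: "z = (A, x, y)" "A \<in> slice W k" "x \<in> A" "y \<in> W" "y \<notin> A" by auto
    have "finite A" using fin z by auto
    then have "card (insert y (A - {x})) = k" using z by (simp add: slice_def card.insert_remove) 
       (metis One_nat_def Suc_pred card_gt_0_iff empty_iff)
    moreover have "x \<in> W" "A \<subseteq> W" using z by (auto simp: slice_def)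
    ultimately show "?f z \<in> ?T" "?f (?f z) = z" using z by (auto simp: slice_def)
    then show "?f (?f z) = z" by simp
    show "?f z \<in> ?T" by fact
    show "(case ?f z of (A, x, y) \<Rightarrow> g A) = (case z of (A, x, y) \<Rightarrow> g (insert y (A - {x})))" using z by simp
  qed
  also have "\<dots> = (\<Sum>A\<in>slice W k. \<Sum>x\<in>A. \<Sum>y\<in>W - A. g A)"
    using assms fin by (simp add: sum.Sigma sum.cartesian_product split_def del: sum_constant)
  finally show ?thesis .
qed

lemma swap_in_slice:
  assumes "finite W" "A \<in> slice W k" "x \<in> A" "y \<in> W - A"
  shows "insert y (A - {x}) \<in> slice W k" "y \<in> insert y (A - {x})" "x \<in> W - insert y (A - {x})"
    "insert x (insert y (A - {x}) - {y}) = A"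
proof -
  have "finite A" using assms finite_subset by (auto simp: slice_def)
  then have "card (insert y (A - {x})) = k" using assms by (simp add: slice_def card.insert_remove) 
       (metis One_nat_def Suc_pred card_gt_0_iff empty_iff)
  then show "insert y (A - {x}) \<in> slice W k" using assms by (auto simp: slice_def)
qed (use assms in \<open>auto simp: slice_def\<close>)

text \<open>\<open>h\<^sup>2\<close> is a density of mean 1 against the uniform measure on the
  slice. Between good sets a swap changes \<open>h\<close> by a small relative amount. From good to
  bad only a factor 4 of the density is controlled, and this is enough because the bad sets carry
  density mass at most \<open>\<theta>\<close>.\<close>

locale slice_density =
  fixes W :: "'a set" and k :: nat and h :: "'a set \<Rightarrow> real" and good :: "'a set \<Rightarrow> bool"
    and \<delta> \<theta> :: real
  assumes finW: "finite W" and kW: "k \<le> card W"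
    and h_nonneg: "\<And>A. A \<in> slice W k \<Longrightarrow> 0 \<le> h A"
    and h_norm: "(\<Sum>A\<in>slice W k. (h A)\<^sup>2) = real (card W choose k)"
    and \<delta>_nonneg: "0 \<le> \<delta>"
    and lip: "\<And>A x y. A \<in> slice W k \<Longrightarrow> x \<in> A \<Longrightarrow> y \<in> W - A \<Longrightarrow> good A \<Longrightarrow> good (insert y (A - {x})) \<Longrightarrow>
        \<bar>h (insert y (A - {x})) - h A\<bar> \<le> \<delta> * h A"
    and crude: "\<And>A x y. A \<in> slice W k \<Longrightarrow> x \<in> A \<Longrightarrow> y \<in> W - A \<Longrightarrow> good A \<Longrightarrow> \<not> good (insert y (A - {x})) \<Longrightarrow>
        (h A)\<^sup>2 \<le> 4 * (h (insert y (A - {x})))\<^sup>2"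
    and bad_mass: "(\<Sum>A | A \<in> slice W k \<and> \<not> good A. (h A)\<^sup>2) \<le> \<theta> * real (card W choose k)"
begin

abbreviation "S \<equiv> slice W k"
abbreviation "N \<equiv> real (card W)"
abbreviation "M \<equiv> real (card W choose k)"

lemma finS: "finite S" using finW by simp

lemma M_pos: "M > 0" using kW by simp

lemma \<theta>_nonneg: "\<theta> \<ge> 0"
proof -
  have "0 \<le> \<theta> * M" using bad_mass by (rule order_trans[rotated]) (intro sum_nonneg, auto)
  then show ?thesis using M_pos by (simp add: zero_le_mult_iff)
qed

lemma sum_slice_swaps_const: "(\<Sum>A\<in>S. \<Sum>x\<in>A. \<Sum>y\<in>W - A. g A) \<le> N\<^sup>2 * (\<Sum>A\<in>S. g A)"
  if "\<And>A. A \<in> S \<Longrightarrow> g A \<ge> (0::real)" for g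
  unfolding sum_distrib_left
proof (rule sum_mono)
  fix A assume A: "A \<in> S"
  then have sub: "A \<subseteq> W" and fA: "finite A" using finW finite_subset by (auto simp: slice_def)
  have "real (card A) * real (card (W - A)) \<le> N * N"
    using sub finW by (intro mult_mono) (auto intro!: card_mono)
  then have "real (card A) * real (card (W - A)) * g A \<le> N * N * g A"
    using that[OF A] by (rule mult_right_mono)
  then show "(\<Sum>x\<in>A. \<Sum>y\<in>W - A. g A) \<le> N\<^sup>2 * g A" by (simp add: power2_eq_square mult_ac)
qed

text \<open>The Poincare inequality for \<open>\<psi> \<circ> h\<close>. Since \<open>\<psi>\<close>
  is constant off \<open>U\<close>, a swap between good sets costs energy only if one of its ends
  has \<open>h\<close> in \<open>U\<close>; this locality is what lets the truncations below be
  iterated.\<close>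

lemma variance_le:
  fixes \<psi> :: "real \<Rightarrow> real" and U :: "real set"
  assumes \<psi>: "\<And>u v. \<bar>\<psi> u - \<psi> v\<bar> \<le> \<bar>u - v\<bar>" and U: "\<And>u v. u \<notin> U \<Longrightarrow> v \<notin> U \<Longrightarrow> \<psi> u = \<psi> v"
  shows "(\<Sum>A\<in>S. (\<psi> (h A))\<^sup>2) - (\<Sum>A\<in>S. \<psi> (h A))\<^sup>2 / M \<le>
     N * \<delta>\<^sup>2 * (\<Sum>A | A \<in> S \<and> h A \<in> U. (h A)\<^sup>2) + 5 * N * \<theta> * M"
proof (cases "card W = 0")
  case True
  then have "W = {}" "k = 0" using finW kW by auto
  then have "S = {{}}" by (auto simp: slice_def)
  then show ?thesis using True \<open>k = 0\<close> by simp
next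
  case False
  then have N0: "N > 0" by simp
  \<comment> \<open>\<open>g\<close> is the charge on one end of a swap. A swap between good sets is
    charged to an end with \<open>h\<close> in \<open>U\<close>. A swap with a bad end costs at most
    the sum of both densities, which \<open>crude\<close> bounds by five times the density at the
    bad end if the other end is good.\<close>
  define g where "g = (\<lambda>A. (if h A \<in> U then \<delta>\<^sup>2 * (h A)\<^sup>2 else 0) + (if good A then 0 else 5 * (h A)\<^sup>2))"
  have g0: "g A \<ge> 0" for A by (simp add: g_def)
  have key: "(\<psi> (h A) - \<psi> (h (insert y (A - {x}))))\<^sup>2 \<le> g A + g (insert y (A - {x}))"
    if A: "A \<in> S" "x \<in> A" "y \<in> W - A" for A x y
  proof -
    let ?B = "insert y (A - {x})"
    note B = swap_in_slice[OF finW A]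
    have hs: "0 \<le> h A" "0 \<le> h ?B" using h_nonneg A B by auto
    have "(\<psi> (h A) - \<psi> (h ?B))\<^sup>2 \<le> (h A - h ?B)\<^sup>2"
      using \<psi>[of "h A" "h ?B"] by (simp add: abs_le_square_iff)
    moreover have sq: "(h A - h ?B)\<^sup>2 \<le> (h A)\<^sup>2 + (h ?B)\<^sup>2"
      using mult_nonneg_nonneg[OF hs] by (simp add: power2_eq_square algebra_simps)
    ultimately have le: "(\<psi> (h A) - \<psi> (h ?B))\<^sup>2 \<le> (h A - h ?B)\<^sup>2"
      "(\<psi> (h A) - \<psi> (h ?B))\<^sup>2 \<le> (h A)\<^sup>2 + (h ?B)\<^sup>2" by auto
    show ?thesis
    proof (cases "good A")
      case True
      show ?thesis
      proof (cases "good ?B")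
        case gB: True
        have l1: "(h A - h ?B)\<^sup>2 \<le> (\<delta> * h A)\<^sup>2"
          using lip[OF A True gB] hs \<delta>_nonneg by (subst abs_le_square_iff[symmetric]) (simp add: abs_mult abs_minus_commute)
        have l2: "(h A - h ?B)\<^sup>2 \<le> (\<delta> * h ?B)\<^sup>2"
          using lip[OF B(1-3) gB] True B(4) hs \<delta>_nonneg by (subst abs_le_square_iff[symmetric]) (simp add: abs_mult)
        consider "h A \<in> U" | "h ?B \<in> U" | "\<psi> (h A) = \<psi> (h ?B)" using U by blast
        then show ?thesis
        proof cases
          case 1
          then have "g A \<ge> (\<delta> * h A)\<^sup>2" by (simp add: g_def power_mult_distrib)
          then show ?thesis using le l1 g0[of ?B] by linarith
        next
          case 2
          then have "g ?B \<ge> (\<delta> * h ?B)\<^sup>2" by (simp add: g_def power_mult_distrib)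
          then show ?thesis using le l2 g0[of A] by linarith
        next
          case 3
          then show ?thesis using g0[of A] g0[of ?B] by simp
        qed
      next
        case False
        then have "g ?B \<ge> 5 * (h ?B)\<^sup>2" by (simp add: g_def)
        then show ?thesis using le crude[OF A True False] g0[of A] by linarith
      qed
    next
      case False
      then have gA: "g A \<ge> 5 * (h A)\<^sup>2" by (simp add: g_def)
      show ?thesis
      proof (cases "good ?B")
        case True
        have "(h ?B)\<^sup>2 \<le> 4 * (h A)\<^sup>2" using crude[OF B(1-3) True] False B(4) by simp
        then show ?thesis using le gA g0[of ?B] by linarith
      next
        case False
        then have "g ?B \<ge> 5 * (h ?B)\<^sup>2" by (simp add: g_def)
        then show ?thesis using le gA zero_le_power2[of "h A"] zero_le_power2[of "h ?B"] by linarith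
      qed
    qed
  qed
  have "2 * N * ((\<Sum>A\<in>S. (\<psi> (h A))\<^sup>2) - (\<Sum>A\<in>S. \<psi> (h A))\<^sup>2 / M) \<le> swap_energy W k (\<lambda>A. \<psi> (h A))"
    by (rule slice_poincare[OF finW kW])
  also have "\<dots> \<le> (\<Sum>A\<in>S. \<Sum>x\<in>A. \<Sum>y\<in>W - A. g A + g (insert y (A - {x})))"
    unfolding swap_energy_def by (intro sum_mono key)
  also have "\<dots> = 2 * (\<Sum>A\<in>S. \<Sum>x\<in>A. \<Sum>y\<in>W - A. g A)"
    by (simp only: sum.distrib sum_swaps_reindex[OF finW] mult_2)
  also have "\<dots> \<le> 2 * (N\<^sup>2 * (\<Sum>A\<in>S. g A))"
    by (intro mult_left_mono sum_slice_swaps_const) (auto simp: g0)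
  also have "\<dots> = 2 * N * (N * (\<Sum>A\<in>S. g A))" by (simp add: power2_eq_square)
  finally have "(\<Sum>A\<in>S. (\<psi> (h A))\<^sup>2) - (\<Sum>A\<in>S. \<psi> (h A))\<^sup>2 / M \<le> N * (\<Sum>A\<in>S. g A)"
    using N0 by (simp only: mult_le_cancel_left_pos[of "2 * N"])
  also have "(\<Sum>A\<in>S. g A) = \<delta>\<^sup>2 * (\<Sum>A | A \<in> S \<and> h A \<in> U. (h A)\<^sup>2) + 5 * (\<Sum>A | A \<in> S \<and> \<not> good A. (h A)\<^sup>2)"
    unfolding g_def sum.distrib sum_distrib_left sum.inter_filter[OF finS]
    by (intro arg_cong2[where f = "(+)"] sum.cong) auto
  also have "N * \<dots> \<le> N * (\<delta>\<^sup>2 * (\<Sum>A | A \<in> S \<and> h A \<in> U. (h A)\<^sup>2) + 5 * (\<theta> * M))"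
    using bad_mass by (intro mult_left_mono add_left_mono) auto
  finally show ?thesis by (simp add: algebra_simps)
qed

context
  fixes \<sigma> :: real
  assumes \<sigma>: "0 < \<sigma>" "\<sigma> \<le> 1" "16 * (N * \<delta>\<^sup>2 + 5 * N * \<theta>) \<le> \<sigma>\<^sup>2"
begin

lemma \<kappa>\<beta>_nonneg: "0 \<le> N * \<delta>\<^sup>2" "0 \<le> 5 * N * \<theta>" using \<theta>_nonneg by auto

lemma \<kappa>_le: "16 * (N * \<delta>\<^sup>2) \<le> \<sigma>\<^sup>2" 
proof -
  have "16 * x \<le> z" if "16 * (x + y) \<le> z" "0 \<le> y" for x y z :: real using that by simp
  then show ?thesis using \<sigma>(3) \<kappa>\<beta>_nonneg(2) by blast
qed

text \<open>With the identity as truncation, \<open>variance_le\<close> bounds the variance of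
  \<open>h\<close>. As \<open>h\<^sup>2\<close> has mean 1, the mean of \<open>h\<close> lies
  between \<open>1 - \<omega>\<close> and 1, and Chebyshev's inequality leaves at most a quarter of
  the slice on either side. This ensures that all later truncations have small support.\<close>

lemma median_bounds:
  shows "real (card {A \<in> S. h A > 1 + \<sigma>}) \<le> M / 4" "real (card {A \<in> S. h A < 1 - \<sigma>}) \<le> M / 4"
proof -
  define \<mu> where "\<mu> = (\<Sum>A\<in>S. h A) / M"
  define \<omega> where "\<omega> = N * \<delta>\<^sup>2 + 5 * N * \<theta>"
  have cS: "real (card S) = M" using finW by (simp add: card_slice)
  have "(\<Sum>A\<in>S. (h A)\<^sup>2) - (\<Sum>A\<in>S. h A)\<^sup>2 / M \<le> N * \<delta>\<^sup>2 * (\<Sum>A | A \<in> S \<and> h A \<in> UNIV. (h A)\<^sup>2) + 5 * N * \<theta> * M"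
    using variance_le[of "\<lambda>u. u" UNIV] by simp
  then have v: "M - M * \<mu>\<^sup>2 \<le> \<omega> * M"
    using M_pos h_norm by (simp add: \<mu>_def \<omega>_def power2_eq_square field_simps)
  have "(\<Sum>A\<in>S. (h A - \<mu>)\<^sup>2) = (\<Sum>A\<in>S. (h A)\<^sup>2 - 2 * \<mu> * h A + \<mu>\<^sup>2)"
    by (intro sum.cong) (auto simp: power2_eq_square algebra_simps)
  also have "\<dots> = M - 2 * \<mu> * (\<Sum>A\<in>S. h A) + M * \<mu>\<^sup>2"
    using cS h_norm by (simp add: sum.distrib sum_subtractf sum_distrib_left)
  also have "\<dots> = M - M * \<mu>\<^sup>2"
    using M_pos by (simp add: \<mu>_def power2_eq_square field_simps)
  finally have var: "(\<Sum>A\<in>S. (h A - \<mu>)\<^sup>2) = M - M * \<mu>\<^sup>2" .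
  then have "M * \<mu>\<^sup>2 \<le> M" using sum_nonneg[of S "\<lambda>A. (h A - \<mu>)\<^sup>2"] by simp
  then have "\<mu>\<^sup>2 \<le> 1" using M_pos by simp
  then have \<mu>1: "\<mu> \<le> 1" by (simp add: abs_square_le_1)
  have \<mu>0: "\<mu> \<ge> 0" unfolding \<mu>_def using h_nonneg M_pos by (intro divide_nonneg_pos sum_nonneg) auto
  have "M * (1 - \<mu>\<^sup>2) \<le> M * \<omega>" using v by (simp add: algebra_simps)
  then have "1 - \<mu>\<^sup>2 \<le> \<omega>" using M_pos by simp
  moreover have "\<mu>\<^sup>2 \<le> \<mu>" using \<mu>0 \<mu>1 by (simp add: power2_eq_square mult_left_le)
  ultimately have \<mu>2: "\<mu> \<ge> 1 - \<omega>" by simp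
  have \<omega>: "16 * \<omega> \<le> \<sigma>\<^sup>2" using \<sigma> by (simp add: \<omega>_def)
  moreover have "\<sigma>\<^sup>2 \<le> \<sigma>" using \<sigma> by (simp add: power2_eq_square mult_left_le)
  ultimately have \<omega>\<sigma>: "\<omega> \<le> \<sigma> / 2" using \<sigma> by linarith
  have cheb: "real (card X) \<le> M / 4" if X: "X \<subseteq> S" "\<And>A. A \<in> X \<Longrightarrow> \<bar>h A - \<mu>\<bar> \<ge> \<sigma> / 2" for X
  proof -
    have "real (card X) * (\<sigma> / 2)\<^sup>2 = (\<Sum>A\<in>X. (\<sigma> / 2)\<^sup>2)" by simp
    also have "\<dots> \<le> (\<Sum>A\<in>X. (h A - \<mu>)\<^sup>2)"
    proof (rule sum_mono)
      fix A assume "A \<in> X"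
      then have "(\<sigma> / 2)\<^sup>2 \<le> \<bar>h A - \<mu>\<bar>\<^sup>2" using X \<sigma> by (intro power_mono) auto
      then show "(\<sigma> / 2)\<^sup>2 \<le> (h A - \<mu>)\<^sup>2" by simp
    qed
    also have "\<dots> \<le> (\<Sum>A\<in>S. (h A - \<mu>)\<^sup>2)" using X finS by (intro sum_mono2) auto
    also have "\<dots> \<le> \<omega> * M" using var v by simp
    also have "\<dots> \<le> (\<sigma>\<^sup>2 / 16) * M" using \<omega> M_pos by (intro mult_right_mono) auto
    finally have "\<sigma>\<^sup>2 * (real (card X) / 4) \<le> \<sigma>\<^sup>2 * (M / 16)" by (simp add: power_divide field_simps)
    then show ?thesis using \<sigma> by simp
  qed
  show "real (card {A \<in> S. h A > 1 + \<sigma>}) \<le> M / 4" using \<mu>1 \<sigma> by (intro cheb) auto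
  show "real (card {A \<in> S. h A < 1 - \<sigma>}) \<le> M / 4" using \<mu>2 \<omega>\<sigma> \<sigma> by (intro cheb) auto
qed

text \<open>By Cauchy-Schwarz a function that lives on a small part of the slice has a small mean,
  so its second moment is comparable with its variance. This removes the subtracted mean from the
  Poincare inequality.\<close>

lemma half_support:
  fixes F :: "'a set \<Rightarrow> real"
  assumes "real (card {A \<in> S. F A \<noteq> 0}) \<le> M / 4"
  shows "(\<Sum>A\<in>S. (F A)\<^sup>2) \<le> 2 * ((\<Sum>A\<in>S. (F A)\<^sup>2) - (\<Sum>A\<in>S. F A)\<^sup>2 / M)"
proof -
  let ?X = "{A \<in> S. F A \<noteq> 0}"
  have "(\<Sum>A\<in>S. F A)\<^sup>2 = (\<Sum>A\<in>?X. 1 * F A)\<^sup>2"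
    using finS by (intro arg_cong[where f = "\<lambda>u. u\<^sup>2"] sum.mono_neutral_cong_right) auto
  also have "\<dots> \<le> (\<Sum>A\<in>?X. 1\<^sup>2) * (\<Sum>A\<in>?X. (F A)\<^sup>2)" by (rule Cauchy_Schwarz_ineq_sum)
  also have "(\<Sum>A\<in>?X. (F A)\<^sup>2) = (\<Sum>A\<in>S. (F A)\<^sup>2)"
    using finS by (intro sum.mono_neutral_cong_left) auto
  also have "(\<Sum>A\<in>?X. 1\<^sup>2) * (\<Sum>A\<in>S. (F A)\<^sup>2) \<le> (M / 2) * (\<Sum>A\<in>S. (F A)\<^sup>2)"
    using assms M_pos by (intro mult_right_mono sum_nonneg) auto
  finally have "(\<Sum>A\<in>S. F A)\<^sup>2 / M \<le> (\<Sum>A\<in>S. (F A)\<^sup>2) / 2"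
    using M_pos by (simp add: field_simps)
  moreover have "X \<le> 2 * (X - Y)" if "Y \<le> X / 2" for X Y :: real using that by simp
  ultimately show ?thesis by blast
qed

text \<open>The truncation at \<open>a\<close> has its energy charged to \<open>h > a\<close> and is
  at least \<open>\<sigma> / 2 * h\<close> where \<open>h > a + \<sigma>\<close>; the limit 2 on
  \<open>a + \<sigma>\<close> is used for that. By the choice of \<open>\<sigma>\<close> the
  quotient of the two constants is at most one half, so raising the level by \<open>\<sigma>\<close>
  halves the density mass.\<close>

lemma upper_step:
  assumes a: "a \<ge> 1 + \<sigma>" "a + \<sigma> \<le> 2"
  shows "(\<Sum>A | A \<in> S \<and> h A > a + \<sigma>. (h A)\<^sup>2) \<le>
     (\<Sum>A | A \<in> S \<and> h A > a. (h A)\<^sup>2) / 2 + (40 * N * \<theta> / \<sigma>\<^sup>2) * M"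
proof -
  let ?V = "\<lambda>a. \<Sum>A | A \<in> S \<and> h A > a. (h A)\<^sup>2"
  define \<psi> where "\<psi> = (\<lambda>u::real. max (u - a) 0)"
  have V0: "?V b \<ge> 0" for b by (intro sum_nonneg) auto
  have "card {A \<in> S. \<psi> (h A) \<noteq> 0} \<le> card {A \<in> S. h A > 1 + \<sigma>}"
    using finS a by (intro card_mono) (auto simp: \<psi>_def max_def)
  then have c: "real (card {A \<in> S. \<psi> (h A) \<noteq> 0}) \<le> M / 4" using median_bounds by linarith
  have "(\<Sum>A\<in>S. (\<psi> (h A))\<^sup>2) \<le> 2 * ((\<Sum>A\<in>S. (\<psi> (h A))\<^sup>2) - (\<Sum>A\<in>S. \<psi> (h A))\<^sup>2 / M)"
    using c by (rule half_support)
  also have "\<dots> \<le> 2 * (N * \<delta>\<^sup>2 * (\<Sum>A | A \<in> S \<and> h A \<in> {a<..}. (h A)\<^sup>2) + 5 * N * \<theta> * M)"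
    by (intro mult_left_mono variance_le) (auto simp: \<psi>_def)
  finally have 1: "(\<Sum>A\<in>S. (\<psi> (h A))\<^sup>2) \<le> 2 * (N * \<delta>\<^sup>2 * ?V a + 5 * N * \<theta> * M)" by simp
  have "(\<sigma>\<^sup>2 / 4) * ?V (a + \<sigma>) = (\<Sum>A | A \<in> S \<and> h A > a + \<sigma>. (\<sigma>\<^sup>2 / 4) * (h A)\<^sup>2)"
    by (simp add: sum_distrib_left)
  also have "\<dots> \<le> (\<Sum>A | A \<in> S \<and> h A > a + \<sigma>. (\<psi> (h A))\<^sup>2)"
  proof (rule sum_mono)
    fix A assume "A \<in> {A. A \<in> S \<and> h A > a + \<sigma>}"
    then have hA: "h A > a + \<sigma>" by simp
    have "\<sigma> * h A \<le> (a + \<sigma>) * (h A - a)"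
    proof -
      have "0 \<le> a * (h A - a - \<sigma>)" using hA a \<sigma> by simp
      then show ?thesis by (simp add: algebra_simps)
    qed
    also have "\<dots> \<le> 2 * (h A - a)" using hA a \<sigma> by (intro mult_right_mono) auto
    finally have "\<sigma> / 2 * h A \<le> h A - a" by simp
    then have "(\<sigma> / 2 * h A)\<^sup>2 \<le> (h A - a)\<^sup>2" using \<sigma> hA a by (intro power_mono) auto
    also have "h A - a = \<psi> (h A)" using hA \<sigma> by (simp add: \<psi>_def)
    finally show "\<sigma>\<^sup>2 / 4 * (h A)\<^sup>2 \<le> (\<psi> (h A))\<^sup>2" by (simp add: power_mult_distrib power_divide)
  qed
  also have "\<dots> \<le> (\<Sum>A\<in>S. (\<psi> (h A))\<^sup>2)" using finS by (intro sum_mono2) auto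
  also note 1
  finally have "?V (a + \<sigma>) \<le> (8 * (N * \<delta>\<^sup>2) / \<sigma>\<^sup>2) * ?V a + (40 * N * \<theta> / \<sigma>\<^sup>2) * M"
    using \<sigma> by (simp add: field_simps)
  also have "(8 * (N * \<delta>\<^sup>2) / \<sigma>\<^sup>2) * ?V a \<le> (1 / 2) * ?V a"
    using \<sigma>(1) \<kappa>_le V0 by (intro mult_right_mono) (simp_all add: divide_le_eq)
  finally show ?thesis by simp
qed

text \<open>The mirror image, for the uniform measure: below level 1 the density is at most 1, so
  the density mass that bounds the energy is itself bounded by a count.\<close>

lemma lower_step:
  assumes a: "a \<le> 1 - \<sigma>" "a \<ge> 0"
  shows "real (card {A \<in> S. h A < a - \<sigma>}) \<le>
     real (card {A \<in> S. h A < a}) / 2 + (40 * N * \<theta> / \<sigma>\<^sup>2) * M"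
proof -
  let ?V = "\<lambda>a. real (card {A \<in> S. h A < a})"
  define \<psi> where "\<psi> = (\<lambda>u::real. max (a - u) 0)"
  have "card {A \<in> S. \<psi> (h A) \<noteq> 0} \<le> card {A \<in> S. h A < 1 - \<sigma>}"
    using finS a by (intro card_mono) (auto simp: \<psi>_def max_def)
  then have c: "real (card {A \<in> S. \<psi> (h A) \<noteq> 0}) \<le> M / 4" using median_bounds by linarith
  have "(\<Sum>A\<in>S. (\<psi> (h A))\<^sup>2) \<le> 2 * ((\<Sum>A\<in>S. (\<psi> (h A))\<^sup>2) - (\<Sum>A\<in>S. \<psi> (h A))\<^sup>2 / M)"
    using c by (rule half_support)
  also have "\<dots> \<le> 2 * (N * \<delta>\<^sup>2 * (\<Sum>A | A \<in> S \<and> h A \<in> {..<a}. (h A)\<^sup>2) + 5 * N * \<theta> * M)"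
    by (intro mult_left_mono variance_le) (auto simp: \<psi>_def)
  also have "(\<Sum>A | A \<in> S \<and> h A \<in> {..<a}. (h A)\<^sup>2) \<le> (\<Sum>A | A \<in> S \<and> h A \<in> {..<a}. 1)"
  proof (rule sum_mono)
    fix A assume A: "A \<in> {A. A \<in> S \<and> h A \<in> {..<a}}"
    then have "0 \<le> h A" "h A \<le> 1" using a \<sigma> h_nonneg by auto
    then show "(h A)\<^sup>2 \<le> 1" by (simp add: abs_square_le_1)
  qed
  also have "\<dots> = ?V a" by simp
  finally have 1: "(\<Sum>A\<in>S. (\<psi> (h A))\<^sup>2) \<le> 2 * (N * \<delta>\<^sup>2 * ?V a + 5 * N * \<theta> * M)"
    by (simp add: mult_left_mono)
  have "\<sigma>\<^sup>2 * ?V (a - \<sigma>) = (\<Sum>A | A \<in> S \<and> h A < a - \<sigma>. \<sigma>\<^sup>2)" by simp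
  also have "\<dots> \<le> (\<Sum>A | A \<in> S \<and> h A < a - \<sigma>. (\<psi> (h A))\<^sup>2)"
    using \<sigma> by (intro sum_mono power_mono) (auto simp: \<psi>_def)
  also have "\<dots> \<le> (\<Sum>A\<in>S. (\<psi> (h A))\<^sup>2)" using finS by (intro sum_mono2) auto
  also note 1
  finally have "?V (a - \<sigma>) \<le> (2 * (N * \<delta>\<^sup>2) / \<sigma>\<^sup>2) * ?V a + (10 * N * \<theta> / \<sigma>\<^sup>2) * M"
    using \<sigma> by (simp add: field_simps)
  also have "(2 * (N * \<delta>\<^sup>2) / \<sigma>\<^sup>2) * ?V a \<le> (1 / 2) * ?V a"
  proof (rule mult_right_mono)
    have aux: "2 * x / z \<le> 1 / 2" if "16 * x \<le> z" "0 \<le> x" "0 < z" for x z :: real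
      using that by (simp add: divide_le_eq)
    show "2 * (N * \<delta>\<^sup>2) / \<sigma>\<^sup>2 \<le> 1 / 2"
      by (rule aux[OF \<kappa>_le \<kappa>\<beta>_nonneg(1)]) (use \<sigma>(1) in simp)
  qed simp
  also have "(10 * N * \<theta> / \<sigma>\<^sup>2) * M \<le> (40 * N * \<theta> / \<sigma>\<^sup>2) * M"
    using \<sigma> \<theta>_nonneg by (intro mult_right_mono divide_right_mono) auto
  finally show ?thesis by simp
qed

text \<open>Iterated halving; the additive errors form a geometric series, whence 80 in place of
  40.\<close>

lemma upper_tail:
  assumes "real (j + 1) * \<sigma> \<le> 1"
  shows "(\<Sum>A | A \<in> S \<and> h A > 1 + real (j + 1) * \<sigma>. (h A)\<^sup>2) \<le> (1 / 2 ^ j + 80 * N * \<theta> / \<sigma>\<^sup>2) * M"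
  using assms
proof (induction j)
  case 0
  have "(\<Sum>A | A \<in> S \<and> h A > 1 + \<sigma>. (h A)\<^sup>2) \<le> (\<Sum>A\<in>S. (h A)\<^sup>2)" using finS by (intro sum_mono2) auto
  also have "\<dots> = 1 * M" using h_norm by simp
  also have "\<dots> \<le> (1 / 2 ^ 0 + 80 * N * \<theta> / \<sigma>\<^sup>2) * M" using \<theta>_nonneg by (intro mult_right_mono) auto
  finally show ?case by simp
next
  case (Suc j)
  have le: "real (j + 1) * \<sigma> \<le> 1" using Suc.prems \<sigma> by (simp add: algebra_simps)
  have eq: "1 + real (Suc j + 1) * \<sigma> = (1 + real (j + 1) * \<sigma>) + \<sigma>" by (simp add: algebra_simps)
  have "(\<Sum>A | A \<in> S \<and> h A > 1 + real (Suc j + 1) * \<sigma>. (h A)\<^sup>2) \<le>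
      (\<Sum>A | A \<in> S \<and> h A > 1 + real (j + 1) * \<sigma>. (h A)\<^sup>2) / 2 + (40 * N * \<theta> / \<sigma>\<^sup>2) * M"
    unfolding eq using Suc.prems \<sigma> by (intro upper_step) (auto simp: algebra_simps)
  also have "\<dots> \<le> ((1 / 2 ^ j + 80 * N * \<theta> / \<sigma>\<^sup>2) * M) / 2 + (40 * N * \<theta> / \<sigma>\<^sup>2) * M"
    using Suc.IH[OF le] by (intro add_right_mono divide_right_mono) auto
  also have "\<dots> = (1 / 2 ^ Suc j + 80 * N * \<theta> / \<sigma>\<^sup>2) * M" by (simp add: algebra_simps add_divide_distrib)
  finally show ?case .
qed

lemma lower_tail:
  assumes "real (j + 1) * \<sigma> \<le> 1"
  shows "real (card {A \<in> S. h A < 1 - real (j + 1) * \<sigma>}) \<le> (1 / 2 ^ j + 80 * N * \<theta> / \<sigma>\<^sup>2) * M"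
  using assms
proof (induction j)
  case 0
  have "card {A \<in> S. h A < 1 - \<sigma>} \<le> card S" using finS by (intro card_mono) auto
  then have "real (card {A \<in> S. h A < 1 - \<sigma>}) \<le> 1 * M" using finW by (simp add: card_slice)
  also have "\<dots> \<le> (1 / 2 ^ 0 + 80 * N * \<theta> / \<sigma>\<^sup>2) * M" using \<theta>_nonneg by (intro mult_right_mono) auto
  finally show ?case by simp
next
  case (Suc j)
  have le: "real (j + 1) * \<sigma> \<le> 1" using Suc.prems \<sigma> by (simp add: algebra_simps)
  have eq: "1 - real (Suc j + 1) * \<sigma> = (1 - real (j + 1) * \<sigma>) - \<sigma>" by (simp add: algebra_simps)
  have "real (card {A \<in> S. h A < 1 - real (Suc j + 1) * \<sigma>}) \<le>
      real (card {A \<in> S. h A < 1 - real (j + 1) * \<sigma>}) / 2 + (40 * N * \<theta> / \<sigma>\<^sup>2) * M"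
    unfolding eq using Suc.prems \<sigma> by (intro lower_step) (auto simp: algebra_simps)
  also have "\<dots> \<le> ((1 / 2 ^ j + 80 * N * \<theta> / \<sigma>\<^sup>2) * M) / 2 + (40 * N * \<theta> / \<sigma>\<^sup>2) * M"
    using Suc.IH[OF le] by (intro add_right_mono divide_right_mono) auto
  also have "\<dots> = (1 / 2 ^ Suc j + 80 * N * \<theta> / \<sigma>\<^sup>2) * M" by (simp add: algebra_simps add_divide_distrib)
  finally show ?case .
qed

end

end

section \<open>Switchings\<close>

text \<open>The flag lets the bipartite and the loop-free directed models share one proof;
  \<open>D\<close> is meant to come with \<open>m = n\<close>.\<close>

definition cells :: "bool \<Rightarrow> nat \<Rightarrow> nat \<Rightarrow> (nat \<times> nat) set" where
  "cells D m n = {(i, j). i < m \<and> j < n \<and> \<not> (D \<and> i = j)}"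

definition rdeg :: "(nat \<times> nat) set \<Rightarrow> nat \<Rightarrow> nat" where "rdeg E = fst (degrees_of E)"
definition cdeg :: "(nat \<times> nat) set \<Rightarrow> nat \<Rightarrow> nat" where "cdeg E = snd (degrees_of E)"

lemma rdeg_eq: "rdeg E i = card {j. (i, j) \<in> E}" by (simp add: rdeg_def degrees_of_def)
lemma cdeg_eq: "cdeg E j = card {i. (i, j) \<in> E}" by (simp add: cdeg_def degrees_of_def)
lemma degrees_of_eq: "degrees_of E = (rdeg E, cdeg E)" by (simp add: rdeg_def cdeg_def)

definition codeg :: "(nat \<times> nat) set \<Rightarrow> nat set \<Rightarrow> nat" where
  "codeg E S = card {j. \<forall>a\<in>S. (a, j) \<in> E}"

lemma codeg_single: "codeg E {a} = rdeg E a" by (simp add: codeg_def rdeg_eq)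

definition fibre :: "'a set set \<Rightarrow> ('a set \<Rightarrow> 'b) \<Rightarrow> 'b \<Rightarrow> 'a set set" where
  "fibre \<G> f w = {E \<in> \<G>. f E = w}"

text \<open>Moves stay inside a column, so column degrees are never touched. The last conjunct keeps
  the target cell \<open>(c, j)\<close> off the forbidden diagonal.\<close>

definition movable :: "bool \<Rightarrow> (nat \<times> nat) set \<Rightarrow> nat \<Rightarrow> nat \<Rightarrow> nat set" where
  "movable D E a c = {j. (a, j) \<in> E \<and> (c, j) \<notin> E \<and> \<not> (D \<and> j = c)}"

definition mv :: "(nat \<times> nat) set \<Rightarrow> nat \<Rightarrow> nat \<Rightarrow> nat \<Rightarrow> (nat \<times> nat) set" where
  "mv E a c j = insert (c, j) (E - {(a, j)})"

lemma finite_cells [simp]: "finite (cells D m n)"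
  by (rule finite_subset[of _ "{..<m} \<times> {..<n}"]) (auto simp: cells_def)

lemma finite_subcells: "E \<subseteq> cells D m n \<Longrightarrow> finite E"
  by (rule finite_subset[OF _ finite_cells])

lemma cells_row: "E \<subseteq> cells D m n \<Longrightarrow> {j. (a, j) \<in> E} \<subseteq> {..<n}"
  by (auto simp: cells_def)

lemma cells_col: "E \<subseteq> cells D m n \<Longrightarrow> {i. (i, j) \<in> E} \<subseteq> {..<m}"
  by (auto simp: cells_def)

lemma finite_row [simp]: "E \<subseteq> cells D m n \<Longrightarrow> finite {j. (a, j) \<in> E}"
  by (rule finite_subset[OF cells_row finite_lessThan])

lemma finite_col [simp]: "E \<subseteq> cells D m n \<Longrightarrow> finite {i. (i, j) \<in> E}"
  by (rule finite_subset[OF cells_col finite_lessThan])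

lemma finite_movable [simp]: "E \<subseteq> cells D m n \<Longrightarrow> finite (movable D' E a c)"
  unfolding movable_def by (rule finite_subset[OF _ finite_row[of E D m n a]]) blast+

lemma card_movable_le: "E \<subseteq> cells D m n \<Longrightarrow> card (movable D' E a c) \<le> n"
  using card_mono[of "{..<n}" "movable D' E a c"] cells_row[of E D m n a] by (auto simp: movable_def)

lemma mv_subset:
  assumes "E \<subseteq> cells D m n" "j \<in> movable D E a c" "c < m"
  shows "mv E a c j \<subseteq> cells D m n"
  using assms by (auto simp: mv_def movable_def cells_def)

lemma mv_movable:
  assumes "j \<in> movable D E a c" "a \<noteq> c" "E \<subseteq> cells D m n"
  shows "movable D (mv E a c j) a c = movable D E a c - {j}"
    "movable D (mv E a c j) c a = insert j (movable D E c a)"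
    "mv (mv E a c j) c a j = E"
  using assms by (auto simp: mv_def movable_def cells_def)

lemma mv_cdeg:
  assumes "j \<in> movable D E a c" "a \<noteq> c" "E \<subseteq> cells D m n"
  shows "cdeg (mv E a c j) = cdeg E"
proof
  fix l
  show "cdeg (mv E a c j) l = cdeg E l"
  proof (cases "l = j")
    case True
    have "{i. (i, l) \<in> mv E a c j} = insert c ({i. (i, j) \<in> E} - {a})"
      using True assms by (auto simp: mv_def)
    moreover have "c \<notin> {i. (i, j) \<in> E} - {a}" "a \<in> {i. (i, j) \<in> E}" using assms by (auto simp: movable_def)
    ultimately show ?thesis using finite_col[OF assms(3), of j] True
      by (simp add: cdeg_eq) (metis One_nat_def Suc_pred card_gt_0_iff empty_iff mem_Collect_eq)
  next
    case False
    then have "{i. (i, l) \<in> mv E a c j} = {i. (i, l) \<in> E}" by (auto simp: mv_def)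
    then show ?thesis by (simp add: cdeg_eq)
  qed
qed

lemma mv_rdeg:
  assumes "j \<in> movable D E a c" "a \<noteq> c" "E \<subseteq> cells D m n"
  shows "rdeg (mv E a c j) = (rdeg E)(a := rdeg E a - 1, c := rdeg E c + 1)"
proof
  fix i
  consider "i = a" | "i = c" | "i \<noteq> a" "i \<noteq> c" by blast
  then show "rdeg (mv E a c j) i = ((rdeg E)(a := rdeg E a - 1, c := rdeg E c + 1)) i"
  proof cases
    case 1
    then have "{l. (i, l) \<in> mv E a c j} = {l. (a, l) \<in> E} - {j}" using assms by (auto simp: mv_def)
    then show ?thesis using 1 assms finite_row[OF assms(3), of a] by (simp add: rdeg_eq movable_def)
  next
    case 2
    then have "{l. (i, l) \<in> mv E a c j} = insert j {l. (c, l) \<in> E}" using assms by (auto simp: mv_def)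
    then show ?thesis using 2 assms finite_row[OF assms(3), of c] by (simp add: rdeg_eq movable_def)
  next
    case 3
    then have "{l. (i, l) \<in> mv E a c j} = {l. (i, l) \<in> E}" by (auto simp: mv_def)
    then show ?thesis using 3 by (simp add: rdeg_eq)
  qed
qed

lemma rdeg_pos:
  assumes "j \<in> movable D E a c" "E \<subseteq> cells D' m n"
  shows "rdeg E a \<ge> 1"
proof -
  have "{j. (a, j) \<in> E} \<noteq> {}" using assms(1) unfolding movable_def by blast
  then have "card {j. (a, j) \<in> E} \<noteq> 0" using finite_row[OF assms(2)] by simp
  then show ?thesis by (simp add: rdeg_eq)
qed

abbreviation deg_fibre :: "bool \<Rightarrow> nat \<Rightarrow> nat \<Rightarrow> degrees \<Rightarrow> (nat \<times> nat) set set" where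
  "deg_fibre D m n \<omega> \<equiv> fibre (Pow (cells D m n)) degrees_of \<omega>"

lemma finite_deg_fibre [simp]: "finite (deg_fibre D m n \<omega>)"
  unfolding fibre_def by simp

lemma deg_fibreD: "E \<in> deg_fibre D m n (s, t) \<Longrightarrow> E \<subseteq> cells D m n \<and> rdeg E = s \<and> cdeg E = t"
  by (auto simp: fibre_def degrees_of_eq)

lemma deg_fibreI: "E \<subseteq> cells D m n \<Longrightarrow> rdeg E = s \<Longrightarrow> cdeg E = t \<Longrightarrow> E \<in> deg_fibre D m n (s, t)"
  by (auto simp: fibre_def degrees_of_eq)

text \<open>Double counting of pairs (graph, moved column). The moved edge becomes movable
  backwards, so \<open>card (movable D E b a) + 1\<close> is the number of backward moves of the
  image; with its reciprocal as weight, each image that has a backward move is counted once. Ratios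
  of fibre sizes thus become averages over a single fibre.\<close>

lemma move_identity:
  assumes ab: "a \<noteq> b" "a < m" "b < m" and sa: "s a \<ge> 1"
  defines "s' \<equiv> s(a := s a - 1, b := s b + 1)"
  shows "(\<Sum>E\<in>deg_fibre D m n (s, t). real (card (movable D E a b)) / (real (card (movable D E b a)) + 1)) =
     real (card {E \<in> deg_fibre D m n (s', t). movable D E b a \<noteq> {}})"
proof -
  let ?O = "deg_fibre D m n (s, t)" and ?O' = "deg_fibre D m n (s', t)"
  let ?T = "SIGMA E:?O. movable D E a b" and ?T' = "SIGMA E:?O'. movable D E b a"
  have "(\<Sum>E\<in>?O. real (card (movable D E a b)) / (real (card (movable D E b a)) + 1)) =
     (\<Sum>E\<in>?O. \<Sum>j\<in>movable D E a b. 1 / (real (card (movable D E b a)) + 1))" by simp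
  also have "\<dots> = (\<Sum>(E, j)\<in>?T. 1 / (real (card (movable D E b a)) + 1))"
    by (rule sum.Sigma) (auto dest: deg_fibreD)
  also have "\<dots> = (\<Sum>(E, j)\<in>?T'. 1 / real (card (movable D E b a)))"
  proof (rule sum.reindex_bij_witness[of _ "\<lambda>(E, j). (mv E b a j, j)" "\<lambda>(E, j). (mv E a b j, j)"], goal_cases)
    case (1 z)
    then obtain E j where z: "z = (E, j)" "E \<in> ?O" "j \<in> movable D E a b" by auto
    have "E \<subseteq> cells D m n" using deg_fibreD z by auto
    then show ?case using mv_movable(3)[OF z(3) ab(1)] z by simp
  next
    case (2 z)
    then obtain E j where z: "z = (E, j)" "E \<in> ?O" "j \<in> movable D E a b" by auto
    have E: "E \<subseteq> cells D m n" "rdeg E = s" "cdeg E = t" using deg_fibreD z by auto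
    have "mv E a b j \<in> ?O'"
    proof (rule deg_fibreI)
      show "rdeg (mv E a b j) = s'" using mv_rdeg[OF z(3) ab(1) E(1)] E(2) by (simp add: s'_def)
      show "cdeg (mv E a b j) = t" using mv_cdeg[OF z(3) ab(1) E(1)] E(3) by simp
    qed (rule mv_subset[OF E(1) z(3) ab(3)])
    then show ?case using mv_movable(2)[OF z(3) ab(1) E(1)] z by simp
  next
    case (3 z)
    then obtain E j where z: "z = (E, j)" "E \<in> ?O'" "j \<in> movable D E b a" by auto
    have "E \<subseteq> cells D m n" using deg_fibreD z by auto
    then show ?case using mv_movable(3)[OF z(3) ab(1)[symmetric]] z by simp
  next
    case (4 z)
    then obtain E j where z: "z = (E, j)" "E \<in> ?O'" "j \<in> movable D E b a" by auto
    have E: "E \<subseteq> cells D m n" "rdeg E = s'" "cdeg E = t" using deg_fibreD z by auto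
    have "mv E b a j \<in> ?O"
    proof (rule deg_fibreI)
      have "s'(b := s' b - 1, a := s' a + 1) = s"
        by (rule ext) (use ab sa in \<open>simp add: s'_def\<close>)
      then show "rdeg (mv E b a j) = s" using mv_rdeg[OF z(3) ab(1)[symmetric] E(1)] E(2) by simp
      show "cdeg (mv E b a j) = t" using mv_cdeg[OF z(3) ab(1)[symmetric] E(1)] E(3) by simp
    qed (rule mv_subset[OF E(1) z(3) ab(2)])
    then show ?case using mv_movable(2)[OF z(3) ab(1)[symmetric] E(1)] z by simp
  next
    case (5 z)
    then obtain E j where z: "z = (E, j)" "E \<in> ?O" "j \<in> movable D E a b" by auto
    have E: "E \<subseteq> cells D m n" using deg_fibreD z by auto
    have "j \<notin> movable D E b a" using z by (auto simp: movable_def)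
    then show ?case using mv_movable(2)[OF z(3) ab(1) E] z E by (simp add: add.commute)
  qed
  also have "\<dots> = (\<Sum>E\<in>?O'. \<Sum>j\<in>movable D E b a. 1 / real (card (movable D E b a)))"
    by (rule sum.Sigma[symmetric]) (auto dest: deg_fibreD)
  also have "\<dots> = (\<Sum>E\<in>?O'. if movable D E b a \<noteq> {} then 1 else 0)"
    by (intro sum.cong) (auto dest: deg_fibreD)
  also have "\<dots> = real (card {E \<in> ?O'. movable D E b a \<noteq> {}})"
    by (simp add: sum.If_cases Int_def)
  finally show ?thesis .
qed

text \<open>Moving \<open>j\<close> from \<open>a\<close> to \<open>c\<close> and \<open>l\<close>
  from \<open>c\<close> to \<open>a\<close> keeps all degrees and both numbers of movable columns,
  and the reverse switching undoes it. It exchanges the roles of the two columns, while weights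
  depending on these numbers, and a \<open>\<phi>\<close> that does not look at rows
  \<open>a\<close> and \<open>c\<close>, are preserved.\<close>

lemma switch_aux:
  fixes \<phi> :: "(nat \<times> nat) set \<Rightarrow> nat \<Rightarrow> real" and w :: "nat \<Rightarrow> nat \<Rightarrow> real"
  assumes ac: "a \<noteq> c" "a < m" "c < m"
    and \<phi>: "\<And>E E' j. (\<And>i l. i \<noteq> a \<Longrightarrow> i \<noteq> c \<Longrightarrow> (i, l) \<in> E \<longleftrightarrow> (i, l) \<in> E') \<Longrightarrow> \<phi> E j = \<phi> E' j"
  shows "(\<Sum>E\<in>deg_fibre D m n \<omega>. w (card (movable D E a c)) (card (movable D E c a)) *
            (real (card (movable D E c a)) * (\<Sum>j\<in>movable D E a c. \<phi> E j))) =
         (\<Sum>E\<in>deg_fibre D m n \<omega>. w (card (movable D E a c)) (card (movable D E c a)) *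
            (real (card (movable D E a c)) * (\<Sum>j\<in>movable D E c a. \<phi> E j)))"
proof -
  obtain s t where \<omega>: "\<omega> = (s, t)" by (cases \<omega>)
  let ?O = "deg_fibre D m n (s, t)"
  define W where "W = (\<lambda>E. w (card (movable D E a c)) (card (movable D E c a)))"
  let ?T = "SIGMA E:?O. movable D E a c \<times> movable D E c a"
  let ?T' = "SIGMA E:?O. movable D E c a \<times> movable D E a c"
  have fin: "finite (movable D E x y)" if "E \<in> ?O" for E x y using that deg_fibreD by (meson finite_movable)
  have prodsum: "(\<Sum>(j, l)\<in>A \<times> B. x * g j) = x * (real (card B) * (\<Sum>j\<in>A. g j))"
    for A B :: "nat set" and x and g :: "nat \<Rightarrow> real"
  proof -
    have "(\<Sum>(j, l)\<in>A \<times> B. x * g j) = (\<Sum>j\<in>A. \<Sum>l\<in>B. x * g j)"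
      by (simp only: sum.cartesian_product)
    also have "\<dots> = (\<Sum>j\<in>A. (x * real (card B)) * g j)" by (simp add: mult_ac)
    also have "\<dots> = x * (real (card B) * (\<Sum>j\<in>A. g j))" by (simp only: sum_distrib_left mult.assoc)
    finally show ?thesis .
  qed
  have "(\<Sum>E\<in>?O. W E * (real (card (movable D E c a)) * (\<Sum>j\<in>movable D E a c. \<phi> E j)))
     = (\<Sum>E\<in>?O. \<Sum>(j, l)\<in>movable D E a c \<times> movable D E c a. W E * \<phi> E j)"
    by (intro sum.cong refl) (simp only: prodsum)
  also have "\<dots> = (\<Sum>(E, j, l)\<in>?T. W E * \<phi> E j)"
    by (subst sum.Sigma) (auto simp: fin)
  also have "\<dots> = (\<Sum>(E, j, l)\<in>?T'. W E * \<phi> E j)"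
  proof -
    have main: "mv (mv E x y j) y x l \<in> ?O \<and> j \<in> movable D (mv (mv E x y j) y x l) y x \<and>
       l \<in> movable D (mv (mv E x y j) y x l) x y \<and> mv (mv (mv (mv E x y j) y x l) y x j) x y l = E \<and>
       card (movable D (mv (mv E x y j) y x l) x y) = card (movable D E x y) \<and>
       card (movable D (mv (mv E x y j) y x l) y x) = card (movable D E y x)"
      if E: "E \<in> ?O" and j: "j \<in> movable D E x y" and l: "l \<in> movable D E y x"
        and xy: "x \<noteq> y" "x < m" "y < m" for E x y j l
    proof -
      have Es: "E \<subseteq> cells D m n" "rdeg E = s" "cdeg E = t" using deg_fibreD E by auto
      let ?F = "mv E x y j" and ?G = "mv (mv E x y j) y x l"
      have jl: "j \<noteq> l" "j \<notin> movable D E y x" "l \<notin> movable D E x y" using j l by (auto simp: movable_def)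
      have F: "?F \<subseteq> cells D m n" by (rule mv_subset[OF Es(1) j xy(3)])
      have lF: "l \<in> movable D ?F y x" using mv_movable(2)[OF j xy(1) Es(1)] l by simp
      have G: "?G \<subseteq> cells D m n" by (rule mv_subset[OF F lF xy(2)])
      have m1: "movable D ?G y x = insert j (movable D E y x) - {l}"
        using mv_movable(1)[OF lF xy(1)[symmetric] F] mv_movable(2)[OF j xy(1) Es(1)] by simp
      have m2: "movable D ?G x y = insert l (movable D E x y - {j})"
        using mv_movable(2)[OF lF xy(1)[symmetric] F] mv_movable(1)[OF j xy(1) Es(1)] by simp
      have "rdeg E x \<ge> 1" "rdeg E y \<ge> 1" using rdeg_pos j l Es by blast+
      then have "rdeg ?G = s"
        unfolding mv_rdeg[OF lF xy(1)[symmetric] F] mv_rdeg[OF j xy(1) Es(1)] Es(2)[symmetric]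
        by (intro ext) (use xy in simp)
      moreover have "cdeg ?G = t"
        using mv_cdeg[OF lF xy(1)[symmetric] F] mv_cdeg[OF j xy(1) Es(1)] Es by simp
      ultimately have "?G \<in> ?O" using G by (intro deg_fibreI) auto
      moreover have "mv (mv ?G y x j) x y l = E"
      proof -
        have "(x, j) \<in> E" "(y, j) \<notin> E" "(y, l) \<in> E" "(x, l) \<notin> E" using j l by (auto simp: movable_def)
        then show ?thesis using jl(1) xy(1) by (auto simp: mv_def)
      qed
      moreover have "card (movable D ?G x y) = card (movable D E x y)" "card (movable D ?G y x) = card (movable D E y x)"
        unfolding m1 m2 using fin[OF E, of x y] fin[OF E, of y x] j l jl
          card_Suc_Diff1[OF fin[OF E] j] card_Suc_Diff1[OF fin[OF E] l] by (simp_all add: insert_Diff_if)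
      ultimately show ?thesis using m1 m2 jl by auto
    qed
    have \<phi>': "\<phi> (mv (mv E x y j) y x l) i = \<phi> E i" if "{x, y} = {a, c}" for E x y j l i
      using that by (intro \<phi>) (auto simp: mv_def doubleton_eq_iff)
    show ?thesis
    proof (rule sum.reindex_bij_witness[of _ "\<lambda>(E, j, l). (mv (mv E c a j) a c l, j, l)"
            "\<lambda>(E, j, l). (mv (mv E a c j) c a l, j, l)"], goal_cases)
      case (1 z)
      then obtain E j l where z: "z = (E, j, l)" "E \<in> ?O" "j \<in> movable D E a c" "l \<in> movable D E c a" by auto
      then show ?case using main[OF z(2-4) ac] by simp
    next
      case (2 z)
      then obtain E j l where z: "z = (E, j, l)" "E \<in> ?O" "j \<in> movable D E a c" "l \<in> movable D E c a" by auto
      then show ?case using main[OF z(2-4) ac] by simp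
    next
      case (3 z)
      then obtain E j l where z: "z = (E, j, l)" "E \<in> ?O" "j \<in> movable D E c a" "l \<in> movable D E a c" by auto
      then show ?case using main[OF z(2-4) ac(1)[symmetric] ac(3,2)] by simp
    next
      case (4 z)
      then obtain E j l where z: "z = (E, j, l)" "E \<in> ?O" "j \<in> movable D E c a" "l \<in> movable D E a c" by auto
      then show ?case using main[OF z(2-4) ac(1)[symmetric] ac(3,2)] by simp
    next
      case (5 z)
      then obtain E j l where z: "z = (E, j, l)" "E \<in> ?O" "j \<in> movable D E a c" "l \<in> movable D E c a" by auto
      then show ?case using main[OF z(2-4) ac] \<phi>'[of a c] by (simp add: W_def)
    qed
  qed
  also have "\<dots> = (\<Sum>E\<in>?O. \<Sum>(j, l)\<in>movable D E c a \<times> movable D E a c. W E * \<phi> E j)"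
    by (subst sum.Sigma) (auto simp: fin)
  also have "\<dots> = (\<Sum>E\<in>?O. W E * (real (card (movable D E a c)) * (\<Sum>j\<in>movable D E c a. \<phi> E j)))"
    by (intro sum.cong refl) (simp only: prodsum)
  finally show ?thesis unfolding \<omega> W_def .
qed

text \<open>With \<open>\<alpha>\<close>, \<open>\<gamma>\<close> the numbers of movable columns and
  \<open>u\<close>, \<open>v\<close> the two sums, \<open>u - v - (\<alpha> - \<gamma>) * (u + v) /
  (\<alpha> + \<gamma>)\<close> equals
  \<open>2 * (\<gamma> * u - \<alpha> * v) / (\<alpha> + \<gamma>)\<close>, and
  \<open>switch_aux\<close> makes the total of the latter zero. An unknown difference is traded for
  \<open>\<alpha> - \<gamma>\<close>, which the degrees determine up to 1.\<close>

lemma switch_identity: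
  fixes \<phi> :: "(nat \<times> nat) set \<Rightarrow> nat \<Rightarrow> real"
  assumes ac: "a \<noteq> c" "a < m" "c < m"
    and \<phi>: "\<And>E E' j. (\<And>i l. i \<noteq> a \<Longrightarrow> i \<noteq> c \<Longrightarrow> (i, l) \<in> E \<longleftrightarrow> (i, l) \<in> E') \<Longrightarrow> \<phi> E j = \<phi> E' j"
  shows "(\<Sum>E\<in>deg_fibre D m n \<omega>. (\<Sum>j\<in>movable D E a c. \<phi> E j) - (\<Sum>j\<in>movable D E c a. \<phi> E j)) =
         (\<Sum>E\<in>deg_fibre D m n \<omega>. (real (card (movable D E a c)) - real (card (movable D E c a))) *
            (((\<Sum>j\<in>movable D E a c. \<phi> E j) + (\<Sum>j\<in>movable D E c a. \<phi> E j)) /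
            (real (card (movable D E a c)) + real (card (movable D E c a)))))"
proof -
  let ?O = "deg_fibre D m n \<omega>"
  let ?\<alpha> = "\<lambda>E. real (card (movable D E a c))" and ?\<gamma> = "\<lambda>E. real (card (movable D E c a))"
  let ?u = "\<lambda>E. \<Sum>j\<in>movable D E a c. \<phi> E j" and ?v = "\<lambda>E. \<Sum>j\<in>movable D E c a. \<phi> E j"
  have "(\<Sum>E\<in>?O. 1 / (?\<alpha> E + ?\<gamma> E) * (?\<gamma> E * ?u E)) = (\<Sum>E\<in>?O. 1 / (?\<alpha> E + ?\<gamma> E) * (?\<alpha> E * ?v E))"
    by (rule switch_aux[OF ac, where \<phi> = \<phi> and w = "\<lambda>x y. 1 / (real x + real y)"]) (rule \<phi>)
  then have 0: "(\<Sum>E\<in>?O. 2 * (1 / (?\<alpha> E + ?\<gamma> E) * (?\<gamma> E * ?u E)) - 2 * (1 / (?\<alpha> E + ?\<gamma> E) * (?\<alpha> E * ?v E))) = 0"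
    by (simp only: sum_subtractf sum_distrib_left[symmetric])
  have "(?u E - ?v E) - (?\<alpha> E - ?\<gamma> E) * ((?u E + ?v E) / (?\<alpha> E + ?\<gamma> E)) =
     2 * (1 / (?\<alpha> E + ?\<gamma> E) * (?\<gamma> E * ?u E)) - 2 * (1 / (?\<alpha> E + ?\<gamma> E) * (?\<alpha> E * ?v E))" if E: "E \<in> ?O" for E
  proof (cases "?\<alpha> E + ?\<gamma> E = 0")
    \<comment> \<open>No movable column at all: both sums are empty, and the division by zero yields
      0.\<close>
    case True
    then have "card (movable D E a c) = 0" "card (movable D E c a) = 0" by auto
    moreover have "E \<subseteq> cells D m n" using E by (auto simp: fibre_def)
    ultimately have "movable D E a c = {}" "movable D E c a = {}" by auto
    then show ?thesis by simp
  next
    case False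
    moreover have "(u - v) - (x - y) * ((u + v) / (x + y)) = 2 * (1 / (x + y) * (y * u)) - 2 * (1 / (x + y) * (x * v))"
      if "x + y \<noteq> 0" for u v x y :: real
      using that by (simp add: divide_simps) (simp add: algebra_simps)
    ultimately show ?thesis by blast
  qed
  then have "(\<Sum>E\<in>?O. (?u E - ?v E) - (?\<alpha> E - ?\<gamma> E) * ((?u E + ?v E) / (?\<alpha> E + ?\<gamma> E))) = 0"
    by (subst sum.cong[OF refl]) (assumption, rule 0)
  then show ?thesis by (simp only: sum_subtractf right_minus_eq)
qed

lemma card_movable:
  assumes "E \<subseteq> cells D m n" "a \<noteq> c"
  shows "real (card (movable D E a c)) =
     real (rdeg E a) - real (codeg E {a, c}) - of_bool (D \<and> (a, c) \<in> E)"
proof -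
  let ?B = "if D \<and> (a, c) \<in> E then {c} else {}"
  have fin: "finite {j. (a, j) \<in> E \<and> (c, j) \<in> E}"
    using finite_row[OF assms(1), of a] by (rule rev_finite_subset) auto
  have "{j. (a, j) \<in> E} = movable D E a c \<union> ({j. (a, j) \<in> E \<and> (c, j) \<in> E} \<union> ?B)"
    by (auto simp: movable_def)
  moreover have "card \<dots> = card (movable D E a c) + card ({j. (a, j) \<in> E \<and> (c, j) \<in> E} \<union> ?B)"
    using assms fin by (intro card_Un_disjoint) (auto simp: movable_def)
  moreover have "card ({j. (a, j) \<in> E \<and> (c, j) \<in> E} \<union> ?B) = card {j. (a, j) \<in> E \<and> (c, j) \<in> E} + card ?B"
    using assms fin by (intro card_Un_disjoint) (auto simp: cells_def)
  ultimately have "card {j. (a, j) \<in> E} = card (movable D E a c) + (card {j. (a, j) \<in> E \<and> (c, j) \<in> E} + card ?B)"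
    by metis
  then show ?thesis by (simp add: rdeg_eq codeg_def)
qed

lemma sum_movable_mem:
  assumes "E \<subseteq> cells D m n" "a \<noteq> c"
  shows "(\<Sum>j\<in>movable D E a c. of_bool ((b, j) \<in> E) :: real) =
     real (codeg E {a, b}) - real (codeg E {a, b, c}) - of_bool (D \<and> (a, c) \<in> E \<and> (b, c) \<in> E)"
proof -
  let ?B = "if D \<and> (a, c) \<in> E \<and> (b, c) \<in> E then {c} else {}"
  let ?M = "{j \<in> movable D E a c. (b, j) \<in> E}" and ?C = "{j. (a, j) \<in> E \<and> (b, j) \<in> E \<and> (c, j) \<in> E}"
  have fin: "finite ?C"
    using finite_row[OF assms(1), of a] by (rule rev_finite_subset) auto
  have "{j. (a, j) \<in> E \<and> (b, j) \<in> E} = ?M \<union> (?C \<union> ?B)"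
    by (auto simp: movable_def)
  moreover have "card \<dots> = card ?M + card (?C \<union> ?B)"
    using assms fin by (intro card_Un_disjoint) (auto simp: movable_def)
  moreover have "card (?C \<union> ?B) = card ?C + card ?B"
    using assms fin by (intro card_Un_disjoint) (auto simp: cells_def)
  ultimately have c: "card {j. (a, j) \<in> E \<and> (b, j) \<in> E} = card ?M + (card ?C + card ?B)" by metis
  have "(\<Sum>j\<in>movable D E a c. of_bool ((b, j) \<in> E) :: real) = real (card ?M)"
    using assms by (simp add: of_bool_def sum.If_cases Int_def)
  then show ?thesis using c by (simp add: codeg_def)
qed

text \<open>Column \<open>j\<close> contributes 1 to the codegree of every ordered pair of distinct
  rows among its \<open>cdeg E j\<close> neighbours. The total over all pairs is therefore fixed by
  the column degrees, although single codegrees are not.\<close>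

lemma sum_codeg_pairs:
  assumes "E \<subseteq> cells D m n"
  shows "(\<Sum>a<m. \<Sum>b\<in>{..<m} - {a}. real (codeg E {a, b})) = (\<Sum>j<n. real (cdeg E j) * (real (cdeg E j) - 1))"
proof -
  have cd: "real (codeg E {a, b}) = (\<Sum>j<n. of_bool ((a, j) \<in> E \<and> (b, j) \<in> E))" for a b
  proof -
    have "{j. \<forall>a'\<in>{a, b}. (a', j) \<in> E} = {j \<in> {..<n}. (a, j) \<in> E \<and> (b, j) \<in> E}"
      using assms by (auto simp: cells_def)
    then show ?thesis by (simp add: codeg_def of_bool_def sum.If_cases Int_def)
  qed
  have cj: "real (cdeg E j) = (\<Sum>i<m. of_bool ((i, j) \<in> E))" for j
  proof -
    have "{i. (i, j) \<in> E} = {i \<in> {..<m}. (i, j) \<in> E}" using assms by (auto simp: cells_def)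
    then show ?thesis by (simp add: cdeg_eq of_bool_def sum.If_cases Int_def)
  qed
  have "(\<Sum>a<m. \<Sum>b\<in>{..<m} - {a}. real (codeg E {a, b})) =
     (\<Sum>a<m. \<Sum>b\<in>{..<m} - {a}. \<Sum>j<n. of_bool ((a, j) \<in> E \<and> (b, j) \<in> E))" by (simp only: cd)
  also have "\<dots> = (\<Sum>a<m. \<Sum>j<n. \<Sum>b\<in>{..<m} - {a}. of_bool ((a, j) \<in> E \<and> (b, j) \<in> E))"
    by (rule sum.cong[OF refl], rule sum.swap)
  also have "\<dots> = (\<Sum>j<n. \<Sum>a<m. \<Sum>b\<in>{..<m} - {a}. of_bool ((a, j) \<in> E \<and> (b, j) \<in> E))"
    by (rule sum.swap)
  also have "\<dots> = (\<Sum>j<n. real (cdeg E j) * (real (cdeg E j) - 1))"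
  proof (rule sum.cong[OF refl])
    fix j
    define g where "g = (\<lambda>b. of_bool ((b, j) \<in> E) :: real)"
    have c: "real (cdeg E j) = sum g {..<m}" unfolding cj g_def ..
    have gg: "g a * g a = g a" for a by (simp add: g_def)
    have "(\<Sum>a<m. \<Sum>b\<in>{..<m} - {a}. of_bool ((a, j) \<in> E \<and> (b, j) \<in> E)) = (\<Sum>a<m. \<Sum>b\<in>{..<m} - {a}. g a * g b)"
      unfolding g_def by (intro sum.cong refl) simp
    also have "\<dots> = (\<Sum>a<m. g a * (sum g {..<m} - g a))"
      by (intro sum.cong refl) (simp add: sum_diff1 flip: sum_distrib_left)
    also have "\<dots> = sum g {..<m} * (sum g {..<m} - 1)"
      by (simp add: right_diff_distrib gg sum_subtractf sum_distrib_right[symmetric])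
    finally show "(\<Sum>a<m. \<Sum>b\<in>{..<m} - {a}. of_bool ((a, j) \<in> E \<and> (b, j) \<in> E)) =
        real (cdeg E j) * (real (cdeg E j) - 1)" by (simp only: c)
  qed
  finally show ?thesis .
qed

lemma sum_rdeg:
  assumes "E \<subseteq> cells D m n"
  shows "(\<Sum>i<m. rdeg E i) = card E"
proof -
  have "E = (SIGMA i:{..<m}. {j. (i, j) \<in> E})" using assms by (auto simp: cells_def)
  then have "card E = card (SIGMA i:{..<m}. {j. (i, j) \<in> E})" by (rule arg_cong)
  also have "\<dots> = (\<Sum>i<m. rdeg E i)" using assms by (subst card_SigmaI) (auto simp: rdeg_eq)
  finally show ?thesis by simp
qed

lemma cells_converse: "(cells D m n)\<inverse> = cells D n m" by (auto simp: cells_def)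

lemma cdeg_converse: "cdeg E = rdeg (E\<inverse>)" by (rule ext) (simp add: rdeg_eq cdeg_eq)

lemma sum_cdeg:
  assumes "E \<subseteq> cells D m n"
  shows "(\<Sum>j<n. cdeg E j) = card E"
proof -
  have "E\<inverse> \<subseteq> cells D n m" using assms cells_converse by blast
  then show ?thesis using sum_rdeg[of "E\<inverse>" D n m] by (simp add: cdeg_converse)
qed

text \<open>Rows can be filled independently. The product of binomials in the definition of
  \<open>B_k\<close> is thus a count of edge sets, which later realises \<open>B_k\<close> by two
  independent uniform edge sets.\<close>

lemma card_row_fibre:
  assumes D: "D \<Longrightarrow> m = n" and s: "\<And>i. i \<ge> m \<Longrightarrow> s i = 0"
  shows "card (fibre (Pow (cells D m n)) rdeg s) = (\<Prod>i<m. (n - of_bool D) choose s i)"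
proof -
  let ?C = "\<lambda>i. {j. (i, j) \<in> cells D m n}"
  have cC: "card (?C i) = n - of_bool D" if "i < m" for i
  proof -
    have "?C i = {..<n} - (if D then {i} else {})" using that by (auto simp: cells_def)
    then have "card (?C i) = card ({..<n} - (if D then {i} else {}))" by (rule arg_cong)
    then show ?thesis using that D by (cases D) (simp_all add: card_Diff_subset)
  qed
  have fC: "finite (?C i)" for i by (rule finite_subset[of _ "{..<n}"]) (auto simp: cells_def)
  have "bij_betw (\<lambda>E. \<lambda>i\<in>{..<m}. {j. (i, j) \<in> E}) (fibre (Pow (cells D m n)) rdeg s)
      (PiE {..<m} (\<lambda>i. {A. A \<subseteq> ?C i \<and> card A = s i}))"
  proof (rule bij_betw_byWitness[where f' = "\<lambda>f. SIGMA i:{..<m}. f i"])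
    show "\<forall>E\<in>fibre (Pow (cells D m n)) rdeg s. Sigma {..<m} (\<lambda>i\<in>{..<m}. {j. (i, j) \<in> E}) = E"
      by (auto simp: fibre_def cells_def)
    show "\<forall>f\<in>PiE {..<m} (\<lambda>i. {A. A \<subseteq> ?C i \<and> card A = s i}). (\<lambda>i\<in>{..<m}. {j. (i, j) \<in> Sigma {..<m} f}) = f"
      by (auto simp: fun_eq_iff PiE_def extensional_def)
    show "(\<lambda>E. \<lambda>i\<in>{..<m}. {j. (i, j) \<in> E}) ` fibre (Pow (cells D m n)) rdeg s
       \<subseteq> PiE {..<m} (\<lambda>i. {A. A \<subseteq> ?C i \<and> card A = s i})"
      by (auto simp: fibre_def rdeg_eq)
    show "(\<lambda>f. SIGMA i:{..<m}. f i) ` PiE {..<m} (\<lambda>i. {A. A \<subseteq> ?C i \<and> card A = s i})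
       \<subseteq> fibre (Pow (cells D m n)) rdeg s"
    proof clarify
      fix f assume f: "f \<in> PiE {..<m} (\<lambda>i. {A. A \<subseteq> ?C i \<and> card A = s i})"
      have "rdeg (Sigma {..<m} f) i = s i" for i
        using PiE_mem[OF f, of i] s[of i] by (cases "i < m") (auto simp: rdeg_eq)
      moreover have "Sigma {..<m} f \<subseteq> cells D m n" using f by (fastforce simp: PiE_def Pi_def)
      ultimately show "Sigma {..<m} f \<in> fibre (Pow (cells D m n)) rdeg s" by (auto simp: fibre_def)
    qed
  qed
  then have "card (fibre (Pow (cells D m n)) rdeg s) = card (PiE {..<m} (\<lambda>i. {A. A \<subseteq> ?C i \<and> card A = s i}))"
    by (rule bij_betw_same_card)
  also have "\<dots> = (\<Prod>i<m. card {A. A \<subseteq> ?C i \<and> card A = s i})" by (rule card_PiE) simp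
  also have "\<dots> = (\<Prod>i<m. (n - of_bool D) choose s i)"
    by (intro prod.cong refl) (simp add: n_subsets[OF fC] cC)
  finally show ?thesis .
qed

lemma card_col_fibre:
  assumes D: "D \<Longrightarrow> m = n" and t: "\<And>j. j \<ge> n \<Longrightarrow> t j = 0"
  shows "card (fibre (Pow (cells D m n)) cdeg t) = (\<Prod>j<n. (m - of_bool D) choose t j)"
proof -
  have "bij_betw converse (fibre (Pow (cells D m n)) cdeg t) (fibre (Pow (cells D n m)) rdeg t)"
  proof (rule bij_betw_byWitness[where f' = converse])
    show "converse ` fibre (Pow (cells D m n)) cdeg t \<subseteq> fibre (Pow (cells D n m)) rdeg t"
      using cells_converse[of D m n] by (auto simp: fibre_def cdeg_converse)
    show "converse ` fibre (Pow (cells D n m)) rdeg t \<subseteq> fibre (Pow (cells D m n)) cdeg t"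
      using cells_converse[of D n m] by (auto simp: fibre_def cdeg_converse)
  qed auto
  then show ?thesis using card_row_fibre[of D n m t] assms by (simp add: bij_betw_same_card)
qed

lemma card_cells:
  assumes "D \<Longrightarrow> m = n"
  shows "card (cells D m n) = m * (n - of_bool D)"
proof -
  have "cells D m n = (SIGMA i:{..<m}. {..<n} - (if D then {i} else {}))" by (auto simp: cells_def split: if_splits)
  then have "card (cells D m n) = card (SIGMA i:{..<m}. {..<n} - (if D then {i} else {}))" by (rule arg_cong)
  also have "\<dots> = (\<Sum>i<m. card ({..<n} - (if D then {i} else {})))" by (intro card_SigmaI) auto
  also have "\<dots> = (\<Sum>i<m. n - of_bool D)"
    using assms by (intro sum.cong refl) (cases D, simp_all add: card_Diff_subset)
  finally show ?thesis by simp
qed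

section \<open>Concentration of degrees and codegrees\<close>

definition wt :: "real \<Rightarrow> 'a set \<Rightarrow> 'a set \<Rightarrow> real" where
  "wt p W E = p ^ card E * (1 - p) ^ card (W - E)"

lemma sum_wt_superset:
  assumes "finite W" "A \<subseteq> W"
  shows "(\<Sum>E | E \<subseteq> W \<and> A \<subseteq> E. wt p W E) = p ^ card A"
proof -
  have fA: "finite A" using assms finite_subset by blast
  have "(\<Sum>E | E \<subseteq> W \<and> A \<subseteq> E. wt p W E) = (\<Sum>B\<in>Pow (W - A). wt p W (A \<union> B))"
    by (rule sum.reindex_bij_witness[of _ "\<lambda>B. A \<union> B" "\<lambda>E. E - A"])
      (use assms in \<open>auto intro!: arg_cong[where f = "wt p W"]\<close>)
  also have "\<dots> = (\<Sum>B\<in>Pow (W - A). p ^ card A * ((\<Prod>i\<in>B. p) * (\<Prod>i\<in>W - A - B. 1 - p)))"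
  proof (rule sum.cong[OF refl])
    fix B assume B: "B \<in> Pow (W - A)"
    then have "finite B" using assms by (meson PowD finite_Diff finite_subset)
    then have "card (A \<union> B) = card A + card B" using B fA by (intro card_Un_disjoint) auto
    moreover have "W - (A \<union> B) = W - A - B" by auto
    ultimately show "wt p W (A \<union> B) = p ^ card A * ((\<Prod>i\<in>B. p) * (\<Prod>i\<in>W - A - B. 1 - p))"
      by (simp add: wt_def power_add)
  qed
  also have "\<dots> = p ^ card A * (\<Prod>i\<in>W - A. p + (1 - p))"
    using assms by (subst prod_add) (auto simp: sum_distrib_left)
  finally show ?thesis by simp
qed

text \<open>The generating function of the number of blocks \<open>C i\<close> inside a random set.
  The power of \<open>z\<close> expands into a sum over families of contained blocks, and
  disjointness turns the weight of a union into a product, so the count behaves like a binomial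
  variable with success probability \<open>p ^ w\<close>.\<close>

lemma sum_wt_prod:
  fixes C :: "'i \<Rightarrow> 'a set"
  assumes W: "finite W" and I: "finite I" and C: "\<And>i. i \<in> I \<Longrightarrow> C i \<subseteq> W \<and> card (C i) = w"
    and disj: "\<And>i j. i \<in> I \<Longrightarrow> j \<in> I \<Longrightarrow> i \<noteq> j \<Longrightarrow> C i \<inter> C j = {}"
  shows "(\<Sum>E\<in>Pow W. wt p W E * z ^ card {i \<in> I. C i \<subseteq> E}) = (1 + (z - 1) * p ^ w) ^ card I"
proof -
  have fC: "finite (C i)" if "i \<in> I" for i using C[OF that] W finite_subset by blast
  have "(\<Sum>E\<in>Pow W. wt p W E * z ^ card {i \<in> I. C i \<subseteq> E}) =
     (\<Sum>E\<in>Pow W. \<Sum>B\<in>Pow I. wt p W E * ((z - 1) ^ card B * of_bool (\<Union>(C ` B) \<subseteq> E)))"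
  proof (rule sum.cong[OF refl])
    fix E
    have "z ^ card {i \<in> I. C i \<subseteq> E} = (\<Prod>i\<in>{i \<in> I. C i \<subseteq> E}. z)" by simp
    also have "\<dots> = (\<Prod>i\<in>I. if C i \<subseteq> E then z else 1)" by (rule prod.inter_filter[OF I])
    also have "\<dots> = (\<Prod>i\<in>I. (z - 1) * of_bool (C i \<subseteq> E) + 1)"
      by (intro prod.cong) auto
    also have "\<dots> = (\<Sum>B\<in>Pow I. (\<Prod>i\<in>B. (z - 1) * of_bool (C i \<subseteq> E)) * (\<Prod>i\<in>I - B. 1))"
      by (rule prod_add[OF I])
    also have "\<dots> = (\<Sum>B\<in>Pow I. (z - 1) ^ card B * of_bool (\<Union>(C ` B) \<subseteq> E))"
    proof (rule sum.cong[OF refl])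
      fix B assume "B \<in> Pow I"
      then have fB: "finite B" using I finite_subset by auto
      have "(\<Prod>i\<in>B. of_bool (C i \<subseteq> E) :: real) = of_bool (\<forall>i\<in>B. C i \<subseteq> E)"
        using fB by (induction B) auto
      moreover have "(\<Union>(C ` B) \<subseteq> E) = (\<forall>i\<in>B. C i \<subseteq> E)" by auto
      ultimately show "(\<Prod>i\<in>B. (z - 1) * of_bool (C i \<subseteq> E)) * (\<Prod>i\<in>I - B. 1) = (z - 1) ^ card B * of_bool (\<Union>(C ` B) \<subseteq> E)"
        by (simp add: prod.distrib)
    qed
    finally show "wt p W E * z ^ card {i \<in> I. C i \<subseteq> E} =
       (\<Sum>B\<in>Pow I. wt p W E * ((z - 1) ^ card B * of_bool (\<Union>(C ` B) \<subseteq> E)))" by (simp add: sum_distrib_left)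
  qed
  also have "\<dots> = (\<Sum>B\<in>Pow I. \<Sum>E\<in>Pow W. wt p W E * ((z - 1) ^ card B * of_bool (\<Union>(C ` B) \<subseteq> E)))"
    by (rule sum.swap)
  also have "\<dots> = (\<Sum>B\<in>Pow I. (\<Prod>i\<in>B. (z - 1) * p ^ w) * (\<Prod>i\<in>I - B. 1))"
  proof (rule sum.cong[OF refl])
    fix B assume B: "B \<in> Pow I"
    then have fB: "finite B" using I finite_subset by auto
    have "card (\<Union>(C ` B)) = (\<Sum>i\<in>B. card (C i))"
      using B disj fC by (intro card_UN_disjoint[OF fB]) (auto simp: subset_iff)
    also have "\<dots> = (\<Sum>i\<in>B. w)" using B C by (intro sum.cong) auto
    finally have cU: "card (\<Union>(C ` B)) = card B * w" by simp
    have "(\<Sum>E\<in>Pow W. wt p W E * ((z - 1) ^ card B * of_bool (\<Union>(C ` B) \<subseteq> E)))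
       = (z - 1) ^ card B * (\<Sum>E\<in>Pow W. if \<Union>(C ` B) \<subseteq> E then wt p W E else 0)"
      by (simp add: sum_distrib_left of_bool_def if_distrib mult_ac cong: if_cong)
    also have "(\<Sum>E\<in>Pow W. if \<Union>(C ` B) \<subseteq> E then wt p W E else 0) = (\<Sum>E | E \<in> Pow W \<and> \<Union>(C ` B) \<subseteq> E. wt p W E)"
      using W by (intro sum.inter_filter[symmetric]) auto
    also have "\<dots> = p ^ card (\<Union>(C ` B))"
    proof -
      have "\<Union>(C ` B) \<subseteq> W" using B C by blast
      then show ?thesis using sum_wt_superset[OF W, of "\<Union>(C ` B)" p] by simp
    qed
    finally show "(\<Sum>E\<in>Pow W. wt p W E * ((z - 1) ^ card B * of_bool (\<Union>(C ` B) \<subseteq> E))) =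
       (\<Prod>i\<in>B. (z - 1) * p ^ w) * (\<Prod>i\<in>I - B. 1)"
      by (simp add: cU power_mult_distrib power_mult[symmetric] mult.commute)
  qed
  also have "\<dots> = (\<Prod>i\<in>I. (z - 1) * p ^ w + 1)" by (rule prod_add[OF I, symmetric])
  finally show ?thesis by (simp add: add.commute)
qed

lemma exp_le_quadratic:
  fixes x :: real
  assumes "\<bar>x\<bar> \<le> 1"
  shows "exp x \<le> 1 + x + x\<^sup>2"
proof (cases "x \<ge> 0")
  case True
  then show ?thesis using exp_bound assms by auto
next
  case False
  have "1 - x \<le> exp (- x)" using exp_ge_add_one_self[of "- x"] by simp
  then have "exp x \<le> 1 / (1 - x)" using False by (simp add: exp_minus field_simps)
  also have "\<dots> \<le> 1 + x + x\<^sup>2"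
  proof -
    have "(1 + x + x\<^sup>2) * (1 - x) = 1 - x ^ 3" by (simp add: algebra_simps power2_eq_square power3_eq_cube)
    moreover have "x ^ 3 \<le> 0" using False by (simp add: power_le_zero_eq)
    ultimately have "1 \<le> (1 + x + x\<^sup>2) * (1 - x)" by simp
    then show ?thesis using False by (simp add: divide_le_eq)
  qed
  finally show ?thesis .
qed

lemma bernoulli_mgf_le:
  fixes x \<theta> :: real
  assumes "0 \<le> x" "x \<le> 1" "\<bar>\<theta>\<bar> \<le> 1"
  shows "(1 + (exp \<theta> - 1) * x) ^ r \<le> exp (real r * (\<theta> * x + \<theta>\<^sup>2))"
proof -
  have "1 + (exp \<theta> - 1) * x \<le> 1 + (\<theta> + \<theta>\<^sup>2) * x"
    using exp_le_quadratic[OF assms(3)] assms by (intro add_left_mono mult_right_mono) auto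
  also have "\<dots> \<le> 1 + (\<theta> * x + \<theta>\<^sup>2)" using assms by (simp add: algebra_simps mult_left_le_one_le)
  also have "\<dots> \<le> exp (\<theta> * x + \<theta>\<^sup>2)" by (rule exp_ge_add_one_self)
  finally have le: "1 + (exp \<theta> - 1) * x \<le> exp (\<theta> * x + \<theta>\<^sup>2)" .
  have "0 \<le> (1 - x) + exp \<theta> * x" using assms by (intro add_nonneg_nonneg) auto
  then have "0 \<le> 1 + (exp \<theta> - 1) * x" by (simp add: algebra_simps)
  then have "(1 + (exp \<theta> - 1) * x) ^ r \<le> exp (\<theta> * x + \<theta>\<^sup>2) ^ r" using le by (intro power_mono)
  then show ?thesis by (simp add: exp_of_nat_mult)
qed

text \<open>Stated for weights with a binomial generating function, so that it serves edge sets and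
  binomial weights alike. The choice \<open>\<theta> = L / (2 * R)\<close> minimises
  \<open>R * \<theta>\<^sup>2 - \<theta> * L\<close>, and \<open>L \<le> 2 * R\<close> keeps it in
  the range of the quadratic bound for \<open>exp\<close>.\<close>

lemma chernoff_weights:
  fixes f g :: "'a \<Rightarrow> real"
  assumes fin: "finite A" and g0: "\<And>x. x \<in> A \<Longrightarrow> 0 \<le> g x"
    and x01: "0 \<le> x" "x \<le> 1" and r: "real r \<le> R" "R > 0" and lam: "0 \<le> L" "L \<le> 2 * R"
    and mgf: "\<And>\<theta>. (\<Sum>a\<in>A. g a * exp (\<theta> * f a)) = (1 + (exp \<theta> - 1) * x) ^ r"
  shows "(\<Sum>a | a \<in> A \<and> L \<le> \<bar>f a - real r * x\<bar>. g a) \<le> 2 * exp (- (L\<^sup>2 / (4 * R)))"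
proof -
  define \<theta> where "\<theta> = L / (2 * R)"
  have \<theta>: "0 \<le> \<theta>" "\<theta> \<le> 1" using r lam by (auto simp: \<theta>_def)
  have one: "(\<Sum>a | a \<in> A \<and> L \<le> e * (f a - real r * x). g a) \<le> exp (- (L\<^sup>2 / (4 * R)))"
    if e: "e = 1 \<or> e = -1" for e :: real
  proof -
    have "(\<Sum>a | a \<in> A \<and> L \<le> e * (f a - real r * x). g a)
       \<le> (\<Sum>a | a \<in> A \<and> L \<le> e * (f a - real r * x). g a * exp (\<theta> * (e * (f a - real r * x) - L)))"
    proof (rule sum_mono)
      fix a assume "a \<in> {a. a \<in> A \<and> L \<le> e * (f a - real r * x)}"
      then have "0 \<le> g a" "1 \<le> exp (\<theta> * (e * (f a - real r * x) - L))" using g0 \<theta> by auto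
      then show "g a \<le> g a * exp (\<theta> * (e * (f a - real r * x) - L))" using mult_left_mono by fastforce
    qed
    also have "\<dots> \<le> (\<Sum>a\<in>A. g a * exp (\<theta> * (e * (f a - real r * x) - L)))"
      using fin g0 by (intro sum_mono2) auto
    also have "\<dots> = (\<Sum>a\<in>A. g a * exp ((\<theta> * e) * f a)) * exp (- (\<theta> * e * real r * x) - \<theta> * L)"
      by (simp only: sum_distrib_right mult.assoc exp_add[symmetric]) (simp add: algebra_simps)
    also have "\<dots> \<le> exp (real r * ((\<theta> * e) * x + (\<theta> * e)\<^sup>2)) * exp (- (\<theta> * e * real r * x) - \<theta> * L)"
      unfolding mgf using x01 \<theta> e by (intro mult_right_mono bernoulli_mgf_le) (auto simp: abs_mult)
    also have "\<dots> = exp (real r * \<theta>\<^sup>2 - \<theta> * L)" using e by (elim disjE) (simp_all add: algebra_simps power_mult_distrib flip: exp_add)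
    also have "\<dots> \<le> exp (R * \<theta>\<^sup>2 - \<theta> * L)" using r by (simp add: mult_right_mono)
    also have "R * \<theta>\<^sup>2 - \<theta> * L = - (L\<^sup>2 / (4 * R))" using r by (simp add: \<theta>_def power2_eq_square field_simps)
    finally show ?thesis .
  qed
  have "(\<Sum>a | a \<in> A \<and> L \<le> \<bar>f a - real r * x\<bar>. g a) \<le>
     (\<Sum>a \<in> {a. a \<in> A \<and> L \<le> 1 * (f a - real r * x)} \<union> {a. a \<in> A \<and> L \<le> -1 * (f a - real r * x)}. g a)"
    using fin g0 by (intro sum_mono2) (auto simp: abs_if split: if_splits)
  also have "\<dots> \<le> (\<Sum>a | a \<in> A \<and> L \<le> 1 * (f a - real r * x). g a) + (\<Sum>a | a \<in> A \<and> L \<le> -1 * (f a - real r * x). g a)"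
    using fin g0 by (subst sum.union_inter[symmetric]) (auto intro!: sum_nonneg)
  also have "\<dots> \<le> 2 * exp (- (L\<^sup>2 / (4 * R)))" using one[of 1] one[of "-1"] by simp
  finally show ?thesis .
qed

text \<open>The quotient of consecutive weights passes 1 at \<open>k\<close>, so \<open>k\<close> is
  a mode, and the largest of \<open>N + 1\<close> weights with sum 1 is at least
  \<open>1 / (N + 1)\<close>. Conditioning independent edges on their number therefore costs only a
  factor \<open>N + 1\<close>.\<close>

lemma binomial_mode:
  fixes k N :: nat
  assumes "k \<le> N" "N > 0"
  defines "p \<equiv> real k / real N"
  shows "1 \<le> (real N + 1) * (real (N choose k) * p ^ k * (1 - p) ^ (N - k))"
proof -
  define b where "b = (\<lambda>j. real (N choose j) * p ^ j * (1 - p) ^ (N - j))"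
  have p: "0 \<le> p" "p \<le> 1" using assms by (auto simp: p_def)
  have b0: "b j \<ge> 0" for j using p by (simp add: b_def)
  have step: "b (Suc j) * (real (Suc j) * (1 - p)) = b j * (real (N - j) * p)" if "j < N" for j
  proof -
    have ch: "real (Suc j) * real (N choose Suc j) = real (N - j) * real (N choose j)"
      by (metis of_nat_mult Suc_times_binomial_eq binomial_absorb_comp that Suc_diff_Suc diff_Suc_1 mult.commute binomial_absorption gr0_implies_Suc Suc_pred neq0_conv not_less_zero)
    have "(1 - p) ^ (N - j) = (1 - p) ^ (N - Suc j) * (1 - p)"
      using that by (metis Suc_diff_Suc power_Suc2)
    then show ?thesis using ch by (simp add: b_def mult_ac)
  qed
  \<comment> \<open>One numerator decides both directions: it is nonnegative for
    \<open>j < k\<close> and nonpositive for \<open>j \<ge> k\<close>.\<close>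
  have c: "real (N - j) * p - real (Suc j) * (1 - p) = (real N * (real k - real j - 1) + real k) / real N" if "j < N" for j
    using that assms by (simp add: p_def field_simps of_nat_diff)
  have up: "b j \<le> b (Suc j)" if "j < k" for j
  proof (cases "p = 1")
    case True
    then have "b j = 0" unfolding b_def using that assms(1) by simp
    then show ?thesis using b0[of "Suc j"] by simp
  next
    case False
    have "0 \<le> real N * (real k - real j - 1) + real k" using that by (intro add_nonneg_nonneg mult_nonneg_nonneg) auto
    then have "real (Suc j) * (1 - p) \<le> real (N - j) * p" using c[of j] that assms
      by (smt (verit) divide_nonneg_nonneg le_trans less_le_trans of_nat_0_le_iff)
    then have "b j * (real (Suc j) * (1 - p)) \<le> b j * (real (N - j) * p)" using b0 by (intro mult_left_mono) auto
    also have "\<dots> = b (Suc j) * (real (Suc j) * (1 - p))" using step[of j] that assms by simp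
    finally show ?thesis using False p by (simp add: mult_le_cancel_right_pos)
  qed
  have down: "b (Suc j) \<le> b j" if "k \<le> j" "j < N" for j
  proof -
    have "real N * (real k - real j - 1) + real k \<le> real N * (- 1) + real k"
      using that by (intro add_right_mono mult_left_mono) auto
    also have "\<dots> \<le> 0" using assms by simp
    finally have "real (N - j) * p \<le> real (Suc j) * (1 - p)" using c[of j] that assms
      by (smt (verit) divide_nonpos_nonneg of_nat_0_le_iff)
    then have "b j * (real (N - j) * p) \<le> b j * (real (Suc j) * (1 - p))" using b0 by (intro mult_left_mono) auto
    then have le: "b (Suc j) * (real (Suc j) * (1 - p)) \<le> b j * (real (Suc j) * (1 - p))" using step[of j] that by simp
    have "1 - p > 0" using that assms by (simp add: p_def)
    then show ?thesis using le by (simp add: mult_le_cancel_right_pos)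
  qed
  have bk: "b j \<le> b k" if "j \<le> N" for j
  proof (cases "j \<le> k")
    case True
    then show ?thesis by (induction rule: inc_induct) (use up in \<open>auto intro: order_trans\<close>)
  next
    case False
    then have "k \<le> j" by simp
    then show ?thesis using that
    proof (induction j rule: dec_induct)
      case (step i)
      then show ?case using down[of i] by auto
    qed auto
  qed
  have "1 = (p + (1 - p)) ^ N" by simp
  also have "\<dots> = (\<Sum>j\<le>N. b j)" by (simp only: binomial_ring b_def mult_ac)
  also have "\<dots> \<le> (\<Sum>j\<le>N. b k)" using bk by (intro sum_mono) auto
  finally show ?thesis by (simp add: b_def add.commute)
qed

lemma card_slice_le_wt:
  assumes W: "finite W" "card W > 0" "k \<le> card W"
  defines "p \<equiv> real k / real (card W)"
  shows "real (card {E \<in> slice W k. P E}) \<le> (real (card W) + 1) * real (card W choose k) * (\<Sum>E | E \<subseteq> W \<and> P E. wt p W E)"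
proof -
  let ?N = "card W"
  define c where "c = p ^ k * (1 - p) ^ (?N - k)"
  have p: "0 \<le> p" "p \<le> 1" using assms by (auto simp: p_def)
  have c0: "c \<ge> 0" using p by (simp add: c_def)
  have "real (card {E \<in> slice W k. P E}) * 1 \<le> real (card {E \<in> slice W k. P E}) * ((real ?N + 1) * (real (?N choose k) * c))"
    using binomial_mode[of k ?N] W by (intro mult_left_mono) (auto simp: p_def c_def mult_ac)
  also have "\<dots> = (real ?N + 1) * real (?N choose k) * (\<Sum>E\<in>{E \<in> slice W k. P E}. c)" by simp
  also have "(\<Sum>E\<in>{E \<in> slice W k. P E}. c) = (\<Sum>E\<in>{E \<in> slice W k. P E}. wt p W E)"
  proof (rule sum.cong[OF refl])
    fix E assume "E \<in> {E \<in> slice W k. P E}"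
    then have "E \<subseteq> W" "card E = k" by (auto simp: slice_def)
    then show "c = wt p W E" using W finite_subset[of E W] by (simp add: c_def wt_def card_Diff_subset)
  qed
  also have "\<dots> \<le> (\<Sum>E | E \<subseteq> W \<and> P E. wt p W E)"
    using W p by (intro sum_mono2) (auto simp: slice_def wt_def)
  finally show ?thesis by (simp add: mult_left_mono)
qed

lemma slice_tail:
  fixes C :: "'i \<Rightarrow> 'a set"
  assumes W: "finite W" "card W > 0" "k \<le> card W" and I: "finite I" and C: "\<And>i. i \<in> I \<Longrightarrow> C i \<subseteq> W \<and> card (C i) = w"
    and disj: "\<And>i j. i \<in> I \<Longrightarrow> j \<in> I \<Longrightarrow> i \<noteq> j \<Longrightarrow> C i \<inter> C j = {}"
    and R: "real (card I) \<le> R" "R > 0" "0 \<le> L" "L \<le> 2 * R"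
  defines "p \<equiv> real k / real (card W)"
  shows "real (card {E \<in> slice W k. L \<le> \<bar>real (card {i \<in> I. C i \<subseteq> E}) - real (card I) * p ^ w\<bar>})
     \<le> (real (card W) + 1) * real (card W choose k) * (2 * exp (- (L\<^sup>2 / (4 * R))))"
proof -
  have p: "0 \<le> p" "p \<le> 1" using W by (auto simp: p_def)
  have "(\<Sum>E | E \<in> Pow W \<and> L \<le> \<bar>real (card {i \<in> I. C i \<subseteq> E}) - real (card I) * p ^ w\<bar>. wt p W E)
     \<le> 2 * exp (- (L\<^sup>2 / (4 * R)))"
  proof (rule chernoff_weights[OF _ _ _ _ R])
    show "(\<Sum>E\<in>Pow W. wt p W E * exp (\<theta> * real (card {i \<in> I. C i \<subseteq> E}))) = (1 + (exp \<theta> - 1) * p ^ w) ^ card I" for \<theta>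
      using sum_wt_prod[OF W(1) I C disj, where p = p and z = "exp \<theta>"] by (simp add: exp_of_nat2_mult mult.commute)
  qed (use W p in \<open>auto simp: wt_def power_le_one\<close>)
  then have "(real (card W) + 1) * real (card W choose k) * (\<Sum>E | E \<subseteq> W \<and> L \<le> \<bar>real (card {i \<in> I. C i \<subseteq> E}) - real (card I) * p ^ w\<bar>. wt p W E)
    \<le> (real (card W) + 1) * real (card W choose k) * (2 * exp (- (L\<^sup>2 / (4 * R))))"
    by (intro mult_left_mono) (auto simp: Pow_def)
  then show ?thesis using card_slice_le_wt[OF W, of "\<lambda>E. L \<le> \<bar>real (card {i \<in> I. C i \<subseteq> E}) - real (card I) * p ^ w\<bar>"]
    unfolding p_def by linarith
qed

text \<open>Up to three rows occur together: the two that exchange edges and the one whose codegree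
  is watched. Column degrees are measured in units of \<open>sqrt n\<close> as well, which is
  adequate as long as \<open>m \<le> K * n\<close>.\<close>

definition conc :: "nat \<Rightarrow> nat \<Rightarrow> real \<Rightarrow> real \<Rightarrow> (nat \<times> nat) set \<Rightarrow> bool" where
  "conc m n p K E \<longleftrightarrow>
     (\<forall>S. S \<subseteq> {..<m} \<and> card S \<in> {1, 2, 3} \<longrightarrow> \<bar>real (codeg E S) - real n * p ^ card S\<bar> \<le> K * sqrt (real n)) \<and>
     (\<forall>j<n. \<bar>real (cdeg E j) - real m * p\<bar> \<le> K * sqrt (real n))"

text \<open>The codegree counts disjoint blocks \<open>S \<times> {j}\<close> inside
  \<open>E\<close>, the form in which \<open>slice_tail\<close> applies. In the directed case the
  columns in \<open>S\<close> drop out, since their blocks contain a forbidden cell.\<close>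

lemma codeg_as_count:
  assumes "E \<subseteq> cells D m n" "S \<noteq> {}"
  shows "codeg E S = card {j \<in> {j. j < n \<and> \<not> (D \<and> j \<in> S)}. S \<times> {j} \<subseteq> E}"
  unfolding codeg_def using assms by (intro arg_cong[where f = card]) (fastforce simp: cells_def)

lemma cdeg_as_count:
  assumes "E \<subseteq> cells D m n"
  shows "cdeg E j = card {i \<in> {i. i < m \<and> \<not> (D \<and> i = j)}. {(i, j)} \<subseteq> E}"
  unfolding cdeg_eq using assms by (intro arg_cong[where f = card]) (fastforce simp: cells_def)

lemma power_diff_le:
  fixes x y :: real
  assumes "0 \<le> x" "x \<le> y" "y \<le> 1"
  shows "y ^ w - x ^ w \<le> real w * (y - x)"
proof (induction w)
  case (Suc w)
  have "y ^ Suc w - x ^ Suc w = y * (y ^ w - x ^ w) + (y - x) * x ^ w" by (simp add: algebra_simps)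
  also have "\<dots> \<le> 1 * (y ^ w - x ^ w) + (y - x) * 1"
    using assms power_mono[of x y w] power_le_one[of x w] by (intro add_mono mult_mono mult_left_mono) auto
  also have "\<dots> \<le> real (Suc w) * (y - x)" using Suc by (simp add: algebra_simps)
  finally show ?case .
qed simp

text \<open>A union bound over at most \<open>4 * K ^ 3 * n ^ 3\<close> counts of disjoint blocks.
  The exponent is linear in \<open>K\<close>, not quadratic, because a column may have up to
  \<open>K * n\<close> cells while the allowed deviation is \<open>K * sqrt n\<close>.\<close>

lemma card_not_conc:
  assumes D: "D \<Longrightarrow> m = n" and mn: "m > 0" "n > 1" "real m \<le> K * real n" and K: "K \<ge> 1" "K * sqrt (real n) \<ge> 12" "K \<le> sqrt (real n)"
    and k: "k \<le> card (cells D m n)"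
  defines "p \<equiv> real k / (real m * real n)"
  shows "real (card {E \<in> slice (cells D m n) k. \<not> conc m n p K E}) \<le>
     16 * K ^ 4 * real n ^ 5 * exp (- (K / 16)) * real (card (cells D m n) choose k)"
proof -
  let ?W = "cells D m n"
  let ?Sl = "slice ?W k"
  define N where "N = card ?W"
  define M where "M = real (N choose k)"
  define d where "d = n - of_bool D"
  have d0: "d > 0" "d \<le> n" "real n - 1 \<le> real d" using mn by (auto simp: d_def)
  have Nd: "N = m * d" using card_cells[OF D] by (simp add: N_def d_def)
  have N0: "N > 0" using mn d0 Nd by simp
  \<comment> \<open>The true density on the allowed cells. It exceeds \<open>p\<close> by at most
    \<open>1 / n\<close>; together with up to three missing columns this shifts every expectation by
    at most 3, which half of the allowed deviation absorbs.\<close>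
  define p' where "p' = real k / real N"
  have p'1: "0 \<le> p'" "p' \<le> 1" using k N0 by (auto simp: p'_def N_def)
  have pp': "p = p' * (real d / real n)" using mn d0 by (simp add: p_def p'_def Nd field_simps)
  have ple: "p \<le> p'" unfolding pp' using p'1 d0 mn by (intro mult_right_le_one_le) auto
  have p0: "0 \<le> p" by (simp add: p_def)
  have "p' - p = p' * ((real n - real d) / real n)" unfolding pp' using mn by (simp add: field_simps)
  also have "\<dots> \<le> 1 * (1 / real n)"
    using p'1 d0 mn by (intro mult_mono divide_right_mono) auto
  finally have pd: "p' - p \<le> 1 / real n" by simp
  define y where "y = sqrt (real n)"
  have y: "y\<^sup>2 = real n" "y > 0" "K * y \<ge> 12" "K \<le> y" using mn K by (auto simp: y_def)
  have sub: "E \<subseteq> ?W" if "E \<in> ?Sl" for E using that by (auto simp: slice_def)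
  define e where "e = exp (- (K / 16))"
  define T where "T = (real N + 1) * M * (2 * e)"
  have yK: "K * y / 2 \<le> 2 * y\<^sup>2" 
  proof -
    have "K * y \<le> y * y" using y by (intro mult_right_mono) auto
    then show ?thesis using y(2) by (simp add: power2_eq_square)
  qed
  have dev: "c / 2 \<le> \<bar>x - A\<bar>" if "\<bar>A - B\<bar> \<le> 3" "6 \<le> c / 2" "\<not> \<bar>x - B\<bar> \<le> c" for x A B c :: real
    using that by linarith
  have rows: "real (card {E \<in> ?Sl. \<not> \<bar>real (codeg E S) - real n * p ^ w\<bar> \<le> K * y}) \<le> T"
    if S: "S \<subseteq> {..<m}" "card S = w" "w \<in> {1, 2, 3}" for S w
  proof -
    let ?I = "{j. j < n \<and> \<not> (D \<and> j \<in> S)}"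
    have fS: "finite S" using S(1) by (rule finite_subset) simp
    have Sne: "S \<noteq> {}" using S by auto
    have fI: "finite ?I" by simp
    have "?I = {..<n} - (if D then S else {})" by auto
    then have "card ?I = card ({..<n} - (if D then S else {}))" by (rule arg_cong)
    moreover have "card {..<n} - card (if D then S else {}) \<le> card ({..<n} - (if D then S else {}))"
      using fS by (intro diff_card_le_card_Diff) auto
    ultimately have "n \<le> card ?I + 3" using S by (auto split: if_splits)
    then have I3: "real n \<le> real (card ?I) + 3" by linarith
    have "card ?I \<le> card {..<n}" by (intro card_mono) auto
    then have In: "real (card ?I) \<le> real n" by simp
    have "real (card {E \<in> ?Sl. K * y / 2 \<le> \<bar>real (card {j \<in> ?I. S \<times> {j} \<subseteq> E}) - real (card ?I) * p' ^ w\<bar>})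
        \<le> (real (card ?W) + 1) * real (card ?W choose k) * (2 * exp (- ((K * y / 2)\<^sup>2 / (4 * real n))))"
      unfolding p'_def N_def
    proof (rule slice_tail)
      show "S \<times> {j} \<subseteq> ?W \<and> card (S \<times> {j}) = w" if "j \<in> ?I" for j
        using that S by (auto simp: cells_def card_cartesian_product)
    qed (use N0 k In mn y yK K in \<open>auto simp: N_def\<close>)
    also have "(K * y / 2)\<^sup>2 / (4 * real n) = K\<^sup>2 / 16" using y mn by (simp add: power_mult_distrib power_divide)
    also have "(real (card ?W) + 1) * real (card ?W choose k) * (2 * exp (- (K\<^sup>2 / 16))) \<le> T"
      unfolding T_def N_def M_def e_def using K by (intro mult_left_mono) (auto simp: power2_eq_square)
    finally have le: "real (card {E \<in> ?Sl. K * y / 2 \<le> \<bar>real (card {j \<in> ?I. S \<times> {j} \<subseteq> E}) - real (card ?I) * p' ^ w\<bar>}) \<le> T" .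
    have "card {E \<in> ?Sl. \<not> \<bar>real (codeg E S) - real n * p ^ w\<bar> \<le> K * y} \<le>
       card {E \<in> ?Sl. K * y / 2 \<le> \<bar>real (card {j \<in> ?I. S \<times> {j} \<subseteq> E}) - real (card ?I) * p' ^ w\<bar>}"
    proof (intro card_mono)
      have pw: "0 \<le> p' ^ w" "p' ^ w \<le> 1" using p'1 by (auto simp: power_le_one)
      have "real n * (p' ^ w - p ^ w) \<le> real n * (real w * (1 / real n))"
        using power_diff_le[OF p0 ple p'1(2), of w] mult_left_mono[OF pd, of "real w"] by (intro mult_left_mono) auto
      also have "\<dots> \<le> 3" using S mn by auto
      finally have 1: "real n * p' ^ w - real n * p ^ w \<le> 3" by (simp add: algebra_simps)
      have 2: "real n * p ^ w \<le> real n * p' ^ w" using power_mono[OF ple p0] by (intro mult_left_mono) auto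
      have "(real n - real (card ?I)) * p' ^ w \<le> 3 * 1" using I3 pw In by (intro mult_mono) auto
      moreover have "0 \<le> (real n - real (card ?I)) * p' ^ w" using In pw by simp
      ultimately have "\<bar>real (card ?I) * p' ^ w - real n * p ^ w\<bar> \<le> 3"
        using 1 2 by (simp add: algebra_simps abs_le_iff)
      moreover have "K * y / 2 \<ge> 6" using y by simp
      ultimately have dv: "K * y / 2 \<le> \<bar>x - real (card ?I) * p' ^ w\<bar>" if "\<not> \<bar>x - real n * p ^ w\<bar> \<le> K * y" for x
        using that by (rule dev)
      show "{E \<in> ?Sl. \<not> \<bar>real (codeg E S) - real n * p ^ w\<bar> \<le> K * y} \<subseteq>
         {E \<in> ?Sl. K * y / 2 \<le> \<bar>real (card {j \<in> ?I. S \<times> {j} \<subseteq> E}) - real (card ?I) * p' ^ w\<bar>}"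
      proof
        fix E assume E: "E \<in> {E \<in> ?Sl. \<not> \<bar>real (codeg E S) - real n * p ^ w\<bar> \<le> K * y}"
        then have "E \<in> ?Sl" by simp
        moreover have "K * y / 2 \<le> \<bar>real (codeg E S) - real (card ?I) * p' ^ w\<bar>" using E by (intro dv) simp
        ultimately show "E \<in> {E \<in> ?Sl. K * y / 2 \<le> \<bar>real (card {j \<in> ?I. S \<times> {j} \<subseteq> E}) - real (card ?I) * p' ^ w\<bar>}"
          unfolding codeg_as_count[OF sub[OF \<open>E \<in> ?Sl\<close>] Sne] by (intro CollectI conjI)
      qed
    qed simp
    then show ?thesis using le by linarith
  qed
  have cols: "real (card {E \<in> ?Sl. \<not> \<bar>real (cdeg E j) - real m * p\<bar> \<le> K * y}) \<le> T" if j: "j < n" for j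
  proof -
    let ?I = "{i. i < m \<and> \<not> (D \<and> i = j)}"
    have "?I = {..<m} - (if D then {j} else {})" by auto
    then have "card ?I = card ({..<m} - (if D then {j} else {}))" by (rule arg_cong)
    then have cI: "card ?I = m - of_bool D" using j D by (auto simp: card_Diff_subset)
    have Kn: "0 < K * real n" "K * y / 2 \<le> 2 * (K * real n)"
    proof -
      show "0 < K * real n" using K mn by simp
      have "K * y * 1 \<le> K * y * y" using K y by (intro mult_left_mono) auto
      then show "K * y / 2 \<le> 2 * (K * real n)" using y(1,2) K
        using mult_pos_pos[of K "real n"] by (simp add: power2_eq_square[symmetric] mult.assoc)
    qed
    have "real (card {E \<in> ?Sl. K * y / 2 \<le> \<bar>real (card {i \<in> ?I. {(i, j)} \<subseteq> E}) - real (card ?I) * p' ^ 1\<bar>})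
        \<le> (real (card ?W) + 1) * real (card ?W choose k) * (2 * exp (- ((K * y / 2)\<^sup>2 / (4 * (K * real n)))))"
      unfolding p'_def N_def
    proof (rule slice_tail)
      show "{(i, j)} \<subseteq> ?W \<and> card {(i, j)} = 1" if "i \<in> ?I" for i
        using that j by (auto simp: cells_def)
    qed (use N0 k mn y K cI Kn in \<open>auto simp: N_def\<close>)
    also have "(K * y / 2)\<^sup>2 / (4 * (K * real n)) = K / 16"
      unfolding y(1)[symmetric] using y(2) K by (simp add: power2_eq_square field_simps)
    also have "(real (card ?W) + 1) * real (card ?W choose k) * (2 * exp (- (K / 16))) = T"
      unfolding T_def N_def M_def e_def by simp
    finally have le: "real (card {E \<in> ?Sl. K * y / 2 \<le> \<bar>real (card {i \<in> ?I. {(i, j)} \<subseteq> E}) - real (card ?I) * p' ^ 1\<bar>}) \<le> T" .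
    have "card {E \<in> ?Sl. \<not> \<bar>real (cdeg E j) - real m * p\<bar> \<le> K * y} \<le>
       card {E \<in> ?Sl. K * y / 2 \<le> \<bar>real (card {i \<in> ?I. {(i, j)} \<subseteq> E}) - real (card ?I) * p' ^ 1\<bar>}"
    proof (intro card_mono)
      have "\<bar>real (card ?I) * p' ^ 1 - real m * p\<bar> \<le> 3"
      proof (cases D)
        case True
        have "real n * (p' - p) \<le> real n * (1 / real n)" using pd by (intro mult_left_mono) auto
        then have "real n * p' - real n * p \<le> 1" using mn by (simp add: algebra_simps)
        moreover have "real n * p \<le> real n * p'" using ple by (intro mult_left_mono) auto
        moreover have cn: "real (card ?I) = real n - 1" using True D cI mn by (simp add: of_nat_diff)
        moreover have "m = n" using True D by simp
        ultimately show ?thesis unfolding cn power_one_right left_diff_distrib using p'1 by (simp only: abs_le_iff) linarith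
      next
        case False
        then have "p = p'" using pp' mn by (simp add: d_def)
        then show ?thesis using False cI by simp
      qed
      moreover have "K * y / 2 \<ge> 6" using y by simp
      ultimately have dv: "K * y / 2 \<le> \<bar>x - real (card ?I) * p' ^ 1\<bar>" if "\<not> \<bar>x - real m * p\<bar> \<le> K * y" for x
        using that by (rule dev)
      show "{E \<in> ?Sl. \<not> \<bar>real (cdeg E j) - real m * p\<bar> \<le> K * y} \<subseteq>
         {E \<in> ?Sl. K * y / 2 \<le> \<bar>real (card {i \<in> ?I. {(i, j)} \<subseteq> E}) - real (card ?I) * p' ^ 1\<bar>}"
      proof
        fix E assume E: "E \<in> {E \<in> ?Sl. \<not> \<bar>real (cdeg E j) - real m * p\<bar> \<le> K * y}"
        then have "E \<in> ?Sl" by simp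
        moreover have "K * y / 2 \<le> \<bar>real (cdeg E j) - real (card ?I) * p' ^ 1\<bar>" using E by (intro dv) simp
        ultimately show "E \<in> {E \<in> ?Sl. K * y / 2 \<le> \<bar>real (card {i \<in> ?I. {(i, j)} \<subseteq> E}) - real (card ?I) * p' ^ 1\<bar>}"
          unfolding cdeg_as_count[OF sub[OF \<open>E \<in> ?Sl\<close>]] by (intro CollectI conjI)
      qed
    qed simp
    then show ?thesis using le by linarith
  qed
  let ?R = "\<lambda>S. {E \<in> ?Sl. \<not> \<bar>real (codeg E S) - real n * p ^ card S\<bar> \<le> K * y}"
  let ?C = "\<lambda>j. {E \<in> ?Sl. \<not> \<bar>real (cdeg E j) - real m * p\<bar> \<le> K * y}"
  let ?SS = "slice {..<m} 1 \<union> slice {..<m} 2 \<union> slice {..<m} 3"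
  have T0: "T \<ge> 0" unfolding T_def M_def e_def by simp
  have "{E \<in> ?Sl. \<not> conc m n p K E} \<subseteq> (\<Union>S\<in>?SS. ?R S) \<union> (\<Union>j<n. ?C j)"
    unfolding conc_def y_def[symmetric] by (auto simp: slice_def)
  then have "card {E \<in> ?Sl. \<not> conc m n p K E} \<le> card ((\<Union>S\<in>?SS. ?R S) \<union> (\<Union>j<n. ?C j))"
    by (intro card_mono) auto
  also have "\<dots> \<le> card (\<Union>S\<in>?SS. ?R S) + card (\<Union>j<n. ?C j)" by (rule card_Un_le)
  also have "\<dots> \<le> (\<Sum>S\<in>?SS. card (?R S)) + (\<Sum>j<n. card (?C j))"
    by (intro add_mono card_UN_le) auto
  finally have "real (card {E \<in> ?Sl. \<not> conc m n p K E}) \<le> (\<Sum>S\<in>?SS. real (card (?R S))) + (\<Sum>j<n. real (card (?C j)))"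
    by (simp only: of_nat_sum[symmetric] of_nat_add[symmetric] of_nat_le_iff)
  also have "\<dots> \<le> (\<Sum>S\<in>?SS. T) + (\<Sum>j<n. T)"
  proof (intro add_mono sum_mono)
    fix S assume "S \<in> ?SS"
    then show "real (card (?R S)) \<le> T" by (intro rows) (auto simp: slice_def)
  qed (use cols in auto)
  also have "\<dots> = (real (card ?SS) + real n) * T" by (simp add: algebra_simps)
  also have "\<dots> \<le> (4 * K ^ 3 * real n ^ 3) * T"
  proof (rule mult_right_mono[OF _ T0])
    have ch: "real (m choose w) \<le> (K * real n) ^ 3" if w: "w \<in> {1, 2, 3}" for w
    proof -
      have "(m choose w) \<le> m ^ w"
        by (cases "w \<le> m") (auto intro: binomial_le_pow simp: binomial_eq_0)
      also have "m ^ w \<le> m ^ 3" using w mn by (intro power_increasing) auto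
      finally have "real (m choose w) \<le> real m ^ 3" by (metis of_nat_le_iff of_nat_power)
      also have "\<dots> \<le> (K * real n) ^ 3" using mn by (intro power_mono) auto
      finally show ?thesis .
    qed
    have "card ?SS \<le> card (slice {..<m} 1) + card (slice {..<m} 2) + card (slice {..<m} 3)"
      by (meson add_le_mono card_Un_le le_refl order_trans)
    then have "card ?SS \<le> (m choose 1) + (m choose 2) + (m choose 3)" by (simp add: card_slice)
    then have "real (card ?SS) \<le> real (m choose 1) + real (m choose 2) + real (m choose 3)"
      by (metis of_nat_add of_nat_le_iff)
    then have 1: "real (card ?SS) \<le> 3 * (K * real n) ^ 3" using ch[of 1] ch[of 2] ch[of 3] by simp
    have "real n * 1 \<le> (K * real n) ^ 3"
    proof -
      have "1 * real n \<le> K * real n" using K by (intro mult_right_mono) auto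
      moreover have "(K * real n) ^ 1 \<le> (K * real n) ^ 3"
        using K mn calculation by (intro power_increasing) linarith+
      ultimately show ?thesis by simp
    qed
    then show "real (card ?SS) + real n \<le> 4 * K ^ 3 * real n ^ 3" using 1 by (simp add: power_mult_distrib)
  qed
  also have "(4 * K ^ 3 * real n ^ 3) * T \<le> (4 * K ^ 3 * real n ^ 3) * ((2 * K * real n ^ 2) * M * (2 * e))"
  proof (rule mult_left_mono)
    have "real N \<le> K * real n * real n" unfolding Nd of_nat_mult using mn d0 K by (intro mult_mono) auto
    moreover have "1 \<le> K * real n * real n"
    proof -
      have "1 * 1 * 1 \<le> K * real n * real n" using K mn by (intro mult_mono) auto
      then show ?thesis by simp
    qed
    ultimately have "real N + 1 \<le> 2 * K * real n ^ 2" by (simp add: power2_eq_square)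
    then show "T \<le> (2 * K * real n ^ 2) * M * (2 * e)"
      unfolding T_def by (intro mult_right_mono) (auto simp: M_def e_def)
  qed (use K in auto)
  also have "\<dots> = 16 * K ^ 4 * real n ^ 5 * e * M" by (simp add: eval_nat_numeral)
  finally show ?thesis unfolding e_def M_def N_def .
qed

section \<open>The density along a fixed column sequence\<close>

text \<open>\<open>K\<close> is one large parameter, later a small power of \<open>n\<close>: it
  bounds the density away from 0 and 1, the quotient of \<open>m\<close> and \<open>n\<close>, and
  the deviations in \<open>conc\<close>. All losses are measured in powers of
  \<open>K\<close>.\<close>

locale dense =
  fixes D :: bool and m n k :: nat and K :: real
  assumes D: "D \<Longrightarrow> m = n" and K: "K \<ge> 100" and nm: "real n \<le> K * real m" "real m \<le> K * real n"
    and big: "K ^ 10 \<le> sqrt (real n)"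
    and p_lower: "1 / K \<le> real k / (real m * real n)" and p_upper: "real k / (real m * real n) \<le> 1 - 1 / K"
begin

definition p :: real where "p = real k / (real m * real n)"
definition y :: real where "y = sqrt (real n)"
abbreviation "W \<equiv> cells D m n"

lemma K_pow_le_y: "i \<le> 10 \<Longrightarrow> K ^ i \<le> y"
proof -
  assume "i \<le> 10"
  then have "K ^ i \<le> K ^ 10" using K by (intro power_increasing) auto
  then show ?thesis using big by (simp add: y_def)
qed

lemma K_step: "c \<le> 100 \<Longrightarrow> c * K ^ i \<le> K ^ Suc i"
  using K by (simp add: mult_right_mono)

lemma y_pos: "y \<ge> 1" "y > 0"
proof -
  have "K ^ 0 \<le> y" by (rule K_pow_le_y) simp
  then show "y \<ge> 1" "y > 0" by auto
qed

lemma n_eq: "real n = y\<^sup>2" by (simp add: y_def)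
lemma n_pos: "n > 0" using n_eq y_pos by (cases n) auto
lemma m_pos: "m > 0" using nm(1) n_pos by (cases m) auto

lemma cK_le_y: "c \<le> 100 \<Longrightarrow> i < 10 \<Longrightarrow> c * K ^ i \<le> y"
  using K_step[of c i] K_pow_le_y[of "Suc i"] by linarith

lemma p01: "1 / K \<le> p" "p \<le> 1 - 1 / K" "0 < p" "p < 1"
proof -
  show 1: "1 / K \<le> p" "p \<le> 1 - 1 / K" using p_lower p_upper by (auto simp: p_def)
  have "0 < 1 / K" using K by simp
  then show "0 < p" "p < 1" using 1 by linarith+
qed

lemma k_eq: "real k = p * real m * real n" using n_pos m_pos by (simp add: p_def)

lemma pq: "1 / (2 * K) \<le> p * (1 - p)"
proof (cases "p \<le> 1 / 2")
  case True
  have "1 / K * (1 / 2) \<le> p * (1 - p)" using p01 K True by (intro mult_mono) auto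
  then show ?thesis by simp
next
  case False
  have "1 / 2 * (1 / K) \<le> p * (1 - p)" using p01 K False by (intro mult_mono) auto
  then show ?thesis by simp
qed

lemma npq: "y\<^sup>2 / (2 * K) \<le> real n * p - real n * p\<^sup>2"
proof -
  have "y\<^sup>2 * (1 / (2 * K)) \<le> y\<^sup>2 * (p * (1 - p))" using pq by (intro mult_left_mono) auto
  then show ?thesis by (simp add: n_eq power2_eq_square algebra_simps)
qed

lemma Ky_le: "c \<le> 100 \<Longrightarrow> c * (K * y) \<le> y\<^sup>2 / (4 * K)"
proof -
  assume c: "c \<le> 100"
  have "4 * (K * K * c) \<le> 400 * K\<^sup>2" using c K by (simp add: power2_eq_square mult_right_mono)
  also have "\<dots> \<le> K ^ 4"
  proof -
    have "400 \<le> K * K" using K mult_mono[of 100 K 100 K] by simp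
    then have "400 * (K * K) \<le> (K * K) * (K * K)" by (intro mult_right_mono) auto
    then show ?thesis by (simp add: eval_nat_numeral mult_ac)
  qed
  also have "\<dots> \<le> y" by (rule K_pow_le_y) simp
  finally have "y * (4 * (K * K * c)) \<le> y * y" using y_pos by (intro mult_left_mono) auto
  then show ?thesis using K by (simp add: field_simps power2_eq_square)
qed

end

lemma abs_mult_le:
  fixes a b c d :: real
  assumes "\<bar>a\<bar> \<le> c" "\<bar>b\<bar> \<le> d"
  shows "\<bar>a * b\<bar> \<le> c * d"
  unfolding abs_mult using assms by (intro mult_mono) auto

text \<open>\<open>card_bad\<close> will show that few edge sets have degrees for which this fails.
  A share of n^(-3) of unconcentrated graphs is small enough for trivial pointwise bounds on them to
  be harmless in averages over the fibre.\<close>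

locale good_fibre = dense +
  fixes s t :: "nat \<Rightarrow> nat"
  assumes nonempty: "deg_fibre D m n (s, t) \<noteq> {}"
    and few_bad: "real (card {E \<in> deg_fibre D m n (s, t). \<not> conc m n p K E}) * real n ^ 3 \<le> real (card (deg_fibre D m n (s, t)))"
    and sum_s: "(\<Sum>i<m. s i) = k"
begin

abbreviation "\<Omega> \<equiv> deg_fibre D m n (s, t)"
abbreviation cc :: "(nat \<times> nat) set \<Rightarrow> bool" where "cc \<equiv> conc m n p K"

definition Av :: "((nat \<times> nat) set \<Rightarrow> real) \<Rightarrow> real" where
  "Av g = (\<Sum>E\<in>\<Omega>. g E) / real (card \<Omega>)"

lemma card_pos: "real (card \<Omega>) > 0" using nonempty by (simp add: card_gt_0_iff)

lemma Av_add: "Av (\<lambda>E. f E + g E) = Av f + Av g" by (simp add: Av_def sum.distrib add_divide_distrib)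
lemma Av_diff: "Av (\<lambda>E. f E - g E) = Av f - Av g" by (simp add: Av_def sum_subtractf diff_divide_distrib)
lemma Av_cmult: "Av (\<lambda>E. c * f E) = c * Av f" by (simp add: Av_def sum_distrib_left[symmetric])
lemma Av_const: "Av (\<lambda>E. c) = c" using nonempty by (simp add: Av_def)
lemma Av_sum: "Av (\<lambda>E. \<Sum>i\<in>I. f i E) = (\<Sum>i\<in>I. Av (f i))"
  unfolding Av_def by (subst sum.swap) (simp add: sum_divide_distrib)
lemma Av_cong: "(\<And>E. E \<in> \<Omega> \<Longrightarrow> f E = g E) \<Longrightarrow> Av f = Av g"
  unfolding Av_def by (metis (no_types, lifting) sum.cong)

text \<open>A sharp bound on concentrated graphs and a trivial one elsewhere; \<open>few_bad\<close>
  divides the trivial bound by \<open>n ^ 3\<close>.\<close>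

lemma Av_abs_le:
  assumes c: "\<And>E. E \<in> \<Omega> \<Longrightarrow> cc E \<Longrightarrow> \<bar>g E\<bar> \<le> c" and c': "\<And>E. E \<in> \<Omega> \<Longrightarrow> \<bar>g E\<bar> \<le> c'" and c0: "0 \<le> c" "0 \<le> c'"
  shows "\<bar>Av g\<bar> \<le> c + c' / real n ^ 3"
proof -
  let ?B = "{E \<in> \<Omega>. \<not> cc E}"
  have "\<bar>\<Sum>E\<in>\<Omega>. g E\<bar> \<le> (\<Sum>E\<in>\<Omega>. \<bar>g E\<bar>)" by (rule sum_abs)
  also have "\<dots> \<le> (\<Sum>E\<in>\<Omega>. c + (if \<not> cc E then c' else 0))"
  proof (rule sum_mono)
    fix E assume E: "E \<in> \<Omega>"
    show "\<bar>g E\<bar> \<le> c + (if \<not> cc E then c' else 0)"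
    proof (cases "cc E")
      case False
      then show ?thesis using c'[OF E] c0 by simp
    qed (use c[OF E] in simp)
  qed
  also have "\<dots> = real (card \<Omega>) * c + real (card ?B) * c'"
    by (simp add: sum.distrib sum.If_cases Int_def)
  also have "real (card ?B) \<le> real (card \<Omega>) / real n ^ 3"
    using few_bad n_pos by (simp add: field_simps)
  finally have "\<bar>\<Sum>E\<in>\<Omega>. g E\<bar> \<le> real (card \<Omega>) * (c + c' / real n ^ 3)"
    using c0 by (simp add: distrib_left mult_right_mono)
  then show ?thesis unfolding Av_def using card_pos by (simp add: field_simps)
qed

lemma n3: "real n ^ 3 \<ge> 2"
proof -
  have "2 * K ^ 0 \<le> y" by (rule cK_le_y) auto
  then have "2 \<le> y" by simp
  then have "2 ^ 6 \<le> y ^ 6" by (intro power_mono) auto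
  moreover have "real n ^ 3 = y ^ 6" by (simp add: n_eq power_mult[symmetric])
  ultimately show ?thesis by simp
qed

lemma ex_conc: "\<exists>E\<in>\<Omega>. cc E"
proof (rule ccontr)
  assume "\<not> (\<exists>E\<in>\<Omega>. cc E)"
  then have "{E \<in> \<Omega>. \<not> cc E} = \<Omega>" by blast
  then have "real (card \<Omega>) * real n ^ 3 \<le> real (card \<Omega>) * 1" using few_bad by simp
  then show False using card_pos n3 by (simp add: mult_le_cancel_left_pos)
qed

lemma in_\<Omega>: "E \<in> \<Omega> \<Longrightarrow> E \<subseteq> W" "E \<in> \<Omega> \<Longrightarrow> rdeg E = s" "E \<in> \<Omega> \<Longrightarrow> cdeg E = t"
  using deg_fibreD by blast+

lemma cc_pair: "cc E \<Longrightarrow> a < m \<Longrightarrow> b < m \<Longrightarrow> a \<noteq> b \<Longrightarrow> \<bar>real (codeg E {a, b}) - real n * p\<^sup>2\<bar> \<le> K * y"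
  unfolding conc_def y_def by (elim conjE allE[of _ "{a, b}"]) (auto simp: power2_eq_square)

lemma cc_triple:
  assumes "cc E" "a < m" "b < m" "c < m" "a \<noteq> b" "b \<noteq> c" "a \<noteq> c"
  shows "\<bar>real (codeg E {a, b, c}) - real n * p ^ 3\<bar> \<le> K * y"
proof -
  have "card {a, b, c} = 3" using assms by auto
  then show ?thesis using assms unfolding conc_def y_def by (elim conjE allE[of _ "{a, b, c}"]) (auto simp: power3_eq_cube mult.assoc)
qed

text \<open>The degrees are constant on the fibre, so a single concentrated member bounds
  them.\<close>

lemma s_bound: "a < m \<Longrightarrow> \<bar>real (s a) - real n * p\<bar> \<le> K * y"
proof -
  assume a: "a < m"
  obtain E where "E \<in> \<Omega>" "cc E" using ex_conc by blast
  then show ?thesis using a in_\<Omega>(2)[of E] unfolding conc_def y_def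
    by (elim conjE allE[of _ "{a}"]) (auto simp: codeg_single)
qed

lemma t_bound: "j < n \<Longrightarrow> \<bar>real (t j) - real m * p\<bar> \<le> K * y"
  using ex_conc in_\<Omega>(3) unfolding conc_def y_def by blast

lemma s_le: "s a \<le> n"
proof -
  obtain E where "E \<in> \<Omega>" using nonempty by blast
  then have E: "E \<subseteq> W" "rdeg E = s" using in_\<Omega> by auto
  have "card {j. (a, j) \<in> E} \<le> card {..<n}" using cells_row[OF E(1)] by (intro card_mono) auto
  then show ?thesis using E(2) by (auto simp: rdeg_eq)
qed

lemma movable_eq:
  assumes "E \<in> \<Omega>" "a \<noteq> c"
  shows "real (card (movable D E a c)) = real (s a) - real (codeg E {a, c}) - of_bool (D \<and> (a, c) \<in> E)"
  using card_movable[OF in_\<Omega>(1)[OF assms(1)] assms(2)] in_\<Omega>(2)[OF assms(1)] by simp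

lemma movable_le: "E \<in> \<Omega> \<Longrightarrow> real (card (movable D E a c)) \<le> real n"
  using card_movable_le[OF in_\<Omega>(1)] by simp

lemma movable_conc:
  assumes E: "E \<in> \<Omega>" "cc E" and ac: "a < m" "c < m" "a \<noteq> c"
  shows "\<bar>real (card (movable D E a c)) - (real n * p - real n * p\<^sup>2)\<bar> \<le> 2 * (K * y) + 1"
  using movable_eq[OF E(1) ac(3)] s_bound[OF ac(1)] cc_pair[OF E(2) ac] by (auto simp: abs_le_iff of_bool_def)

lemma movable_lower:
  assumes E: "E \<in> \<Omega>" "cc E" and ac: "a < m" "c < m" "a \<noteq> c"
  shows "real (card (movable D E a c)) \<ge> y\<^sup>2 / (4 * K)"
proof -
  have "3 * (K * y) \<le> y\<^sup>2 / (4 * K)" by (rule Ky_le) simp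
  moreover have "1 \<le> K * y" using mult_mono[of 1 K 1 y] K y_pos by simp
  moreover have "y\<^sup>2 / (2 * K) = y\<^sup>2 / (4 * K) + y\<^sup>2 / (4 * K)" by simp
  ultimately show ?thesis using movable_conc[OF assms] npq by (simp only: abs_le_iff) linarith
qed

text \<open>The codegree is symmetric and cancels; degrees and the correction for the diagonal
  remain.\<close>

lemma movable_diff:
  assumes "E \<in> \<Omega>" "a \<noteq> c"
  shows "\<bar>(real (card (movable D E a c)) - real (card (movable D E c a))) - (real (s a) - real (s c))\<bar> \<le> 1"
  using movable_eq[OF assms] movable_eq[OF assms(1) assms(2)[symmetric]]
  by (auto simp: insert_commute of_bool_def)

lemma s_diff: "a < m \<Longrightarrow> c < m \<Longrightarrow> \<bar>real (s a) - real (s c)\<bar> \<le> 2 * (K * y)"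
  using s_bound[of a] s_bound[of c] by (simp add: abs_le_iff)

lemma Ky1: "1 \<le> K * y" using mult_mono[of 1 K 1 y] K y_pos by simp

lemma movable_diff_le:
  assumes "E \<in> \<Omega>" "a < m" "c < m" "a \<noteq> c"
  shows "\<bar>real (card (movable D E a c)) - real (card (movable D E c a))\<bar> \<le> 3 * (K * y)"
  using movable_diff[OF assms(1,4)] s_diff[OF assms(2,3)] Ky1 by (simp add: abs_le_iff)

text \<open>\<open>switch_identity\<close> with \<open>\<phi>\<close> testing row \<open>b\<close>.
  In \<open>u - v\<close> the triple codegrees cancel, leaving the difference of the two codegrees
  up to 1. On the other side \<open>al - ga\<close> is \<open>s a - s c\<close> up to 1, hence at
  most \<open>3 * K * y\<close>, and the quotient is \<open>p\<close> up to
  \<open>18 * K\<^sup>2 / y\<close>. The product of these two sizes no longer contains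
  \<open>y\<close>: averages are known far better than single codegrees, which fluctuate by
  \<open>K * y\<close>.\<close>

lemma codeg_step:
  assumes abc: "a < m" "b < m" "c < m" "a \<noteq> b" "b \<noteq> c" "a \<noteq> c"
  shows "\<bar>Av (\<lambda>E. real (codeg E {a, b})) - Av (\<lambda>E. real (codeg E {c, b})) - p * (real (s a) - real (s c))\<bar> \<le> 60 * K ^ 3"
proof -
  define u where "u = (\<lambda>E. \<Sum>j\<in>movable D E a c. of_bool ((b, j) \<in> E) :: real)"
  define v where "v = (\<lambda>E. \<Sum>j\<in>movable D E c a. of_bool ((b, j) \<in> E) :: real)"
  define al where "al = (\<lambda>E. real (card (movable D E a c)))"
  define ga where "ga = (\<lambda>E. real (card (movable D E c a)))"
  define rho where "rho = (\<lambda>E. (u E + v E) / (al E + ga E))"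
  have sw: "(\<Sum>E\<in>\<Omega>. u E - v E) = (\<Sum>E\<in>\<Omega>. (al E - ga E) * rho E)"
    unfolding u_def v_def al_def ga_def rho_def
    by (rule switch_identity) (use abc in auto)
  have uv0: "0 \<le> u E" "u E \<le> al E" "0 \<le> v E" "v E \<le> ga E" for E
  proof -
    have "u E \<le> (\<Sum>j\<in>movable D E a c. 1)" unfolding u_def by (intro sum_mono) auto
    then show "u E \<le> al E" by (simp add: al_def)
    have "v E \<le> (\<Sum>j\<in>movable D E c a. 1)" unfolding v_def by (intro sum_mono) auto
    then show "v E \<le> ga E" by (simp add: ga_def)
  qed (auto simp: u_def v_def intro!: sum_nonneg)
  have rho01: "0 \<le> rho E" "rho E \<le> 1" for E
    unfolding rho_def using uv0[of E] by (auto simp: divide_le_eq intro!: divide_nonneg_nonneg)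
  have ueq: "u E = real (codeg E {a, b}) - real (codeg E {a, b, c}) - of_bool (D \<and> (a, c) \<in> E \<and> (b, c) \<in> E)" if "E \<in> \<Omega>" for E
    unfolding u_def by (rule sum_movable_mem[OF in_\<Omega>(1)[OF that] abc(6)])
  have veq: "v E = real (codeg E {c, b}) - real (codeg E {a, b, c}) - of_bool (D \<and> (c, a) \<in> E \<and> (b, a) \<in> E)" if "E \<in> \<Omega>" for E
    unfolding v_def sum_movable_mem[OF in_\<Omega>(1)[OF that] abc(6)[symmetric]]
    by (simp add: insert_commute)
  define g where "g = (\<lambda>E. (real (codeg E {a, b}) - real (codeg E {c, b}) - (u E - v E)) +
      ((al E - ga E) * rho E - p * (real (s a) - real (s c))))"
  have Avg: "Av g = Av (\<lambda>E. real (codeg E {a, b})) - Av (\<lambda>E. real (codeg E {c, b})) - p * (real (s a) - real (s c))"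
  proof -
    have "Av (\<lambda>E. u E - v E) = Av (\<lambda>E. (al E - ga E) * rho E)" unfolding Av_def sw ..
    then show ?thesis unfolding g_def Av_add Av_diff Av_const by simp
  qed
  have e1: "\<bar>real (codeg E {a, b}) - real (codeg E {c, b}) - (u E - v E)\<bar> \<le> 1" if "E \<in> \<Omega>" for E
    using ueq[OF that] veq[OF that] by (auto simp: of_bool_def)
  have dal: "\<bar>(al E - ga E) - (real (s a) - real (s c))\<bar> \<le> 1" if "E \<in> \<Omega>" for E
    unfolding al_def ga_def using movable_diff[OF that abc(6)] .
  have "\<bar>Av g\<bar> \<le> (54 * K ^ 3 + 2) + (3 * real n) / real n ^ 3"
  proof (rule Av_abs_le)
    fix E assume E: "E \<in> \<Omega>" "cc E"
    have alga: "al E + ga E \<ge> y\<^sup>2 / (2 * K)"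
      using movable_lower[OF E abc(1,3,6)] movable_lower[OF E abc(3,1) abc(6)[symmetric]]
      by (simp add: al_def ga_def)
    have pos: "0 < y\<^sup>2 / (2 * K)" using y_pos K by simp
    \<comment> \<open>Both \<open>u E + v E\<close> and \<open>p * (al E + ga E)\<close> are close
      to \<open>2 * n * (p\<^sup>2 - p ^ 3)\<close>.\<close>
    have num: "\<bar>(u E + v E) - p * (al E + ga E)\<bar> \<le> 9 * (K * y)"
    proof -
      define X Y where "X = real (codeg E {a, c})" and "Y = real (codeg E {a, b, c})"
      define ca where "ca = (of_bool (D \<and> (a, c) \<in> E) :: real)"
      define cb where "cb = (of_bool (D \<and> (c, a) \<in> E) :: real)"
      have alE: "al E + ga E = real (s a) + real (s c) - 2 * X - ca - cb"
        unfolding al_def ga_def movable_eq[OF E(1) abc(6)] movable_eq[OF E(1) abc(6)[symmetric]] ca_def cb_def X_def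
        by (simp add: insert_commute)
      define R where "R = (real (s a) - real n * p) + (real (s c) - real n * p) - 2 * (X - real n * p\<^sup>2) - ca - cb"
      have "p * (al E + ga E) = p * R + 2 * (real n * p\<^sup>2) - 2 * (real n * p ^ 3)"
        unfolding alE R_def by (simp add: algebra_simps power2_eq_square power3_eq_cube)
      moreover have "\<bar>p * R\<bar> \<le> 1 * (4 * (K * y) + 2)"
      proof (rule abs_mult_le)
        have "\<bar>X - real n * p\<^sup>2\<bar> \<le> K * y" unfolding X_def by (rule cc_pair[OF E(2) abc(1,3,6)])
        then show "\<bar>R\<bar> \<le> 4 * (K * y) + 2"
          unfolding R_def ca_def cb_def using s_bound[OF abc(1)] s_bound[OF abc(3)] by (auto simp: abs_le_iff of_bool_def)
      qed (use p01 in simp)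
      moreover have "\<bar>(u E + v E) - (2 * (real n * p\<^sup>2) - 2 * (real n * p ^ 3))\<bar> \<le> 4 * (K * y) + 2"
        using ueq[OF E(1)] veq[OF E(1)] cc_pair[OF E(2) abc(1,2,4)] cc_pair[OF E(2) abc(3,2) abc(5)[symmetric]]
          cc_triple[OF E(2) abc(1,2,3,4,5,6)]
        by (auto simp: abs_le_iff of_bool_def)
      moreover have "4 * K ^ 0 \<le> y" by (rule cK_le_y) auto
      then have "4 \<le> K * y" using mult_mono[of 1 K 4 y] K by simp
      ultimately show ?thesis by (simp add: abs_le_iff)
    qed
    have "rho E - p = ((u E + v E) - p * (al E + ga E)) / (al E + ga E)"
      using alga pos by (simp add: rho_def field_simps)
    then have "\<bar>rho E - p\<bar> = \<bar>(u E + v E) - p * (al E + ga E)\<bar> / (al E + ga E)"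
      using alga pos by simp
    also have "\<dots> \<le> (9 * (K * y)) / (y\<^sup>2 / (2 * K))"
      using num alga pos by (intro frac_le) auto
    also have "\<dots> = 18 * K\<^sup>2 / y" using y_pos K by (simp add: power2_eq_square)
    finally have r: "\<bar>rho E - p\<bar> \<le> 18 * K\<^sup>2 / y" .
    have "\<bar>(al E - ga E) * (rho E - p)\<bar> \<le> (3 * (K * y)) * (18 * K\<^sup>2 / y)"
      using movable_diff_le[OF E(1) abc(1,3,6)] r by (intro abs_mult_le) (auto simp: al_def ga_def)
    also have "\<dots> = 54 * K ^ 3" using y_pos by (simp add: power2_eq_square power3_eq_cube)
    finally have 1: "\<bar>(al E - ga E) * (rho E - p)\<bar> \<le> 54 * K ^ 3" .
    have "\<bar>p * ((al E - ga E) - (real (s a) - real (s c)))\<bar> \<le> 1 * 1"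
      using dal[OF E(1)] p01 by (intro abs_mult_le) auto
    moreover have "(al E - ga E) * rho E - p * (real (s a) - real (s c)) =
       (al E - ga E) * (rho E - p) + p * ((al E - ga E) - (real (s a) - real (s c)))" by (simp add: algebra_simps)
    ultimately show "\<bar>g E\<bar> \<le> 54 * K ^ 3 + 2" using 1 e1[OF E(1)] unfolding g_def by (simp add: abs_le_iff)
  next
    fix E assume E: "E \<in> \<Omega>"
    have "\<bar>al E - ga E\<bar> \<le> real n"
      using movable_le[OF E, of a c] movable_le[OF E, of c a] by (auto simp: al_def ga_def abs_le_iff)
    then have "\<bar>(al E - ga E) * rho E\<bar> \<le> real n * 1" using rho01[of E] by (intro abs_mult_le) auto
    moreover have "\<bar>p * (real (s a) - real (s c))\<bar> \<le> 1 * real n"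
      using p01 s_le[of a] s_le[of c] by (intro abs_mult_le) (auto simp: abs_le_iff)
    moreover have "1 \<le> real n" using n_pos by simp
    ultimately show "\<bar>g E\<bar> \<le> 3 * real n" using e1[OF E] unfolding g_def by (simp add: abs_le_iff)
  qed (use K in auto)
  also have "(3 * real n) / real n ^ 3 \<le> 3"
  proof -
    have "real n ^ 1 \<le> real n ^ 3" using n_pos by (intro power_increasing) auto
    then show ?thesis using n_pos by (simp add: divide_le_eq)
  qed
  also have "54 * K ^ 3 + 2 + 3 \<le> 60 * K ^ 3"
  proof -
    have "1 \<le> K ^ 3" using K by (intro one_le_power) auto
    then show ?thesis by linarith
  qed
  finally show ?thesis unfolding Avg by linarith
qed

lemma m_bounds: "real m \<ge> 2" "real m * real m \<le> 2 * (real m * (real m - 1))"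
proof -
  have "2 * K ^ 1 \<le> y" by (rule cK_le_y) auto
  also have "y \<le> y\<^sup>2" using y_pos by (simp add: power2_eq_square)
  also have "\<dots> \<le> K * real m" using nm(1) n_eq by simp
  finally have "K * 2 \<le> K * real m" by simp
  then show 1: "real m \<ge> 2" using K by (simp add: mult_le_cancel_left_pos)
  have "real m * 2 \<le> real m * real m" using 1 by (intro mult_left_mono) auto
  then show "real m * real m \<le> 2 * (real m * (real m - 1))" by (simp add: right_diff_distrib)
qed

lemma sum_t: "(\<Sum>j<n. real (t j)) = real k"
proof -
  obtain E where E: "E \<in> \<Omega>" using nonempty by blast
  have "(\<Sum>j<n. t j) = card E" using sum_cdeg[OF in_\<Omega>(1)[OF E]] in_\<Omega>(3)[OF E] by simp
  also have "\<dots> = k" using sum_rdeg[OF in_\<Omega>(1)[OF E]] in_\<Omega>(2)[OF E] sum_s by simp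
  finally show ?thesis by (metis of_nat_sum)
qed

text \<open>\<open>H\<close> is the average codegree minus \<open>p * (s a + s b)\<close>. By
  \<open>codeg_step\<close> it hardly changes when one row of the pair is replaced, so all its
  values are within \<open>2 * e\<close> of each other and hence of their mean; the mean is known,
  since \<open>sum_codeg_pairs\<close> expresses the total of the codegrees by the column
  degrees.\<close>

lemma codeg_avg:
  assumes ab: "a < m" "b < m" "a \<noteq> b"
  shows "\<bar>Av (\<lambda>E. real (codeg E {a, b})) - (p * (real (s a) + real (s b)) - real n * p\<^sup>2)\<bar> \<le> 4 * K ^ 4"
proof -
  define H where "H = (\<lambda>a b. Av (\<lambda>E. real (codeg E {a, b})) - p * (real (s a) + real (s b)))"
  define e where "e = 60 * K ^ 3"
  have e0: "e \<ge> 0" using K by (simp add: e_def)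
  have Hsym: "H x z = H z x" for x z unfolding H_def by (simp add: insert_commute add.commute)
  have Hstep: "\<bar>H x z - H w z\<bar> \<le> e" if "x < m" "z < m" "w < m" "x \<noteq> z" "w \<noteq> z" for x z w
  proof (cases "x = w")
    case False
    have "H x z - H w z = Av (\<lambda>E. real (codeg E {x, z})) - Av (\<lambda>E. real (codeg E {w, z})) - p * (real (s x) - real (s w))"
      unfolding H_def by (simp add: algebra_simps)
    then show ?thesis using codeg_step[of x z w] that False by (simp add: e_def)
  qed (use e0 in simp)
  have Hpair: "\<bar>H a b - H c d\<bar> \<le> 2 * e" if cd: "c < m" "d < m" "c \<noteq> d" for c d
  \<comment> \<open>The path through the pair \<open>c\<close>, \<open>b\<close> degenerates if
    \<open>c = b\<close>; then the two pairs share a row and one step is enough.\<close>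
  proof (cases "c = b")
    case True
    have "\<bar>H a b - H d b\<bar> \<le> e" using ab cd True by (intro Hstep) auto
    then show ?thesis using True Hsym[of d b] e0 by simp
  next
    case False
    have "\<bar>H a b - H c b\<bar> \<le> e" using ab cd False by (intro Hstep) auto
    moreover have "\<bar>H b c - H d c\<bar> \<le> e" using ab cd False by (intro Hstep) auto
    ultimately show ?thesis using Hsym[of c b] Hsym[of c d] by (simp add: abs_le_iff)
  qed
  define T where "T = (\<Sum>c<m. \<Sum>d\<in>{..<m} - {c}. H c d)"
  define mm where "mm = real m * (real m - 1)"
  have mm0: "mm > 0" using m_bounds by (simp add: mm_def)
  have cst: "(\<Sum>c<m. \<Sum>d\<in>{..<m} - {c}. z) = mm * z" for z :: real
  proof -
    have "(\<Sum>c<m. \<Sum>d\<in>{..<m} - {c}. z) = (\<Sum>c<m. (real m - 1) * z)"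
      using m_bounds by (intro sum.cong refl) (simp add: of_nat_diff)
    then show ?thesis by (simp add: mm_def)
  qed
  have "\<bar>mm * H a b - T\<bar> = \<bar>\<Sum>c<m. \<Sum>d\<in>{..<m} - {c}. H a b - H c d\<bar>"
    unfolding cst[of "H a b", symmetric] T_def by (simp add: sum_subtractf)
  also have "\<dots> \<le> (\<Sum>c<m. \<Sum>d\<in>{..<m} - {c}. \<bar>H a b - H c d\<bar>)"
    by (intro order_trans[OF sum_abs] sum_mono sum_abs)
  also have "\<dots> \<le> (\<Sum>c<m. \<Sum>d\<in>{..<m} - {c}. 2 * e)" by (intro sum_mono Hpair) auto
  finally have 1: "\<bar>mm * H a b - T\<bar> \<le> mm * (2 * e)" by (simp only: cst)
  have T: "T = (\<Sum>j<n. real (t j) * (real (t j) - 1)) - p * (2 * (real m - 1) * real k)"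
  proof -
    have "(\<Sum>c<m. \<Sum>d\<in>{..<m} - {c}. Av (\<lambda>E. real (codeg E {c, d}))) = Av (\<lambda>E. \<Sum>c<m. \<Sum>d\<in>{..<m} - {c}. real (codeg E {c, d}))"
      by (simp add: Av_sum)
    also have "\<dots> = Av (\<lambda>E. \<Sum>j<n. real (t j) * (real (t j) - 1))"
      using sum_codeg_pairs[OF in_\<Omega>(1)] in_\<Omega>(3) by (intro Av_cong) auto
    finally have A: "(\<Sum>c<m. \<Sum>d\<in>{..<m} - {c}. Av (\<lambda>E. real (codeg E {c, d}))) = (\<Sum>j<n. real (t j) * (real (t j) - 1))"
      by (simp add: Av_const)
    have ss: "(\<Sum>c<m. real (s c)) = real k" using sum_s by (metis of_nat_sum)
    have "(\<Sum>c<m. \<Sum>d\<in>{..<m} - {c}. real (s c) + real (s d)) = (\<Sum>c<m. (real m - 1) * real (s c) + (real k - real (s c)))"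
    proof (intro sum.cong refl)
      fix c assume c: "c \<in> {..<m}"
      have "(\<Sum>d\<in>{..<m} - {c}. real (s d)) = real k - real (s c)"
        unfolding ss[symmetric] using c by (simp add: sum_diff1)
      moreover have "(\<Sum>d\<in>{..<m} - {c}. real (s c)) = (real m - 1) * real (s c)"
        using c m_bounds by (simp add: of_nat_diff)
      ultimately show "(\<Sum>d\<in>{..<m} - {c}. real (s c) + real (s d)) = (real m - 1) * real (s c) + (real k - real (s c))"
        by (simp add: sum.distrib)
    qed
    also have "\<dots> = (real m - 1) * real k + (real m * real k - real k)"
      by (simp only: sum.distrib sum_subtractf ss sum_distrib_left[symmetric]) simp
    also have "\<dots> = 2 * (real m - 1) * real k" by (simp add: algebra_simps)
    finally show ?thesis unfolding T_def H_def sum_subtractf sum_distrib_left[symmetric] A by simp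
  qed
  \<comment> \<open>Completing the square: up to a term of size at most \<open>m * n\<close>, the
    total \<open>T\<close> differs from \<open>- n * p\<^sup>2 * mm\<close> by the squared deviation
    of the column degrees from \<open>m * p\<close>, at most \<open>K\<^sup>2 * n\<^sup>2\<close> by
    concentration.\<close>
  define C where "C = (\<Sum>j<n. (real (t j) - real m * p)\<^sup>2)"
  have C0: "0 \<le> C" unfolding C_def by (intro sum_nonneg) auto
  have "C \<le> (\<Sum>j<n. (K * y)\<^sup>2)"
    unfolding C_def
  proof (rule sum_mono)
    fix j assume "j \<in> {..<n}"
    then have "\<bar>real (t j) - real m * p\<bar> \<le> \<bar>K * y\<bar>" using t_bound[of j] by simp
    then show "(real (t j) - real m * p)\<^sup>2 \<le> (K * y)\<^sup>2" by (simp only: abs_le_square_iff)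
  qed
  then have C1: "C \<le> K\<^sup>2 * real n * real n" by (simp add: power_mult_distrib n_eq[symmetric] mult_ac)
  have "C = (\<Sum>j<n. real (t j) * (real (t j) - 1) + (1 - 2 * real m * p) * real (t j) + (real m * p)\<^sup>2)"
    unfolding C_def by (intro sum.cong) (auto simp: power2_eq_square algebra_simps)
  also have "\<dots> = (\<Sum>j<n. real (t j) * (real (t j) - 1)) + (1 - 2 * real m * p) * real k + real n * (real m * p)\<^sup>2"
    by (simp add: sum.distrib sum_t sum_distrib_left[symmetric])
  finally have "T + real n * p\<^sup>2 * mm = C - p * real m * real n * (1 - p)"
    unfolding T mm_def k_eq by (simp add: algebra_simps power2_eq_square)
  moreover have "0 \<le> p * real m * real n * (1 - p)" "p * real m * real n * (1 - p) \<le> real m * real n"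
  proof -
    have "p * (1 - p) \<le> 1 * 1" using p01 by (intro mult_mono) auto
    then have "(p * (1 - p)) * (real m * real n) \<le> 1 * (real m * real n)" by (intro mult_right_mono) auto
    then show "p * real m * real n * (1 - p) \<le> real m * real n" by (simp add: mult_ac)
  qed (use p01 in simp)
  ultimately have 2: "\<bar>T + real n * p\<^sup>2 * mm\<bar> \<le> K\<^sup>2 * real n * real n + real m * real n"
    using C0 C1 by (simp add: abs_le_iff)
  have "K\<^sup>2 * real n * real n \<le> K\<^sup>2 * (K * real m) * (K * real m)" using nm K by (intro mult_mono) auto
  moreover have "real m * real n \<le> real m * (K * real m)" using nm by (intro mult_left_mono) auto
  moreover have "(K ^ 4 + K) * (real m * real m) \<le> (K ^ 4 + K) * (2 * mm)"
    unfolding mm_def using m_bounds K by (intro mult_left_mono) auto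
  ultimately have "\<bar>T + real n * p\<^sup>2 * mm\<bar> \<le> mm * (2 * K ^ 4 + 2 * K)"
    using 2 by (simp add: algebra_simps eval_nat_numeral)
  then have 3: "\<bar>mm * H a b + real n * p\<^sup>2 * mm\<bar> \<le> mm * (2 * e) + mm * (2 * K ^ 4 + 2 * K)" using 1 by linarith
  have "mm * \<bar>H a b + real n * p\<^sup>2\<bar> = \<bar>mm * (H a b + real n * p\<^sup>2)\<bar>" using mm0 by (simp add: abs_mult)
  also have "mm * (H a b + real n * p\<^sup>2) = mm * H a b + real n * p\<^sup>2 * mm" by (simp add: algebra_simps)
  also note 3
  also have "mm * (2 * e) + mm * (2 * K ^ 4 + 2 * K) = mm * (2 * e + 2 * K ^ 4 + 2 * K)" by (simp add: algebra_simps)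
  finally have "mm * \<bar>H a b + real n * p\<^sup>2\<bar> \<le> mm * (2 * e + 2 * K ^ 4 + 2 * K)" .
  then have "\<bar>H a b + real n * p\<^sup>2\<bar> \<le> 2 * e + 2 * K ^ 4 + 2 * K" using mm0 by (simp add: mult_le_cancel_left_pos)
  also have "\<dots> \<le> 4 * K ^ 4"
  proof -
    have "100 * K ^ 3 \<le> K ^ 4" using K_step[of 100 3] by (simp add: eval_nat_numeral)
    moreover have "K ^ 1 \<le> K ^ 3" using K by (intro power_increasing) auto
    moreover have "0 \<le> K ^ 3" using K by simp
    ultimately show ?thesis unfolding e_def power_one_right by linarith
  qed
  finally show ?thesis unfolding H_def by (simp add: algebra_simps)
qed

text \<open>For the directed case, where the cells \<open>(a, b)\<close> and \<open>(b, a)\<close>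
  enter the numbers of movable columns. \<open>switch_identity\<close> with \<open>\<phi>\<close>
  testing \<open>l = j\<close> shows that the edge probabilities within a column are nearly equal,
  because \<open>u + v\<close> is at most 1; their total is the column degree.\<close>

lemma edge_prob:
  assumes DD: "D" and aj: "a < m" "j < n" "a \<noteq> j"
  shows "\<bar>Av (\<lambda>E. of_bool ((a, j) \<in> E)) - p\<bar> \<le> 8 * K\<^sup>2 / y"
proof -
  have mn: "m = n" using D DD by simp
  define P where "P = (\<lambda>i. Av (\<lambda>E. of_bool ((i, j) \<in> E)))"
  have k2: "0 \<le> K\<^sup>2 / y" using y_pos by simp
  have step: "\<bar>P a - P c\<bar> \<le> 6 * K\<^sup>2 / y + 1 / real n ^ 3" if c: "c < m" "c \<noteq> j" for c
  proof (cases "a = c")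
    case True
    then show ?thesis using k2 by simp
  next
    case False
    define u where "u = (\<lambda>E. \<Sum>l\<in>movable D E a c. of_bool (l = j) :: real)"
    define v where "v = (\<lambda>E. \<Sum>l\<in>movable D E c a. of_bool (l = j) :: real)"
    define al where "al = (\<lambda>E. real (card (movable D E a c)))"
    define ga where "ga = (\<lambda>E. real (card (movable D E c a)))"
    have sw: "(\<Sum>E\<in>\<Omega>. u E - v E) = (\<Sum>E\<in>\<Omega>. (al E - ga E) * ((u E + v E) / (al E + ga E)))"
      unfolding u_def v_def al_def ga_def
      by (rule switch_identity) (use aj c False in auto)
    have uE: "u E = of_bool (j \<in> movable D E a c)" "v E = of_bool (j \<in> movable D E c a)" if "E \<in> \<Omega>" for E
      unfolding u_def v_def using finite_movable[OF in_\<Omega>(1)[OF that]] by (auto simp: of_bool_def)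
    have diff: "u E - v E = of_bool ((a, j) \<in> E) - of_bool ((c, j) \<in> E)" if "E \<in> \<Omega>" for E
      unfolding uE[OF that] movable_def using aj c by auto
    have "P a - P c = Av (\<lambda>E. u E - v E)" unfolding P_def Av_diff[symmetric] using diff by (intro Av_cong) simp
    also have "\<dots> = Av (\<lambda>E. (al E - ga E) * ((u E + v E) / (al E + ga E)))" unfolding Av_def sw ..
    also have "\<bar>\<dots>\<bar> \<le> 6 * K\<^sup>2 / y + 1 / real n ^ 3"
    proof (rule Av_abs_le)
      fix E assume E: "E \<in> \<Omega>"
      have uv: "0 \<le> u E + v E" "u E + v E \<le> 1" unfolding uE[OF E] movable_def by auto
      have "al E \<ge> 0" "ga E \<ge> 0" by (auto simp: al_def ga_def)
      then have "\<bar>(al E - ga E) * ((u E + v E) / (al E + ga E))\<bar> = \<bar>al E - ga E\<bar> / (al E + ga E) * (u E + v E)"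
        using uv by (simp add: abs_mult)
      also have "\<dots> \<le> 1 * 1"
        using uv \<open>al E \<ge> 0\<close> \<open>ga E \<ge> 0\<close> by (intro mult_mono) (auto simp: divide_le_eq)
      finally show "\<bar>(al E - ga E) * ((u E + v E) / (al E + ga E))\<bar> \<le> 1" by simp
    next
      fix E assume E: "E \<in> \<Omega>" "cc E"
      have uv: "0 \<le> u E + v E" "u E + v E \<le> 1" unfolding uE[OF E(1)] movable_def by auto
      have alga: "al E + ga E \<ge> y\<^sup>2 / (2 * K)"
        using movable_lower[OF E aj(1) c(1) False] movable_lower[OF E c(1) aj(1) False[symmetric]]
        by (simp add: al_def ga_def)
      have pos: "0 < y\<^sup>2 / (2 * K)" using y_pos K by simp
      have "\<bar>(u E + v E) / (al E + ga E)\<bar> = (u E + v E) / (al E + ga E)" using uv alga pos by simp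
      also have "\<dots> \<le> 1 / (y\<^sup>2 / (2 * K))" using uv alga pos by (intro frac_le) auto
      finally have "\<bar>(al E - ga E) * ((u E + v E) / (al E + ga E))\<bar> \<le> (3 * (K * y)) * (1 / (y\<^sup>2 / (2 * K)))"
        using movable_diff_le[OF E(1) aj(1) c(1) False] by (intro abs_mult_le) (auto simp: al_def ga_def)
      also have "\<dots> = 6 * K\<^sup>2 / y" using y_pos by (simp add: power2_eq_square)
      finally show "\<bar>(al E - ga E) * ((u E + v E) / (al E + ga E))\<bar> \<le> 6 * K\<^sup>2 / y" .
    qed (use k2 in auto)
    finally show ?thesis .
  qed
  have "(\<Sum>i\<in>{..<m} - {j}. P i) = Av (\<lambda>E. \<Sum>i\<in>{..<m} - {j}. of_bool ((i, j) \<in> E))"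
    unfolding P_def by (rule Av_sum[symmetric])
  also have "\<dots> = Av (\<lambda>E. real (t j))"
  proof (rule Av_cong)
    fix E assume E: "E \<in> \<Omega>"
    have "({..<m} - {j}) \<inter> {i. (i, j) \<in> E} = {i. (i, j) \<in> E}"
      using in_\<Omega>(1)[OF E] DD by (auto simp: cells_def)
    then have "(\<Sum>i\<in>{..<m} - {j}. of_bool ((i, j) \<in> E)) = real (cdeg E j)" by (simp add: cdeg_eq)
    then show "(\<Sum>i\<in>{..<m} - {j}. of_bool ((i, j) \<in> E)) = real (t j)" using in_\<Omega>(3)[OF E] by simp
  qed
  finally have sumP: "(\<Sum>i\<in>{..<m} - {j}. P i) = real (t j)" by (simp add: Av_const)
  define m1 where "m1 = real m - 1"
  have m1: "m1 > 0" "y\<^sup>2 \<le> 2 * m1" using m_bounds n_eq mn by (auto simp: m1_def)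
  have cm: "real (card ({..<m} - {j})) = m1" using aj mn m_bounds by (simp add: m1_def of_nat_diff)
  have "\<bar>m1 * P a - real (t j)\<bar> = \<bar>\<Sum>i\<in>{..<m} - {j}. P a - P i\<bar>"
    unfolding sumP[symmetric] sum_subtractf using cm by simp
  also have "\<dots> \<le> (\<Sum>i\<in>{..<m} - {j}. \<bar>P a - P i\<bar>)" by (rule sum_abs)
  also have "\<dots> \<le> (\<Sum>i\<in>{..<m} - {j}. 6 * K\<^sup>2 / y + 1 / real n ^ 3)" using step by (intro sum_mono) auto
  also have "\<dots> = m1 * (6 * K\<^sup>2 / y + 1 / real n ^ 3)" using cm by simp
  finally have 1: "\<bar>m1 * P a - real (t j)\<bar> \<le> m1 * (6 * K\<^sup>2 / y + 1 / real n ^ 3)" .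
  have "\<bar>real (t j) - m1 * p\<bar> \<le> K * y + 1"
    using t_bound[OF aj(2)] p01 unfolding m1_def by (simp add: algebra_simps abs_le_iff)
  also have "\<dots> \<le> 2 * (K * y)" using Ky1 by simp
  also have "\<dots> \<le> m1 * (4 * K / y)"
  proof -
    have "2 * (K * y) = y\<^sup>2 * (2 * K / y)" using y_pos by (simp add: power2_eq_square)
    also have "\<dots> \<le> (2 * m1) * (2 * K / y)" using m1 K y_pos by (intro mult_right_mono) auto
    finally show ?thesis by (simp add: mult_ac)
  qed
  finally have "\<bar>m1 * P a - m1 * p\<bar> \<le> m1 * (6 * K\<^sup>2 / y + 1 / real n ^ 3) + m1 * (4 * K / y)" using 1 by linarith
  then have "m1 * \<bar>P a - p\<bar> \<le> m1 * (6 * K\<^sup>2 / y + 1 / real n ^ 3 + 4 * K / y)"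
    using m1 by (simp add: abs_mult right_diff_distrib[symmetric] distrib_left)
  then have "\<bar>P a - p\<bar> \<le> 6 * K\<^sup>2 / y + 1 / real n ^ 3 + 4 * K / y" using m1 by (simp add: mult_le_cancel_left_pos)
  also have "\<dots> \<le> 8 * K\<^sup>2 / y"
  proof -
    have "1 / real n ^ 3 \<le> 1 / y"
    proof -
      have "y ^ 1 \<le> y ^ 6" using y_pos by (intro power_increasing) auto
      moreover have "real n ^ 3 = y ^ 6" by (simp add: n_eq power_mult[symmetric])
      ultimately show ?thesis using y_pos by (intro frac_le) auto
    qed
    moreover have "1 / y + 4 * K / y \<le> 2 * K\<^sup>2 / y"
    proof -
      have "100 * K \<le> K * K" using K by (intro mult_right_mono) auto
      then have "1 + 4 * K \<le> 2 * K\<^sup>2" unfolding power2_eq_square using K by linarith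
      then have "(1 + 4 * K) / y \<le> (2 * K\<^sup>2) / y" using y_pos by (intro divide_right_mono) auto
      then show ?thesis by (simp add: add_divide_distrib)
    qed
    moreover have "6 * K\<^sup>2 / y + 2 * K\<^sup>2 / y = 8 * K\<^sup>2 / y" by (simp add: add_divide_distrib[symmetric])
    ultimately show ?thesis by linarith
  qed
  finally show ?thesis unfolding P_def .
qed

end

section \<open>Moving one edge between two rows: fibre sizes against binomial products\<close>

context dense begin

definition d :: nat where "d = n - of_bool D"

definition rprod :: "(nat \<Rightarrow> nat) \<Rightarrow> real" where "rprod s = (\<Prod>i<m. real (d choose s i))"

lemma d_n: "real d + of_bool D = real n" using n_pos by (auto simp: d_def)

text \<open>Cross-multiplied, so that the case \<open>s b = d\<close>, in which both sides vanish,
  needs no separate treatment.\<close>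

lemma rprod_move:
  assumes ab: "a < m" "b < m" "a \<noteq> b" and sa: "1 \<le> s a" "s a \<le> d" and sb: "s b \<le> d"
  shows "rprod (s(a := s a - 1, b := s b + 1)) * ((real (s b) + 1) * (real d + 1 - real (s a))) =
    rprod s * (real (s a) * (real d - real (s b)))"
proof -
  let ?s' = "s(a := s a - 1, b := s b + 1)"
  have split: "rprod r = real (d choose r a) * real (d choose r b) * (\<Prod>i\<in>{..<m} - {a} - {b}. real (d choose r i))" for r
    unfolding rprod_def using ab by (subst prod.remove[of _ a]; (simp)?) (subst prod.remove[of _ b], auto)
  have rest: "(\<Prod>i\<in>{..<m} - {a} - {b}. real (d choose ?s' i)) = (\<Prod>i\<in>{..<m} - {a} - {b}. real (d choose s i))"
    by (intro prod.cong) auto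
  have ch: "real (Suc j) * real (d choose Suc j) = (real d - real j) * real (d choose j)" if "j \<le> d" for j
  proof -
    have "Suc j * (d choose Suc j) = (d - j) * (d choose j)"
      by (metis binomial_absorb_comp binomial_absorption diff_Suc_1 Suc_pred mult.commute neq0_conv that binomial_eq_0 le_neq_implies_less lessI mult_0_right zero_less_diff diff_self_eq_0 mult_is_0)
    then have "real (Suc j) * real (d choose Suc j) = real (d - j) * real (d choose j)" by (metis of_nat_mult)
    then show ?thesis using that by (simp add: of_nat_diff)
  qed
  obtain i where i: "s a = Suc i" using sa by (cases "s a") auto
  have 1: "real (s a) * real (d choose s a) = (real d + 1 - real (s a)) * real (d choose (s a - 1))"
    using ch[of i] sa i by simp
  have 2: "(real (s b) + 1) * real (d choose (s b + 1)) = (real d - real (s b)) * real (d choose s b)"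
    using ch[of "s b"] sb by (simp add: add.commute)
  have "rprod ?s' * ((real (s b) + 1) * (real d + 1 - real (s a))) =
     ((real d + 1 - real (s a)) * real (d choose (s a - 1))) * ((real (s b) + 1) * real (d choose (s b + 1))) *
     (\<Prod>i\<in>{..<m} - {a} - {b}. real (d choose s i))"
    unfolding split rest using ab by simp
  also have "\<dots> = rprod s * (real (s a) * (real d - real (s b)))"
    unfolding 1[symmetric] 2 split[of s] by simp
  finally show ?thesis .
qed

end

context good_fibre begin

lemma s_le_d: "s a \<le> d" if "a < m"
proof -
  obtain E where "E \<in> \<Omega>" using nonempty by blast
  then have E: "E \<subseteq> W" "rdeg E = s" using in_\<Omega> by auto
  have "{j. (a, j) \<in> E} \<subseteq> {..<n} - (if D then {a} else {})" using E(1) by (auto simp: cells_def)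
  then have "card {j. (a, j) \<in> E} \<le> card ({..<n} - (if D then {a} else {}))" by (intro card_mono) auto
  also have "\<dots> = d" using that D by (auto simp: d_def card_Diff_subset)
  finally show ?thesis using E(2) by (auto simp: rdeg_eq)
qed

context
  fixes a b :: nat
  assumes ab: "a < m" "b < m" "a \<noteq> b"
begin

text \<open>By \<open>move_identity\<close> the ratio of the fibre sizes after and before a move is
  essentially the average of \<open>al / G\<close>, where \<open>al = G + dl - be\<close>; the
  \<open>+ 1\<close> in \<open>G\<close> is the one found there. \<open>Gs\<close> is chosen so that
  the binomial products have ratio exactly \<open>1 + dl / Gs\<close>. Comparing the models thus
  means showing that \<open>G\<close> averages to about \<open>Gs\<close> and \<open>be\<close>, the
  effect of the forbidden diagonal, to about zero.\<close>

definition Gs :: real where "Gs = (real (s b) + 1) * (real d + 1 - real (s a)) / (real d + 1)"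
definition dl :: real where "dl = real (s a) - real (s b) - 1"
definition al :: "(nat \<times> nat) set \<Rightarrow> real" where "al E = real (card (movable D E a b))"
definition G :: "(nat \<times> nat) set \<Rightarrow> real" where "G E = real (card (movable D E b a)) + 1"
definition be :: "(nat \<times> nat) set \<Rightarrow> real" where "be E = of_bool (D \<and> (a, b) \<in> E) - of_bool (D \<and> (b, a) \<in> E)"

lemma dl_bound: "\<bar>dl\<bar> \<le> 3 * (K * y)"
  unfolding dl_def using s_diff[OF ab(1,2)] Ky1 by (simp add: abs_le_iff)

text \<open>The codegree predicted by independence and the linear expression of
  \<open>codeg_avg\<close> differ essentially by the product of the deviations of \<open>s a\<close>
  and \<open>s b\<close> from \<open>n * p\<close>, divided by \<open>n\<close>, which is at most
  \<open>K\<^sup>2\<close>. The number \<open>\<iota>\<close> reconciles \<open>d + 1\<close> with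
  \<open>n\<close>: they agree in the directed case and differ by 1 otherwise.\<close>

lemma base_diff:
  "\<bar>(real (s b) + 1) * real (s a) / (real d + 1) - (p * (real (s a) + real (s b)) - real n * p\<^sup>2)\<bar> \<le> K\<^sup>2 + 4"
proof -
  define sa sb where "sa = real (s a)" and "sb = real (s b)"
  define Q where "Q = p * (sa + sb) - real n * p\<^sup>2"
  define \<iota> :: real where "\<iota> = 1 - of_bool D"
  have d1: "real d + 1 = real n + \<iota>" using d_n unfolding \<iota>_def by linarith
  have i01: "0 \<le> \<iota>" "\<iota> \<le> 1" by (auto simp: \<iota>_def)
  have "(sb + 1) * sa - (real n + \<iota>) * Q = (sa - real n * p) * (sb - real n * p) + sa - \<iota> * Q"
    unfolding Q_def by (simp add: algebra_simps power2_eq_square)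
  moreover have "\<bar>(sa - real n * p) * (sb - real n * p)\<bar> \<le> (K * y) * (K * y)"
    using s_bound[OF ab(1)] s_bound[OF ab(2)] by (intro abs_mult_le) (auto simp: sa_def sb_def)
  moreover have san: "0 \<le> sa" "sa \<le> real n" "0 \<le> sb" "sb \<le> real n" using s_le by (auto simp: sa_def sb_def)
  moreover have "\<bar>\<iota> * Q\<bar> \<le> 1 * (3 * real n)"
  proof (rule abs_mult_le)
    have "\<bar>p * (sa + sb)\<bar> \<le> 1 * (2 * real n)" using p01 san by (intro abs_mult_le) auto
    moreover have "\<bar>real n * p\<^sup>2\<bar> \<le> real n * 1" using p01 by (intro abs_mult_le) (auto simp: power_le_one)
    ultimately show "\<bar>Q\<bar> \<le> 3 * real n" unfolding Q_def by (simp only: abs_le_iff) linarith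
  qed (use i01 in auto)
  ultimately have "\<bar>(sb + 1) * sa - (real n + \<iota>) * Q\<bar> \<le> (K * y) * (K * y) + 4 * real n"
    by (simp only: abs_le_iff) linarith
  also have "\<dots> = (K\<^sup>2 + 4) * real n" unfolding n_eq by (simp add: power2_eq_square algebra_simps)
  also have "\<dots> \<le> (K\<^sup>2 + 4) * (real n + \<iota>)" using i01 by (intro mult_left_mono) auto
  finally have le: "\<bar>(sb + 1) * sa - (real n + \<iota>) * Q\<bar> \<le> (K\<^sup>2 + 4) * (real n + \<iota>)" .
  have pos: "real n + \<iota> > 0" using n_pos i01 by linarith
  have "(sb + 1) * sa / (real n + \<iota>) - Q = ((sb + 1) * sa - (real n + \<iota>) * Q) / (real n + \<iota>)"
    using pos by (simp add: field_simps)
  also have "\<bar>\<dots>\<bar> \<le> K\<^sup>2 + 4" using le pos by (simp add: divide_le_eq)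
  finally show ?thesis unfolding d1 Q_def sa_def sb_def .
qed

lemma Gs_eq: "Gs = real (s b) + 1 - (real (s b) + 1) * real (s a) / (real d + 1)"
proof -
  have "real d + 1 > 0" by linarith
  then show ?thesis unfolding Gs_def by (simp add: field_simps)
qed

lemma G_eq: "E \<in> \<Omega> \<Longrightarrow> G E = real (s b) + 1 - real (codeg E {a, b}) - of_bool (D \<and> (b, a) \<in> E)"
  unfolding G_def using movable_eq[of E b a] ab by (simp add: insert_commute)

lemma al_eq: "E \<in> \<Omega> \<Longrightarrow> al E = G E + dl - be E"
  unfolding al_def G_def dl_def be_def using movable_eq[of E b a] movable_eq[of E a b] ab by (simp add: insert_commute)

lemma K_facts: "K\<^sup>2 + 5 \<le> K ^ 4" "K\<^sup>2 + 5 \<le> K * y"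
proof -
  have 1: "100 * 100 \<le> K * K" using K by (intro mult_mono) auto
  have "2 * (K * K) \<le> (K * K) * (K * K)" using 1 by (intro mult_right_mono) auto
  then have "2 * K\<^sup>2 \<le> K ^ 4" by (simp add: eval_nat_numeral mult_ac)
  then show A: "K\<^sup>2 + 5 \<le> K ^ 4" using 1 by (simp add: power2_eq_square)
  have "K ^ 4 \<le> y" by (rule K_pow_le_y) simp
  also have "1 * y \<le> K * y" using K y_pos by (intro mult_right_mono) auto
  finally show "K\<^sup>2 + 5 \<le> K * y" using A by linarith
qed

lemma G_avg: "\<bar>Av G - Gs\<bar> \<le> 5 * K ^ 4"
proof -
  have "Av G = Av (\<lambda>E. real (s b) + 1 - real (codeg E {a, b}) - of_bool (D \<and> (b, a) \<in> E))"
    using G_eq by (rule Av_cong)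
  also have "\<dots> = real (s b) + 1 - Av (\<lambda>E. real (codeg E {a, b})) - Av (\<lambda>E. of_bool (D \<and> (b, a) \<in> E))"
    unfolding Av_diff Av_const ..
  finally have A: "Av G = real (s b) + 1 - Av (\<lambda>E. real (codeg E {a, b})) - Av (\<lambda>E. of_bool (D \<and> (b, a) \<in> E))" .
  have "\<bar>Av (\<lambda>E. of_bool (D \<and> (b, a) \<in> E))\<bar> \<le> 1"
  proof -
    have "\<bar>\<Sum>E\<in>\<Omega>. of_bool (D \<and> (b, a) \<in> E) :: real\<bar> \<le> (\<Sum>E\<in>\<Omega>. \<bar>of_bool (D \<and> (b, a) \<in> E) :: real\<bar>)" by (rule sum_abs)
    also have "\<dots> \<le> (\<Sum>E\<in>\<Omega>. 1)" by (intro sum_mono) auto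
    finally show ?thesis unfolding Av_def using card_pos by (simp add: divide_le_eq)
  qed
  then show ?thesis using codeg_avg[OF ab] base_diff K_facts(1) unfolding A Gs_eq by (simp only: abs_le_iff) linarith
qed

lemma G_conc:
  assumes E: "E \<in> \<Omega>" "cc E"
  shows "\<bar>G E - Gs\<bar> \<le> 4 * (K * y)" "y\<^sup>2 / (4 * K) \<le> G E"
proof -
  have 1: "\<bar>p * (real (s a) - real n * p) + p * (real (s b) - real n * p)\<bar> \<le> 1 * (K * y) + 1 * (K * y)"
    using abs_mult_le[of p 1 _ "K * y", OF _ s_bound[OF ab(1)]] abs_mult_le[of p 1 _ "K * y", OF _ s_bound[OF ab(2)]] p01
    by (simp add: abs_le_iff)
  have eq: "p * (real (s a) - real n * p) + p * (real (s b) - real n * p) = (p * (real (s a) + real (s b)) - real n * p\<^sup>2) - real n * p\<^sup>2"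
    by (simp add: algebra_simps power2_eq_square)
  have "0 \<le> (of_bool (D \<and> (b, a) \<in> E) :: real)" "of_bool (D \<and> (b, a) \<in> E) \<le> (1 :: real)" by auto
  then show "\<bar>G E - Gs\<bar> \<le> 4 * (K * y)"
    using 1 cc_pair[OF E(2) ab] base_diff K_facts(2) unfolding eq G_eq[OF E(1)] Gs_eq by linarith
  show "y\<^sup>2 / (4 * K) \<le> G E" unfolding G_def using movable_lower[OF E ab(2,1) ab(3)[symmetric]] by simp
qed

lemma Gs_bounds: "y\<^sup>2 / (4 * K) \<le> Gs" "Gs \<le> real n + 1"
proof -
  obtain E where E: "E \<in> \<Omega>" "cc E" using ex_conc by blast
  have "7 * (K * y) \<le> y\<^sup>2 / (4 * K)" by (rule Ky_le) simp
  moreover have "y\<^sup>2 / (2 * K) = y\<^sup>2 / (4 * K) + y\<^sup>2 / (4 * K)" by simp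
  moreover have "\<bar>G E - 1 - (real n * p - real n * p\<^sup>2)\<bar> \<le> 2 * (K * y) + 1"
    using movable_conc[OF E ab(2,1) ab(3)[symmetric]] by (simp add: G_def)
  ultimately show "y\<^sup>2 / (4 * K) \<le> Gs" using G_conc(1)[OF E] npq Ky1 by (simp only: abs_le_iff) linarith
  have "0 \<le> (real (s b) + 1) * real (s a) / (real d + 1)" by (intro divide_nonneg_nonneg) auto
  moreover have "real (s b) \<le> real n" using s_le by simp
  ultimately show "Gs \<le> real n + 1" unfolding Gs_eq by linarith
qed

lemma Gs_pos: "Gs > 0"
proof -
  have "0 < y\<^sup>2 / (4 * K)" using y_pos K by simp
  then show ?thesis using Gs_bounds(1) by linarith
qed

lemma inv_Gs: "1 / Gs \<le> 4 * K / y\<^sup>2"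
proof -
  have "1 / Gs \<le> 1 / (y\<^sup>2 / (4 * K))" using Gs_bounds Gs_pos y_pos K by (intro frac_le) auto
  then show ?thesis by simp
qed

lemma be_avg: "\<bar>Av be\<bar> \<le> 16 * K\<^sup>2 / y"
proof (cases D)
  case True
  then have mn: "m = n" by (rule D)
  have "Av be = Av (\<lambda>E. of_bool ((a, b) \<in> E)) - Av (\<lambda>E. of_bool ((b, a) \<in> E))"
    unfolding be_def Av_diff using True by simp
  moreover have "8 * K\<^sup>2 / y + 8 * K\<^sup>2 / y = 16 * K\<^sup>2 / y" by simp
  moreover have "\<bar>Av (\<lambda>E. of_bool ((a, b) \<in> E)) - p\<bar> \<le> 8 * K\<^sup>2 / y"
    by (rule edge_prob[OF True ab(1) _ ab(3)]) (use ab mn in simp)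
  moreover have "\<bar>Av (\<lambda>E. of_bool ((b, a) \<in> E)) - p\<bar> \<le> 8 * K\<^sup>2 / y"
    by (rule edge_prob[OF True ab(2) _ ab(3)[symmetric]]) (use ab mn in simp)
  ultimately show ?thesis by linarith
next
  case False
  have "Av be = Av (\<lambda>E. 0)"
  proof (rule Av_cong)
    show "be E = 0" for E unfolding be_def using False by simp
  qed
  then show ?thesis using y_pos Av_const[of 0] by simp
qed

text \<open>\<open>1 / G\<close> is expanded about \<open>Gs\<close> to second order. The linear
  term is small enough only on average, where \<open>G_avg\<close> replaces a fluctuation
  \<open>K * y\<close> by a power of \<open>K\<close>; the quadratic term is small pointwise. Both
  carry the factor \<open>dl\<close>, at most \<open>3 * K * y\<close>, and \<open>1 / Gs\<close> is
  at most \<open>4 * K / y\<^sup>2\<close>, so every error is a power of \<open>K\<close> over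
  \<open>y ^ 3\<close>. A pointwise estimate of the linear term would leave only
  \<open>y\<^sup>2\<close> in the denominator.\<close>

lemma ratio_avg: "\<bar>Av (\<lambda>E. al E / G E) - (1 + dl / Gs)\<bar> \<le> 3 * K ^ 8 / y ^ 3"
proof -
  define g2 where "g2 = (\<lambda>E. dl * ((Gs - G E)\<^sup>2 / (G E * Gs\<^sup>2)) - be E * (1 / G E - 1 / Gs))"
  have G1: "G E \<ge> 1" for E by (simp add: G_def)
  have dec: "al E / G E = 1 + dl / Gs + (dl / Gs\<^sup>2) * (Gs - G E) - (1 / Gs) * be E + g2 E" if "E \<in> \<Omega>" for E
  proof -
    have Gp: "G E > 0" using G1[of E] by linarith
    have "al E / G E = 1 + dl * (1 / G E) - be E * (1 / G E)"
      unfolding al_eq[OF that] using Gp by (simp add: field_simps)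
    moreover have "1 / G E = 1 / Gs + (Gs - G E) / Gs\<^sup>2 + (Gs - G E)\<^sup>2 / (G E * Gs\<^sup>2)"
      using Gp Gs_pos by (simp add: field_simps power2_eq_square)
    then have "dl * (1 / G E) = dl / Gs + (dl / Gs\<^sup>2) * (Gs - G E) + dl * ((Gs - G E)\<^sup>2 / (G E * Gs\<^sup>2))"
      by (simp only: distrib_left) simp
    ultimately show ?thesis unfolding g2_def by (simp add: algebra_simps)
  qed
  have "Av (\<lambda>E. al E / G E) = Av (\<lambda>E. 1 + dl / Gs + (dl / Gs\<^sup>2) * (Gs - G E) - (1 / Gs) * be E + g2 E)"
    using dec by (rule Av_cong)
  also have "\<dots> = 1 + dl / Gs + (dl / Gs\<^sup>2) * (Gs - Av G) - (1 / Gs) * Av be + Av g2"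
    by (simp only: Av_add Av_diff Av_cmult Av_const)
  finally have A: "Av (\<lambda>E. al E / G E) - (1 + dl / Gs) = (dl / Gs\<^sup>2) * (Gs - Av G) - (1 / Gs) * Av be + Av g2" by simp
  have iG: "0 \<le> 1 / Gs" "\<bar>1 / Gs\<bar> \<le> 4 * K / y\<^sup>2" using Gs_pos inv_Gs by auto
  have iG2: "0 \<le> 1 / Gs\<^sup>2" "1 / Gs\<^sup>2 \<le> 16 * K\<^sup>2 / y ^ 4"
  proof -
    have "(1 / Gs) * (1 / Gs) \<le> (4 * K / y\<^sup>2) * (4 * K / y\<^sup>2)" using inv_Gs iG K y_pos by (intro mult_mono) auto
    then show "1 / Gs\<^sup>2 \<le> 16 * K\<^sup>2 / y ^ 4" by (simp add: power2_eq_square eval_nat_numeral mult_ac)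
  qed simp
  have y3: "y ^ 3 > 0" using y_pos by simp
  have t1: "\<bar>(dl / Gs\<^sup>2) * (Gs - Av G)\<bar> \<le> 240 * K ^ 7 / y ^ 3"
  proof -
    have "\<bar>dl * (1 / Gs\<^sup>2)\<bar> \<le> (3 * (K * y)) * (16 * K\<^sup>2 / y ^ 4)" using dl_bound iG2 by (intro abs_mult_le) auto
    then have "\<bar>(dl * (1 / Gs\<^sup>2)) * (Gs - Av G)\<bar> \<le> ((3 * (K * y)) * (16 * K\<^sup>2 / y ^ 4)) * (5 * K ^ 4)"
      by (rule abs_mult_le) (use G_avg in \<open>simp add: abs_minus_commute\<close>)
    also have "\<dots> = 240 * K ^ 7 / y ^ 3" using y_pos by (simp add: eval_nat_numeral field_simps)
    finally show ?thesis by simp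
  qed
  have t2: "\<bar>(1 / Gs) * Av be\<bar> \<le> 64 * K ^ 3 / y ^ 3"
  proof -
    have "\<bar>(1 / Gs) * Av be\<bar> \<le> (4 * K / y\<^sup>2) * (16 * K\<^sup>2 / y)" using be_avg iG by (intro abs_mult_le) auto
    also have "\<dots> = 64 * K ^ 3 / y ^ 3" using y_pos by (simp add: eval_nat_numeral field_simps)
    finally show ?thesis .
  qed
  have be1: "\<bar>be E\<bar> \<le> 1" for E by (auto simp: be_def)
  \<comment> \<open>The second summand comes from unconcentrated graphs, for which only
    \<open>G \<ge> 1\<close> is used as a lower bound.\<close>
  have "\<bar>Av g2\<bar> \<le> (3072 * K ^ 6 + 64 * K ^ 3) / y ^ 3 + (2000 * K ^ 3 * y) / real n ^ 3"
  proof (rule Av_abs_le)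
    fix E assume E: "E \<in> \<Omega>" "cc E"
    have iE: "0 \<le> 1 / G E" "1 / G E \<le> 4 * K / y\<^sup>2"
    proof -
      have "1 / G E \<le> 1 / (y\<^sup>2 / (4 * K))" using G_conc[OF E] y_pos K G1[of E] by (intro frac_le) auto
      then show "1 / G E \<le> 4 * K / y\<^sup>2" by simp
    qed (use G1[of E] in simp)
    have sq: "(Gs - G E)\<^sup>2 \<le> 16 * K\<^sup>2 * y\<^sup>2"
    proof -
      have "(Gs - G E)\<^sup>2 = \<bar>G E - Gs\<bar>\<^sup>2" by (simp add: power2_commute)
      also have "\<dots> \<le> (4 * (K * y))\<^sup>2" using G_conc[OF E] by (intro power_mono) auto
      finally show ?thesis by (simp add: power_mult_distrib)
    qed
    have "\<bar>(Gs - G E)\<^sup>2 / (G E * Gs\<^sup>2)\<bar> = (Gs - G E)\<^sup>2 * ((1 / G E) * (1 / Gs\<^sup>2))" using G1[of E] by simp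
    also have "\<dots> \<le> (16 * K\<^sup>2 * y\<^sup>2) * ((4 * K / y\<^sup>2) * (16 * K\<^sup>2 / y ^ 4))"
      using sq iE iG2 K y_pos by (intro mult_mono) auto
    also have "\<dots> = 1024 * K ^ 5 / y ^ 4" using y_pos by (simp add: eval_nat_numeral field_simps)
    finally have "\<bar>dl * ((Gs - G E)\<^sup>2 / (G E * Gs\<^sup>2))\<bar> \<le> (3 * (K * y)) * (1024 * K ^ 5 / y ^ 4)"
      using dl_bound by (intro abs_mult_le) auto
    also have "\<dots> = 3072 * K ^ 6 / y ^ 3" using y_pos by (simp add: eval_nat_numeral field_simps)
    finally have 1: "\<bar>dl * ((Gs - G E)\<^sup>2 / (G E * Gs\<^sup>2))\<bar> \<le> 3072 * K ^ 6 / y ^ 3" .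
    have "1 / G E - 1 / Gs = (Gs - G E) * ((1 / G E) * (1 / Gs))"
      using G1[of E] Gs_pos by (simp add: field_simps)
    also have "\<bar>\<dots>\<bar> \<le> (4 * (K * y)) * ((4 * K / y\<^sup>2) * (4 * K / y\<^sup>2))"
      using G_conc[OF E] iE iG by (intro abs_mult_le) (auto simp: abs_minus_commute)
    also have "\<dots> = 64 * K ^ 3 / y ^ 3" using y_pos by (simp add: eval_nat_numeral field_simps)
    finally have "\<bar>1 / G E - 1 / Gs\<bar> \<le> 64 * K ^ 3 / y ^ 3" .
    then have "\<bar>be E * (1 / G E - 1 / Gs)\<bar> \<le> 1 * (64 * K ^ 3 / y ^ 3)" using be1 by (intro abs_mult_le)
    then show "\<bar>g2 E\<bar> \<le> (3072 * K ^ 6 + 64 * K ^ 3) / y ^ 3" using 1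
      unfolding g2_def add_divide_distrib by (simp only: abs_le_iff) linarith
  next
    fix E assume E: "E \<in> \<Omega>"
    have n1: "1 \<le> real n" using n_pos by simp
    have Gn: "1 \<le> G E" "G E \<le> real n + 1" using G1 movable_le[OF E, of b a] by (auto simp: G_def)
    have "\<bar>Gs - G E\<bar> \<le> 2 * real n" using Gn Gs_pos Gs_bounds(2) n1 by (simp only: abs_le_iff) linarith
    then have "\<bar>Gs - G E\<bar>\<^sup>2 \<le> (2 * real n)\<^sup>2" by (intro power_mono) auto
    then have sq: "(Gs - G E)\<^sup>2 \<le> 4 * y ^ 4" by (simp add: n_eq power_mult_distrib flip: power_mult)
    have "\<bar>(Gs - G E)\<^sup>2 / (G E * Gs\<^sup>2)\<bar> = (Gs - G E)\<^sup>2 * ((1 / G E) * (1 / Gs\<^sup>2))" using Gn by simp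
    also have "\<dots> \<le> (4 * y ^ 4) * (1 * (16 * K\<^sup>2 / y ^ 4))"
      using sq iG2 K y_pos Gn by (intro mult_mono) (auto simp: divide_le_eq)
    also have "\<dots> = 64 * K\<^sup>2" using y_pos by simp
    finally have "\<bar>dl * ((Gs - G E)\<^sup>2 / (G E * Gs\<^sup>2))\<bar> \<le> (3 * (K * y)) * (64 * K\<^sup>2)"
      using dl_bound by (intro abs_mult_le) auto
    also have "\<dots> = 192 * (K ^ 3 * y)" by (simp add: eval_nat_numeral)
    finally have 1: "\<bar>dl * ((Gs - G E)\<^sup>2 / (G E * Gs\<^sup>2))\<bar> \<le> 192 * (K ^ 3 * y)" .
    have Ky3: "1 \<le> K ^ 3 * y" using mult_mono[of 1 "K ^ 3" 1 y] one_le_power[of K 3] K y_pos by simp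
    have "1 / G E \<le> 1" "0 \<le> 1 / G E" using Gn by auto
    moreover have "4 * K / y\<^sup>2 \<le> 1"
    proof -
      have "4 * K ^ 1 \<le> y" by (rule cK_le_y) auto
      also have "y \<le> y\<^sup>2" using y_pos by (simp add: power2_eq_square)
      finally show ?thesis using y_pos by (simp add: divide_le_eq)
    qed
    ultimately have "\<bar>1 / G E - 1 / Gs\<bar> \<le> 1" using iG inv_Gs by (simp only: abs_le_iff) linarith
    then have "\<bar>be E * (1 / G E - 1 / Gs)\<bar> \<le> 1 * 1" using be1 by (intro abs_mult_le)
    then show "\<bar>g2 E\<bar> \<le> 2000 * K ^ 3 * y" using 1 Ky3 unfolding g2_def by (simp only: abs_le_iff mult.assoc) linarith
  qed (use K y_pos in auto)
  also have "(2000 * K ^ 3 * y) / real n ^ 3 \<le> K ^ 6 / y ^ 3"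
  proof -
    have "real n ^ 3 = y ^ 3 * y ^ 3" by (simp add: n_eq flip: power_mult power_add)
    then have "(2000 * K ^ 3 * y) / real n ^ 3 = (2000 * K ^ 3 / y\<^sup>2) / y ^ 3"
      using y_pos by (simp add: eval_nat_numeral)
    also have "\<dots> \<le> K ^ 6 / y ^ 3"
    proof (rule divide_right_mono)
      have "K ^ 3 \<ge> 100 ^ 3" using K by (intro power_mono) auto
      then have "2000 \<le> K ^ 3" by simp
      then have "2000 * K ^ 3 \<le> K ^ 3 * K ^ 3" using K by (intro mult_right_mono) auto
      then have "2000 * K ^ 3 \<le> K ^ 6" by (simp flip: power_add)
      moreover have "2000 * K ^ 3 / y\<^sup>2 \<le> 2000 * K ^ 3 / 1" using y_pos K by (intro divide_left_mono) auto
      ultimately show "2000 * K ^ 3 / y\<^sup>2 \<le> K ^ 6" by simp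
    qed (use y_pos in auto)
    finally show ?thesis .
  qed
  finally have t3: "\<bar>Av g2\<bar> \<le> (3072 * K ^ 6 + 64 * K ^ 3) / y ^ 3 + K ^ 6 / y ^ 3" by (simp only: add_le_cancel_left)
  have "\<bar>Av (\<lambda>E. al E / G E) - (1 + dl / Gs)\<bar> \<le>
     240 * K ^ 7 / y ^ 3 + 64 * K ^ 3 / y ^ 3 + ((3072 * K ^ 6 + 64 * K ^ 3) / y ^ 3 + K ^ 6 / y ^ 3)"
    unfolding A using t1 t2 t3 by (simp only: abs_le_iff) linarith
  also have "\<dots> = (240 * K ^ 7 + 128 * K ^ 3 + 3073 * K ^ 6) / y ^ 3" by (simp add: add_divide_distrib)
  also have "\<dots> \<le> 3 * K ^ 8 / y ^ 3"
  proof (rule divide_right_mono)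
    have "100 * K ^ 7 \<le> K ^ 8" "100 * K ^ 6 \<le> K ^ 7" using K_step[of 100 7] K_step[of 100 6] by (simp_all add: eval_nat_numeral)
    moreover have "K ^ 3 \<le> K ^ 6" using K by (intro power_increasing) auto
    moreover have "0 \<le> K ^ 6" using K by simp
    ultimately show "240 * K ^ 7 + 128 * K ^ 3 + 3073 * K ^ 6 \<le> 3 * K ^ 8" by linarith
  qed (use y_pos in auto)
  finally show ?thesis .
qed

lemma dl_Gs_small: "\<bar>dl / Gs\<bar> \<le> 1 / 4"
proof -
  have "\<bar>dl * (1 / Gs)\<bar> \<le> (3 * (K * y)) * (4 * K / y\<^sup>2)"
    using dl_bound inv_Gs Gs_pos by (intro abs_mult_le) auto
  also have "\<dots> = 12 * K\<^sup>2 / y" using y_pos by (simp add: power2_eq_square)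
  also have "\<dots> \<le> 1 / 4" using cK_le_y[of 48 2] y_pos by (simp add: divide_le_eq)
  finally show ?thesis by simp
qed

lemma rprod_ratio:
  assumes "1 \<le> s a"
  shows "rprod (s(a := s a - 1, b := s b + 1)) = rprod s * (1 + dl / Gs)"
proof -
  define z where "z = (real (s b) + 1) * (real d + 1 - real (s a))"
  have sd: "s a \<le> d" "s b \<le> d" using s_le_d ab by auto
  have z: "z > 0" unfolding z_def using sd by (intro mult_pos_pos) auto
  have d1: "real d + 1 > 0" by linarith
  have "rprod (s(a := s a - 1, b := s b + 1)) * z = rprod s * (real (s a) * (real d - real (s b)))"
    unfolding z_def by (rule rprod_move[OF ab assms sd])
  also have "real (s a) * (real d - real (s b)) = z * (1 + dl / Gs)"
  proof -
    have "z * (dl / Gs) = dl * (real d + 1)" unfolding Gs_def z_def[symmetric] using z d1 by simp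
    then have "z * (1 + dl / Gs) = z + dl * (real d + 1)" by (simp add: distrib_left)
    also have "\<dots> = real (s a) * (real d - real (s b))" unfolding z_def dl_def by (simp add: algebra_simps)
    finally show ?thesis by simp
  qed
  finally have "rprod (s(a := s a - 1, b := s b + 1)) * z = (rprod s * (1 + dl / Gs)) * z" by (simp only: mult_ac)
  then show ?thesis using z by (metis mult_right_cancel order_less_irrefl)
qed

lemma rprod_pos: "rprod s > 0"
  unfolding rprod_def using s_le_d by (intro prod_pos) auto

lemma err_small: "3 * K ^ 8 / y ^ 3 \<le> 1 / 100" "real n ^ 3 \<ge> y ^ 3" "y ^ 3 > 0"
proof -
  have "300 * K ^ 8 \<le> y"
  proof -
    have "300 * K ^ 8 \<le> (100 * 100) * K ^ 8" using K by (intro mult_right_mono) auto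
    also have "\<dots> = 100 * (100 * K ^ 8)" by simp
    also have "\<dots> \<le> 100 * K ^ 9" using K_step[of 100 8] by (intro mult_left_mono) (auto simp: eval_nat_numeral)
    also have "\<dots> \<le> y" by (rule cK_le_y) auto
    finally show ?thesis .
  qed
  also have "y \<le> y ^ 3" using power_increasing[of 1 3 y] y_pos by simp
  finally show "3 * K ^ 8 / y ^ 3 \<le> 1 / 100" using y_pos by (simp add: divide_le_eq)
  have "real n ^ 3 = y ^ 6" by (simp add: n_eq flip: power_mult)
  then show "real n ^ 3 \<ge> y ^ 3" using y_pos by (simp add: power_increasing)
qed (use y_pos in simp)

lemma move_count:
  assumes "1 \<le> s a"
  shows "Av (\<lambda>E. al E / G E) * real (card \<Omega>) =
     real (card {E \<in> deg_fibre D m n (s(a := s a - 1, b := s b + 1), t). movable D E b a \<noteq> {}})"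
  using move_identity[OF ab(3,1,2), of s D n t] assms card_pos nonempty unfolding Av_def al_def G_def by simp

text \<open>Images with a backward move are at most all graphs of the new fibre, so goodness of the
  old fibre alone gives this one-sided bound. It is what controls swaps from a good to a bad
  set.\<close>

lemma crude_ratio:
  assumes "1 \<le> s a"
  defines "s' \<equiv> s(a := s a - 1, b := s b + 1)"
  shows "real (card \<Omega>) / rprod s \<le> 4 * (real (card (deg_fibre D m n (s', t))) / rprod s')"
proof -
  have "card {E \<in> deg_fibre D m n (s', t). movable D E b a \<noteq> {}} \<le> card (deg_fibre D m n (s', t))"
    by (intro card_mono) auto
  then have "Av (\<lambda>E. al E / G E) * real (card \<Omega>) \<le> real (card (deg_fibre D m n (s', t)))"
    unfolding move_count[OF assms(1)] s'_def by simp
  moreover have "1 / 2 \<le> Av (\<lambda>E. al E / G E)" using ratio_avg dl_Gs_small err_small(1) by (simp only: abs_le_iff) linarith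
  then have "(1 / 2) * real (card \<Omega>) \<le> Av (\<lambda>E. al E / G E) * real (card \<Omega>)" by (intro mult_right_mono) auto
  ultimately have 1: "real (card \<Omega>) \<le> 2 * real (card (deg_fibre D m n (s', t)))" by linarith
  have r: "rprod s' = rprod s * (1 + dl / Gs)" unfolding s'_def by (rule rprod_ratio[OF assms(1)])
  have R: "0 < 1 + dl / Gs" "1 + dl / Gs \<le> 2" using dl_Gs_small by (auto simp only: abs_le_iff)
  have "real (card \<Omega>) * (1 + dl / Gs) \<le> (2 * real (card (deg_fibre D m n (s', t)))) * 2"
    using 1 R by (intro mult_mono) auto
  then have "real (card \<Omega>) \<le> 4 * (real (card (deg_fibre D m n (s', t))) / (1 + dl / Gs))"
    using R by (simp add: field_simps)
  then have "real (card \<Omega>) / rprod s \<le> (4 * (real (card (deg_fibre D m n (s', t))) / (1 + dl / Gs))) / rprod s"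
    using rprod_pos by (intro divide_right_mono) auto
  then show ?thesis unfolding r by (simp add: mult.commute)
qed

text \<open>If the new fibre is good as well, its graphs without a backward move are unconcentrated
  and make up a share of at most \<open>1 / y ^ 3\<close>; \<open>move_count\<close> then becomes a
  two-sided estimate.\<close>

lemma fine_ratio:
  assumes "1 \<le> s a"
  defines "s' \<equiv> s(a := s a - 1, b := s b + 1)"
  assumes good': "good_fibre D m n k K s' t"
  shows "\<bar>(real (card (deg_fibre D m n (s', t))) / rprod s') / (real (card \<Omega>) / rprod s) - 1\<bar> \<le> 6 * K ^ 8 / y ^ 3"
proof -
  interpret g': good_fibre D m n k K s' t by (rule good')
  let ?O' = "deg_fibre D m n (s', t)"
  define \<rho> where "\<rho> = Av (\<lambda>E. al E / G E)"
  define q where "q = real (card ?O') / real (card \<Omega>)"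
  define R where "R = 1 + dl / Gs"
  have "movable D E b a \<noteq> {}" if "E \<in> ?O'" "conc m n p K E" for E
  proof -
    have "0 < y\<^sup>2 / (4 * K)" using y_pos K by simp
    then show ?thesis using g'.movable_lower[OF that ab(2,1) ab(3)[symmetric]] by auto
  qed
  then have "?O' \<subseteq> {E \<in> ?O'. movable D E b a \<noteq> {}} \<union> {E \<in> ?O'. \<not> conc m n p K E}" by auto
  then have "card ?O' \<le> card ({E \<in> ?O'. movable D E b a \<noteq> {}} \<union> {E \<in> ?O'. \<not> conc m n p K E})"
    by (intro card_mono) auto
  also have "\<dots> \<le> card {E \<in> ?O'. movable D E b a \<noteq> {}} + card {E \<in> ?O'. \<not> conc m n p K E}" by (rule card_Un_le)
  finally have "real (card ?O') \<le> \<rho> * real (card \<Omega>) + real (card {E \<in> ?O'. \<not> conc m n p K E})"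
    unfolding \<rho>_def move_count[OF assms(1)] s'_def by linarith
  moreover have "real (card {E \<in> ?O'. \<not> conc m n p K E}) \<le> real (card ?O') / y ^ 3"
  proof -
    have "real (card {E \<in> ?O'. \<not> conc m n p K E}) * y ^ 3 \<le> real (card {E \<in> ?O'. \<not> conc m n p K E}) * real n ^ 3"
      using err_small by (intro mult_left_mono) auto
    also have "\<dots> \<le> real (card ?O')" by (rule g'.few_bad)
    finally show ?thesis using y_pos by (simp add: le_divide_eq)
  qed
  ultimately have "real (card ?O') \<le> \<rho> * real (card \<Omega>) + real (card ?O') / y ^ 3" by linarith
  then have up: "q \<le> \<rho> + q / y ^ 3" unfolding q_def using card_pos nonempty by (simp add: field_simps)
  have "card {E \<in> ?O'. movable D E b a \<noteq> {}} \<le> card ?O'" by (intro card_mono) auto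
  then have "\<rho> * real (card \<Omega>) \<le> real (card ?O')" unfolding \<rho>_def move_count[OF assms(1)] s'_def by simp
  then have lo: "\<rho> \<le> q" unfolding q_def using card_pos nonempty by (simp add: field_simps)
  have rho: "\<bar>\<rho> - R\<bar> \<le> 3 * K ^ 8 / y ^ 3" unfolding \<rho>_def R_def by (rule ratio_avg)
  have R: "3 / 4 \<le> R" "R \<le> 5 / 4" unfolding R_def using dl_Gs_small by (auto simp only: abs_le_iff)
  have iy: "1 / y ^ 3 \<le> 1 / 100" "0 \<le> 1 / y ^ 3"
  proof -
    have "100 * K ^ 0 \<le> y" by (rule cK_le_y) auto
    also have "y \<le> y ^ 3" using power_increasing[of 1 3 y] y_pos by simp
    finally show "1 / y ^ 3 \<le> 1 / 100" using y_pos by (simp add: divide_le_eq)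
  qed (use y_pos in simp)
  have q0: "0 \<le> q" by (simp add: q_def)
  have qy: "q / y ^ 3 = q * (1 / y ^ 3)" by simp
  have "q * (1 / y ^ 3) \<le> q * (1 / 100)" using iy q0 by (intro mult_left_mono)
  then have "q \<le> 2" using up rho R err_small(1) unfolding qy by linarith
  then have "q * (1 / y ^ 3) \<le> 2 * (1 / y ^ 3)" using iy by (intro mult_right_mono)
  moreover have "2 * (1 / y ^ 3) \<le> K ^ 8 / y ^ 3"
  proof -
    have "2 \<le> K ^ 8" using power_increasing[of 1 8 K] K by simp
    then have "2 / y ^ 3 \<le> K ^ 8 / y ^ 3" using y_pos by (intro divide_right_mono) auto
    then show ?thesis by simp
  qed
  moreover have "3 * K ^ 8 / y ^ 3 = 3 * (K ^ 8 / y ^ 3)" by simp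
  ultimately have qR: "\<bar>q - R\<bar> \<le> 4 * (K ^ 8 / y ^ 3)" using up lo rho unfolding qy by linarith
  have "(real (card ?O') / rprod s') / (real (card \<Omega>) / rprod s) = q / R"
    unfolding s'_def rprod_ratio[OF assms(1)] q_def R_def[symmetric] using rprod_pos by (simp add: s'_def)
  then have "(real (card ?O') / rprod s') / (real (card \<Omega>) / rprod s) - 1 = (q - R) / R" using R by (simp add: field_simps)
  also have "\<bar>\<dots>\<bar> = \<bar>q - R\<bar> / R" using R by simp
  also have "\<dots> \<le> (4 * (K ^ 8 / y ^ 3)) / (3 / 4)" using qR R by (intro frac_le) auto
  also have "\<dots> \<le> 6 * K ^ 8 / y ^ 3"
  proof -
    have "0 \<le> K ^ 8 / y ^ 3" using K y_pos by simp
    then show ?thesis by simp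
  qed
  finally show ?thesis .
qed

end

end

section \<open>Fixed number of edges\<close>

lemma swap_rdeg:
  assumes "finite A" "(a, j) \<in> A" "(b, l) \<notin> A"
  shows "rdeg (insert (b, l) (A - {(a, j)})) =
    (if a = b then rdeg A else (rdeg A)(a := rdeg A a - 1, b := rdeg A b + 1))" "1 \<le> rdeg A a"
proof -
  have fin: "finite {j. (i, j) \<in> A}" for i
    by (rule finite_surj[OF assms(1), of _ snd]) force
  have pos: "card {j. (a, j) \<in> A} > 0" using assms fin by (auto simp: card_gt_0_iff)
  then show "1 \<le> rdeg A a" by (simp add: rdeg_eq)
  show "rdeg (insert (b, l) (A - {(a, j)})) = (if a = b then rdeg A else (rdeg A)(a := rdeg A a - 1, b := rdeg A b + 1))"
  proof
    fix i
    have "{j'. (i, j') \<in> insert (b, l) (A - {(a, j)})} =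
      (if i = b then insert l (if i = a then {j'. (i, j') \<in> A} - {j} else {j'. (i, j') \<in> A})
       else (if i = a then {j'. (i, j') \<in> A} - {j} else {j'. (i, j') \<in> A}))" by auto
    then have "rdeg (insert (b, l) (A - {(a, j)})) i = card
      (if i = b then insert l (if i = a then {j'. (i, j') \<in> A} - {j} else {j'. (i, j') \<in> A})
       else (if i = a then {j'. (i, j') \<in> A} - {j} else {j'. (i, j') \<in> A}))" unfolding rdeg_eq by (rule arg_cong)
    also have "\<dots> = (if a = b then rdeg A else (rdeg A)(a := rdeg A a - 1, b := rdeg A b + 1)) i"
      using assms fin[of i] pos by (auto simp: rdeg_eq card_insert_if)
    finally show "rdeg (insert (b, l) (A - {(a, j)})) i = (if a = b then rdeg A else (rdeg A)(a := rdeg A a - 1, b := rdeg A b + 1)) i" .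
  qed
qed

lemma two_tails_arith:
  fixes a b e z :: real
  assumes "1 * e \<le> z" "a \<le> e" "b \<le> 4 * z"
  shows "2 * (a + b) \<le> 10 * z"
  using assms by argo

lemma sqrt_diff_le:
  fixes u v c :: real
  assumes "0 < u" "0 \<le> v" "\<bar>v / u - 1\<bar> \<le> c"
  shows "\<bar>sqrt v - sqrt u\<bar> \<le> c * sqrt u"
proof -
  have "v - u = (v / u - 1) * u" using assms by (simp add: field_simps)
  then have "\<bar>v - u\<bar> = \<bar>v / u - 1\<bar> * u" using assms by (simp add: abs_mult)
  also have "\<dots> \<le> c * u" using assms by (intro mult_right_mono) auto
  finally have 1: "\<bar>v - u\<bar> \<le> c * u" .
  have "v - u = (sqrt v - sqrt u) * (sqrt v + sqrt u)"
    using assms by (simp add: algebra_simps flip: power2_eq_square)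
  then have "\<bar>v - u\<bar> = \<bar>sqrt v - sqrt u\<bar> * (sqrt v + sqrt u)" using assms by (simp add: abs_mult)
  moreover have "\<bar>sqrt v - sqrt u\<bar> * sqrt u \<le> \<bar>sqrt v - sqrt u\<bar> * (sqrt v + sqrt u)"
    using assms by (intro mult_left_mono) auto
  ultimately have "\<bar>sqrt v - sqrt u\<bar> * sqrt u \<le> (c * sqrt u) * sqrt u"
    using 1 assms by (simp add: mult.assoc)
  then show ?thesis using assms by (simp add: mult_le_cancel_right_pos)
qed

section \<open>The density for a fixed column sequence as a function on the slice\<close>

context dense begin

abbreviation "S \<equiv> slice W k"
abbreviation "M \<equiv> real (card W choose k)"
definition rc :: "(nat \<Rightarrow> nat) \<Rightarrow> real" where "rc s = real (card {E \<in> S. rdeg E = s})"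
definition ct :: "(nat \<Rightarrow> nat) \<Rightarrow> real" where "ct t = real (card {E \<in> S. cdeg E = t})"
definition Ndeg :: "(nat \<Rightarrow> nat) \<Rightarrow> (nat \<Rightarrow> nat) \<Rightarrow> real" where
  "Ndeg s t = real (card {E \<in> S. rdeg E = s \<and> cdeg E = t})"

lemma k_le: "k \<le> card W"
proof -
  have "real k = p * (real m * real n)" by (simp add: k_eq)
  also have "\<dots> \<le> (1 - 1 / K) * (real m * real n)" using p01 by (intro mult_right_mono) auto
  also have "\<dots> \<le> real m * real d"
  proof -
    have "1 \<le> real n / K"
    proof -
      have "K ^ 1 \<le> y" by (rule K_pow_le_y) simp
      also have "y \<le> y\<^sup>2" using y_pos by (simp add: power2_eq_square)
      finally show ?thesis using K n_eq by simp
    qed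
    then have "(1 - 1 / K) * real n \<le> real d" using d_n by (simp add: left_diff_distrib)
      (smt (verit) of_bool_less_eq_one)
    then have "real m * ((1 - 1 / K) * real n) \<le> real m * real d" by (intro mult_left_mono) auto
    then show ?thesis by (simp add: mult_ac)
  qed
  also have "\<dots> = real (card W)" using card_cells[OF D] by (simp add: d_def)
  finally show ?thesis by simp
qed

lemma M_pos: "M > 0" using k_le by simp
lemma finS: "finite S" by simp
lemma cardS: "real (card S) = M" by (simp add: card_slice)

lemma S_sub: "A \<in> S \<Longrightarrow> A \<subseteq> W" by (simp add: slice_def)

lemma rc_pos: "A \<in> S \<Longrightarrow> rc (rdeg A) > 0"
  unfolding rc_def by (simp add: card_gt_0_iff) blast

lemma ct_pos: "A \<in> S \<Longrightarrow> ct (cdeg A) > 0"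
  unfolding ct_def by (simp add: card_gt_0_iff) blast

lemma same_row_in_S:
  assumes "A \<in> S" "E \<subseteq> W" "rdeg E = rdeg A"
  shows "E \<in> S"
  using sum_rdeg[OF assms(2)] sum_rdeg[OF S_sub[OF assms(1)]] assms by (simp add: slice_def)

lemma fibre_in_S:
  assumes "A \<in> S"
  shows "deg_fibre D m n (rdeg A, t) = {E \<in> S. rdeg E = rdeg A \<and> cdeg E = t}"
proof (intro set_eqI iffI)
  fix E assume "E \<in> deg_fibre D m n (rdeg A, t)"
  then have "E \<subseteq> W" "rdeg E = rdeg A" "cdeg E = t" using deg_fibreD by auto
  then show "E \<in> {E \<in> S. rdeg E = rdeg A \<and> cdeg E = t}" using same_row_in_S[OF assms] by simp
next
  fix E assume "E \<in> {E \<in> S. rdeg E = rdeg A \<and> cdeg E = t}"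
  then show "E \<in> deg_fibre D m n (rdeg A, t)" using S_sub by (intro deg_fibreI) auto
qed

lemma rprod_rdeg:
  assumes "A \<in> S"
  shows "rprod (rdeg A) = rc (rdeg A)"
proof -
  have z: "rdeg A i = 0" if "i \<ge> m" for i
  proof -
    have "{j. (i, j) \<in> A} = {}" using S_sub[OF assms] that by (auto simp: cells_def)
    then show ?thesis by (simp add: rdeg_eq)
  qed
  have "{E \<in> S. rdeg E = rdeg A} = fibre (Pow W) rdeg (rdeg A)"
  proof (intro set_eqI iffI)
    fix E assume "E \<in> fibre (Pow W) rdeg (rdeg A)"
    then have "E \<subseteq> W" "rdeg E = rdeg A" by (auto simp: fibre_def)
    then show "E \<in> {E \<in> S. rdeg E = rdeg A}" using same_row_in_S[OF assms] by simp
  qed (use S_sub in \<open>auto simp: fibre_def\<close>)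
  then have "rc (rdeg A) = real (card (fibre (Pow W) rdeg (rdeg A)))" unfolding rc_def by simp
  also have "\<dots> = rprod (rdeg A)" using card_row_fibre[OF D z] by (simp add: rprod_def d_def)
  finally show ?thesis by simp
qed

text \<open>Each row sequence is attained by \<open>rc\<close> sets \<open>A\<close>, which cancels
  the denominator; sums of the density over the slice become counts of graphs in the column class
  \<open>t\<close>.\<close>

lemma sum_over_fibre:
  "(\<Sum>A | A \<in> S \<and> Q (rdeg A). Ndeg (rdeg A) t / rc (rdeg A)) = real (card {E \<in> S. cdeg E = t \<and> Q (rdeg E)})"
proof -
  let ?X = "{A. A \<in> S \<and> Q (rdeg A)}" and ?Y = "{E \<in> S. cdeg E = t \<and> Q (rdeg E)}"
  have "(\<Sum>A\<in>?X. Ndeg (rdeg A) t / rc (rdeg A)) = (\<Sum>A\<in>?X. \<Sum>E | E \<in> ?Y \<and> rdeg A = rdeg E. 1 / rc (rdeg A))"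
  proof (rule sum.cong[OF refl])
    fix A assume A: "A \<in> ?X"
    then have "{E. E \<in> ?Y \<and> rdeg A = rdeg E} = {E \<in> S. rdeg E = rdeg A \<and> cdeg E = t}" by auto
    then show "Ndeg (rdeg A) t / rc (rdeg A) = (\<Sum>E | E \<in> ?Y \<and> rdeg A = rdeg E. 1 / rc (rdeg A))"
      by (simp add: Ndeg_def)
  qed
  also have "\<dots> = (\<Sum>E\<in>?Y. \<Sum>A | A \<in> ?X \<and> rdeg A = rdeg E. 1 / rc (rdeg A))"
    by (rule sum.swap_restrict) auto
  also have "\<dots> = (\<Sum>E\<in>?Y. 1)"
  proof (rule sum.cong[OF refl])
    fix E assume E: "E \<in> ?Y"
    have "(\<Sum>A | A \<in> ?X \<and> rdeg A = rdeg E. 1 / rc (rdeg A)) = (\<Sum>A | A \<in> S \<and> rdeg A = rdeg E. 1 / rc (rdeg E))"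
      using E by (intro sum.cong) auto
    also have "\<dots> = rc (rdeg E) * (1 / rc (rdeg E))" by (simp only: sum_constant rc_def)
    also have "\<dots> = 1" using rc_pos[of E] E by simp
    finally show "(\<Sum>A | A \<in> ?X \<and> rdeg A = rdeg E. 1 / rc (rdeg A)) = 1" .
  qed
  finally show ?thesis by simp
qed

definition goodA :: "(nat \<Rightarrow> nat) \<Rightarrow> (nat \<times> nat) set \<Rightarrow> bool" where
  "goodA t A \<longleftrightarrow> good_fibre D m n k K (rdeg A) t"

text \<open>The bound of \<open>card_not_conc\<close>, times the factor \<open>n ^ 3\<close> lost in
  \<open>card_bad\<close>.\<close>

definition eps1 :: real where "eps1 = 16 * K ^ 4 * real n ^ 8 * exp (- (K / 16))"

lemma eps1_pos: "eps1 > 0" using K n_pos by (simp add: eps1_def)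

text \<open>Markov's inequality over fibres. A fibre that is not good has a share of unconcentrated
  members above n^(-3). Spreading each unconcentrated graph evenly over its own fibre gives it total
  weight 1, so at most \<open>n ^ 3\<close> times their number of edge sets are affected.\<close>

lemma card_bad: "real (card {E \<in> S. \<not> goodA (cdeg E) E}) \<le> eps1 * M"
proof -
  let ?B = "{E \<in> S. \<not> goodA (cdeg E) E}" and ?C = "{E \<in> S. \<not> conc m n p K E}"
  let ?O = "\<lambda>E. {F \<in> S. degrees_of F = degrees_of E}"
  have key: "1 \<le> real n ^ 3 * (real (card {F \<in> ?O E. \<not> conc m n p K F}) / real (card (?O E)))" if E: "E \<in> ?B" for E
  proof -
    have O: "deg_fibre D m n (rdeg E, cdeg E) = ?O E" using E fibre_in_S[of E "cdeg E"] by (auto simp: degrees_of_eq)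
    have ne: "?O E \<noteq> {}" using E by auto
    have "\<not> real (card {F \<in> ?O E. \<not> conc m n p K F}) * real n ^ 3 \<le> real (card (?O E))"
    proof
      assume "real (card {F \<in> ?O E. \<not> conc m n p K F}) * real n ^ 3 \<le> real (card (?O E))"
      then have "good_fibre D m n k K (rdeg E) (cdeg E)"
        using ne E sum_rdeg[OF S_sub, of E] dense_axioms
        by (intro good_fibre.intro good_fibre_axioms.intro) (auto simp: O slice_def p_def)
      then show False using E by (simp add: goodA_def)
    qed
    moreover have "real (card (?O E)) > 0" using ne by (simp add: card_gt_0_iff)
    ultimately show ?thesis by (simp add: field_simps)
  qed
  have "real (card ?B) = (\<Sum>E\<in>?B. 1)" by simp
  also have "\<dots> \<le> (\<Sum>E\<in>?B. real n ^ 3 * (real (card {F \<in> ?O E. \<not> conc m n p K F}) / real (card (?O E))))"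
    using key by (intro sum_mono)
  also have "\<dots> \<le> (\<Sum>E\<in>S. real n ^ 3 * (real (card {F \<in> ?O E. \<not> conc m n p K F}) / real (card (?O E))))"
    by (intro sum_mono2) auto
  also have "\<dots> = real n ^ 3 * (\<Sum>E\<in>S. \<Sum>F | F \<in> ?C \<and> degrees_of F = degrees_of E. 1 / real (card (?O E)))"
  proof -
    have "{F \<in> ?O E. \<not> conc m n p K F} = {F. F \<in> ?C \<and> degrees_of F = degrees_of E}" for E by auto
    then show ?thesis by (simp add: sum_distrib_left)
  qed
  also have "(\<Sum>E\<in>S. \<Sum>F | F \<in> ?C \<and> degrees_of F = degrees_of E. 1 / real (card (?O E)))
     = (\<Sum>F\<in>?C. \<Sum>E | E \<in> S \<and> degrees_of F = degrees_of E. 1 / real (card (?O E)))"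
    by (rule sum.swap_restrict) auto
  also have "\<dots> = (\<Sum>F\<in>?C. 1)"
  proof (rule sum.cong[OF refl])
    fix F assume F: "F \<in> ?C"
    have "(\<Sum>E | E \<in> S \<and> degrees_of F = degrees_of E. 1 / real (card (?O E))) = (\<Sum>E\<in>?O F. 1 / real (card (?O F)))"
      by (intro sum.cong) auto
    also have "\<dots> = 1" using F by (auto simp: card_gt_0_iff)
    finally show "(\<Sum>E | E \<in> S \<and> degrees_of F = degrees_of E. 1 / real (card (?O E))) = 1" .
  qed
  finally have 1: "real (card ?B) \<le> real n ^ 3 * real (card ?C)" by simp
  have yy: "12 * K ^ 0 \<le> y" "2 * K ^ 0 \<le> y" "K ^ 1 \<le> y" by (rule cK_le_y cK_le_y K_pow_le_y; simp)+
  have "1 * y \<le> K * y" using K y_pos by (intro mult_right_mono) auto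
  then have Ky: "K * sqrt (real n) \<ge> 12" using yy unfolding y_def by simp
  have "n > 1"
  proof -
    have "y \<le> y\<^sup>2" using y_pos by (simp add: power2_eq_square)
    then have "real n \<ge> 2" using yy n_eq by simp
    then show ?thesis by simp
  qed
  then have "real (card ?C) \<le> 16 * K ^ 4 * real n ^ 5 * exp (- (K / 16)) * M"
    unfolding p_def using card_not_conc[OF D m_pos _ nm(2) _ Ky _ k_le] K yy by (simp add: y_def)
  then have "real n ^ 3 * real (card ?C) \<le> real n ^ 3 * (16 * K ^ 4 * real n ^ 5 * exp (- (K / 16)) * M)"
    by (intro mult_left_mono) auto
  also have "\<dots> = eps1 * M" unfolding eps1_def by (simp add: mult_ac flip: power_add)
  finally show ?thesis using 1 by linarith
qed

context
  fixes t :: "nat \<Rightarrow> nat"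
  assumes tS: "\<exists>E\<in>S. cdeg E = t"
begin

text \<open>Its square is the ratio \<open>f\<close>: \<open>Ndeg / M\<close> is the point
  probability in the graph model and \<open>rc * ct / M\<^sup>2\<close> the one in the independent
  model. \<open>A\<close> enters only through its row degrees; it stands for a uniform edge set that
  supplies the rows, which makes the reference measure uniform on the slice.\<close>

definition hh :: "(nat \<times> nat) set \<Rightarrow> real" where
  "hh A = sqrt (Ndeg (rdeg A) t * M / (rc (rdeg A) * ct t))"

text \<open>The share of the column class whose fibres are not good, to serve as
  \<open>\<theta>\<close> in \<open>slice_density\<close>.\<close>

definition th :: real where "th = real (card {E \<in> S. cdeg E = t \<and> \<not> goodA t E}) / ct t"

lemma ct0: "ct t > 0" using tS ct_pos by auto

lemma hh_sq: "A \<in> S \<Longrightarrow> (hh A)\<^sup>2 = (M / ct t) * (Ndeg (rdeg A) t / rc (rdeg A))"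
  unfolding hh_def using rc_pos[of A] ct0 by (simp add: Ndeg_def mult.commute)

lemma sum_hh: "(\<Sum>A | A \<in> S \<and> Q (rdeg A). (hh A)\<^sup>2) = (M / ct t) * real (card {E \<in> S. cdeg E = t \<and> Q (rdeg E)})"
proof -
  have "(\<Sum>A | A \<in> S \<and> Q (rdeg A). (hh A)\<^sup>2) = (\<Sum>A | A \<in> S \<and> Q (rdeg A). (M / ct t) * (Ndeg (rdeg A) t / rc (rdeg A)))"
    using hh_sq by (intro sum.cong) auto
  then show ?thesis by (simp only: sum_distrib_left[symmetric] sum_over_fibre)
qed

text \<open>An arbitrary swap of cells affects the row degrees like a move between two rows, or not
  at all. The columns of the two cells may differ, because \<open>t\<close> is held fixed and the
  columns of \<open>A\<close> are ignored.\<close>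

lemma swap_cases:
  assumes A: "A \<in> S" "x \<in> A" "y' \<in> W - A" and B: "B = insert y' (A - {x})"
  obtains "rdeg B = rdeg A" | a b where "a \<noteq> b" "a < m" "b < m" "1 \<le> rdeg A a"
    "rdeg B = (rdeg A)(a := rdeg A a - 1, b := rdeg A b + 1)"
proof -
  obtain a j b l where xy: "x = (a, j)" "y' = (b, l)" by (cases x, cases y')
  have "finite A" using finite_subcells[OF S_sub[OF A(1)]] .
  note sw = swap_rdeg[OF this, of a j b l]
  have "a < m" "b < m" using A S_sub[OF A(1)] xy by (auto simp: cells_def)
  then show thesis using sw A xy B that by (cases "a = b") auto
qed

lemma Ndeg_eq: "A \<in> S \<Longrightarrow> Ndeg (rdeg A) t / rc (rdeg A) = real (card (deg_fibre D m n (rdeg A, t))) / rprod (rdeg A)"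
  unfolding Ndeg_def by (simp add: rprod_rdeg fibre_in_S)

lemma hh_eq: "A \<in> S \<Longrightarrow> hh A = sqrt ((M / ct t) * (real (card (deg_fibre D m n (rdeg A, t))) / rprod (rdeg A)))"
  unfolding Ndeg_eq[symmetric] hh_def by (simp add: mult_ac)

text \<open>\<open>fine_ratio\<close> and \<open>crude_ratio\<close> supply the two swap conditions;
  the binomial product in them is the count \<open>rc\<close> by \<open>rprod_rdeg\<close>, and
  passing to the square root preserves the relative bound.\<close>

lemma slice_density_hh: "slice_density W k hh (goodA t) (6 * K ^ 8 / y ^ 3) th"
proof
  let ?c = "M / ct t" and ?F = "\<lambda>A. real (card (deg_fibre D m n (rdeg A, t))) / rprod (rdeg A)"
  have c0: "?c > 0" using M_pos ct0 by simp
  show "finite W" "k \<le> card W" using k_le by auto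
  show "0 \<le> hh A" if "A \<in> S" for A unfolding hh_def by (simp add: Ndeg_def rc_def ct_def)
  have "(\<Sum>A\<in>S. (hh A)\<^sup>2) = (M / ct t) * real (card {E \<in> S. cdeg E = t})"
    using sum_hh[of "\<lambda>_. True"] by simp
  then show "(\<Sum>A\<in>S. (hh A)\<^sup>2) = M" using ct0 unfolding ct_def[symmetric] by simp
  show "0 \<le> 6 * K ^ 8 / y ^ 3" using K y_pos by simp
  fix A x y' assume A: "A \<in> S" "x \<in> A" "y' \<in> W - A" and g: "goodA t A"
  define B where "B = insert y' (A - {x})"
  have BS: "B \<in> S" unfolding B_def by (rule swap_in_slice(1)[OF finite_cells A])
  interpret g: good_fibre D m n k K "rdeg A" t using g by (simp add: goodA_def)
  have FA: "?F A > 0" using g.card_pos rprod_rdeg[OF A(1)] rc_pos[OF A(1)] by simp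
  have FB: "?F B \<ge> 0" using rprod_rdeg[OF BS] rc_pos[OF BS] by simp
  {
    assume gB: "goodA t (insert y' (A - {x}))"
    have "\<bar>hh B - hh A\<bar> \<le> 6 * K ^ 8 / y ^ 3 * hh A"
    proof (rule swap_cases[OF A B_def])
      assume "rdeg B = rdeg A"
      then have "hh B = hh A" by (simp add: hh_def)
      moreover have "0 \<le> hh A" unfolding hh_def by (simp add: Ndeg_def rc_def ct_def)
      ultimately show ?thesis using K y_pos by simp
    next
      fix a b assume ab: "a \<noteq> b" "a < m" "b < m" "1 \<le> rdeg A a" "rdeg B = (rdeg A)(a := rdeg A a - 1, b := rdeg A b + 1)"
      have gB': "good_fibre D m n k K (rdeg B) t" using gB by (simp add: goodA_def B_def)
      have "\<bar>?F B / ?F A - 1\<bar> \<le> 6 * K ^ 8 / y ^ 3"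
        using g.fine_ratio[OF ab(2,3,1,4)] gB' unfolding ab(5) by simp
      moreover have "(?c * ?F B) / (?c * ?F A) = ?F B / ?F A"
        by (rule mult_divide_mult_cancel_left) (use c0 in linarith)
      ultimately have "\<bar>(?c * ?F B) / (?c * ?F A) - 1\<bar> \<le> 6 * K ^ 8 / y ^ 3" by (simp only:)
      then show ?thesis unfolding hh_eq[OF A(1)] hh_eq[OF BS]
        using c0 FA FB by (intro sqrt_diff_le mult_pos_pos mult_nonneg_nonneg) auto
    qed
    then show "\<bar>hh (insert y' (A - {x})) - hh A\<bar> \<le> 6 * K ^ 8 / y ^ 3 * hh A" by (simp add: B_def)
  }
  {
    assume gB: "\<not> goodA t (insert y' (A - {x}))"
    have "?F A \<le> 4 * ?F B"
    proof (rule swap_cases[OF A B_def])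
      assume "rdeg B = rdeg A"
      then show ?thesis using FA by simp
    next
      fix a b assume ab: "a \<noteq> b" "a < m" "b < m" "1 \<le> rdeg A a" "rdeg B = (rdeg A)(a := rdeg A a - 1, b := rdeg A b + 1)"
      show ?thesis using g.crude_ratio[OF ab(2,3,1,4)] unfolding ab(5) by simp
    qed
    then have "?c * ?F A \<le> ?c * (4 * ?F B)" using c0 by (intro mult_left_mono) auto
    also have "?c * (4 * ?F B) = 4 * (?c * ?F B)" by (rule mult.left_commute)
    finally have "(hh A)\<^sup>2 \<le> 4 * (hh B)\<^sup>2" unfolding hh_sq[OF A(1)] hh_sq[OF BS] Ndeg_eq[OF A(1)] Ndeg_eq[OF BS] .
    then show "(hh A)\<^sup>2 \<le> 4 * (hh (insert y' (A - {x})))\<^sup>2" by (simp add: B_def)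
  }
next
  have "(\<Sum>A | A \<in> S \<and> \<not> goodA t A. (hh A)\<^sup>2) = (M / ct t) * real (card {E \<in> S. cdeg E = t \<and> \<not> goodA t E})"
    using sum_hh[of "\<lambda>s. \<not> good_fibre D m n k K s t"] by (simp add: goodA_def)
  then show "(\<Sum>A | A \<in> S \<and> \<not> goodA t A. (hh A)\<^sup>2) \<le> th * M" by (simp add: th_def mult.commute)
qed

end

definition eta :: real where "eta = K ^ 12 / y"
text \<open>Cross-multiplied form of the ratio \<open>f\<close> differing from 1 by more than
  \<open>eta\<close>.\<close>

definition badp :: "(nat \<Rightarrow> nat) \<Rightarrow> (nat \<Rightarrow> nat) \<Rightarrow> bool" where
  "badp s t \<longleftrightarrow> \<not> \<bar>Ndeg s t * M - rc s * ct t\<bar> \<le> eta * (rc s * ct t)"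
definition tau :: real where "tau = 10 * K\<^sup>2 * real n ^ 7 * exp (- (K / 32))"

lemma N_le: "real (card W) \<le> K * y ^ 4"
proof -
  have "real (card W) = real m * real d" using card_cells[OF D] by (simp add: d_def)
  also have "\<dots> \<le> (K * real n) * real n" using nm K by (intro mult_mono) (auto simp: d_def)
  also have "\<dots> = K * y ^ 4" by (simp add: n_eq eval_nat_numeral)
  finally show ?thesis .
qed

lemma sqrt_eps1: "sqrt eps1 = 4 * K\<^sup>2 * real n ^ 4 * exp (- (K / 32))"
proof -
  have "eps1 = (4 * K\<^sup>2 * real n ^ 4 * exp (- (K / 32)))\<^sup>2"
  proof -
    have "exp (- (K / 16)) = (exp (- (K / 32)))\<^sup>2" unfolding power2_eq_square exp_add[symmetric] by simp
    then show ?thesis unfolding eps1_def by (simp add: power_mult_distrib flip: power_mult)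
  qed
  then show ?thesis using K by simp
qed

text \<open>The first bound concerns the graph model given the columns \<open>t\<close>, the second
  the independent model, where the rows come from a uniform set.\<close>

lemma bad_for_column:
  assumes t: "\<exists>E\<in>S. cdeg E = t" and th: "th t \<le> sqrt eps1" and big12: "K ^ 12 \<le> y" and hexp: "eps1 * real n ^ 6 \<le> 1"
  shows "(\<Sum>A | A \<in> S \<and> badp (rdeg A) t. (hh t A)\<^sup>2) \<le> tau * M" "real (card {A \<in> S. badp (rdeg A) t}) \<le> tau * M"
proof -
  interpret sd: slice_density W k "hh t" "goodA t" "6 * K ^ 8 / y ^ 3" "th t" by (rule slice_density_hh[OF t])
  \<comment> \<open>\<open>N * \<delta>\<^sup>2\<close> is at most
    \<open>36 * K ^ 17 / y\<^sup>2\<close>, so \<open>K ^ 10 / y\<close> meets the requirement on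
    \<open>\<sigma>\<close> with room. About \<open>K\<close> halvings bring the tails below
    \<open>exp (- K / 32)\<close>, while the level moves by at most \<open>2 * K ^ 11 / y\<close>; a
    factor 3 for passing from \<open>h\<close> to its square still fits below
    \<open>eta\<close>.\<close>
  define \<sigma> where "\<sigma> = K ^ 10 / y"
  define j where "j = nat \<lceil>K\<rceil>"
  have y6: "real n ^ 3 = y ^ 6" "real n ^ 6 = y ^ 12" by (simp_all add: n_eq flip: power_mult)
  have th0: "th t \<ge> 0" by (rule sd.\<theta>_nonneg)
  have thy: "th t * y ^ 6 \<le> 1"
  proof -
    have "(sqrt eps1 * y ^ 6)\<^sup>2 \<le> 1" using hexp eps1_pos by (simp add: y6 power_mult_distrib flip: power_mult)
    then have "sqrt eps1 * y ^ 6 \<le> 1" by (simp add: abs_square_le_1)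
    moreover have "th t * y ^ 6 \<le> sqrt eps1 * y ^ 6" using th y_pos by (intro mult_right_mono) auto
    ultimately show ?thesis by linarith
  qed
  have Kbig: "K ^ 2 \<ge> 10000" "K ^ 18 \<ge> 80" "K ^ 19 \<ge> 80"
    using power_mono[of 100 K 2] power_mono[of 100 K 18] power_mono[of 100 K 19] K by auto
  have \<sigma>0: "\<sigma> > 0" using K y_pos by (simp add: \<sigma>_def)
  have j: "K \<le> real j" "real j \<le> K + 1" unfolding j_def using K by linarith+
  have j\<sigma>: "real (j + 1) * \<sigma> \<le> 2 * K ^ 11 / y"
  proof -
    have "real (j + 1) * \<sigma> \<le> (2 * K) * \<sigma>" using j K \<sigma>0 by (intro mult_right_mono) auto
    also have "\<dots> = 2 * K ^ 11 / y" by (simp add: \<sigma>_def flip: power_Suc)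
    finally show ?thesis .
  qed
  have e12: "100 * K ^ 11 / y \<le> K ^ 12 / y" 
  proof (rule divide_right_mono)
    have "100 * K ^ 11 \<le> K * K ^ 11" using K by (intro mult_right_mono) auto
    then show "100 * K ^ 11 \<le> K ^ 12" by (simp flip: power_Suc)
  qed (use y_pos in simp)
  have pw: "y ^ 6 = y ^ 4 * y\<^sup>2" "K ^ 17 = K * K ^ 16" "K ^ 20 = K * K ^ 19"
    by (simp_all flip: power_add power_Suc)
  have e1: "K ^ 12 / y \<le> 1" using big12 y_pos by simp
  have K11: "0 \<le> K ^ 11 / y" using K y_pos by simp
  have e11: "2 * K ^ 11 / y = 2 * (K ^ 11 / y)" "100 * K ^ 11 / y = 100 * (K ^ 11 / y)" by auto
  have j1: "real (j + 1) * \<sigma> \<le> 1" using j\<sigma> e12 e1 K11 unfolding e11 by linarith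
  have "1 * \<sigma> \<le> real (j + 1) * \<sigma>" using \<sigma>0 by (intro mult_right_mono) auto
  then have \<sigma>1: "\<sigma> \<le> 1" using j1 by linarith
  have NN: "0 \<le> real (card W)" by simp
  have \<sigma>3: "16 * (real (card W) * (6 * K ^ 8 / y ^ 3)\<^sup>2 + 5 * real (card W) * th t) \<le> \<sigma>\<^sup>2"
  proof -
    have "real (card W) * (6 * K ^ 8 / y ^ 3)\<^sup>2 \<le> (K * y ^ 4) * (6 * K ^ 8 / y ^ 3)\<^sup>2"
      using N_le by (intro mult_right_mono) auto
    also have "\<dots> = 36 * (K ^ 17 / y\<^sup>2)"
    proof -
      have sq: "(6 * K ^ 8 / y ^ 3)\<^sup>2 = 36 * K ^ 16 / y ^ 6" by (simp add: power_divide power_mult_distrib flip: power_mult)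
      have gen: "x * z * (36 * c / (z * w)) = 36 * (x * c / w)" if "z \<noteq> 0" for x z c w :: real
        using that by simp
      show ?thesis unfolding sq pw by (rule gen) (use y_pos in simp)
    qed
    finally have 1: "real (card W) * (6 * K ^ 8 / y ^ 3)\<^sup>2 \<le> 36 * (K ^ 17 / y\<^sup>2)" .
    have "real (card W) * th t \<le> (K * y ^ 4) * th t" using N_le th0 by (intro mult_right_mono) auto
    also have "\<dots> = (th t * y ^ 6) * (K / y\<^sup>2)"
    proof -
      have gen: "x * z * c = (c * (z * w)) * (x / w)" if "w \<noteq> 0" for x z c w :: real
        using that by simp
      show ?thesis unfolding pw by (rule gen) (use y_pos in simp)
    qed
    also have "\<dots> \<le> 1 * (K / y\<^sup>2)" using thy K by (intro mult_right_mono) auto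
    also have "\<dots> \<le> K ^ 17 / y\<^sup>2" using power_increasing[of 1 17 K] K by (simp add: divide_right_mono)
    finally have 2: "real (card W) * th t \<le> K ^ 17 / y\<^sup>2" .
    have s2: "\<sigma>\<^sup>2 = K ^ 20 / y\<^sup>2" by (simp add: \<sigma>_def power_divide flip: power_mult)
    have "10000 * K ^ 17 \<le> K\<^sup>2 * K ^ 17" using Kbig K by (intro mult_right_mono) auto
    also have "\<dots> = K ^ 19" by (simp flip: power_add)
    also have "\<dots> \<le> K ^ 20" using K by (intro power_increasing) auto
    finally have "10000 * K ^ 17 / y\<^sup>2 \<le> K ^ 20 / y\<^sup>2" by (intro divide_right_mono) auto
    then have 3: "10000 * (K ^ 17 / y\<^sup>2) \<le> \<sigma>\<^sup>2" by (simp add: s2)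
    have "0 \<le> K ^ 17 / y\<^sup>2" using K by simp
    then show ?thesis using 1 2 3 by (simp only: distrib_left mult.assoc)
  qed
  define T where "T = 1 / 2 ^ j + 80 * real (card W) * th t / \<sigma>\<^sup>2"
  note up = sd.upper_tail[OF \<sigma>0 \<sigma>1 \<sigma>3 j1, folded T_def]
  note lo = sd.lower_tail[OF \<sigma>0 \<sigma>1 \<sigma>3 j1, folded T_def]
  have T: "2 * T \<le> tau"
  proof -
    have "exp (K / 32) \<le> exp (real j * (2 / 3))" using j K by simp
    also have "\<dots> \<le> exp (real j * ln 2)" 
      unfolding exp_le_cancel_iff by (rule mult_left_mono[OF ln2_ge_two_thirds]) simp
    also have "\<dots> = 2 ^ j" by (simp add: exp_of_nat_mult)
    finally have "1 / 2 ^ j \<le> 1 / exp (K / 32)" by (intro frac_le) auto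
    then have 1: "1 / 2 ^ j \<le> exp (- (K / 32))" by (simp add: exp_minus field_simps)
    have "80 * real (card W) * th t / \<sigma>\<^sup>2 \<le> 80 * (K * y ^ 4) * sqrt eps1 / \<sigma>\<^sup>2"
      using N_le th th0 K y_pos by (intro divide_right_mono mult_mono) auto
    also have "\<dots> = (80 / K ^ 19) * (y ^ 6 * sqrt eps1)"
    proof -
      have s2': "\<sigma>\<^sup>2 = K ^ 20 / y\<^sup>2" by (simp add: \<sigma>_def power_divide flip: power_mult)
      show ?thesis unfolding s2' pw using y_pos K by simp
    qed
    also have "\<dots> \<le> 1 * (y ^ 6 * sqrt eps1)" using Kbig eps1_pos y_pos K by (intro mult_right_mono) auto
    also have "\<dots> = 4 * (K\<^sup>2 * real n ^ 7 * exp (- (K / 32)))" unfolding sqrt_eps1 y6[symmetric] by (simp flip: power_add)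
    finally have 2: "80 * real (card W) * th t / \<sigma>\<^sup>2 \<le> 4 * (K\<^sup>2 * real n ^ 7 * exp (- (K / 32)))" .
    have 3: "1 * exp (- (K / 32)) \<le> (K\<^sup>2 * real n ^ 7) * exp (- (K / 32))"
      using mult_mono[of 1 "K\<^sup>2" 1 "real n ^ 7"] one_le_power[of K 2] one_le_power[of "real n" 7] K n_pos by (intro mult_right_mono) auto
    have tz: "tau = 10 * ((K\<^sup>2 * real n ^ 7) * exp (- (K / 32)))" by (simp add: tau_def)
    show ?thesis unfolding T_def tz by (rule two_tails_arith[OF 3 1 2])
  qed
  have dich: "hh t A > 1 + real (j + 1) * \<sigma> \<or> hh t A < 1 - real (j + 1) * \<sigma>" if A: "A \<in> S" "badp (rdeg A) t" for A
  proof (rule ccontr)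
    assume "\<not> ?thesis"
    then have le: "\<bar>hh t A - 1\<bar> \<le> 2 * (K ^ 11 / y)" using j\<sigma> unfolding e11 by (simp only: abs_le_iff) linarith
    define x where "x = hh t A - 1"
    have x: "\<bar>x\<bar> \<le> 2 * (K ^ 11 / y)" "\<bar>x\<bar> \<le> 1" using le e12 e1 K11 unfolding e11 x_def by linarith+
    have "(hh t A)\<^sup>2 - 1 = 2 * x + x * x" unfolding x_def by (simp add: power2_eq_square algebra_simps)
    moreover have "\<bar>x * x\<bar> \<le> \<bar>x\<bar> * 1" using x by (intro abs_mult_le) auto
    ultimately have "\<bar>(hh t A)\<^sup>2 - 1\<bar> \<le> 3 * \<bar>x\<bar>" by linarith
    then have l: "\<bar>(hh t A)\<^sup>2 - 1\<bar> \<le> eta" using x e12 K11 unfolding e11 eta_def by linarith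
    have pos: "rc (rdeg A) * ct t > 0" using rc_pos[OF A(1)] ct0[OF t] by simp
    have "(hh t A)\<^sup>2 = Ndeg (rdeg A) t * M / (rc (rdeg A) * ct t)" unfolding hh_sq[OF t A(1)] by (simp add: mult_ac)
    then have "(hh t A)\<^sup>2 - 1 = (Ndeg (rdeg A) t * M - rc (rdeg A) * ct t) / (rc (rdeg A) * ct t)"
      using pos rc_pos[OF A(1)] ct0[OF t] by (simp add: diff_divide_distrib)
    then have "\<bar>Ndeg (rdeg A) t * M - rc (rdeg A) * ct t\<bar> / (rc (rdeg A) * ct t) \<le> eta" using l pos by (simp add: abs_divide)
    then have "\<bar>Ndeg (rdeg A) t * M - rc (rdeg A) * ct t\<bar> \<le> eta * (rc (rdeg A) * ct t)" using pos by (simp add: divide_le_eq)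
    then show False using A(2) by (simp add: badp_def)
  qed
  let ?U = "{A. A \<in> S \<and> hh t A > 1 + real (j + 1) * \<sigma>}" and ?L = "{A \<in> S. hh t A < 1 - real (j + 1) * \<sigma>}"
  have sub: "{A. A \<in> S \<and> badp (rdeg A) t} \<subseteq> ?U \<union> ?L" using dich by blast
  have h0: "0 \<le> hh t A" if "A \<in> S" for A using sd.h_nonneg that by blast
  have disj: "?U \<inter> ?L = {}" using \<sigma>0 j1 by (auto simp: not_less) (smt (verit) mult_nonneg_nonneg of_nat_0_le_iff)
  have jj: "0 \<le> real (j + 1) * \<sigma>" using \<sigma>0 by simp
  have "(\<Sum>A\<in>?L. (hh t A)\<^sup>2) \<le> (\<Sum>A\<in>?L. 1)"
  proof (rule sum_mono)
    fix A assume A: "A \<in> ?L"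
    then have "0 \<le> hh t A" "hh t A \<le> 1" using h0 jj by auto
    then show "(hh t A)\<^sup>2 \<le> 1" by (simp add: abs_square_le_1)
  qed
  then have L1: "(\<Sum>A\<in>?L. (hh t A)\<^sup>2) \<le> T * M" using lo by simp
  have "(\<Sum>A | A \<in> S \<and> badp (rdeg A) t. (hh t A)\<^sup>2) \<le> (\<Sum>A\<in>?U \<union> ?L. (hh t A)\<^sup>2)"
    using sub by (intro sum_mono2) auto
  also have "\<dots> = (\<Sum>A\<in>?U. (hh t A)\<^sup>2) + (\<Sum>A\<in>?L. (hh t A)\<^sup>2)"
    using disj by (intro sum.union_disjoint) auto
  also have "\<dots> \<le> T * M + T * M" using up L1 by (intro add_mono)
  also have "\<dots> = (2 * T) * M" by simp
  also have "\<dots> \<le> tau * M" using T by (intro mult_right_mono) auto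
  finally show "(\<Sum>A | A \<in> S \<and> badp (rdeg A) t. (hh t A)\<^sup>2) \<le> tau * M" .
  have "real (card ?U) = (\<Sum>A\<in>?U. 1)" by simp
  also have "\<dots> \<le> (\<Sum>A\<in>?U. (hh t A)\<^sup>2)"
  proof (rule sum_mono)
    fix A assume A: "A \<in> ?U"
    then have "1 \<le> hh t A" using jj by auto
    then show "1 \<le> (hh t A)\<^sup>2" by (rule one_le_power)
  qed
  finally have U1: "real (card ?U) \<le> T * M" using up by linarith
  have "card {A \<in> S. badp (rdeg A) t} \<le> card (?U \<union> ?L)" using sub by (intro card_mono) auto
  also have "\<dots> \<le> card ?U + card ?L" by (rule card_Un_le)
  finally have "real (card {A \<in> S. badp (rdeg A) t}) \<le> T * M + T * M" using U1 lo by linarith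
  also have "\<dots> = (2 * T) * M" by simp
  also have "\<dots> \<le> tau * M" using T by (intro mult_right_mono) auto
  finally show "real (card {A \<in> S. badp (rdeg A) t}) \<le> tau * M" .
qed

lemma card_by_column:
  "real (card {E \<in> S. P E}) = (\<Sum>t\<in>cdeg ` S. real (card {E \<in> S. cdeg E = t \<and> P E}))"
proof -
  have "real (card {E \<in> S. P E}) = (\<Sum>E\<in>S. if P E then 1 else 0)" by (simp add: sum.If_cases Int_def)
  also have "\<dots> = (\<Sum>t\<in>cdeg ` S. \<Sum>E | E \<in> S \<and> cdeg E = t. if P E then 1 else 0)"
    by (rule sum.image_gen) simp
  also have "\<dots> = (\<Sum>t\<in>cdeg ` S. real (card {E \<in> S. cdeg E = t \<and> P E}))"
    by (intro sum.cong refl) (simp add: sum.If_cases Int_def conj_assoc)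
  finally show ?thesis .
qed

text \<open>Markov's inequality again, now over column sequences: writing \<open>eps1\<close> as a
  product of two square roots makes both the threshold and the exceptional mass small.\<close>

lemma card_bad_columns: "real (card {E \<in> S. \<not> th (cdeg E) \<le> sqrt eps1}) \<le> sqrt eps1 * M"
proof -
  define q where "q = sqrt eps1"
  have q: "q > 0" "q * q = eps1" using eps1_pos by (auto simp: q_def)
  have "q * real (card {E \<in> S. \<not> th (cdeg E) \<le> q}) = (\<Sum>t\<in>cdeg ` S. q * real (card {E \<in> S. cdeg E = t \<and> \<not> th (cdeg E) \<le> q}))"
    by (subst card_by_column) (rule sum_distrib_left)
  also have "\<dots> \<le> (\<Sum>t\<in>cdeg ` S. real (card {E \<in> S. cdeg E = t \<and> \<not> goodA (cdeg E) E}))"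
  proof (rule sum_mono)
    fix t assume t: "t \<in> cdeg ` S"
    then have ct: "ct t > 0" using ct_pos by auto
    have eq: "{E \<in> S. cdeg E = t \<and> \<not> goodA (cdeg E) E} = {E \<in> S. cdeg E = t \<and> \<not> goodA t E}" by auto
    show "q * real (card {E \<in> S. cdeg E = t \<and> \<not> th (cdeg E) \<le> q}) \<le> real (card {E \<in> S. cdeg E = t \<and> \<not> goodA (cdeg E) E})"
    proof (cases "th t \<le> q")
      case True
      then have e: "{E \<in> S. cdeg E = t \<and> \<not> th (cdeg E) \<le> q} = {}" by auto
      show ?thesis unfolding e by simp
    next
      case False
      then have "{E \<in> S. cdeg E = t \<and> \<not> th (cdeg E) \<le> q} = {E \<in> S. cdeg E = t}" by auto
      then have "q * real (card {E \<in> S. cdeg E = t \<and> \<not> th (cdeg E) \<le> q}) = q * ct t" by (simp add: ct_def)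
      also have "\<dots> \<le> th t * ct t" using False ct by (intro mult_right_mono) auto
      also have "\<dots> = real (card {E \<in> S. cdeg E = t \<and> \<not> goodA t E})" 
      proof -
        have "\<exists>E\<in>S. cdeg E = t" using t by auto
        then show ?thesis using ct by (simp add: th_def)
      qed
      finally show ?thesis unfolding eq .
    qed
  qed
  also have "\<dots> = real (card {E \<in> S. \<not> goodA (cdeg E) E})" by (rule card_by_column[symmetric])
  also have "\<dots> \<le> q * (q * M)" using card_bad q by (simp add: mult.assoc[symmetric])
  finally show ?thesis using q unfolding q_def[symmetric] by (simp add: mult_le_cancel_left_pos)
qed

definition rr :: real where "rr = 14 * K\<^sup>2 * real n ^ 7 * exp (- (K / 32))"

lemma tau_rr: "tau + sqrt eps1 \<le> rr" "0 \<le> tau"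
proof -
  have "K\<^sup>2 * real n ^ 4 * exp (- (K / 32)) \<le> K\<^sup>2 * real n ^ 7 * exp (- (K / 32))"
    using n_pos by (intro mult_right_mono mult_left_mono power_increasing) auto
  then show "tau + sqrt eps1 \<le> rr" unfolding tau_def rr_def sqrt_eps1 by simp
qed (simp add: tau_def)

text \<open>In the first bound exceptional columns are charged by their mass in the graph model. In
  the second the rows come from \<open>A\<close> and the columns from an independent
  \<open>E\<close>, and an exceptional column costs all \<open>M\<close> choices of
  \<open>A\<close>.\<close>

theorem fixed_edges:
  assumes big12: "K ^ 12 \<le> y" and hexp: "eps1 * real n ^ 6 \<le> 1"
  shows "real (card {E \<in> S. badp (rdeg E) (cdeg E)}) \<le> rr * M"
    "(\<Sum>E\<in>S. real (card {A \<in> S. badp (rdeg A) (cdeg E)})) \<le> rr * M\<^sup>2"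
proof -
  define q where "q = sqrt eps1"
  let ?H = "{E \<in> S. \<not> th (cdeg E) \<le> q}"
  have H: "real (card ?H) \<le> q * M" using card_bad_columns by (simp add: q_def)
  let ?B = "{E \<in> S. badp (rdeg E) (cdeg E)}" and ?B' = "{E \<in> S. badp (rdeg E) (cdeg E) \<and> th (cdeg E) \<le> q}"
  have "card ?B \<le> card (?H \<union> ?B')" by (intro card_mono) auto
  also have "\<dots> \<le> card ?H + card ?B'" by (rule card_Un_le)
  finally have 1: "real (card ?B) \<le> q * M + real (card ?B')" using H by linarith
  have "real (card ?B') = (\<Sum>t\<in>cdeg ` S. real (card {E \<in> S. cdeg E = t \<and> (badp (rdeg E) (cdeg E) \<and> th (cdeg E) \<le> q)}))"
    by (rule card_by_column)
  also have "\<dots> \<le> (\<Sum>t\<in>cdeg ` S. tau * ct t)"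
  proof (rule sum_mono)
    fix t assume "t \<in> cdeg ` S"
    then have t: "\<exists>E\<in>S. cdeg E = t" by auto
    have ct: "ct t > 0" using ct0[OF t] .
    show "real (card {E \<in> S. cdeg E = t \<and> (badp (rdeg E) (cdeg E) \<and> th (cdeg E) \<le> q)}) \<le> tau * ct t"
    proof (cases "th t \<le> q")
      case False
      then have "{E \<in> S. cdeg E = t \<and> (badp (rdeg E) (cdeg E) \<and> th (cdeg E) \<le> q)} = {}" by auto
      then show ?thesis using ct tau_rr by (simp only: card.empty) simp
    next
      case True
      then have eq: "{E \<in> S. cdeg E = t \<and> (badp (rdeg E) (cdeg E) \<and> th (cdeg E) \<le> q)} = {E \<in> S. cdeg E = t \<and> badp (rdeg E) t}" by auto
      have "(M / ct t) * real (card {E \<in> S. cdeg E = t \<and> badp (rdeg E) t}) \<le> tau * M"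
        using bad_for_column(1)[OF t _ big12 hexp] True sum_hh[OF t, of "\<lambda>s. badp s t"] by (simp add: q_def)
      then show ?thesis unfolding eq using ct M_pos by (simp add: field_simps)
    qed
  qed
  also have "\<dots> = tau * (\<Sum>t\<in>cdeg ` S. ct t)" by (simp add: sum_distrib_left)
  also have "(\<Sum>t\<in>cdeg ` S. ct t) = M" using card_by_column[of "\<lambda>_. True"] cardS by (simp add: ct_def)
  finally have "real (card ?B) \<le> (tau + q) * M" using 1 by (simp add: algebra_simps)
  also have "\<dots> \<le> rr * M" using tau_rr by (intro mult_right_mono) (auto simp: q_def)
  finally show "real (card ?B) \<le> rr * M" .
  have "(\<Sum>E\<in>S. real (card {A \<in> S. badp (rdeg A) (cdeg E)})) \<le> (\<Sum>E\<in>S. tau * M + (if \<not> th (cdeg E) \<le> q then M else 0))"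
  proof (rule sum_mono)
    fix E assume E: "E \<in> S"
    then have t: "\<exists>E'\<in>S. cdeg E' = cdeg E" by auto
    show "real (card {A \<in> S. badp (rdeg A) (cdeg E)}) \<le> tau * M + (if \<not> th (cdeg E) \<le> q then M else 0)"
    proof (cases "th (cdeg E) \<le> q")
      case True
      then show ?thesis using bad_for_column(2)[OF t _ big12 hexp] by (simp add: q_def)
    next
      case False
      have "card {A \<in> S. badp (rdeg A) (cdeg E)} \<le> card S" by (intro card_mono) auto
      then have "real (card {A \<in> S. badp (rdeg A) (cdeg E)}) \<le> M" using cardS by linarith
      moreover have "0 \<le> tau * M" using tau_rr by simp
      ultimately show ?thesis using False by simp
    qed
  qed
  also have "\<dots> = M * (tau * M) + real (card ?H) * M"
    unfolding sum.distrib using cardS by (simp add: sum.If_cases Int_def)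
  also have "\<dots> \<le> M * (tau * M) + (q * M) * M" using H by (intro add_left_mono mult_right_mono) auto
  also have "\<dots> = (tau + q) * M\<^sup>2" by (simp add: algebra_simps power2_eq_square)
  also have "\<dots> \<le> rr * M\<^sup>2" using tau_rr by (intro mult_right_mono) (auto simp: q_def)
  finally show "(\<Sum>E\<in>S. real (card {A \<in> S. badp (rdeg A) (cdeg E)})) \<le> rr * M\<^sup>2" .
qed

end

section \<open>Closeness of distributions\<close>

text \<open>The exceptional set must be small under both measures, since both masses enter the
  comparison of expectations; pointwise closeness off \<open>B\<close> would bound the
  \<open>Q\<close>-mass of \<open>B\<close> only up to order \<open>\<eta>\<close>, not by an
  exponentially small quantity.\<close>

definition close_pmf :: "'a set \<Rightarrow> 'a pmf \<Rightarrow> 'a pmf \<Rightarrow> real \<Rightarrow> real \<Rightarrow> bool" where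
  "close_pmf \<Omega> P Q \<eta> r \<longleftrightarrow> set_pmf P \<subseteq> \<Omega> \<and> set_pmf Q \<subseteq> \<Omega> \<and>
     (\<exists>B\<subseteq>\<Omega>. measure_pmf.prob P B \<le> r \<and> measure_pmf.prob Q B \<le> r \<and>
        (\<forall>\<omega>\<in>\<Omega> - B. \<bar>pmf P \<omega> - pmf Q \<omega>\<bar> \<le> \<eta> * pmf Q \<omega>))"

text \<open>Formulated for nonnegative functions rather than probability mass functions, so that it
  also applies to products of point masses in \<open>close_variance\<close>.\<close>

lemma close_sum:
  fixes f g X :: "'a \<Rightarrow> real"
  assumes fin: "finite \<Omega>" and B: "B \<subseteq> \<Omega>" and nn: "\<And>\<omega>. \<omega> \<in> \<Omega> \<Longrightarrow> 0 \<le> f \<omega> \<and> 0 \<le> g \<omega>"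
    and fB: "sum f B \<le> r" "sum g B \<le> r" and close: "\<And>\<omega>. \<omega> \<in> \<Omega> - B \<Longrightarrow> \<bar>f \<omega> - g \<omega>\<bar> \<le> \<eta> * g \<omega>" and \<eta>: "0 \<le> \<eta>"
    and X: "\<And>\<omega>. \<omega> \<in> \<Omega> \<Longrightarrow> \<bar>X \<omega>\<bar> \<le> C" and C0: "0 \<le> C"
  shows "\<bar>(\<Sum>\<omega>\<in>\<Omega>. f \<omega> * X \<omega>) - (\<Sum>\<omega>\<in>\<Omega>. g \<omega> * X \<omega>)\<bar> \<le> \<eta> * (\<Sum>\<omega>\<in>\<Omega>. g \<omega> * \<bar>X \<omega>\<bar>) + 2 * r * C"
proof -
  have finB: "finite B" using B fin by (rule finite_subset)
  have "\<bar>(\<Sum>\<omega>\<in>\<Omega>. f \<omega> * X \<omega>) - (\<Sum>\<omega>\<in>\<Omega>. g \<omega> * X \<omega>)\<bar> = \<bar>\<Sum>\<omega>\<in>\<Omega>. (f \<omega> - g \<omega>) * X \<omega>\<bar>"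
    by (simp add: left_diff_distrib sum_subtractf)
  also have "\<dots> \<le> (\<Sum>\<omega>\<in>\<Omega>. \<bar>(f \<omega> - g \<omega>) * X \<omega>\<bar>)" by (rule sum_abs)
  also have "\<dots> \<le> (\<Sum>\<omega>\<in>\<Omega>. \<eta> * (g \<omega> * \<bar>X \<omega>\<bar>) + (if \<omega> \<in> B then (f \<omega> + g \<omega>) * C else 0))"
  proof (rule sum_mono)
    fix \<omega> assume w: "\<omega> \<in> \<Omega>"
    show "\<bar>(f \<omega> - g \<omega>) * X \<omega>\<bar> \<le> \<eta> * (g \<omega> * \<bar>X \<omega>\<bar>) + (if \<omega> \<in> B then (f \<omega> + g \<omega>) * C else 0)"
    proof (cases "\<omega> \<in> B")
      case True
      have "\<bar>f \<omega> - g \<omega>\<bar> \<le> f \<omega> + g \<omega>" using nn[OF w] by (auto simp: abs_le_iff)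
      then have "\<bar>(f \<omega> - g \<omega>) * X \<omega>\<bar> \<le> (f \<omega> + g \<omega>) * C" using X[OF w] by (rule abs_mult_le)
      moreover have "0 \<le> \<eta> * (g \<omega> * \<bar>X \<omega>\<bar>)" using \<eta> nn[OF w] by simp
      ultimately show ?thesis using True by simp
    next
      case False
      then have "\<bar>f \<omega> - g \<omega>\<bar> * \<bar>X \<omega>\<bar> \<le> (\<eta> * g \<omega>) * \<bar>X \<omega>\<bar>" using close w by (intro mult_right_mono) auto
      then show ?thesis using False by (simp add: abs_mult mult.assoc)
    qed
  qed
  also have "\<dots> = \<eta> * (\<Sum>\<omega>\<in>\<Omega>. g \<omega> * \<bar>X \<omega>\<bar>) + (\<Sum>\<omega>\<in>B. (f \<omega> + g \<omega>) * C)"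
  proof -
    have "(\<Sum>\<omega>\<in>\<Omega>. if \<omega> \<in> B then (f \<omega> + g \<omega>) * C else 0) = (\<Sum>\<omega>\<in>B. (f \<omega> + g \<omega>) * C)"
      using fin B by (intro sum.mono_neutral_cong_right) auto
    then show ?thesis by (simp add: sum.distrib sum_distrib_left)
  qed
  also have "(\<Sum>\<omega>\<in>B. (f \<omega> + g \<omega>) * C) \<le> 2 * r * C"
  proof -
    have "(\<Sum>\<omega>\<in>B. (f \<omega> + g \<omega>) * C) = (sum f B + sum g B) * C" by (simp add: sum.distrib sum_distrib_right[symmetric])
    also have "\<dots> \<le> (2 * r) * C" using fB C0 by (intro mult_right_mono) auto
    finally show ?thesis .
  qed
  finally show ?thesis by simp
qed

lemma prob_finite_support:
  assumes "finite \<Omega>" "set_pmf P \<subseteq> \<Omega>" "E \<subseteq> \<Omega>"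
  shows "measure_pmf.prob P E = sum (pmf P) E"
proof -
  have "finite E" using assms(3,1) by (rule finite_subset)
  then show ?thesis by (rule measure_measure_pmf_finite)
qed

lemma expectation_finite_support:
  fixes X :: "'a \<Rightarrow> real"
  assumes "finite \<Omega>" "set_pmf P \<subseteq> \<Omega>"
  shows "measure_pmf.expectation P X = (\<Sum>\<omega>\<in>\<Omega>. pmf P \<omega> * X \<omega>)"
  using assms by (subst integral_measure_pmf_real[of \<Omega>]) (auto simp: mult.commute)

lemma close_event:
  assumes fin: "finite \<Omega>" and cl: "close_pmf \<Omega> P Q \<eta> r" and \<eta>: "0 \<le> \<eta>" and E: "E \<subseteq> \<Omega>"
  shows "\<bar>measure_pmf.prob P E - measure_pmf.prob Q E\<bar> \<le> \<eta> * measure_pmf.prob Q E + 2 * r"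
proof -
  obtain B where B: "B \<subseteq> \<Omega>" "measure_pmf.prob P B \<le> r" "measure_pmf.prob Q B \<le> r"
    "\<forall>\<omega>\<in>\<Omega> - B. \<bar>pmf P \<omega> - pmf Q \<omega>\<bar> \<le> \<eta> * pmf Q \<omega>" and s: "set_pmf P \<subseteq> \<Omega>" "set_pmf Q \<subseteq> \<Omega>"
    using cl unfolding close_pmf_def by blast
  have ind: "measure_pmf.prob R E = (\<Sum>\<omega>\<in>\<Omega>. pmf R \<omega> * of_bool (\<omega> \<in> E))" if "set_pmf R \<subseteq> \<Omega>" for R :: "'a pmf"
    unfolding prob_finite_support[OF fin that E] using fin E by (intro sum.mono_neutral_cong_left) auto
  have "\<bar>(\<Sum>\<omega>\<in>\<Omega>. pmf P \<omega> * of_bool (\<omega> \<in> E)) - (\<Sum>\<omega>\<in>\<Omega>. pmf Q \<omega> * of_bool (\<omega> \<in> E))\<bar>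
     \<le> \<eta> * (\<Sum>\<omega>\<in>\<Omega>. pmf Q \<omega> * \<bar>of_bool (\<omega> \<in> E)\<bar>) + 2 * r * 1"
    using B by (intro close_sum[OF fin B(1)]) (auto simp: prob_finite_support[OF fin] s \<eta>)
  then show ?thesis unfolding ind[OF s(1)] ind[OF s(2)] by simp
qed

lemma close_expectation:
  fixes X :: "'a \<Rightarrow> real"
  assumes fin: "finite \<Omega>" "\<Omega> \<noteq> {}" and cl: "close_pmf \<Omega> P Q \<eta> r" and \<eta>: "0 \<le> \<eta>"
  shows "\<bar>measure_pmf.expectation P X - measure_pmf.expectation Q X\<bar> \<le>
     \<eta> * measure_pmf.expectation Q (\<lambda>\<omega>. \<bar>X \<omega>\<bar>) + 2 * r * Max ((\<lambda>\<omega>. \<bar>X \<omega>\<bar>) ` \<Omega>)"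
proof -
  obtain B where B: "B \<subseteq> \<Omega>" "measure_pmf.prob P B \<le> r" "measure_pmf.prob Q B \<le> r"
    "\<forall>\<omega>\<in>\<Omega> - B. \<bar>pmf P \<omega> - pmf Q \<omega>\<bar> \<le> \<eta> * pmf Q \<omega>" and s: "set_pmf P \<subseteq> \<Omega>" "set_pmf Q \<subseteq> \<Omega>"
    using cl unfolding close_pmf_def by blast
  have M0: "0 \<le> Max ((\<lambda>\<omega>. \<bar>X \<omega>\<bar>) ` \<Omega>)" using fin by (subst Max_ge_iff) auto
  show ?thesis
    unfolding expectation_finite_support[OF fin(1) s(1)] expectation_finite_support[OF fin(1) s(2)]
    using B by (intro close_sum[OF fin(1) B(1)]) (auto simp: prob_finite_support[OF fin(1)] s \<eta> fin M0)
qed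

text \<open>The double sum removes the mean, which differs between the two measures, and has
  nonnegative terms; a relative error of the weights then becomes a relative error of the
  variance.\<close>

lemma variance_double_sum:
  fixes X :: "'a \<Rightarrow> real"
  assumes fin: "finite \<Omega>" and s: "set_pmf P \<subseteq> \<Omega>"
  shows "2 * measure_pmf.variance P X = (\<Sum>(u, v)\<in>\<Omega> \<times> \<Omega>. (pmf P u * pmf P v) * (X u - X v)\<^sup>2)"
proof -
  have one: "(\<Sum>\<omega>\<in>\<Omega>. pmf P \<omega>) = 1" using sum_pmf_eq_1[OF fin s] .
  define \<mu> where "\<mu> = measure_pmf.expectation P X"
  have mu: "\<mu> = (\<Sum>\<omega>\<in>\<Omega>. pmf P \<omega> * X \<omega>)" unfolding \<mu>_def by (rule expectation_finite_support[OF fin s])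
  define Y where "Y = (\<lambda>\<omega>. X \<omega> - \<mu>)"
  have Y0: "(\<Sum>\<omega>\<in>\<Omega>. pmf P \<omega> * Y \<omega>) = 0"
    unfolding Y_def by (simp add: right_diff_distrib sum_subtractf mu sum_distrib_right[symmetric] one)
  define V where "V = (\<Sum>\<omega>\<in>\<Omega>. pmf P \<omega> * (Y \<omega>)\<^sup>2)"
  have V: "measure_pmf.variance P X = V"
    unfolding V_def Y_def \<mu>_def by (rule expectation_finite_support[OF fin s])
  have "(\<Sum>(u, v)\<in>\<Omega> \<times> \<Omega>. (pmf P u * pmf P v) * (X u - X v)\<^sup>2) = (\<Sum>u\<in>\<Omega>. \<Sum>v\<in>\<Omega>. (pmf P u * pmf P v) * (Y u - Y v)\<^sup>2)"
    by (simp add: sum.cartesian_product Y_def)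
  also have "\<dots> = (\<Sum>u\<in>\<Omega>. pmf P u * (Y u)\<^sup>2 * (\<Sum>v\<in>\<Omega>. pmf P v) - 2 * (pmf P u * Y u) * (\<Sum>v\<in>\<Omega>. pmf P v * Y v) + pmf P u * V)"
    unfolding V_def sum_distrib_left sum.distrib[symmetric] sum_subtractf[symmetric]
    by (intro sum.cong refl) (simp add: power2_eq_square algebra_simps)
  also have "\<dots> = (\<Sum>u\<in>\<Omega>. pmf P u * (Y u)\<^sup>2) + (\<Sum>u\<in>\<Omega>. pmf P u) * V"
    by (simp add: one Y0 sum.distrib flip: sum_distrib_right)
  finally show ?thesis by (simp add: one V V_def)
qed

text \<open>\<open>close_sum\<close> on pairs: the relative errors combine to
  \<open>2 * \<eta> + \<eta>\<^sup>2 \<le> 3 * \<eta>\<close>, a pair is bad if one entry is, with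
  mass at most \<open>2 * r\<close>, and \<open>(X u - X v)\<^sup>2\<close> is at most four times
  the maximum of \<open>X\<^sup>2\<close>.\<close>

lemma close_variance:
  fixes X :: "'a \<Rightarrow> real"
  assumes fin: "finite \<Omega>" "\<Omega> \<noteq> {}" and cl: "close_pmf \<Omega> P Q \<eta> r" and \<eta>: "0 \<le> \<eta>" "\<eta> \<le> 1"
  shows "\<bar>measure_pmf.variance P X - measure_pmf.variance Q X\<bar> \<le>
     3 * \<eta> * measure_pmf.variance Q X + 8 * r * Max ((\<lambda>\<omega>. (X \<omega>)\<^sup>2) ` \<Omega>)"
proof -
  obtain B where B: "B \<subseteq> \<Omega>" "measure_pmf.prob P B \<le> r" "measure_pmf.prob Q B \<le> r"
    and cl': "\<And>\<omega>. \<omega> \<in> \<Omega> - B \<Longrightarrow> \<bar>pmf P \<omega> - pmf Q \<omega>\<bar> \<le> \<eta> * pmf Q \<omega>" and s: "set_pmf P \<subseteq> \<Omega>" "set_pmf Q \<subseteq> \<Omega>"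
    using cl unfolding close_pmf_def by blast
  define C where "C = Max ((\<lambda>\<omega>. (X \<omega>)\<^sup>2) ` \<Omega>)"
  have XC: "(X \<omega>)\<^sup>2 \<le> C" if "\<omega> \<in> \<Omega>" for \<omega> unfolding C_def using fin that by (intro Max_ge) auto
  have C0: "0 \<le> C" unfolding C_def using fin by (subst Max_ge_iff) auto
  let ?O2 = "\<Omega> \<times> \<Omega>" and ?B2 = "B \<times> \<Omega> \<union> \<Omega> \<times> B"
  let ?f = "\<lambda>(u, v). pmf P u * pmf P v" and ?g = "\<lambda>(u, v). pmf Q u * pmf Q v" and ?Z = "\<lambda>(u, v). (X u - X v)\<^sup>2"
  have finB: "finite B" using B(1) fin(1) by (rule finite_subset)
  have bad: "sum (\<lambda>(u, v). pmf R u * pmf R v) ?B2 \<le> 2 * r" if "set_pmf R \<subseteq> \<Omega>" "measure_pmf.prob R B \<le> r" for R :: "'a pmf"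
  proof -
    have one: "(\<Sum>\<omega>\<in>\<Omega>. pmf R \<omega>) = 1" using sum_pmf_eq_1[OF fin(1) that(1)] .
    have rB: "sum (pmf R) B \<le> r" using that(2) finB by (simp add: measure_measure_pmf_finite)
    have "sum (\<lambda>(u, v). pmf R u * pmf R v) ?B2 \<le> sum (\<lambda>(u, v). pmf R u * pmf R v) (B \<times> \<Omega>) + sum (\<lambda>(u, v). pmf R u * pmf R v) (\<Omega> \<times> B)"
      using fin finB by (subst sum.union_inter[symmetric]) (auto intro!: sum_nonneg)
    also have "\<dots> = sum (pmf R) B * sum (pmf R) \<Omega> + sum (pmf R) \<Omega> * sum (pmf R) B"
      by (simp only: sum_product sum.cartesian_product)
    finally show ?thesis using rB one by simp
  qed
  have "\<bar>(\<Sum>z\<in>?O2. ?f z * ?Z z) - (\<Sum>z\<in>?O2. ?g z * ?Z z)\<bar> \<le> (3 * \<eta>) * (\<Sum>z\<in>?O2. ?g z * \<bar>?Z z\<bar>) + 2 * (2 * r) * (4 * C)"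
  proof (rule close_sum[where B = ?B2])
    show "sum ?f ?B2 \<le> 2 * r" "sum ?g ?B2 \<le> 2 * r" using bad[OF s(1) B(2)] bad[OF s(2) B(3)] by auto
    show "\<bar>?f z - ?g z\<bar> \<le> 3 * \<eta> * ?g z" if z: "z \<in> ?O2 - ?B2" for z
    proof -
      obtain u v where uv: "z = (u, v)" "u \<in> \<Omega> - B" "v \<in> \<Omega> - B" using z by auto
      let ?a = "pmf P u - pmf Q u" and ?b = "pmf P v - pmf Q v"
      have "?f z - ?g z = ?a * pmf Q v + pmf Q u * ?b + ?a * ?b" unfolding uv by (simp add: algebra_simps)
      moreover have "\<bar>?a * pmf Q v\<bar> \<le> (\<eta> * pmf Q u) * pmf Q v" "\<bar>pmf Q u * ?b\<bar> \<le> pmf Q u * (\<eta> * pmf Q v)"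
        "\<bar>?a * ?b\<bar> \<le> (\<eta> * pmf Q u) * (\<eta> * pmf Q v)"
        using cl'[OF uv(2)] cl'[OF uv(3)] by (intro abs_mult_le; simp)+
      moreover have "(\<eta> * pmf Q u) * (\<eta> * pmf Q v) \<le> (\<eta> * pmf Q u) * (1 * pmf Q v)"
        using \<eta> by (intro mult_left_mono mult_right_mono) auto
      ultimately show ?thesis unfolding uv by (simp add: abs_le_iff algebra_simps)
    qed
    show "\<bar>?Z z\<bar> \<le> 4 * C" if z: "z \<in> ?O2" for z
    proof -
      obtain u v where uv: "z = (u, v)" "u \<in> \<Omega>" "v \<in> \<Omega>" using z by auto
      have "(X u - X v)\<^sup>2 + (X u + X v)\<^sup>2 = 2 * (X u)\<^sup>2 + 2 * (X v)\<^sup>2" by (simp add: power2_eq_square algebra_simps)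
      then have "(X u - X v)\<^sup>2 \<le> 2 * (X u)\<^sup>2 + 2 * (X v)\<^sup>2" using zero_le_power2[of "X u + X v"] by linarith
      then show ?thesis using XC[OF uv(2)] XC[OF uv(3)] unfolding uv by simp
    qed
  qed (use fin B \<eta> C0 in auto)
  moreover have v: "2 * measure_pmf.variance R X = (\<Sum>z\<in>?O2. (case z of (u, v) \<Rightarrow> pmf R u * pmf R v) * ?Z z)" if "set_pmf R \<subseteq> \<Omega>" for R :: "'a pmf"
    unfolding variance_double_sum[OF fin(1) that] by (simp add: split_def)
  moreover have "(\<Sum>z\<in>?O2. ?g z * \<bar>?Z z\<bar>) = (\<Sum>z\<in>?O2. ?g z * ?Z z)" by (intro sum.cong) auto
  ultimately have "\<bar>2 * measure_pmf.variance P X - 2 * measure_pmf.variance Q X\<bar> \<le> 3 * \<eta> * (2 * measure_pmf.variance Q X) + 16 * r * C"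
    unfolding v[OF s(1)] v[OF s(2)] by simp
  then show ?thesis unfolding C_def[symmetric] by (simp add: abs_le_iff)
qed

lemma bip_cells: "bip_edges m n = cells False m n" "dir_edges n = cells True n n"
  by (auto simp: bip_edges_def dir_edges_def cells_def)

definition Bk :: "bool \<Rightarrow> nat \<Rightarrow> nat \<Rightarrow> nat \<Rightarrow> degrees pmf" where
  "Bk D m n k = (if D then B_k_dir n k else B_k m n k)"

lemma pmf_Bk:
  assumes D: "D \<Longrightarrow> m = n" and k: "k \<le> card (cells D m n)"
  shows "pmf (Bk D m n k) (s, t) =
    (if (s, t) \<in> deg_space m n \<and> (\<Sum>i<m. s i) = k \<and> (\<Sum>j<n. t j) = k
     then real (\<Prod>i<m. (n - of_bool D) choose s i) * real (\<Prod>j<n. (m - of_bool D) choose t j) / real (card (cells D m n) choose k) ^ 2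
     else 0)"
proof (cases D)
  case True
  then have mn: "m = n" by (rule D)
  have e: "card (cells D m n) = n ^ 2 - n" using card_cells[OF D] True mn by (simp add: power2_eq_square diff_mult_distrib2)
  show ?thesis using pmf_B_k_dir[of k n s t] k unfolding e Bk_def using True mn by simp
next
  case False
  have e: "card (cells D m n) = m * n" using card_cells[OF D] False by simp
  show ?thesis using pmf_B_k[of k m n s t] k unfolding e Bk_def using False by simp
qed

lemma deg_space_degrees: "E \<subseteq> cells D m n \<Longrightarrow> (rdeg E, cdeg F) \<in> deg_space m n" if "F \<subseteq> cells D m n"
proof -
  assume E: "E \<subseteq> cells D m n"
  have r: "rdeg E i \<le> n" for i unfolding rdeg_eq using card_mono[OF _ cells_row[OF E, of i]] by simp
  have c: "cdeg F j \<le> m" for j unfolding cdeg_eq using card_mono[OF _ cells_col[OF that, of j]] by simp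
  have r0: "rdeg E i = 0" if "\<not> i < m" for i
  proof -
    have "{j. (i, j) \<in> E} = {}" using E that by (auto simp: cells_def)
    then show ?thesis unfolding rdeg_eq by simp
  qed
  have c0: "cdeg F j = 0" if "\<not> j < n" for j
  proof -
    have "{i. (i, j) \<in> F} = {}" using \<open>F \<subseteq> cells D m n\<close> that by (auto simp: cells_def)
    then show ?thesis unfolding cdeg_eq by simp
  qed
  show "(rdeg E, cdeg F) \<in> deg_space m n" unfolding deg_space_def PiE_dflt_def using r c r0 c0 by auto
qed

lemma edge_unif_slice: "edge_unif W k = map_pmf degrees_of (pmf_of_set (slice W k))"
  by (simp add: edge_unif_def slice_def)

lemma prob_map_pmf_of_set:
  assumes "finite A" "A \<noteq> {}"
  shows "measure_pmf.prob (map_pmf f (pmf_of_set A)) B = real (card {x \<in> A. f x \<in> B}) / real (card A)"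
proof -
  have "A \<inter> f -` B = {x \<in> A. f x \<in> B}" by auto
  then show ?thesis using assms by (simp add: measure_map_pmf measure_pmf_of_set)
qed

lemma pmf_map_pmf_of_set:
  assumes "finite A" "A \<noteq> {}"
  shows "pmf (map_pmf f (pmf_of_set A)) w = real (card {x \<in> A. f x = w}) / real (card A)"
  using prob_map_pmf_of_set[OF assms, of f "{w}"] by (simp add: measure_pmf_single)

lemma slice_nonempty: "finite W \<Longrightarrow> k \<le> card W \<Longrightarrow> slice W k \<noteq> {}"
  using card_slice[of W k] by (metis binomial_eq_0_iff card.empty not_less)

lemma slice_rows_fibre:
  assumes "(\<Sum>i<m. s i) = k"
  shows "{E \<in> slice (cells D m n) k. rdeg E = s} = fibre (Pow (cells D m n)) rdeg s"
  using assms by (auto simp: slice_def fibre_def sum_rdeg)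

lemma slice_cols_fibre:
  assumes "(\<Sum>j<n. t j) = k"
  shows "{E \<in> slice (cells D m n) k. cdeg E = t} = fibre (Pow (cells D m n)) cdeg t"
  using assms by (auto simp: slice_def fibre_def sum_cdeg)

text \<open>Take the rows of one uniform edge set and the columns of another, independent one: the
  fibre counts are the two products of binomials.\<close>

lemma Bk_eq_map:
  assumes D: "D \<Longrightarrow> m = n" and k: "k \<le> card (cells D m n)"
  defines "S \<equiv> slice (cells D m n) k"
  shows "Bk D m n k = map_pmf (\<lambda>(A, E). (rdeg A, cdeg E)) (pmf_of_set (S \<times> S))"
proof (rule pmf_eqI)
  fix w :: degrees
  obtain s t where w: "w = (s, t)" by (cases w)
  have fS: "finite S" "S \<noteq> {}" "card S = card (cells D m n) choose k"
    using slice_nonempty[OF _ k] by (auto simp: S_def card_slice)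
  have "{x \<in> S \<times> S. (case x of (A, E) \<Rightarrow> (rdeg A, cdeg E)) = w} = {A \<in> S. rdeg A = s} \<times> {E \<in> S. cdeg E = t}"
    unfolding w by auto
  then have R: "pmf (map_pmf (\<lambda>(A, E). (rdeg A, cdeg E)) (pmf_of_set (S \<times> S))) w =
     real (card {A \<in> S. rdeg A = s}) * real (card {E \<in> S. cdeg E = t}) / real (card (cells D m n) choose k) ^ 2"
    using fS by (subst pmf_map_pmf_of_set) (auto simp: card_cartesian_product power2_eq_square)
  show "pmf (Bk D m n k) w = pmf (map_pmf (\<lambda>(A, E). (rdeg A, cdeg E)) (pmf_of_set (S \<times> S))) w"
  proof (cases "(s, t) \<in> deg_space m n \<and> (\<Sum>i<m. s i) = k \<and> (\<Sum>j<n. t j) = k")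
    case True
    then have s0: "\<And>i. i \<ge> m \<Longrightarrow> s i = 0" and t0: "\<And>j. j \<ge> n \<Longrightarrow> t j = 0"
      by (auto simp: deg_space_def PiE_dflt_def)
    have e1: "card {A \<in> S. rdeg A = s} = (\<Prod>i<m. (n - of_bool D) choose s i)"
      unfolding S_def using True card_row_fibre[OF D s0] by (simp add: slice_rows_fibre)
    have e2: "card {E \<in> S. cdeg E = t} = (\<Prod>j<n. (m - of_bool D) choose t j)"
      unfolding S_def using True card_col_fibre[OF D t0] by (simp add: slice_cols_fibre)
    show ?thesis unfolding R e1 e2 unfolding w by (subst pmf_Bk[OF D k]) (simp_all only: True if_True simp_thms)
  next
    case False
    have "{A \<in> S. rdeg A = s} = {} \<or> {E \<in> S. cdeg E = t} = {}"
    proof (rule ccontr)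
      assume "\<not> ?thesis"
      then obtain A E where "A \<in> S" "rdeg A = s" "E \<in> S" "cdeg E = t" by auto
      then show False using False deg_space_degrees[of E D m n A] sum_rdeg[of A D m n] sum_cdeg[of E D m n]
        by (auto simp: S_def slice_def)
    qed
    then have z: "real (card {A \<in> S. rdeg A = s}) * real (card {E \<in> S. cdeg E = t}) = 0"
    proof
      assume e: "{A \<in> S. rdeg A = s} = {}"
      show ?thesis unfolding e by simp
    next
      assume e: "{E \<in> S. cdeg E = t} = {}"
      show ?thesis unfolding e by simp
    qed
    show ?thesis unfolding R z unfolding w by (subst pmf_Bk[OF D k]) (simp_all only: False if_False div_0)
  qed
qed

context dense begin

theorem close_fixed_edges:
  assumes big12: "K ^ 12 \<le> y" and hexp: "eps1 * real n ^ 6 \<le> 1"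
  shows "close_pmf (deg_space m n) (edge_unif W k) (Bk D m n k) eta rr"
proof -
  have ne: "S \<noteq> {}" using slice_nonempty[OF finite_cells k_le] .
  let ?P = "edge_unif W k" and ?Q = "Bk D m n k"
  define B where "B = {w \<in> deg_space m n. \<not> \<bar>pmf ?P w - pmf ?Q w\<bar> \<le> eta * pmf ?Q w}"
  have Q: "?Q = map_pmf (\<lambda>(A, E). (rdeg A, cdeg E)) (pmf_of_set (S \<times> S))" by (rule Bk_eq_map[OF D k_le])
  have cS: "real (card S) = M" by (rule cardS)
  have pP: "pmf ?P (s, t) = Ndeg s t / M" for s t
    unfolding edge_unif_slice pmf_map_pmf_of_set[OF finS ne] cS Ndeg_def by (simp add: degrees_of_eq)
  have pQ: "pmf ?Q (s, t) = rc s * ct t / M\<^sup>2" for s t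
  proof -
    have "{x \<in> S \<times> S. (case x of (A, E) \<Rightarrow> (rdeg A, cdeg E)) = (s, t)} = {A \<in> S. rdeg A = s} \<times> {E \<in> S. cdeg E = t}" by auto
    then show ?thesis unfolding Q using finS ne cS
      by (subst pmf_map_pmf_of_set) (auto simp: card_cartesian_product power2_eq_square rc_def ct_def)
  qed
  have bad: "badp s t" if "(s, t) \<in> B" for s t
  proof (rule ccontr)
    assume "\<not> badp s t"
    then have "\<bar>Ndeg s t * M - rc s * ct t\<bar> / M\<^sup>2 \<le> (eta * (rc s * ct t)) / M\<^sup>2"
      unfolding badp_def by (intro divide_right_mono) auto
    moreover have "Ndeg s t / M - rc s * ct t / M\<^sup>2 = (Ndeg s t * M - rc s * ct t) / M\<^sup>2"
      using M_pos by (simp add: diff_divide_distrib power2_eq_square)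
    ultimately have "\<bar>Ndeg s t / M - rc s * ct t / M\<^sup>2\<bar> \<le> eta * (rc s * ct t / M\<^sup>2)" by simp
    moreover have "\<not> \<bar>pmf ?P (s, t) - pmf ?Q (s, t)\<bar> \<le> eta * pmf ?Q (s, t)" using that unfolding B_def by blast
    ultimately show False unfolding pP pQ by blast
  qed
  have "card {E \<in> S. degrees_of E \<in> B} \<le> card {E \<in> S. badp (rdeg E) (cdeg E)}"
    using bad by (intro card_mono) (auto simp: degrees_of_eq)
  then have "real (card {E \<in> S. degrees_of E \<in> B}) \<le> rr * M" using fixed_edges(1)[OF assms] by linarith
  then have 1: "measure_pmf.prob ?P B \<le> rr"
    unfolding edge_unif_slice prob_map_pmf_of_set[OF finS ne] cS using M_pos by (simp add: divide_le_eq)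
  \<comment> \<open>The bound for \<open>?Q\<close> sums over the set \<open>E\<close> that supplies
    the columns, so the pairs are flipped to match.\<close>
  have "real (card {x \<in> S \<times> S. (case x of (A, E) \<Rightarrow> (rdeg A, cdeg E)) \<in> B}) \<le> real (card (SIGMA E:S. {A \<in> S. badp (rdeg A) (cdeg E)}))"
  proof -
    have "card {x \<in> S \<times> S. (case x of (A, E) \<Rightarrow> (rdeg A, cdeg E)) \<in> B} = card (prod.swap ` {x \<in> S \<times> S. (case x of (A, E) \<Rightarrow> (rdeg A, cdeg E)) \<in> B})"
      by (rule card_image[symmetric]) (auto intro: inj_onI)
    also have "\<dots> \<le> card (SIGMA E:S. {A \<in> S. badp (rdeg A) (cdeg E)})"
      using bad by (intro card_mono) auto
    finally show ?thesis by (simp only: of_nat_le_iff)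
  qed
  also have "\<dots> = (\<Sum>E\<in>S. real (card {A \<in> S. badp (rdeg A) (cdeg E)}))" by (subst card_SigmaI) auto
  also have "\<dots> \<le> rr * M\<^sup>2" by (rule fixed_edges(2)[OF assms])
  finally have 2: "measure_pmf.prob ?Q B \<le> rr"
    unfolding Q using finS ne cS M_pos
    by (subst prob_map_pmf_of_set) (auto simp: card_cartesian_product power2_eq_square divide_le_eq)
  have ds: "(rdeg A, cdeg E) \<in> deg_space m n" if "A \<in> S" "E \<in> S" for A E
    using deg_space_degrees[OF S_sub[OF that(2)] S_sub[OF that(1)]] .
  have sP: "set_pmf ?P \<subseteq> deg_space m n"
    unfolding edge_unif_slice using finS ne ds by (auto simp: degrees_of_eq)
  have sQ: "set_pmf ?Q \<subseteq> deg_space m n"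
    unfolding Q using finS ne ds by auto
  show ?thesis unfolding close_pmf_def
    using sP sQ 1 2 by (intro conjI exI[of _ B]) (auto simp: B_def)
qed

end

section \<open>Binomial weights\<close>

definition bw :: "nat \<Rightarrow> real \<Rightarrow> nat \<Rightarrow> real" where
  "bw N x j = real (N choose j) * x ^ j * (1 - x) ^ (N - j)"

text \<open>The probability that two independent binomial variables agree; it is the normalising
  factor when the binomial model is conditioned on equal sums.\<close>

definition bsq :: "nat \<Rightarrow> real \<Rightarrow> real" where
  "bsq N x = (\<Sum>j\<le>N. (bw N x j)\<^sup>2)"

lemma bw_nonneg: "0 \<le> x \<Longrightarrow> x \<le> 1 \<Longrightarrow> 0 \<le> bw N x j" by (simp add: bw_def)
lemma bw_pos: "0 < x \<Longrightarrow> x < 1 \<Longrightarrow> j \<le> N \<Longrightarrow> 0 < bw N x j" by (simp add: bw_def)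

lemma sum_bw: "(\<Sum>j\<le>N. bw N x j) = 1"
proof -
  have "1 = (x + (1 - x)) ^ N" by simp
  also have "\<dots> = (\<Sum>j\<le>N. bw N x j)" by (simp only: binomial_ring bw_def)
  finally show ?thesis by simp
qed

lemma bw_Suc:
  assumes "j < N"
  shows "bw N x (Suc j) * (real (Suc j) * (1 - x)) = bw N x j * (real (N - j) * x)"
proof -
  have "Suc j * (N choose Suc j) = (N - j) * (N choose j)"
    by (metis Suc_times_binomial_eq binomial_absorb_comp assms Suc_diff_Suc diff_Suc_1 mult.commute binomial_absorption gr0_implies_Suc Suc_pred neq0_conv not_less_zero)
  then have ch: "real (Suc j) * real (N choose Suc j) = real (N - j) * real (N choose j)" by (metis of_nat_mult)
  have "(1 - x) ^ (N - j) = (1 - x) ^ (N - Suc j) * (1 - x)"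
    using assms by (metis Suc_diff_Suc power_Suc2)
  then show ?thesis using ch by (simp add: bw_def mult_ac)
qed

lemma bw_le_1: "0 \<le> x \<Longrightarrow> x \<le> 1 \<Longrightarrow> j \<le> N \<Longrightarrow> bw N x j \<le> 1"
  using member_le_sum[of j "{..N}" "bw N x"] bw_nonneg[of x N] sum_bw[of N x] by auto

lemma bw_tail:
  assumes x: "0 \<le> x" "x \<le> 1" and N: "N > 0" and l: "0 \<le> l" "l \<le> 2 * real N"
  shows "(\<Sum>j | j \<in> {..N} \<and> l \<le> \<bar>real j - real N * x\<bar>. bw N x j) \<le> 2 * exp (- (l\<^sup>2 / (4 * real N)))"
proof (rule chernoff_weights)
  fix \<theta>
  have "(\<Sum>j\<le>N. bw N x j * exp (\<theta> * real j)) = (\<Sum>j\<le>N. real (N choose j) * (x * exp \<theta>) ^ j * (1 - x) ^ (N - j))"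
    by (intro sum.cong refl) (simp add: bw_def power_mult_distrib exp_of_nat2_mult mult.commute)
  also have "\<dots> = (x * exp \<theta> + (1 - x)) ^ N" by (rule binomial_ring[symmetric])
  also have "x * exp \<theta> + (1 - x) = 1 + (exp \<theta> - 1) * x" by (simp add: algebra_simps)
  finally show "(\<Sum>j\<le>N. bw N x j * exp (\<theta> * real j)) = (1 + (exp \<theta> - 1) * x) ^ N" .
qed (use x N l bw_nonneg in auto)

lemma bsq_pos: "0 < x \<Longrightarrow> x < 1 \<Longrightarrow> 0 < bsq N x"
  unfolding bsq_def using bw_pos[of x 0 N] by (intro sum_pos2[of _ 0]) auto

lemma bsq_lower:
  assumes "0 \<le> x" "x \<le> 1"
  shows "1 \<le> (real N + 1) * bsq N x"
proof -
  have "(\<Sum>j\<le>N. 1 * bw N x j)\<^sup>2 \<le> (\<Sum>j\<le>N. 1\<^sup>2) * (\<Sum>j\<le>N. (bw N x j)\<^sup>2)" by (rule Cauchy_Schwarz_ineq_sum)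
  then show ?thesis using sum_bw[of N x] by (simp add: bsq_def add.commute)
qed

text \<open>A Stein identity for the weights \<open>b\<^sup>2\<close>: squaring the recursion for
  \<open>b\<close> gives \<open>f (Suc j) = g j\<close>, so the sum of the differences telescopes to
  zero. It expresses the first moment of \<open>j - N * x\<close> by the second and thereby bounds
  it by a power of \<open>K\<close> instead of \<open>sqrt N\<close>.\<close>

lemma bw_stein:
  fixes x :: real
  shows "(\<Sum>j\<le>N. (bw N x j)\<^sup>2 * ((real j - real N * x) * (2 * (real N * x * (1 - x)) + (1 - 2 * x) * (real j - real N * x)))) = 0"
proof -
  define f where "f = (\<lambda>j. (bw N x j)\<^sup>2 * ((1 - x) * real j)\<^sup>2)"
  define g where "g = (\<lambda>j. (bw N x j)\<^sup>2 * (x * (real N - real j))\<^sup>2)"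
  have fg: "f (Suc j) = g j" if "j < N" for j
  proof -
    have "f (Suc j) = (bw N x (Suc j) * (real (Suc j) * (1 - x)))\<^sup>2" by (simp only: f_def power_mult_distrib mult_ac)
    also have "\<dots> = (bw N x j * (real (N - j) * x))\<^sup>2" by (simp only: bw_Suc[OF that])
    also have "\<dots> = g j" using that by (simp add: g_def power_mult_distrib of_nat_diff)
    finally show ?thesis .
  qed
  have "(\<Sum>j\<le>N. f j) = f 0 + (\<Sum>j<N. f (Suc j))" by (rule sum.atMost_shift)
  also have "\<dots> = (\<Sum>j<N. g j)" using fg by (simp add: f_def)
  also have "\<dots> = (\<Sum>j\<le>N. g j)" by (simp add: lessThan_Suc_atMost[symmetric] g_def)
  finally have "(\<Sum>j\<le>N. f j - g j) = 0" by (simp add: sum_subtractf)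
  moreover have "f j - g j = (bw N x j)\<^sup>2 * ((real j - real N * x) * (2 * (real N * x * (1 - x)) + (1 - 2 * x) * (real j - real N * x)))" for j
    unfolding f_def g_def by (simp add: power2_eq_square algebra_simps)
  ultimately show ?thesis by simp
qed

text \<open>\<open>N\<close> is the number of cells and \<open>L\<close> the product
  \<open>m * n\<close> in the exponent of the kernel; in the directed case they differ by
  \<open>n\<close>, which is at most \<open>2 * sqrt N\<close>.\<close>

locale mix =
  fixes N L :: nat and p K :: real
  assumes K: "K \<ge> 100" and p_bounds: "1 / K \<le> p" "p \<le> 1 - 1 / K"
    and big: "K ^ 10 \<le> sqrt (real N)" and NL: "N \<le> L" "real L \<le> real N + 2 * sqrt (real N)"
    and small: "(real N + 1) ^ 3 * exp (- K) \<le> 1 / 16"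
begin

definition Y :: real where "Y = sqrt (real N)"

lemma N_eq: "real N = Y\<^sup>2" by (simp add: Y_def)
lemma K_pow_le: "i \<le> 10 \<Longrightarrow> K ^ i \<le> Y"
  unfolding Y_def by (rule order_trans[OF power_increasing big]) (use K in auto)
lemma Y_big: "Y \<ge> 100" "Y > 0" "K * K * 100 \<le> Y"
proof -
  have "K ^ 1 \<le> Y" by (rule K_pow_le) simp
  then show "Y \<ge> 100" "Y > 0" using K by auto
  have "100 * (K * K) \<le> K * (K * K)" using K by (intro mult_right_mono) auto
  also have "\<dots> = K ^ 3" by (simp add: power3_eq_cube)
  also have "\<dots> \<le> Y" by (rule K_pow_le) simp
  finally show "K * K * 100 \<le> Y" by simp
qed
lemma N_pos: "N > 0" using N_eq Y_big by (cases N) auto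
lemma p01: "0 < p" "p < 1"
proof -
  have "0 < 1 / K" using K by simp
  then show "0 < p" "p < 1" using p_bounds by linarith+
qed

lemma inv_bounds: "1 / p \<le> K" "1 / (1 - p) \<le> K" "1 / (p * (1 - p)) \<le> 2 * K" "p * (1 - p) > 0"
proof -
  show 1: "1 / p \<le> K" using p_bounds p01 K by (simp add: field_simps)
  have "1 / K \<le> 1 - p" using p_bounds by simp
  then show 2: "1 / (1 - p) \<le> K" using p01 K by (simp add: field_simps)
  have "1 / (p * (1 - p)) = 1 / p + 1 / (1 - p)" using p01 by (simp add: field_simps)
  then show "1 / (p * (1 - p)) \<le> 2 * K" using 1 2 by linarith
  show "p * (1 - p) > 0" using p01 by simp
qed

lemma near_p:
  assumes "\<bar>x - p\<bar> \<le> 4 * K / Y"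
  shows "1 / (2 * K) \<le> x" "1 / (2 * K) \<le> 1 - x" "0 < x" "x < 1" "1 / (x * (1 - x)) \<le> 4 * K"
proof -
  have "4 * K / Y \<le> 1 / (2 * K)" using Y_big K by (simp add: field_simps)
  moreover have "1 / K = 1 / (2 * K) + 1 / (2 * K)" by simp
  ultimately show 1: "1 / (2 * K) \<le> x" "1 / (2 * K) \<le> 1 - x" using assms p_bounds by (simp_all only: abs_le_iff) linarith+
  have "0 < 1 / (2 * K)" using K by simp
  then show 2: "0 < x" "x < 1" using 1 by linarith+
  have "1 / x \<le> 2 * K" "1 / (1 - x) \<le> 2 * K" using 1 2 K by (simp_all add: field_simps)
  moreover have "1 / (x * (1 - x)) = 1 / x + 1 / (1 - x)" using 2 by (simp add: field_simps)
  ultimately show "1 / (x * (1 - x)) \<le> 4 * K" by linarith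
qed

definition dlog :: "real \<Rightarrow> real \<Rightarrow> nat \<Rightarrow> real" where
  "dlog x x' j = 2 * (real j * ln (x' / x) + (real N - real j) * ln ((1 - x') / (1 - x)))"

lemma bw_ratio:
  assumes x: "0 < x" "x < 1" "0 < x'" "x' < 1" and j: "j \<le> N"
  shows "(bw N x' j)\<^sup>2 = (bw N x j)\<^sup>2 * exp (dlog x x' j)"
proof -
  have "exp (dlog x x' j) = (exp (real j * ln (x' / x)) * exp (real (N - j) * ln ((1 - x') / (1 - x))))\<^sup>2"
    using j by (simp add: dlog_def of_nat_diff power2_eq_square flip: exp_add)
  also have "\<dots> = ((x' / x) ^ j * ((1 - x') / (1 - x)) ^ (N - j))\<^sup>2"
    using x by (simp add: exp_of_nat_mult)
  finally show ?thesis using x by (simp add: bw_def power_divide power_mult_distrib)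
qed

lemma dlog_approx:
  assumes x: "\<bar>x - p\<bar> \<le> 3 * K / Y" and h: "\<bar>h\<bar> = 1 / (2 * real N)" and j: "j \<le> N"
  shows "\<bar>dlog x (x + h) j - 2 * h * ((real j - real N * x) / (x * (1 - x)))\<bar> \<le> 4 * K\<^sup>2 / real N"
proof -
  have xb: "1 / (2 * K) \<le> x" "1 / (2 * K) \<le> 1 - x" "0 < x" "x < 1"
    using near_p[of x] x K Y_big by (auto intro: order_trans simp: divide_right_mono)
  have ix: "1 / x \<le> 2 * K" "1 / (1 - x) \<le> 2 * K" using xb K by (simp_all add: field_simps)
  define e where "e = K / real N"
  have e: "e \<ge> 0" "e \<le> 1 / 2"
  proof -
    show "e \<ge> 0" using K by (simp add: e_def)
    have "K * 1 \<le> K * K" using K by (intro mult_left_mono) auto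
    then have "2 * K \<le> Y" using Y_big(3) K by linarith
    also have "Y \<le> real N" unfolding N_eq using Y_big by (simp add: power2_eq_square)
    finally show "e \<le> 1 / 2" using N_pos by (simp add: e_def divide_le_eq)
  qed
  have a: "\<bar>h / x\<bar> \<le> e" "\<bar>- h / (1 - x)\<bar> \<le> e"
  proof -
    have "\<bar>h * (1 / x)\<bar> \<le> (1 / (2 * real N)) * (2 * K)" using h ix xb by (intro abs_mult_le) auto
    then show "\<bar>h / x\<bar> \<le> e" by (simp add: e_def)
    have "\<bar>h * (1 / (1 - x))\<bar> \<le> (1 / (2 * real N)) * (2 * K)" using h ix xb by (intro abs_mult_le) auto
    then show "\<bar>- h / (1 - x)\<bar> \<le> e" by (simp add: e_def)
  qed
  have l: "\<bar>ln (1 + u) - u\<bar> \<le> 2 * e\<^sup>2" if "\<bar>u\<bar> \<le> e" for u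
  proof -
    have "\<bar>ln (1 + u) - u\<bar> \<le> 2 * u\<^sup>2" using that e by (intro abs_ln_one_plus_x_minus_x_bound) auto
    moreover have "\<bar>u\<bar>\<^sup>2 \<le> e\<^sup>2" using that by (intro power_mono) auto
    ultimately show ?thesis by simp
  qed
  have r: "(x + h) / x = 1 + h / x" "(1 - (x + h)) / (1 - x) = 1 + - h / (1 - x)" using xb by (auto simp: field_simps)
  define A where "A = ln (1 + h / x) - h / x"
  define B where "B = ln (1 + - h / (1 - x)) - (- h / (1 - x))"
  have AB: "\<bar>A\<bar> \<le> 2 * e\<^sup>2" "\<bar>B\<bar> \<le> 2 * e\<^sup>2" unfolding A_def B_def by (intro l a)+
  have "2 * h * ((real j - real N * x) / (x * (1 - x))) = 2 * (real j * (h / x) + (real N - real j) * (- h / (1 - x)))"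
    using xb by (simp add: field_simps)
  then have "dlog x (x + h) j - 2 * h * ((real j - real N * x) / (x * (1 - x))) = 2 * (real j * A + (real N - real j) * B)"
    unfolding dlog_def r A_def B_def by (simp add: algebra_simps)
  moreover have "\<bar>real j * A\<bar> \<le> real j * (2 * e\<^sup>2)" "\<bar>(real N - real j) * B\<bar> \<le> (real N - real j) * (2 * e\<^sup>2)"
    using AB j by (intro abs_mult_le; simp)+
  moreover have "\<bar>2 * (a + b)\<bar> \<le> 2 * (c + d)" if "\<bar>a\<bar> \<le> c" "\<bar>b\<bar> \<le> d" for a b c d :: real
    using that by (auto simp: abs_le_iff)
  ultimately have "\<bar>dlog x (x + h) j - 2 * h * ((real j - real N * x) / (x * (1 - x)))\<bar> \<le> 2 * (real j * (2 * e\<^sup>2) + (real N - real j) * (2 * e\<^sup>2))"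
    by (simp only:)
  also have "\<dots> = 4 * (real N * e\<^sup>2)" by (simp add: algebra_simps)
  also have "\<dots> = 4 * K\<^sup>2 / real N" using N_pos by (simp add: e_def power2_eq_square)
  finally show ?thesis .
qed

lemma exp_K2: "2 * exp (- (K\<^sup>2 / 4)) \<le> 2 * exp (- K)" "2 * exp (- (K\<^sup>2 / 16)) \<le> 2 * exp (- K)"
proof -
  have "16 * K \<le> K * K" using K by (intro mult_right_mono) auto
  then show "2 * exp (- (K\<^sup>2 / 4)) \<le> 2 * exp (- K)" "2 * exp (- (K\<^sup>2 / 16)) \<le> 2 * exp (- K)"
    using K by (auto simp: power2_eq_square)
qed

text \<open>Within \<open>K * Y\<close> of the centre the square is bounded directly. Beyond it the
  tail bound is available for \<open>b\<close>, not for \<open>b\<^sup>2\<close>, and is compared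
  with \<open>bsq\<close> through the lower bound \<open>1 / (N + 1)\<close>.\<close>

lemma second_moment:
  assumes x: "0 < x" "x < 1"
  shows "(\<Sum>j\<le>N. (bw N x j)\<^sup>2 * (real j - real N * x)\<^sup>2) \<le> 2 * K\<^sup>2 * real N * bsq N x"
proof -
  let ?u = "\<lambda>j. real j - real N * x"
  let ?F = "{j. j \<in> {..N} \<and> K * Y \<le> \<bar>?u j\<bar>}"
  have xx: "0 \<le> x" "x \<le> 1" using x by auto
  have uN: "\<bar>?u j\<bar> \<le> real N" if "j \<le> N" for j
  proof -
    have "real N * x \<le> real N * 1" using xx by (intro mult_left_mono) auto
    moreover have "0 \<le> real N * x" using xx by simp
    moreover have "real j \<le> real N" using that by simp
    ultimately show ?thesis by (simp only: abs_le_iff) linarith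
  qed
  have "(\<Sum>j\<le>N. (bw N x j)\<^sup>2 * (?u j)\<^sup>2) \<le> (\<Sum>j\<le>N. (bw N x j)\<^sup>2 * (K * Y)\<^sup>2 + (if K * Y \<le> \<bar>?u j\<bar> then bw N x j * (real N)\<^sup>2 else 0))"
  proof (rule sum_mono)
    fix j assume j: "j \<in> {..N}"
    have b: "0 \<le> bw N x j" "bw N x j \<le> 1" using bw_nonneg[OF xx] bw_le_1[OF xx] j by auto
    show "(bw N x j)\<^sup>2 * (?u j)\<^sup>2 \<le> (bw N x j)\<^sup>2 * (K * Y)\<^sup>2 + (if K * Y \<le> \<bar>?u j\<bar> then bw N x j * (real N)\<^sup>2 else 0)"
    proof (cases "K * Y \<le> \<bar>?u j\<bar>")
      case True
      have "\<bar>?u j\<bar>\<^sup>2 \<le> (real N)\<^sup>2" using uN j by (intro power_mono) auto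
      then have "(bw N x j)\<^sup>2 * (?u j)\<^sup>2 \<le> bw N x j * (real N)\<^sup>2"
        using b by (intro mult_mono) (auto simp: power2_eq_square mult_left_le)
      then show ?thesis using True by (simp add: add_increasing)
    next
      case False
      then have "\<bar>?u j\<bar>\<^sup>2 \<le> (K * Y)\<^sup>2" by (intro power_mono) auto
      then show ?thesis using False by (simp add: mult_left_mono)
    qed
  qed
  also have "\<dots> = (K * Y)\<^sup>2 * bsq N x + (\<Sum>j\<in>?F. bw N x j) * (real N)\<^sup>2"
  proof -
    have "(\<Sum>j\<le>N. if K * Y \<le> \<bar>?u j\<bar> then bw N x j * (real N)\<^sup>2 else 0) = (\<Sum>j\<in>?F. bw N x j * (real N)\<^sup>2)"
      by (rule sum.inter_filter[symmetric]) simp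
    then show ?thesis by (simp add: sum.distrib bsq_def sum_distrib_left sum_distrib_right mult.commute)
  qed
  also have "(\<Sum>j\<in>?F. bw N x j) \<le> 2 * exp (- ((K * Y)\<^sup>2 / (4 * real N)))"
  proof (rule bw_tail[OF xx N_pos])
    have "K * Y \<le> Y * Y" using K_pow_le[of 1] Y_big by (intro mult_right_mono) auto
    then show "K * Y \<le> 2 * real N" unfolding N_eq power2_eq_square using Y_big by (smt (verit) mult_pos_pos)
  qed (use K Y_big in auto)
  also have "(K * Y)\<^sup>2 / (4 * real N) = K\<^sup>2 / 4" using Y_big by (simp add: N_eq power_mult_distrib)
  also have "2 * exp (- (K\<^sup>2 / 4)) \<le> 2 * exp (- K)" by (rule exp_K2)
  finally have "(\<Sum>j\<le>N. (bw N x j)\<^sup>2 * (?u j)\<^sup>2) \<le> (K * Y)\<^sup>2 * bsq N x + 2 * exp (- K) * (real N)\<^sup>2"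
    by (simp add: mult_right_mono)
  also have "2 * exp (- K) * (real N)\<^sup>2 \<le> K\<^sup>2 * real N * bsq N x"
  proof -
    have b: "1 \<le> (real N + 1) * bsq N x" by (rule bsq_lower[OF xx])
    have "(real N + 1) * (real N)\<^sup>2 \<le> (real N + 1) ^ 3"
      by (simp add: power2_eq_square power3_eq_cube mult_mono)
    then have "(real N + 1) * (real N)\<^sup>2 * exp (- K) \<le> (real N + 1) ^ 3 * exp (- K)" by (intro mult_right_mono) auto
    then have "(real N + 1) * (real N)\<^sup>2 * exp (- K) \<le> 1 / 16" using small by (rule order_trans)
    moreover have "2 * exp (- K) * (real N)\<^sup>2 * (real N + 1) = 2 * ((real N + 1) * (real N)\<^sup>2 * exp (- K))" by simp
    ultimately have s: "2 * exp (- K) * (real N)\<^sup>2 * (real N + 1) \<le> 1" by linarith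
    have b0: "0 \<le> bsq N x" using bsq_pos[OF x] by (rule less_imp_le)
    have "2 * exp (- K) * (real N)\<^sup>2 * 1 \<le> 2 * exp (- K) * (real N)\<^sup>2 * ((real N + 1) * bsq N x)"
      using b by (intro mult_left_mono) auto
    also have "\<dots> = (2 * exp (- K) * (real N)\<^sup>2 * (real N + 1)) * bsq N x" by simp
    also have "\<dots> \<le> 1 * bsq N x" using s b0 by (intro mult_right_mono)
    also have "\<dots> \<le> (K\<^sup>2 * real N) * bsq N x"
      using b0 mult_mono[of 1 "K\<^sup>2" 1 "real N"] one_le_power[of K 2] K N_pos by (intro mult_right_mono) auto
    finally show ?thesis by simp
  qed
  finally show ?thesis by (simp add: N_eq power_mult_distrib algebra_simps)
qed

text \<open>The error per shift has to be of order \<open>1 / N\<close>, because up to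
  \<open>2 * K * Y\<close> shifts are chained. The first-order term is
  \<open>2 * h / (x * (1 - x))\<close> times the first moment of \<open>j - N * x\<close> under
  \<open>b\<^sup>2\<close>, which \<open>bw_stein\<close> controls; sizes alone would give
  \<open>1 / sqrt N\<close>. Since \<open>h\<close> may have either sign, the lower bound yields an
  upper bound as well.\<close>

lemma bsq_shift:
  assumes x: "\<bar>x - p\<bar> \<le> 3 * K / Y" "\<bar>x + h - p\<bar> \<le> 4 * K / Y" and h: "\<bar>h\<bar> = 1 / (2 * real N)"
  shows "bsq N x * (1 - 20 * K ^ 4 / real N) \<le> bsq N (x + h)"
proof -
  have x4: "\<bar>x - p\<bar> \<le> 4 * K / Y" using x(1) K Y_big by (auto intro: order_trans simp: divide_right_mono)
  note xb = near_p[OF x4] and xb' = near_p[OF x(2)]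
  let ?u = "\<lambda>j. real j - real N * x"
  define v where "v = real N * x * (1 - x)"
  define i where "i = 1 / (x * (1 - x))"
  have i: "0 \<le> i" "i \<le> 4 * K" using xb by (auto simp: i_def)
  have v0: "v > 0" using xb N_pos by (simp add: v_def)
  define U where "U = (\<Sum>j\<le>N. (bw N x j)\<^sup>2 * ?u j)"
  define U2 where "U2 = (\<Sum>j\<le>N. (bw N x j)\<^sup>2 * (?u j)\<^sup>2)"
  have "2 * v * U + (1 - 2 * x) * U2 = 0"
    using bw_stein[of N x] unfolding U_def U2_def v_def[symmetric] sum_distrib_left sum.distrib[symmetric]
    by (simp add: power2_eq_square algebra_simps)
  then have "2 * v * \<bar>U\<bar> = \<bar>1 - 2 * x\<bar> * \<bar>U2\<bar>" using v0 by (simp add: abs_mult[symmetric]) (metis abs_minus_cancel abs_mult abs_of_pos abs_numeral add_eq_0_iff mult.assoc)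
  also have "\<dots> \<le> 1 * (2 * K\<^sup>2 * real N * bsq N x)"
  proof (rule mult_mono)
    have "0 \<le> U2" unfolding U2_def by (intro sum_nonneg) auto
    then show "\<bar>U2\<bar> \<le> 2 * K\<^sup>2 * real N * bsq N x" using second_moment[OF xb(3,4)] by (simp add: U2_def)
  qed (use xb in auto)
  finally have "\<bar>U\<bar> \<le> (K\<^sup>2 * real N * bsq N x) / v" using v0 by (simp add: field_simps)
  also have "\<dots> = K\<^sup>2 * i * bsq N x" using N_pos xb by (simp add: v_def i_def)
  also have "\<dots> \<le> K\<^sup>2 * (4 * K) * bsq N x" using i bsq_pos[OF xb(3,4)] by (intro mult_right_mono mult_left_mono) (auto intro: less_imp_le)
  finally have Ub: "\<bar>U\<bar> \<le> 4 * K ^ 3 * bsq N x" by (simp add: power2_eq_square power3_eq_cube)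
  have b0: "0 \<le> bsq N x" using bsq_pos[OF xb(3,4)] by (rule less_imp_le)
  have "bsq N (x + h) = (\<Sum>j\<le>N. (bw N x j)\<^sup>2 * exp (dlog x (x + h) j))"
    unfolding bsq_def by (intro sum.cong refl bw_ratio) (use xb xb' in auto)
  also have "\<dots> \<ge> (\<Sum>j\<le>N. (bw N x j)\<^sup>2 * (1 + (2 * h * i * ?u j - 4 * K\<^sup>2 / real N)))"
  proof (intro sum_mono mult_left_mono)
    fix j assume "j \<in> {..N}"
    then have "\<bar>dlog x (x + h) j - 2 * h * (?u j / (x * (1 - x)))\<bar> \<le> 4 * K\<^sup>2 / real N"
      using dlog_approx[OF x(1) h] by simp
    then have "2 * h * i * ?u j - 4 * K\<^sup>2 / real N \<le> dlog x (x + h) j" by (simp add: i_def abs_le_iff)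
    then show "1 + (2 * h * i * ?u j - 4 * K\<^sup>2 / real N) \<le> exp (dlog x (x + h) j)"
      using exp_ge_add_one_self[of "dlog x (x + h) j"] by linarith
  qed auto
  also have "(\<Sum>j\<le>N. (bw N x j)\<^sup>2 * (1 + (2 * h * i * ?u j - 4 * K\<^sup>2 / real N))) = (1 - 4 * K\<^sup>2 / real N) * bsq N x + 2 * h * i * U"
    unfolding bsq_def U_def sum_distrib_left sum.distrib[symmetric] by (intro sum.cong refl) (simp add: algebra_simps)
  finally have 1: "(1 - 4 * K\<^sup>2 / real N) * bsq N x + 2 * h * i * U \<le> bsq N (x + h)" by simp
  have "\<bar>(2 * h * i) * U\<bar> \<le> (2 * (1 / (2 * real N)) * (4 * K)) * (4 * K ^ 3 * bsq N x)"
    using h i Ub by (intro abs_mult_le) auto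
  also have "\<dots> = (16 * K ^ 4 / real N) * bsq N x" by (simp add: eval_nat_numeral)
  finally have 2: "\<bar>2 * h * i * U\<bar> \<le> (16 * K ^ 4 / real N) * bsq N x" .
  have "K\<^sup>2 \<le> K ^ 4" using K by (intro power_increasing) auto
  then have "4 * K\<^sup>2 / real N + 16 * K ^ 4 / real N \<le> 20 * K ^ 4 / real N" by (simp add: add_divide_distrib[symmetric] divide_right_mono)
  then have "(4 * K\<^sup>2 / real N + 16 * K ^ 4 / real N) * bsq N x \<le> (20 * K ^ 4 / real N) * bsq N x" using b0 by (intro mult_right_mono)
  then show ?thesis using 1 2 by (simp add: algebra_simps abs_le_iff)
qed

definition Lam :: real where "Lam = real L / (p * (1 - p))"
text \<open>The integrand for \<open>k\<close> divided by the target weight \<open>bw N p k\<close>,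
  still without the normaliser \<open>bsq\<close>, which \<open>II\<close> adds. The aim is that
  \<open>II\<close> depends on \<open>k\<close> only through a shift of \<open>x\<close>, up to a
  small factor.\<close>

definition QQ :: "nat \<Rightarrow> real \<Rightarrow> real" where
  "QQ k x = exp (- Lam * (x - p)\<^sup>2) * (bw N x k)\<^sup>2 / bw N p k"
definition II :: "nat \<Rightarrow> real \<Rightarrow> real" where "II k x = QQ k x / bsq N x"
definition Tk :: "nat set" where "Tk = {k. k \<le> N \<and> \<bar>real k - real N * p\<bar> \<le> K * Y}"

lemma Tk_inside:
  assumes "k \<in> Tk"
  shows "0 < k" "k < N" "real k / real N \<ge> 1 / (2 * K)"
proof -
  have k: "\<bar>real k - real N * p\<bar> \<le> K * Y" "k \<le> N" using assms by (auto simp: Tk_def)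
  have KY: "K * Y \<le> real N / (4 * K)"
  proof -
    have "4 * K * (K * Y) \<le> Y * Y" using Y_big mult_right_mono[of "4 * K * K" Y Y] by (simp add: mult_ac)
    then show ?thesis using K by (simp add: N_eq power2_eq_square field_simps)
  qed
  have a: "real N / K \<le> real N * p" using mult_left_mono[OF p_bounds(1), of "real N"] by simp
  have b: "real N * p \<le> real N - real N / K" using mult_left_mono[OF p_bounds(2), of "real N"] by (simp add: right_diff_distrib)
  have c: "real N / K = 4 * (real N / (4 * K))" by simp
  have pos: "0 < real N / (4 * K)" using N_pos K by simp
  have d: "2 * (real N / (4 * K)) \<le> real k" using k a c KY pos by (simp only: abs_le_iff) linarith
  then show "0 < k" using pos by (cases k) auto
  have "real k < real N" using k b c KY pos by (simp only: abs_le_iff) linarith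
  then show "k < N" by simp
  have "real N / (2 * K) \<le> real k" using d by simp
  then show "real k / real N \<ge> 1 / (2 * K)" using N_pos K by (simp add: field_simps)
qed

text \<open>All logarithms are expanded to first order. The relative displacements are multiples of
  \<open>e = K\<^sup>2 / Y\<close>, so the remainders are multiples of
  \<open>e\<^sup>2 = K ^ 4 / N\<close>; for the shift \<open>1 / (2 * N)\<close> the first-order
  terms cancel.\<close>

lemma QQ_shift:
  assumes k: "k \<in> Tk" "Suc k \<in> Tk" and x: "\<bar>x - p\<bar> \<le> 2 * K / Y"
  defines "h \<equiv> 1 / (2 * real N)"
  shows "\<exists>R. \<bar>R\<bar> \<le> 2 * K ^ 5 / real N \<and> QQ (Suc k) (x + h) = QQ k x * exp R"
proof -
  define q where "q = 1 - p"
  define u where "u = real k - real N * p"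
  define z where "z = x - p"
  define z' where "z' = z + h"
  define NN where "NN = real N"
  have N0: "NN > 0" using N_pos by (simp add: NN_def)
  have NY: "NN = Y * Y" using N_eq by (simp add: NN_def power2_eq_square)
  have h0: "h > 0" "\<bar>h\<bar> = 1 / (2 * NN)" "2 * h = 1 / NN" using N0 by (auto simp: h_def NN_def)
  have hY: "h \<le> K / Y"
  proof -
    have "1 / (2 * NN) \<le> 1 / Y" using Y_big NY by (intro frac_le) (auto simp: mult_mono)
    also have "\<dots> \<le> K / Y" using K Y_big by (intro divide_right_mono) auto
    finally show ?thesis by (simp add: h_def NN_def)
  qed
  have x3: "\<bar>x - p\<bar> \<le> 3 * K / Y" "\<bar>x - p\<bar> \<le> 4 * K / Y" using x K Y_big by (auto intro: order_trans simp: divide_right_mono)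
  have z: "\<bar>z\<bar> \<le> 2 * K / Y" using x by (simp add: z_def)
  have z'b: "\<bar>z'\<bar> \<le> 3 * K / Y" unfolding z'_def using z hY h0(1) K by (simp add: abs_le_iff)
  have x': "\<bar>(x + h) - p\<bar> \<le> 4 * K / Y" using z'b K Y_big unfolding z'_def z_def by (auto intro: order_trans simp: divide_right_mono algebra_simps)
  note xb = near_p[OF x3(2)] and xb' = near_p[OF x']
  have q: "q > 0" "1 / q \<le> K" using inv_bounds p01 by (auto simp: q_def)
  have ip: "1 / p \<le> K" "0 < p" using inv_bounds p01 by auto
  define ipq where "ipq = 1 / (p * q)"
  have ipq: "0 < ipq" "ipq \<le> 2 * K" "ipq = 1 / p + 1 / q" using inv_bounds p01 q by (auto simp: ipq_def q_def field_simps)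
  have ub: "\<bar>u\<bar> \<le> K * Y" "\<bar>u + 1\<bar> \<le> K * Y" using k by (auto simp: u_def Tk_def)
  have kN: "k < N" "0 < k" using Tk_inside[OF k(1)] by auto
  define e where "e = K\<^sup>2 / Y"
  have e0: "0 \<le> e" using Y_big by (simp add: e_def)
  have e3: "3 * e \<le> 1 / 2"
    using Y_big by (simp add: e_def power2_eq_square divide_le_eq)
  have e2: "e\<^sup>2 = K ^ 4 / NN" by (simp add: e_def NY power_divide power2_eq_square eval_nat_numeral)
  have lb: "\<bar>ln (1 + w) - w\<bar> \<le> 2 * (c * c) * e\<^sup>2" if "\<bar>w\<bar> \<le> c * e" "c \<le> 3" for w c
  proof -
    have "c * e \<le> 3 * e" using that e0 by (intro mult_right_mono) auto
    then have "\<bar>ln (1 + w) - w\<bar> \<le> 2 * w\<^sup>2" using that e3 by (intro abs_ln_one_plus_x_minus_x_bound) linarith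
    moreover have "\<bar>w\<bar>\<^sup>2 \<le> (c * e)\<^sup>2" using that by (intro power_mono) auto
    then have "w\<^sup>2 \<le> (c * c) * e\<^sup>2" by (simp add: power2_eq_square mult_ac)
    moreover have "2 * (c * c) * e\<^sup>2 = 2 * ((c * c) * e\<^sup>2)" by simp
    ultimately show ?thesis by linarith
  qed
  have uN: "\<bar>w / NN\<bar> \<le> K / Y" if "\<bar>w\<bar> \<le> K * Y" for w
  proof -
    have "\<bar>w\<bar> / NN \<le> (K * Y) / NN" using that N0 by (intro divide_right_mono) auto
    then show ?thesis using N0 Y_big by (simp add: NY)
  qed
  define A1 where "A1 = ln (1 + - (u / NN) * (1 / q)) - - (u / NN) * (1 / q)"
  define A2 where "A2 = ln (1 + ((u + 1) / NN) * (1 / p)) - ((u + 1) / NN) * (1 / p)"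
  define A3 where "A3 = ln (1 + z' * (1 / p)) - z' * (1 / p)"
  define A4 where "A4 = ln (1 + - z' * (1 / q)) - - z' * (1 / q)"
  have KKe: "(K / Y) * K = 1 * e" "(3 * K / Y) * K = 3 * e" by (auto simp: e_def power2_eq_square)
  have A1: "\<bar>A1\<bar> \<le> 2 * e\<^sup>2"
  proof -
    have "\<bar>- (u / NN) * (1 / q)\<bar> \<le> (K / Y) * K" using uN[OF ub(1)] q by (intro abs_mult_le) auto
    then have "\<bar>A1\<bar> \<le> 2 * (1 * 1) * e\<^sup>2" unfolding A1_def KKe by (rule lb) simp
    then show ?thesis by simp
  qed
  have A2: "\<bar>A2\<bar> \<le> 2 * e\<^sup>2"
  proof -
    have "\<bar>((u + 1) / NN) * (1 / p)\<bar> \<le> (K / Y) * K" using uN[OF ub(2)] ip by (intro abs_mult_le) auto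
    then have "\<bar>A2\<bar> \<le> 2 * (1 * 1) * e\<^sup>2" unfolding A2_def KKe by (rule lb) simp
    then show ?thesis by simp
  qed
  have A3: "\<bar>A3\<bar> \<le> 18 * e\<^sup>2"
  proof -
    have "\<bar>z' * (1 / p)\<bar> \<le> (3 * K / Y) * K" using z'b ip by (intro abs_mult_le) auto
    then have "\<bar>A3\<bar> \<le> 2 * (3 * 3) * e\<^sup>2" unfolding A3_def KKe by (rule lb) simp
    then show ?thesis by simp
  qed
  have A4: "\<bar>A4\<bar> \<le> 18 * e\<^sup>2"
  proof -
    have "\<bar>- z' * (1 / q)\<bar> \<le> (3 * K / Y) * K" using z'b q by (intro abs_mult_le) auto
    then have "\<bar>A4\<bar> \<le> 2 * (3 * 3) * e\<^sup>2" unfolding A4_def KKe by (rule lb) simp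
    then show ?thesis by simp
  qed
  define DD where "DD = dlog x (x + h) k"
  define ixx where "ixx = 1 / (x * (1 - x))"
  have D1: "\<bar>DD - (1 / NN) * ((u - NN * z) * ixx)\<bar> \<le> 4 * e\<^sup>2"
  proof -
    have "\<bar>DD - 2 * h * ((real k - real N * x) / (x * (1 - x)))\<bar> \<le> 4 * K\<^sup>2 / real N"
      unfolding DD_def by (rule dlog_approx[OF x3(1)]) (use h0 kN in \<open>auto simp: NN_def\<close>)
    moreover have "2 * h * ((real k - real N * x) / (x * (1 - x))) = (1 / NN) * ((u - NN * z) * ixx)"
      unfolding h0(3) u_def z_def ixx_def NN_def by (simp add: algebra_simps)
    moreover have "4 * K\<^sup>2 / real N \<le> 4 * e\<^sup>2"
      unfolding e2 NN_def using power_increasing[of 2 4 K] K by (simp add: divide_right_mono)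
    ultimately show ?thesis by linarith
  qed
  have D2: "\<bar>(u / NN - z) * (ixx - ipq)\<bar> \<le> 48 * e\<^sup>2"
  proof -
    have "ixx - ipq = z * ((p + x - 1) * (ixx * ipq))"
      unfolding ixx_def ipq_def z_def q_def using xb p01 by (simp add: field_simps)
    also have "\<bar>\<dots>\<bar> \<le> (2 * K / Y) * (1 * ((4 * K) * (2 * K)))"
    proof (rule abs_mult_le[OF z], rule abs_mult_le)
      show "\<bar>p + x - 1\<bar> \<le> 1" using xb p01 by (simp add: abs_le_iff)
      show "\<bar>ixx * ipq\<bar> \<le> (4 * K) * (2 * K)" using xb ipq by (intro abs_mult_le) (auto simp: ixx_def)
    qed
    finally have "\<bar>ixx - ipq\<bar> \<le> 16 * K ^ 3 / Y" by (simp add: power3_eq_cube)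
    moreover have "\<bar>u / NN - z\<bar> \<le> 3 * K / Y"
    proof -
      have "3 * K / Y = K / Y + 2 * K / Y" by (simp add: add_divide_distrib)
      then show ?thesis using abs_triangle_ineq4[of "u / NN" z] uN[OF ub(1)] z by linarith
    qed
    ultimately have "\<bar>(u / NN - z) * (ixx - ipq)\<bar> \<le> (3 * K / Y) * (16 * K ^ 3 / Y)" by (intro abs_mult_le)
    also have "\<dots> = 48 * e\<^sup>2" unfolding e2 NY by (simp add: eval_nat_numeral)
    finally show ?thesis .
  qed
  define LL where "LL = Lam * (2 * z * h + h\<^sup>2)"
  have L1: "\<bar>LL - z * ipq\<bar> \<le> 9 * e\<^sup>2"
  proof -
    define l where "l = real L / NN"
    have l: "1 \<le> l" "l - 1 \<le> 2 / Y" "l \<le> 2"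
    proof -
      show "1 \<le> l" using NL(1) N_pos by (simp add: l_def NN_def)
      have "real L / NN \<le> (NN + 2 * Y) / NN" using NL(2) N0 by (intro divide_right_mono) (auto simp: NN_def Y_def)
      also have "\<dots> = 1 + 2 / Y" using N0 Y_big by (simp add: NY add_divide_distrib)
      finally show 1: "l - 1 \<le> 2 / Y" by (simp add: l_def)
      have "2 / Y \<le> 1" using Y_big by simp
      then show "l \<le> 2" using 1 by linarith
    qed
    have LamE: "Lam = l * NN * ipq" unfolding Lam_def l_def ipq_def q_def using N0 by simp
    have "LL = l * ipq * (z * (2 * h * NN) + h * (h * NN))" unfolding LL_def LamE by (simp add: algebra_simps power2_eq_square)
    also have "2 * h * NN = 1" using N_pos by (simp add: h_def NN_def)
    also have "h * NN = 1 / 2" using N_pos by (simp add: h_def NN_def)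
    finally have "LL - z * ipq = (l - 1) * (z * ipq) + (l * ipq) * (h / 2)" by (simp add: algebra_simps)
    moreover have "\<bar>(l - 1) * (z * ipq)\<bar> \<le> (2 / Y) * ((2 * K / Y) * (2 * K))"
      using l z ipq by (intro abs_mult_le) auto
    moreover have "\<bar>(l * ipq) * (h / 2)\<bar> \<le> (2 * (2 * K)) * (1 / (4 * NN))"
      using l ipq h0 by (intro abs_mult_le) auto
    moreover have "(2 / Y) * ((2 * K / Y) * (2 * K)) = 8 * (K\<^sup>2 / NN)" by (simp add: NY power2_eq_square)
    moreover have "(2 * (2 * K)) * (1 / (4 * NN)) \<le> K\<^sup>2 / NN"
      using N0 K by (simp add: power2_eq_square field_simps)
    ultimately have "\<bar>LL - z * ipq\<bar> \<le> 9 * (K\<^sup>2 / NN)"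
      using abs_triangle_ineq[of "(l - 1) * (z * ipq)" "(l * ipq) * (h / 2)"] by argo
    also have "\<dots> \<le> 9 * e\<^sup>2" unfolding e2 using power_increasing[of 2 4 K] K N0 by (simp add: divide_right_mono)
    finally show ?thesis .
  qed
  define R where "R = DD + (A1 + - (u / NN) * (1 / q)) - (A2 + ((u + 1) / NN) * (1 / p)) + 2 * ((A3 + z' * (1 / p)) - (A4 + - z' * (1 / q))) - LL"
  have Rb: "\<bar>R\<bar> \<le> 2 * K ^ 5 / real N"
  proof -
    have c1: "\<bar>(1 / NN) * (1 / p)\<bar> \<le> e\<^sup>2"
    proof -
      have "\<bar>(1 / NN) * (1 / p)\<bar> \<le> (1 / NN) * K" using ip N0 by (intro abs_mult_le) auto
      also have "\<dots> \<le> e\<^sup>2" unfolding e2 using power_increasing[of 1 4 K] K N0 by (simp add: divide_right_mono)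
      finally show ?thesis .
    qed
    have c2: "\<bar>2 * h * ipq\<bar> \<le> 2 * e\<^sup>2"
    proof -
      have "\<bar>2 * h * ipq\<bar> \<le> (1 / NN) * (2 * K)" unfolding h0(3) using ipq N0 by (intro abs_mult_le) auto
      also have "\<dots> \<le> 2 * e\<^sup>2" unfolding e2 using power_increasing[of 1 4 K] K N0 by (simp add: divide_right_mono)
      finally show ?thesis .
    qed
    \<comment> \<open>The cancellation, in units of \<open>ipq\<close>: the shift of
      \<open>x\<close> in \<open>b\<^sub>x\<^sup>2\<close> gives \<open>u / NN - z\<close>, the step
      from \<open>k\<close> to \<open>k + 1\<close> in \<open>b\<^sub>x\<^sup>2\<close> and
      \<open>b\<^sub>p\<close> together gives \<open>2 * z - u / NN\<close>, and the kernel gives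
      \<open>- z\<close>. Left over are the remainders and two terms of order \<open>1 / NN\<close>
      up to a factor \<open>K\<close>.\<close>
    have "R = (DD - (1 / NN) * ((u - NN * z) * ixx)) + (u / NN - z) * (ixx - ipq) + A1 - A2 + 2 * A3 - 2 * A4 - (LL - z * ipq)
       - (1 / NN) * (1 / p) + 2 * h * ipq"
    proof -
      have "(1 / NN) * ((u - NN * z) * ixx) = (u / NN - z) * ixx" using N0 by (simp add: field_simps)
      moreover have "- (u / NN) * (1 / q) - ((u + 1) / NN) * (1 / p) = - (u / NN) * ipq - (1 / NN) * (1 / p)"
        unfolding ipq(3) by (simp add: algebra_simps add_divide_distrib)
      moreover have "z' * (1 / p) - - z' * (1 / q) = (z + h) * ipq" unfolding ipq(3) z'_def by (simp add: algebra_simps add_divide_distrib)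
      moreover have "(u / NN - z) * (ixx - ipq) = (u / NN - z) * ixx - (u / NN) * ipq + z * ipq"
        by (simp only: left_diff_distrib right_diff_distrib)
      moreover have "2 * ((z + h) * ipq) = 2 * (z * ipq) + 2 * h * ipq" by (simp add: algebra_simps)
      moreover have "d + (a1 + v1) - (a2 + v2) + 2 * (a3 + w1 - (a4 + w2)) - l
          = d - e1 + pr + a1 - a2 + 2 * a3 - 2 * a4 - (l - zi) - v4 + hi"
        if "e1 = e2" "v1 - v2 = - g * i - v4" "w1 - w2 = zh" "pr = e2 - g * i + zi" "2 * zh = 2 * zi + hi"
        for d a1 a2 a3 a4 v1 v2 v4 w1 w2 l e1 e2 pr g i zi zh hi :: real
      proof -
        have "v1 = v2 - g * i - v4" "w1 = zh + w2" "hi = 2 * zh - 2 * zi" using that by (auto simp: algebra_simps)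
        then show ?thesis using that(1,4) by (simp add: algebra_simps)
      qed
      ultimately show ?thesis unfolding R_def by blast
    qed
    then have "\<bar>R\<bar> \<le> 140 * e\<^sup>2" using D1 D2 A1 A2 A3 A4 L1 c1 c2 by (simp only: abs_le_iff) linarith
    also have "\<dots> \<le> 2 * K ^ 5 / real N"
    proof -
      have "70 * K ^ 4 \<le> K * K ^ 4" using K by (intro mult_right_mono) auto
      then have "140 * K ^ 4 \<le> 2 * K ^ 5" by (simp add: eval_nat_numeral)
      then have "140 * K ^ 4 / NN \<le> 2 * K ^ 5 / NN" using N0 by (intro divide_right_mono) auto
      then show ?thesis by (simp add: e2 NN_def)
    qed
    finally show ?thesis .
  qed
  have "QQ (Suc k) (x + h) = QQ k x * exp R"
  proof -
    have Sk: "real (Suc k) * (1 - w) \<noteq> 0" if "w < 1" for w using that by simp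
    have step: "bw N w (Suc k) = bw N w k * (real (N - k) * w / (real (Suc k) * (1 - w)))" if "w < 1" for w
    proof -
      have "bw N w (Suc k) * (real (Suc k) * (1 - w)) = bw N w k * (real (N - k) * w)"
        using bw_Suc[OF kN(1), of w] by (simp only: mult_ac)
      then show ?thesis using Sk[OF that] by (simp only: times_divide_eq_right eq_divide_eq) simp
    qed
    have alg: "(A / l) * ((B * d) * (g * X / (s * Z))\<^sup>2) / (c * (g * P / (s * Q)))
        = A * B / c * (d * (g / (M * Q)) / (s / (M * P)) * ((X / P) / (Z / Q))\<^sup>2 / l)"
      if "l \<noteq> 0" "c \<noteq> 0" "g \<noteq> 0" "s \<noteq> 0" "Z \<noteq> 0" "P \<noteq> 0" "Q \<noteq> 0" "M \<noteq> 0"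
      for A B M P Q X Z c d g l s :: real
      using that by (simp add: power2_eq_square divide_simps)
    have pos: "real (N - k) > 0" using kN by simp
    have e1: "1 + - (u / NN) * (1 / q) = real (N - k) / (NN * q)"
      using kN N0 q by (simp add: u_def NN_def q_def of_nat_diff field_simps)
    have e2: "1 + ((u + 1) / NN) * (1 / p) = real (Suc k) / (NN * p)"
      using kN N0 ip by (simp add: u_def NN_def field_simps)
    have e3: "1 + z' * (1 / p) = (x + h) / p" using ip by (simp add: z'_def z_def field_simps)
    have e4: "1 + - z' * (1 / q) = (1 - (x + h)) / q" using q by (simp add: z'_def z_def q_def field_simps)
    have R': "R = DD + ln (real (N - k) / (NN * q)) - ln (real (Suc k) / (NN * p)) + 2 * (ln ((x + h) / p) - ln ((1 - (x + h)) / q)) - LL"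
      unfolding R_def A1_def A2_def A3_def A4_def e1 e2 e3 e4 by simp
    have "exp R = exp DD * (real (N - k) / (NN * q)) / (real (Suc k) / (NN * p)) * (((x + h) / p) / ((1 - (x + h)) / q))\<^sup>2 / exp LL"
    proof -
      have a: "exp (2 * (ln ((x + h) / p) - ln ((1 - (x + h)) / q))) = (((x + h) / p) / ((1 - (x + h)) / q))\<^sup>2"
        unfolding exp_double exp_diff using xb' ip q by (simp add: divide_pos_pos)
      have b: "exp (ln (real (N - k) / (NN * q))) = real (N - k) / (NN * q)" "exp (ln (real (Suc k) / (NN * p))) = real (Suc k) / (NN * p)"
        using pos N0 ip q by (simp_all add: divide_pos_pos del: of_nat_Suc)
      show ?thesis unfolding R' exp_diff exp_add[of _ "2 * (ln ((x + h) / p) - ln ((1 - (x + h)) / q))"] a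
        unfolding exp_diff exp_add b by simp
    qed
    moreover have "exp (- Lam * (x + h - p)\<^sup>2) = exp (- Lam * (x - p)\<^sup>2) / exp LL"
      unfolding LL_def z_def exp_diff[symmetric] by (simp add: power2_eq_square algebra_simps)
    moreover have "(bw N (x + h) k)\<^sup>2 = (bw N x k)\<^sup>2 * exp DD"
      unfolding DD_def using xb xb' kN by (intro bw_ratio) auto
    moreover have "bw N p k > 0" using bw_pos[OF p01] kN by simp
    ultimately show ?thesis
      unfolding QQ_def step[OF xb'(4)] step[OF p01(2)] q_def[symmetric] power_mult_distrib[of "bw N (x + h) k"]
      using pos N0 ip q xb' by (simp only:) (rule alg, auto)
  qed
  then show ?thesis using Rb by blast
qed

end

section \<open>The mixing weights against the binomial weights\<close>

context mix begin

text \<open>\<open>K_p\<close> without its constant factor, which cancels against the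
  normalisation.\<close>

definition kern :: "real \<Rightarrow> real" where "kern x = exp (- Lam * (x - p)\<^sup>2)"
definition F :: "nat \<Rightarrow> real \<Rightarrow> real" where "F k x = kern x * ((bw N x k)\<^sup>2 / bsq N x)"
definition Vn :: real where "Vn = integral {0..1} kern"
text \<open>The weight of \<open>B_k\<close> in the mixture \<open>V_p\<close>, as
  \<open>pmf_Vp\<close> confirms.\<close>

definition w :: "nat \<Rightarrow> real" where "w k = integral {0..1} (F k) / Vn"
definition zeta :: real where "zeta = K / (2 * Y)"
definition Z :: "real set" where "Z = {p - zeta..p + zeta}"
definition ck :: "nat \<Rightarrow> real" where "ck k = (p + real k / real N) / 2"
text \<open>The window sits around the peak of the integrand and moves with \<open>k\<close>, so
  that the shift by \<open>1 / (2 * N)\<close> maps it exactly onto the next one. For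
  \<open>k\<close> in \<open>Tk\<close> it contains the fixed window \<open>Z\<close>, which puts
  \<open>mainw\<close> between \<open>nearw\<close> and \<open>w\<close>.\<close>

definition Xk :: "nat \<Rightarrow> real set" where "Xk k = {ck k - K / Y..ck k + K / Y}"
definition AA :: "nat \<Rightarrow> real" where "AA k = integral (Xk k) (II k)"
definition mainw :: "nat \<Rightarrow> real" where "mainw k = integral (Xk k) (F k) / Vn"
definition nearw :: "nat \<Rightarrow> real" where "nearw k = integral Z (F k) / Vn"
definition E1 :: real where "E1 = 3 * K ^ 7 / Y"

lemma bsq_pos': "0 \<le> x \<Longrightarrow> x \<le> 1 \<Longrightarrow> 0 < bsq N x"
proof -
  assume "0 \<le> x" "x \<le> 1"
  then have "1 \<le> (real N + 1) * bsq N x" by (rule bsq_lower)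
  then show ?thesis by (metis add_nonneg_pos less_le_trans of_nat_0_le_iff zero_less_mult_pos zero_less_one)
qed

lemma cont_kern: "continuous_on A kern" unfolding kern_def by (intro continuous_intros)

lemma cont_F: "continuous_on {0..1} (F k)"
  unfolding F_def bsq_def bw_def
proof (intro continuous_intros cont_kern)
  show "\<forall>x\<in>{0..1}. (\<Sum>j\<le>N. (real (N choose j) * x ^ j * (1 - x) ^ (N - j))\<^sup>2) \<noteq> 0"
    using bsq_pos' unfolding bsq_def bw_def by (metis atLeastAtMost_iff less_irrefl)
qed

lemma kern_pos: "0 < kern x" by (simp add: kern_def)

lemma F_nonneg: "x \<in> {0..1} \<Longrightarrow> 0 \<le> F k x"
  unfolding F_def using kern_pos[of x] bsq_pos'[of x] by (intro mult_nonneg_nonneg divide_nonneg_pos) auto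

lemma int_F: "{a..b} \<subseteq> {0..1} \<Longrightarrow> F k integrable_on {a..b}"
  by (intro integrable_continuous_real continuous_on_subset[OF cont_F])

lemma int_kern: "kern integrable_on {a..b}"
  by (intro integrable_continuous_real cont_kern)

lemma KY_small: "4 * K / Y \<le> 1 / (2 * K)" "2 * K / Y \<le> 1 / K" "K / Y \<ge> 0"
proof -
  show "4 * K / Y \<le> 1 / (2 * K)" using Y_big K by (simp add: field_simps)
  show "2 * K / Y \<le> 1 / K" using Y_big K by (simp add: field_simps)
  show "K / Y \<ge> 0" using Y_big K by simp
qed

lemma ck_near: "k \<in> Tk \<Longrightarrow> \<bar>ck k - p\<bar> \<le> zeta"
proof -
  assume k: "k \<in> Tk"
  have "ck k - p = (real k - real N * p) / (2 * real N)" using N_pos by (simp add: ck_def field_simps)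
  then have "\<bar>ck k - p\<bar> = \<bar>real k - real N * p\<bar> / (2 * real N)" by simp
  also have "\<dots> \<le> (K * Y) / (2 * real N)" using k by (intro divide_right_mono) (auto simp: Tk_def)
  also have "\<dots> = zeta" using Y_big by (simp add: N_eq zeta_def power2_eq_square)
  finally show ?thesis .
qed

lemma zeta2: "K / Y = zeta + zeta" "zeta \<ge> 0" using Y_big K by (auto simp: zeta_def)

lemma Z_sub: "Z \<subseteq> {0..1}" "k \<in> Tk \<Longrightarrow> Z \<subseteq> Xk k" "k \<in> Tk \<Longrightarrow> Xk k \<subseteq> {0..1}"
proof -
  have a: "2 * (K / Y) \<le> p" "2 * (K / Y) \<le> 1 - p" using KY_small(2) p_bounds by auto
  show "Z \<subseteq> {0..1}" unfolding Z_def using a zeta2 by auto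
  assume k: "k \<in> Tk"
  show "Z \<subseteq> Xk k" unfolding Z_def Xk_def using ck_near[OF k] zeta2 by (auto simp: abs_le_iff)
  show "Xk k \<subseteq> {0..1}" unfolding Xk_def using ck_near[OF k] zeta2 a by (auto simp: abs_le_iff)
qed

lemma sum_F: "x \<in> {0..1} \<Longrightarrow> (\<Sum>k\<le>N. F k x) = kern x"
  unfolding F_def using bsq_pos'[of x]
  by (simp add: sum_distrib_left[symmetric] sum_divide_distrib[symmetric] flip: bsq_def)

lemma Lam_pos: "Lam \<ge> 4 * real N" "Lam \<le> 4 * K * real N"
proof -
  have "p * (1 - p) \<le> 1 / 4"
  proof -
    have "0 \<le> (p - 1 / 2)\<^sup>2" by simp
    then show ?thesis by (simp add: power2_eq_square algebra_simps)
  qed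
  then have i: "4 \<le> 1 / (p * (1 - p))" using inv_bounds(4) by (simp add: field_simps)
  have Lam: "Lam = real L * (1 / (p * (1 - p)))" by (simp add: Lam_def)
  have "real N * 4 \<le> real L * (1 / (p * (1 - p)))" using NL(1) i by (intro mult_mono) auto
  then show "Lam \<ge> 4 * real N" unfolding Lam by simp
  have "2 * Y \<le> real N" unfolding N_eq using Y_big by (simp add: power2_eq_square mult_right_mono)
  then have "real L \<le> 2 * real N" using NL(2) unfolding Y_def by linarith
  then have "real L * (1 / (p * (1 - p))) \<le> (2 * real N) * (2 * K)" using inv_bounds by (intro mult_mono) auto
  then show "Lam \<le> 4 * K * real N" unfolding Lam by (simp add: mult_ac)
qed

lemma Vn_lower: "exp (- (4 * K)) / Y \<le> Vn" "Vn > 0"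
proof -
  have sub: "{p..p + 1 / Y} \<subseteq> {0..1}"
  proof -
    have "1 / Y \<le> K / Y" using K Y_big by (intro divide_right_mono) auto
    then show ?thesis using KY_small p_bounds p01 by auto
  qed
  have Y0: "0 \<le> 1 / Y" using Y_big by simp
  have "exp (- (4 * K)) * (1 / Y) = integral {p..p + 1 / Y} (\<lambda>x. exp (- (4 * K)))" using Y0 by simp
  also have "\<dots> \<le> integral {p..p + 1 / Y} kern"
  proof (rule integral_le[OF _ int_kern])
    fix x assume x: "x \<in> {p..p + 1 / Y}"
    then have "(x - p)\<^sup>2 \<le> (1 / Y)\<^sup>2" by (intro power_mono) auto
    then have "Lam * (x - p)\<^sup>2 \<le> (4 * K * real N) * (1 / Y)\<^sup>2" using Lam_pos K by (intro mult_mono) auto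
    also have "\<dots> = 4 * K" using Y_big by (simp add: N_eq power_divide)
    finally show "exp (- (4 * K)) \<le> kern x" by (simp add: kern_def)
  qed (intro integrable_continuous_real continuous_intros)
  also have "\<dots> \<le> Vn" unfolding Vn_def using kern_pos by (intro integral_subset_le sub int_kern) (auto intro: less_imp_le)
  finally show 1: "exp (- (4 * K)) / Y \<le> Vn" by simp
  have "0 < exp (- (4 * K)) / Y" using Y_big by simp
  then show "Vn > 0" using 1 by linarith
qed

lemma far_mass: "integral {0..1} kern - integral Z kern \<le> exp (- (K\<^sup>2))"
proof -
  have z: "0 \<le> p - zeta" "p + zeta \<le> 1" "p - zeta \<le> p + zeta" using Z_sub(1) zeta2 unfolding Z_def by auto
  have "integral {0..1} kern = integral {0..p - zeta} kern + integral {p - zeta..1} kern"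
    using z by (intro Henstock_Kurzweil_Integration.integral_combine[symmetric] int_kern) auto
  also have "integral {p - zeta..1} kern = integral Z kern + integral {p + zeta..1} kern"
    unfolding Z_def using z by (intro Henstock_Kurzweil_Integration.integral_combine[symmetric] int_kern) auto
  finally have eq: "integral {0..1} kern - integral Z kern = integral {0..p - zeta} kern + integral {p + zeta..1} kern" by simp
  have small: "kern x \<le> exp (- (K\<^sup>2))" if "\<bar>x - p\<bar> \<ge> zeta" for x
  proof -
    have "zeta\<^sup>2 \<le> \<bar>x - p\<bar>\<^sup>2" using that zeta2 by (intro power_mono)
    then have "(4 * real N) * zeta\<^sup>2 \<le> Lam * (x - p)\<^sup>2" using Lam_pos by (intro mult_mono) auto
    moreover have "(4 * real N) * zeta\<^sup>2 = K\<^sup>2" using Y_big by (simp add: N_eq zeta_def power_divide power_mult_distrib)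
    ultimately show ?thesis by (simp add: kern_def)
  qed
  have "integral {0..p - zeta} kern \<le> integral {0..p - zeta} (\<lambda>x. exp (- (K\<^sup>2)))"
    using z zeta2 by (intro integral_le int_kern small) auto
  moreover have "integral {p + zeta..1} kern \<le> integral {p + zeta..1} (\<lambda>x. exp (- (K\<^sup>2)))"
    using z zeta2 by (intro integral_le int_kern small) auto
  ultimately have "integral {0..1} kern - integral Z kern \<le> exp (- (K\<^sup>2)) * (p - zeta) + exp (- (K\<^sup>2)) * (1 - (p + zeta))"
    unfolding eq using z by (simp add: mult.commute)
  also have "\<dots> = exp (- (K\<^sup>2)) * (1 - 2 * zeta)" by (simp add: algebra_simps)
  also have "\<dots> \<le> exp (- (K\<^sup>2)) * 1" using zeta2 by (intro mult_left_mono) auto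
  finally show ?thesis by simp
qed

lemma Y_le_N: "Y \<le> real N + 1"
proof -
  have "Y * 1 \<le> Y * Y" using Y_big by (intro mult_left_mono) auto
  then show ?thesis by (simp add: N_eq power2_eq_square)
qed

lemma exp_beat: "Y * exp (4 * K - K\<^sup>2) \<le> (real N + 1) * exp (- K)"
proof (rule mult_mono)
  have "5 * K \<le> K * K" using K by (intro mult_right_mono) auto
  then show "exp (4 * K - K\<^sup>2) \<le> exp (- K)" by (simp add: power2_eq_square)
  show "Y \<le> real N + 1" by (rule Y_le_N)
qed auto

text \<open>Bounds the relative mass of the kernel outside \<open>Z\<close>. The factor
  \<open>N + 1\<close> covers the \<open>Y\<close> that comes from \<open>1 / Vn\<close> and, in
  other estimates, \<open>1 / bsq\<close>.\<close>

definition far :: real where "far = (real N + 1) * exp (- K)"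

lemma far_le: "(integral {0..1} kern - integral Z kern) / Vn \<le> far"
proof -
  have "(integral {0..1} kern - integral Z kern) / Vn \<le> exp (- (K\<^sup>2)) / (exp (- (4 * K)) / Y)"
    using far_mass Vn_lower Y_big by (intro frac_le) auto
  also have "\<dots> = Y * exp (4 * K - K\<^sup>2)" by (simp add: exp_diff exp_minus field_simps)
  finally show ?thesis using exp_beat unfolding far_def by linarith
qed

lemma sum_w: "(\<Sum>k\<le>N. w k) = 1"
proof -
  have "(\<Sum>k\<le>N. integral {0..1} (F k)) = integral {0..1} (\<lambda>x. \<Sum>k\<le>N. F k x)"
    by (rule integral_sum[symmetric]) (auto intro: int_F)
  also have "\<dots> = Vn" unfolding Vn_def using sum_F by (intro Henstock_Kurzweil_Integration.integral_cong) auto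
  finally show ?thesis unfolding w_def using Vn_lower by (simp add: sum_divide_distrib[symmetric])
qed

lemma sum_near: "(\<Sum>k\<le>N. nearw k) = integral Z kern / Vn"
proof -
  have "(\<Sum>k\<le>N. integral Z (F k)) = integral Z (\<lambda>x. \<Sum>k\<le>N. F k x)"
    unfolding Z_def using Z_sub(1) by (intro integral_sum[symmetric] int_F) (auto simp: Z_def)
  also have "\<dots> = integral Z kern" using sum_F Z_sub(1) by (intro Henstock_Kurzweil_Integration.integral_cong) auto
  finally show ?thesis unfolding nearw_def by (simp add: sum_divide_distrib[symmetric])
qed

lemma near_le_w: "nearw k \<le> w k" "0 \<le> nearw k"
proof -
  have "integral Z (F k) \<le> integral {0..1} (F k)"
    using Z_sub(1) F_nonneg by (intro integral_subset_le) (auto simp: Z_def intro!: int_F)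
  then show "nearw k \<le> w k" unfolding nearw_def w_def using Vn_lower by (intro divide_right_mono) auto
  have "0 \<le> integral Z (F k)" using Z_sub(1) F_nonneg by (intro integral_nonneg) (auto simp: Z_def intro!: int_F)
  then show "0 \<le> nearw k" unfolding nearw_def using Vn_lower by simp
qed

lemma w_nonneg: "0 \<le> w k" using near_le_w[of k] by linarith

lemma main_between:
  assumes "k \<in> Tk"
  shows "nearw k \<le> mainw k" "mainw k \<le> w k"
proof -
  have i: "F k integrable_on Xk k" using Z_sub(3)[OF assms] unfolding Xk_def by (rule int_F)
  have "integral Z (F k) \<le> integral (Xk k) (F k)"
    using Z_sub(1) Z_sub(2,3)[OF assms] F_nonneg i by (intro integral_subset_le) (auto simp: Z_def intro!: int_F)
  then show "nearw k \<le> mainw k" unfolding nearw_def mainw_def using Vn_lower by (intro divide_right_mono) auto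
  have "integral (Xk k) (F k) \<le> integral {0..1} (F k)"
    using Z_sub(3)[OF assms] F_nonneg i by (intro integral_subset_le) (auto intro!: int_F)
  then show "mainw k \<le> w k" unfolding w_def mainw_def using Vn_lower by (intro divide_right_mono) auto
qed

lemma Tk_sub: "Tk \<subseteq> {..N}" "finite Tk"
  by (auto simp: Tk_def intro: finite_subset[of _ "{..N}"])

lemma sum_tail_main: "(\<Sum>k\<in>Tk. w k - mainw k) \<le> far"
proof -
  have "(\<Sum>k\<in>Tk. w k - mainw k) \<le> (\<Sum>k\<in>Tk. w k - nearw k)" using main_between by (intro sum_mono) auto
  also have "\<dots> \<le> (\<Sum>k\<le>N. w k - nearw k)" using Tk_sub near_le_w by (intro sum_mono2) auto
  also have "\<dots> = 1 - integral Z kern / Vn" unfolding sum_subtractf sum_w sum_near ..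
  also have "\<dots> = (integral {0..1} kern - integral Z kern) / Vn" using Vn_lower by (simp add: Vn_def diff_divide_distrib)
  finally show ?thesis using far_le by linarith
qed

text \<open>Either \<open>x\<close> lies outside \<open>Z\<close>, which has little kernel mass, or
  \<open>x\<close> is so close to \<open>p\<close> that an atypical \<open>k\<close> is at least
  \<open>K * Y / 2\<close> away from \<open>N * x\<close>; then \<open>b\<^sup>2 \<le> b\<close> and
  \<open>1 / bsq \<le> N + 1\<close> reduce the claim to the binomial tail.\<close>

lemma sum_w_outside: "(\<Sum>k\<in>{..N} - Tk. w k) \<le> 3 * far"
proof -
  have "(\<Sum>k\<in>{..N} - Tk. w k) = (\<Sum>k\<in>{..N} - Tk. w k - nearw k) + (\<Sum>k\<in>{..N} - Tk. nearw k)"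
    by (simp add: sum.distrib[symmetric])
  also have "(\<Sum>k\<in>{..N} - Tk. w k - nearw k) \<le> (\<Sum>k\<le>N. w k - nearw k)" using near_le_w by (intro sum_mono2) auto
  also have "\<dots> = 1 - integral Z kern / Vn" unfolding sum_subtractf sum_w sum_near ..
  also have "\<dots> = (integral {0..1} kern - integral Z kern) / Vn" using Vn_lower by (simp add: Vn_def diff_divide_distrib)
  also have "\<dots> \<le> far" by (rule far_le)
  also have "(\<Sum>k\<in>{..N} - Tk. nearw k) \<le> 2 * far"
  proof -
    have "(\<Sum>k\<in>{..N} - Tk. integral Z (F k)) = integral Z (\<lambda>x. \<Sum>k\<in>{..N} - Tk. F k x)"
      unfolding Z_def using Z_sub(1) by (intro integral_sum[symmetric] int_F) (auto simp: Z_def)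
    also have "\<dots> \<le> integral Z (\<lambda>x. (2 * far) * kern x)"
    proof (rule integral_le)
      show "(\<lambda>x. \<Sum>k\<in>{..N} - Tk. F k x) integrable_on Z"
        unfolding Z_def using Z_sub(1) by (intro integrable_sum int_F) (auto simp: Z_def)
      show "(\<lambda>x. (2 * far) * kern x) integrable_on Z"
        unfolding Z_def by (intro integrable_on_mult_right int_kern)
      fix x assume x: "x \<in> Z"
      then have x01: "0 \<le> x" "x \<le> 1" using Z_sub(1) by auto
      let ?A = "{j. j \<in> {..N} \<and> K * Y / 2 \<le> \<bar>real j - real N * x\<bar>}"
      have sub: "{..N} - Tk \<subseteq> ?A"
      proof
        fix j assume j: "j \<in> {..N} - Tk"
        have "\<bar>real N * x - real N * p\<bar> = real N * \<bar>x - p\<bar>" by (simp add: abs_mult right_diff_distrib[symmetric])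
        also have "\<dots> \<le> real N * zeta" using x by (intro mult_left_mono) (auto simp: Z_def)
        also have "\<dots> = K * Y / 2" using Y_big by (simp add: N_eq zeta_def power2_eq_square)
        finally have "\<bar>real N * x - real N * p\<bar> \<le> K * Y / 2" .
        moreover have "\<not> \<bar>real j - real N * p\<bar> \<le> K * Y" using j by (auto simp: Tk_def)
        moreover have "c / 2 \<le> \<bar>J - A\<bar>" if "\<bar>A - B\<bar> \<le> c / 2" "\<not> \<bar>J - B\<bar> \<le> c" for A B J c :: real
          using that by (simp add: abs_if split: if_splits)
        ultimately have "K * Y / 2 \<le> \<bar>real j - real N * x\<bar>" by blast
        then show "j \<in> ?A" using j by simp
      qed
      have b: "0 < bsq N x" using bsq_pos' x01 by blast
      have KYs: "K * Y / 2 \<le> 2 * real N"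
      proof -
        have "K * Y \<le> Y * Y" using K_pow_le[of 1] Y_big by (intro mult_right_mono) auto
        then show ?thesis using mult_pos_pos[of Y Y] Y_big unfolding N_eq power2_eq_square by linarith
      qed
      have "(\<Sum>k\<in>{..N} - Tk. F k x) = kern x * ((\<Sum>k\<in>{..N} - Tk. (bw N x k)\<^sup>2) / bsq N x)"
        by (simp add: F_def sum_distrib_left sum_divide_distrib)
      also have "\<dots> \<le> kern x * (2 * far)"
      proof (rule mult_left_mono)
        have "(\<Sum>k\<in>{..N} - Tk. (bw N x k)\<^sup>2) \<le> (\<Sum>k\<in>{..N} - Tk. bw N x k)"
          using bw_nonneg[OF x01] bw_le_1[OF x01] by (intro sum_mono) (auto simp: power2_eq_square mult_left_le)
        also have "\<dots> \<le> (\<Sum>k\<in>?A. bw N x k)" using sub bw_nonneg[OF x01] by (intro sum_mono2) auto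
        also have "\<dots> \<le> 2 * exp (- ((K * Y / 2)\<^sup>2 / (4 * real N)))"
          using K Y_big KYs by (intro bw_tail[OF x01 N_pos]) auto
        also have "(K * Y / 2)\<^sup>2 / (4 * real N) = K\<^sup>2 / 16" using Y_big by (simp add: N_eq power_mult_distrib power_divide)
        also have "2 * exp (- (K\<^sup>2 / 16)) \<le> 2 * exp (- K)" by (rule exp_K2)
        finally have s: "(\<Sum>k\<in>{..N} - Tk. (bw N x k)\<^sup>2) \<le> 2 * exp (- K)" .
        have "1 / bsq N x \<le> real N + 1" using bsq_lower[OF x01, of N] b by (simp add: divide_le_eq)
        then have "(\<Sum>k\<in>{..N} - Tk. (bw N x k)\<^sup>2) * (1 / bsq N x) \<le> (2 * exp (- K)) * (real N + 1)"
          using s b by (intro mult_mono) auto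
        then show "(\<Sum>k\<in>{..N} - Tk. (bw N x k)\<^sup>2) / bsq N x \<le> 2 * far" by (simp add: far_def mult_ac)
      qed (use kern_pos[of x] in simp)
      finally show "(\<Sum>k\<in>{..N} - Tk. F k x) \<le> (2 * far) * kern x" by (simp add: mult.commute)
    qed
    also have "\<dots> = (2 * far) * integral Z kern" by simp
    also have "\<dots> \<le> (2 * far) * Vn"
    proof (rule mult_left_mono)
      show "integral Z kern \<le> Vn" unfolding Vn_def Z_def using Z_sub(1) kern_pos
        by (intro integral_subset_le int_kern) (auto simp: Z_def intro: less_imp_le)
    qed (simp add: far_def)
    finally show ?thesis unfolding nearw_def sum_divide_distrib[symmetric] using Vn_lower by (simp add: divide_le_eq)
  qed
  finally show ?thesis by simp
qed

lemma sum_bw_outside: "(\<Sum>k\<in>{..N} - Tk. bw N p k) \<le> 2 * far"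
proof -
  have p': "0 \<le> p" "p \<le> 1" using p01 by auto
  have "(\<Sum>k\<in>{..N} - Tk. bw N p k) \<le> (\<Sum>j | j \<in> {..N} \<and> K * Y \<le> \<bar>real j - real N * p\<bar>. bw N p j)"
    using bw_nonneg[OF p'] by (intro sum_mono2) (auto simp: Tk_def)
  also have "\<dots> \<le> 2 * exp (- ((K * Y)\<^sup>2 / (4 * real N)))"
  proof (rule bw_tail[OF p' N_pos])
    have "K * Y \<le> Y * Y" using K_pow_le[of 1] Y_big by (intro mult_right_mono) auto
    then show "K * Y \<le> 2 * real N" using mult_pos_pos[of Y Y] Y_big unfolding N_eq power2_eq_square by linarith
  qed (use K Y_big in auto)
  also have "(K * Y)\<^sup>2 / (4 * real N) = K\<^sup>2 / 4" using Y_big by (simp add: N_eq power_mult_distrib)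
  also have "2 * exp (- (K\<^sup>2 / 4)) \<le> 2 * exp (- K)" by (rule exp_K2)
  also have "\<dots> \<le> 2 * far" unfolding far_def by simp
  finally show ?thesis .
qed

text \<open>\<open>bsq_shift\<close> is applied from \<open>x\<close> with \<open>h\<close> and from
  \<open>x + h\<close> with \<open>- h\<close>, which gives both directions;
  \<open>K ^ 6 / N\<close> dominates the errors of \<open>QQ\<close> and \<open>bsq\<close>
  together.\<close>

lemma II_bounds:
  assumes k: "k \<in> Tk" "Suc k \<in> Tk" and x: "\<bar>x - p\<bar> \<le> 2 * K / Y"
  defines "h \<equiv> 1 / (2 * real N)"
  shows "II (Suc k) (x + h) \<le> (1 + K ^ 6 / real N) * II k x" "II k x \<le> (1 + K ^ 6 / real N) * II (Suc k) (x + h)"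
proof -
  define a where "a = 1 / real N"
  have a0: "a > 0" using N_pos by (simp add: a_def)
  define E where "E = K ^ 6 * a"
  define Ep where "Ep = 2 * K ^ 5 * a"
  define e2 where "e2 = 20 * K ^ 4 * a"
  have K6: "K ^ 6 * a \<le> 1 / 100"
  proof -
    have "K ^ 6 \<le> Y" by (rule K_pow_le) simp
    moreover have "100 * Y \<le> real N" unfolding N_eq power2_eq_square using Y_big by (intro mult_right_mono) auto
    ultimately have "100 * K ^ 6 \<le> real N" by linarith
    then show ?thesis using N_pos by (simp add: a_def field_simps)
  qed
  have rel: "100 * Ep \<le> 2 * E" "500 * e2 \<le> E" "0 \<le> Ep" "0 \<le> e2" "0 \<le> E" "E \<le> 1 / 100"
  proof -
    have "100 * K ^ 5 \<le> K * K ^ 5" "10000 * K ^ 4 \<le> (K * K) * K ^ 4"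
      using K mult_mono[of 100 K 100 K] by (intro mult_right_mono; simp)+
    then have "100 * K ^ 5 * a \<le> K ^ 6 * a" "10000 * K ^ 4 * a \<le> K ^ 6 * a"
      using a0 by (intro mult_right_mono; simp add: eval_nat_numeral mult_ac)+
    then show "100 * Ep \<le> 2 * E" "500 * e2 \<le> E" unfolding Ep_def e2_def E_def by (simp_all add: mult_ac)
    show "0 \<le> Ep" "0 \<le> e2" "0 \<le> E" using K a0 by (auto simp: Ep_def e2_def E_def)
    show "E \<le> 1 / 100" using K6 by (simp add: E_def)
  qed
  obtain R where R: "\<bar>R\<bar> \<le> Ep" "QQ (Suc k) (x + h) = QQ k x * exp R"
    using QQ_shift[OF k x] unfolding h_def Ep_def a_def by auto
  have x3: "\<bar>x - p\<bar> \<le> 3 * K / Y" "\<bar>x - p\<bar> \<le> 4 * K / Y" using x KY_small(3) by auto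
  have h0: "\<bar>h\<bar> = 1 / (2 * real N)" "h > 0" using N_pos by (auto simp: h_def)
  have hY: "h \<le> K / Y"
  proof -
    have "1 / (2 * real N) \<le> 1 / Y" using Y_big by (intro frac_le) (auto simp: N_eq power2_eq_square mult_mono)
    also have "\<dots> \<le> K / Y" using K Y_big by (intro divide_right_mono) auto
    finally show ?thesis by (simp add: h_def)
  qed
  have t: "2 * K / Y = 2 * (K / Y)" "3 * K / Y = 3 * (K / Y)" "4 * K / Y = 4 * (K / Y)" by auto
  have x': "\<bar>x + h - p\<bar> \<le> 3 * K / Y" "\<bar>x + h - p\<bar> \<le> 4 * K / Y"
    using x hY h0(2) KY_small(3) unfolding t by linarith+
  note xb = near_p[OF x3(2)] and xb' = near_p[OF x'(2)]
  have b: "bsq N x > 0" "bsq N (x + h) > 0" using bsq_pos xb xb' by auto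
  have s1: "bsq N x * (1 - e2) \<le> bsq N (x + h)"
    using bsq_shift[OF x3(1) x'(2) h0(1)] by (simp add: e2_def a_def)
  have s2: "bsq N (x + h) * (1 - e2) \<le> bsq N x"
    using bsq_shift[of "x + h" "- h"] x' x3 h0 by (simp add: e2_def a_def)
  have Q0: "0 \<le> QQ k x" "0 \<le> QQ (Suc k) (x + h)"
    unfolding QQ_def using bw_nonneg p01 by (auto intro!: divide_nonneg_nonneg mult_nonneg_nonneg)
  have eR: "exp r \<le> (1 + E) * (1 - e2)" if "\<bar>r\<bar> \<le> Ep" for r
  proof -
    have "exp r \<le> exp Ep" using that by simp
    also have "\<dots> \<le> 1 + Ep + Ep\<^sup>2" using rel by (intro exp_le_quadratic) auto
    also have "Ep\<^sup>2 \<le> Ep * 1" unfolding power2_eq_square using rel by (intro mult_left_mono) auto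
    also have "1 + Ep + Ep * 1 \<le> (1 + E) * (1 - e2)"
    proof -
      have "E * e2 \<le> 1 * e2" using rel by (intro mult_right_mono) auto
      then show ?thesis using rel by (simp add: algebra_simps)
    qed
    finally show ?thesis by simp
  qed
  have e2': "0 < 1 - e2" using rel by linarith
  show "II (Suc k) (x + h) \<le> (1 + K ^ 6 / real N) * II k x"
  proof -
    have "II (Suc k) (x + h) = QQ k x * exp R / bsq N (x + h)" by (simp add: II_def R)
    also have "\<dots> \<le> QQ k x * ((1 + E) * (1 - e2)) / (bsq N x * (1 - e2))"
      using eR[OF R(1)] s1 Q0 b e2' rel by (intro frac_le mult_left_mono mult_nonneg_nonneg) auto
    also have "\<dots> = (1 + E) * II k x" using e2' by (simp add: II_def)
    finally show ?thesis by (simp add: E_def a_def)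
  qed
  show "II k x \<le> (1 + K ^ 6 / real N) * II (Suc k) (x + h)"
  proof -
    have "QQ k x = QQ (Suc k) (x + h) * exp (- R)" by (simp add: R exp_minus)
    then have "II k x = QQ (Suc k) (x + h) * exp (- R) / bsq N x" by (simp add: II_def)
    also have "\<dots> \<le> QQ (Suc k) (x + h) * ((1 + E) * (1 - e2)) / (bsq N (x + h) * (1 - e2))"
      using eR[of "- R"] R(1) s2 Q0 b e2' rel by (intro frac_le mult_left_mono mult_nonneg_nonneg) auto
    also have "\<dots> = (1 + E) * II (Suc k) (x + h)" using e2' by (simp add: II_def)
    finally show ?thesis by (simp add: E_def a_def)
  qed
qed

lemma F_II: "k \<le> N \<Longrightarrow> F k x = bw N p k * II k x"
  unfolding F_def II_def QQ_def kern_def using bw_pos[OF p01, of k N] by simp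

lemma int_F_II: "k \<le> N \<Longrightarrow> integral A (F k) = bw N p k * integral A (II k)"
proof -
  assume "k \<le> N"
  then have "F k = (\<lambda>x. bw N p k * II k x)" using F_II by blast
  then show ?thesis by simp
qed

lemma cont_II: "k \<le> N \<Longrightarrow> continuous_on {0..1} (II k)"
proof -
  assume k: "k \<le> N"
  have "continuous_on {0..1} (\<lambda>x. (1 / bw N p k) * F k x)" by (intro continuous_intros cont_F)
  then show ?thesis using bw_pos[OF p01 k] by (simp add: F_II[OF k])
qed

text \<open>Substituting \<open>x + h\<close> carries the window of \<open>k\<close> onto that of
  \<open>k + 1\<close>, so the pointwise comparison integrates without boundary terms.\<close>

lemma AA_step:
  assumes k: "k \<in> Tk" "Suc k \<in> Tk"
  shows "AA (Suc k) \<le> (1 + K ^ 6 / real N) * AA k" "AA k \<le> (1 + K ^ 6 / real N) * AA (Suc k)"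
proof -
  define h where "h = 1 / (2 * real N)"
  let ?a = "ck k - K / Y" and ?b = "ck k + K / Y"
  have kN: "k \<le> N" "Suc k \<le> N" using k by (auto simp: Tk_def)
  have ckS: "ck (Suc k) = ck k + h" by (simp add: ck_def h_def add_divide_distrib)
  have X: "Xk (Suc k) = {?a + h..?b + h}" by (simp add: Xk_def ckS algebra_simps)
  have cS: "continuous_on {?a + h..?b + h} (II (Suc k))"
    using Z_sub(3)[OF k(2)] unfolding X by (rule continuous_on_subset[OF cont_II[OF kN(2)]])
  have "integral {?a..?b} (II (Suc k) \<circ> (\<lambda>x. x + h)) = integral {?a + h..?b + h} (II (Suc k))"
    by (rule integral_shift[OF cS])
  then have AS: "AA (Suc k) = integral {?a..?b} (\<lambda>x. II (Suc k) (x + h))" by (simp add: AA_def X o_def)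
  have A: "AA k = integral {?a..?b} (II k)" by (simp add: AA_def Xk_def)
  have i1: "II k integrable_on {?a..?b}"
    using Z_sub(3)[OF k(1)] unfolding Xk_def by (intro integrable_continuous_real continuous_on_subset[OF cont_II[OF kN(1)]])
  have i2: "(\<lambda>x. II (Suc k) (x + h)) integrable_on {?a..?b}"
  proof (rule integrable_continuous_real)
    show "continuous_on {?a..?b} (\<lambda>x. II (Suc k) (x + h))"
      by (rule continuous_on_compose2[OF cS]) (auto intro!: continuous_intros)
  qed
  have near: "\<bar>x - p\<bar> \<le> 2 * K / Y" if "x \<in> {?a..?b}" for x
  proof -
    have "\<bar>x - ck k\<bar> \<le> K / Y" using that by (auto simp: abs_le_iff)
    moreover have "2 * K / Y = 2 * (K / Y)" by simp
    ultimately show ?thesis using ck_near[OF k(1)] zeta2 by linarith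
  qed
  have "AA (Suc k) \<le> integral {?a..?b} (\<lambda>x. (1 + K ^ 6 / real N) * II k x)"
    unfolding AS using II_bounds(1)[OF k near] by (intro integral_le i2 integrable_on_mult_right i1) (auto simp: h_def)
  then show "AA (Suc k) \<le> (1 + K ^ 6 / real N) * AA k" by (simp add: A)
  have "AA k \<le> integral {?a..?b} (\<lambda>x. (1 + K ^ 6 / real N) * II (Suc k) (x + h))"
    unfolding A using II_bounds(2)[OF k near] by (intro integral_le i1 integrable_on_mult_right i2) (auto simp: h_def)
  then show "AA k \<le> (1 + K ^ 6 / real N) * AA (Suc k)" by (simp add: AS)
qed

lemma AA_chain:
  assumes "i \<in> Tk" "i + j \<in> Tk"
  shows "AA (i + j) \<le> exp (real j * (K ^ 6 / real N)) * AA i \<and> AA i \<le> exp (real j * (K ^ 6 / real N)) * AA (i + j)"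
  using assms(2)
proof (induction j)
  case (Suc j)
  define e where "e = K ^ 6 / real N"
  \<comment> \<open>\<open>Tk\<close> is an interval, so intermediate counts remain typical.\<close>
  have ij: "i + j \<in> Tk" using assms(1) Suc.prems by (auto simp: Tk_def abs_le_iff)
  have e1: "1 + e \<le> exp e" by (rule exp_ge_add_one_self)
  have ex: "exp (real (Suc j) * e) = exp e * exp (real j * e)" by (simp add: exp_add[symmetric] algebra_simps)
  have A0: "0 \<le> AA i" if "i \<in> Tk" for i
  proof -
    have iN: "i \<le> N" using that by (auto simp: Tk_def)
    have "II i integrable_on Xk i" using Z_sub(3)[OF that] unfolding Xk_def
      by (intro integrable_continuous_real continuous_on_subset[OF cont_II[OF iN]])
    moreover have "0 \<le> II i x" if "x \<in> Xk i" for x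
    proof -
      have "0 \<le> bw N p i * II i x" using F_nonneg[of x i] Z_sub(3)[OF \<open>i \<in> Tk\<close>] that F_II[OF iN, of x] by auto
      then show ?thesis using bw_pos[OF p01 iN] by (simp add: zero_le_mult_iff)
    qed
    ultimately show ?thesis unfolding AA_def by (intro integral_nonneg) auto
  qed
  have st: "AA (Suc (i + j)) \<le> (1 + e) * AA (i + j)" "AA (i + j) \<le> (1 + e) * AA (Suc (i + j))"
    using AA_step[OF ij] Suc.prems by (auto simp: e_def)
  have IH: "AA (i + j) \<le> exp (real j * e) * AA i" "AA i \<le> exp (real j * e) * AA (i + j)" using Suc.IH[OF ij] by (auto simp: e_def)
  have "AA (Suc (i + j)) \<le> exp e * AA (i + j)" using st(1) mult_right_mono[OF e1 A0[OF ij]] by linarith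
  also have "\<dots> \<le> exp e * (exp (real j * e) * AA i)" using IH(1) by (intro mult_left_mono) auto
  finally have 1: "AA (i + Suc j) \<le> exp (real (Suc j) * e) * AA i" by (simp add: ex mult.assoc del: of_nat_Suc)
  have "AA (i + j) \<le> exp e * AA (Suc (i + j))" using st(2) mult_right_mono[OF e1 A0, of "Suc (i + j)"] Suc.prems by simp
  then have "exp (real j * e) * AA (i + j) \<le> exp (real j * e) * (exp e * AA (Suc (i + j)))" by (intro mult_left_mono) auto
  then have "AA i \<le> exp (real j * e) * (exp e * AA (Suc (i + j)))" using IH(2) by linarith
  then have "AA i \<le> exp (real (Suc j) * e) * AA (i + Suc j)" unfolding ex by (simp only: mult.left_commute mult.assoc add_Suc_right)
  then show ?case using 1 by (simp add: e_def)
qed simp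

text \<open>Two typical edge counts differ by at most \<open>2 * K * Y\<close>, and each step costs
  a factor \<open>1 + K ^ 6 / N\<close>; the product is \<open>exp\<close> of a quantity of order
  \<open>K ^ 7 / Y\<close>.\<close>

lemma AA_ratio:
  assumes "i \<in> Tk" "j \<in> Tk"
  shows "AA i \<le> exp E1 * AA j"
proof -
  define l where "l = (if i \<le> j then j - i else i - j)"
  have d: "real l \<le> 2 * (K * Y)" using assms unfolding l_def Tk_def by (auto simp: of_nat_diff abs_le_iff)
  have "real l * (K ^ 6 / real N) \<le> (2 * (K * Y)) * (K ^ 6 / real N)" using d K by (intro mult_right_mono) auto
  also have "\<dots> = 2 * (K ^ 7 / Y)" using Y_big by (simp add: N_eq power2_eq_square flip: power_Suc)
  also have "\<dots> \<le> 3 * (K ^ 7 / Y)" using K Y_big by (intro mult_right_mono) auto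
  also have "\<dots> = E1" by (simp add: E1_def)
  finally have le: "exp (real l * (K ^ 6 / real N)) \<le> exp E1" by simp
  have c: "AA i \<le> exp (real l * (K ^ 6 / real N)) * AA j"
  proof (cases "i \<le> j")
    case True
    then show ?thesis using AA_chain[of i l] assms by (simp add: l_def)
  next
    case False
    then show ?thesis using AA_chain[of j l] assms by (simp add: l_def)
  qed
  have jN: "j \<le> N" using assms by (auto simp: Tk_def)
  have "0 \<le> integral (Xk j) (F j)"
    using near_le_w(2)[of j] main_between(1)[OF assms(2)] Vn_lower by (simp add: mainw_def zero_le_divide_iff) (smt (verit) divide_neg_pos)
  moreover have "integral (Xk j) (F j) = bw N p j * AA j" unfolding AA_def by (rule int_F_II[OF jN])
  ultimately have "0 \<le> AA j" using bw_pos[OF p01 jN] by (simp add: zero_le_mult_iff)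
  then have "exp (real l * (K ^ 6 / real N)) * AA j \<le> exp E1 * AA j" using le by (intro mult_right_mono)
  then show ?thesis using c by linarith
qed

lemma E1_bounds: "0 < E1" "E1 \<le> 1 / 20" "1 / Y \<le> E1"
proof -
  show "0 < E1" using K Y_big by (simp add: E1_def)
  have "60 * K ^ 7 \<le> K * K ^ 7" using K by (intro mult_right_mono) auto
  also have "K * K ^ 7 = K ^ 8" by (simp flip: power_Suc)
  also have "K ^ 8 \<le> Y" by (rule K_pow_le) simp
  finally show "E1 \<le> 1 / 20" using Y_big by (simp add: E1_def divide_le_eq)
  have "1 \<le> K ^ 7" using K by (intro one_le_power) auto
  then have "1 \<le> 3 * K ^ 7" by linarith
  then show "1 / Y \<le> E1" unfolding E1_def using Y_big by (intro divide_right_mono) auto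
qed

lemma far_bounds: "0 \<le> far" "far \<le> E1 / 16"
proof -
  show "0 \<le> far" by (simp add: far_def)
  have "far * (real N + 1)\<^sup>2 = (real N + 1) ^ 3 * exp (- K)" by (simp add: far_def power2_eq_square power3_eq_cube)
  then have 1: "far * (real N + 1)\<^sup>2 \<le> 1 / 16" using small by simp
  have "Y \<le> (real N + 1)\<^sup>2"
  proof -
    have "(real N + 1) * 1 \<le> (real N + 1) * (real N + 1)" by (intro mult_left_mono) auto
    then show ?thesis using order_trans[OF Y_le_N] by (simp only: power2_eq_square mult_1_right)
  qed
  then have "far * Y \<le> far * (real N + 1)\<^sup>2" using \<open>0 \<le> far\<close> by (intro mult_left_mono)
  then have "far * Y \<le> 1 / 16" using 1 by linarith
  then have "far \<le> (1 / 16) / Y" using Y_big by (subst le_divide_eq) auto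
  also have "\<dots> \<le> E1 / 16" using E1_bounds(3) by simp
  finally show "far \<le> E1 / 16" .
qed

text \<open>The quotient of \<open>mainw\<close> and the binomial weight is nearly constant on
  \<open>Tk\<close>. Both families sum to nearly 1 there, so summing the cross-multiplied comparison
  over one index forces the constant to be nearly 1.\<close>

lemma main_vs_bw:
  assumes k: "k \<in> Tk"
  shows "mainw k \<le> (1 + 2 * E1) * bw N p k" "bw N p k \<le> (1 + 2 * E1) * mainw k"
proof -
  have mb: "mainw i = bw N p i * AA i / Vn" if "i \<in> Tk" for i
  proof -
    have "i \<le> N" using that by (auto simp: Tk_def)
    then show ?thesis by (simp add: mainw_def AA_def int_F_II)
  qed
  have bp: "0 < bw N p i" if "i \<in> Tk" for i using that bw_pos[OF p01] by (auto simp: Tk_def)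
  have cross: "mainw i * bw N p j \<le> exp E1 * (mainw j * bw N p i)" if "i \<in> Tk" "j \<in> Tk" for i j
  proof -
    have "(bw N p i * bw N p j / Vn) * AA i \<le> (bw N p i * bw N p j / Vn) * (exp E1 * AA j)"
      using AA_ratio[OF that] bp[OF that(1)] bp[OF that(2)] Vn_lower by (intro mult_left_mono) auto
    then show ?thesis unfolding mb[OF that(1)] mb[OF that(2)] by (simp add: mult_ac)
  qed
  define \<beta> where "\<beta> = (\<Sum>i\<in>Tk. bw N p i)"
  define \<mu> where "\<mu> = (\<Sum>i\<in>Tk. mainw i)"
  have p': "0 \<le> p" "p \<le> 1" using p01 by auto
  have split: "(\<Sum>i\<le>N. f i) = (\<Sum>i\<in>{..N} - Tk. f i) + (\<Sum>i\<in>Tk. f i)" for f :: "nat \<Rightarrow> real"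
    using Tk_sub by (intro sum.subset_diff) auto
  have \<beta>: "\<beta> \<le> 1" "1 - 2 * far \<le> \<beta>"
  proof -
    have "0 \<le> (\<Sum>i\<in>{..N} - Tk. bw N p i)" using bw_nonneg[OF p'] by (intro sum_nonneg) auto
    then show "\<beta> \<le> 1" "1 - 2 * far \<le> \<beta>" using split[of "bw N p"] sum_bw[of N p] sum_bw_outside unfolding \<beta>_def by linarith+
  qed
  have \<mu>: "\<mu> \<le> 1" "1 - 4 * far \<le> \<mu>"
  proof -
    have "0 \<le> (\<Sum>i\<in>{..N} - Tk. w i)" using w_nonneg by (intro sum_nonneg) auto
    moreover have "\<mu> \<le> (\<Sum>i\<in>Tk. w i)" unfolding \<mu>_def using main_between by (intro sum_mono) auto
    moreover have "(\<Sum>i\<in>Tk. w i) - \<mu> \<le> far" using sum_tail_main by (simp add: \<mu>_def sum_subtractf)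
    ultimately show "\<mu> \<le> 1" "1 - 4 * far \<le> \<mu>" using split[of w] sum_w sum_w_outside by linarith+
  qed
  have eE: "exp E1 \<le> 1 + E1 + E1 * E1" using E1_bounds exp_le_quadratic[of E1] by (simp add: power2_eq_square)
  have EE: "E1 * E1 \<le> E1 * (1 / 20)" using E1_bounds by (intro mult_left_mono) auto
  have gap: "exp E1 \<le> (1 + 2 * E1) * (1 - 4 * far)"
  proof -
    have "E1 * far \<le> E1 * (E1 / 16)" using far_bounds E1_bounds by (intro mult_left_mono) auto
    moreover have "E1 * (E1 / 16) = (E1 * E1) / 16" by simp
    ultimately have "E1 + E1 * E1 + 4 * far + 8 * (E1 * far) \<le> 2 * E1"
      using EE far_bounds E1_bounds by linarith
    then show ?thesis using eE by (simp add: algebra_simps)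
  qed
  have f4: "0 < 1 - 4 * far" using far_bounds E1_bounds by linarith
  have m0: "0 \<le> mainw k" using near_le_w(2)[of k] main_between(1)[OF k] by linarith
  have "mainw k * \<beta> \<le> exp E1 * (\<mu> * bw N p k)"
    unfolding \<beta>_def \<mu>_def sum_distrib_left sum_distrib_right using cross[OF k] by (intro sum_mono) auto
  also have "\<dots> \<le> exp E1 * (1 * bw N p k)" using \<mu> bp[OF k] by (intro mult_left_mono mult_right_mono) auto
  also have "\<dots> \<le> ((1 + 2 * E1) * (1 - 4 * far)) * bw N p k" using gap bp[OF k] by (simp add: mult_right_mono)
  finally have "mainw k * \<beta> \<le> (1 - 4 * far) * ((1 + 2 * E1) * bw N p k)" by (simp add: mult_ac)
  moreover have "mainw k * (1 - 4 * far) \<le> mainw k * \<beta>" using \<beta> far_bounds m0 by (intro mult_left_mono) auto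
  ultimately have "(1 - 4 * far) * mainw k \<le> (1 - 4 * far) * ((1 + 2 * E1) * bw N p k)" by (simp add: mult.commute)
  then show "mainw k \<le> (1 + 2 * E1) * bw N p k" using f4 by (simp only: mult_le_cancel_left_pos)
  have "bw N p k * \<mu> \<le> exp E1 * (mainw k * \<beta>)"
  proof -
    have "bw N p k * \<mu> = (\<Sum>i\<in>Tk. mainw i * bw N p k)" by (simp add: \<mu>_def sum_distrib_left mult.commute)
    also have "\<dots> \<le> (\<Sum>i\<in>Tk. exp E1 * (mainw k * bw N p i))" using cross[OF _ k] by (intro sum_mono) auto
    also have "\<dots> = exp E1 * (mainw k * \<beta>)" by (simp add: \<beta>_def sum_distrib_left)
    finally show ?thesis .
  qed
  also have "\<dots> \<le> exp E1 * (mainw k * 1)" using \<beta> m0 by (intro mult_left_mono) auto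
  also have "\<dots> \<le> ((1 + 2 * E1) * (1 - 4 * far)) * mainw k" using gap m0 by (simp add: mult_right_mono)
  finally have "bw N p k * \<mu> \<le> (1 - 4 * far) * ((1 + 2 * E1) * mainw k)" by (simp add: mult_ac)
  moreover have "bw N p k * (1 - 4 * far) \<le> bw N p k * \<mu>" using \<mu> bp[OF k] by (intro mult_left_mono) auto
  ultimately have "(1 - 4 * far) * bw N p k \<le> (1 - 4 * far) * ((1 + 2 * E1) * mainw k)" by (simp add: mult.commute)
  then show "bw N p k \<le> (1 + 2 * E1) * mainw k" using f4 by (simp only: mult_le_cancel_left_pos)
qed

text \<open>\<open>mainw\<close> is close to \<open>w\<close> in total but perhaps not for every
  single \<open>k\<close>; the exceptional counts are removed by Markov's inequality and have
  negligible weight.\<close>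

definition Tgood :: "nat set" where "Tgood = {k \<in> Tk. w k - mainw k \<le> E1 * mainw k}"

theorem weights_close:
  shows "Tgood \<subseteq> Tk" "\<And>k. k \<in> Tgood \<Longrightarrow> \<bar>bw N p k - w k\<bar> \<le> 4 * E1 * w k"
    "(\<Sum>k\<in>{..N} - Tgood. bw N p k) \<le> 6 * (real N + 1) * far" "(\<Sum>k\<in>{..N} - Tgood. w k) \<le> 6 * (real N + 1) * far"
proof -
  show "Tgood \<subseteq> Tk" by (auto simp: Tgood_def)
  show "\<bar>bw N p k - w k\<bar> \<le> 4 * E1 * w k" if k: "k \<in> Tgood" for k
  proof -
    have kT: "k \<in> Tk" and t: "w k \<le> (1 + E1) * mainw k" using k by (auto simp: Tgood_def algebra_simps)
    have mw: "mainw k \<le> w k" by (rule main_between(2)[OF kT])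
    have w0: "0 \<le> w k" by (rule w_nonneg)
    have "bw N p k \<le> (1 + 2 * E1) * w k"
      using main_vs_bw(2)[OF kT] mult_left_mono[OF mw, of "1 + 2 * E1"] E1_bounds by linarith
    moreover have "(1 - 4 * E1) * w k \<le> bw N p k"
    proof -
      have "w k \<le> (1 + E1) * ((1 + 2 * E1) * bw N p k)"
        using t mult_left_mono[OF main_vs_bw(1)[OF kT], of "1 + E1"] E1_bounds by linarith
      then have "(1 - 4 * E1) * w k \<le> (1 - 4 * E1) * ((1 + E1) * ((1 + 2 * E1) * bw N p k))"
        using E1_bounds by (intro mult_left_mono) auto
      also have "\<dots> = ((1 - 4 * E1) * ((1 + E1) * (1 + 2 * E1))) * bw N p k" by simp
      also have "\<dots> \<le> 1 * bw N p k"
      proof (rule mult_right_mono)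
        have "(1 - 4 * E1) * ((1 + E1) * (1 + 2 * E1)) = 1 - E1 - 10 * (E1 * E1) - 8 * (E1 * E1 * E1)" by (simp add: algebra_simps)
        moreover have "0 \<le> E1 * E1" "0 \<le> E1 * E1 * E1" using E1_bounds by auto
        ultimately show "(1 - 4 * E1) * ((1 + E1) * (1 + 2 * E1)) \<le> 1" using E1_bounds by linarith
      qed (use bw_nonneg p01 in auto)
      finally show ?thesis by simp
    qed
    moreover have "0 \<le> E1 * w k" using w0 E1_bounds by simp
    ultimately show ?thesis by (simp add: abs_le_iff algebra_simps)
  qed
  let ?B = "Tk - Tgood"
  have tail: "(\<Sum>k\<in>?B. mainw k) \<le> (real N + 1) * far"
  proof -
    have "E1 * (\<Sum>k\<in>?B. mainw k) \<le> (\<Sum>k\<in>?B. w k - mainw k)"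
      unfolding sum_distrib_left by (intro sum_mono) (auto simp: Tgood_def)
    also have "\<dots> \<le> (\<Sum>k\<in>Tk. w k - mainw k)" using Tk_sub main_between by (intro sum_mono2) auto
    also have "\<dots> \<le> far" by (rule sum_tail_main)
    finally have "(\<Sum>k\<in>?B. mainw k) \<le> far * (1 / E1)" using E1_bounds by (simp add: field_simps)
    also have "\<dots> \<le> far * (real N + 1)"
    proof (rule mult_left_mono)
      have "1 / E1 \<le> Y" using E1_bounds Y_big by (simp add: field_simps)
      also have "Y \<le> real N + 1" by (rule Y_le_N)
      finally show "1 / E1 \<le> real N + 1" .
    qed (rule far_bounds)
    finally show ?thesis by (simp add: mult.commute)
  qed
  have m0: "0 \<le> mainw k" if "k \<in> Tk" for k using near_le_w(2)[of k] main_between(1)[OF that] by linarith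
  have N1: "far \<le> (real N + 1) * far" using far_bounds by (simp add: algebra_simps)
  have split: "(\<Sum>i\<in>{..N} - Tgood. f i) = (\<Sum>i\<in>{..N} - Tk. f i) + (\<Sum>i\<in>?B. f i)" for f :: "nat \<Rightarrow> real"
  proof -
    have "{..N} - Tgood = ({..N} - Tk) \<union> ?B" using Tk_sub by (auto simp: Tgood_def)
    then show ?thesis using Tk_sub by (simp only:) (rule sum.union_disjoint, auto)
  qed
  have "(\<Sum>k\<in>?B. bw N p k) \<le> (\<Sum>k\<in>?B. (1 + 2 * E1) * mainw k)" using main_vs_bw(2) by (intro sum_mono) auto
  also have "\<dots> = (1 + 2 * E1) * (\<Sum>k\<in>?B. mainw k)" by (simp add: sum_distrib_left)
  also have "\<dots> \<le> 2 * (\<Sum>k\<in>?B. mainw k)" using E1_bounds m0 by (intro mult_right_mono sum_nonneg) auto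
  finally have "(\<Sum>k\<in>?B. bw N p k) \<le> 2 * ((real N + 1) * far)" using tail by linarith
  then show "(\<Sum>k\<in>{..N} - Tgood. bw N p k) \<le> 6 * (real N + 1) * far" using split[of "bw N p"] sum_bw_outside N1 far_bounds(1) unfolding mult.assoc by linarith
  have "(\<Sum>k\<in>?B. w k) = (\<Sum>k\<in>?B. w k - mainw k) + (\<Sum>k\<in>?B. mainw k)" by (simp add: sum.distrib[symmetric])
  also have "(\<Sum>k\<in>?B. w k - mainw k) \<le> (\<Sum>k\<in>Tk. w k - mainw k)" using Tk_sub main_between by (intro sum_mono2) auto
  also have "\<dots> \<le> far" by (rule sum_tail_main)
  finally have "(\<Sum>k\<in>?B. w k) \<le> far + (real N + 1) * far" using tail by linarith
  then show "(\<Sum>k\<in>{..N} - Tgood. w k) \<le> 6 * (real N + 1) * far" using split[of w] sum_w_outside N1 far_bounds(1) unfolding mult.assoc by linarith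
qed

end

section \<open>Mixtures\<close>

lemma pmf_edge_set:
  assumes W: "finite W" and p: "0 \<le> p" "p \<le> 1" and E: "E \<subseteq> W"
  shows "pmf (map_pmf (\<lambda>x. {e \<in> W. x e}) (Pi_pmf W False (\<lambda>_. bernoulli_pmf p))) E = wt p W E"
proof -
  let ?P = "Pi_pmf W False (\<lambda>_. bernoulli_pmf p)"
  have "pmf (map_pmf (\<lambda>x. {e \<in> W. x e}) ?P) E = measure_pmf.prob ?P ((\<lambda>x. {e \<in> W. x e}) -` {E})" by (rule pmf_map)
  also have "\<dots> = measure_pmf.prob ?P {\<lambda>e. e \<in> E}"
  proof (rule measure_prob_cong_0)
    fix x assume "x \<in> (\<lambda>x. {e \<in> W. x e}) -` {E} - {\<lambda>e. e \<in> E}"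
    then have "\<exists>e. e \<notin> W \<and> x e \<noteq> False" by fastforce
    then show "pmf ?P x = 0" by (rule pmf_Pi_outside[OF W])
  next
    fix x assume "x \<in> {\<lambda>e. e \<in> E} - (\<lambda>x. {e \<in> W. x e}) -` {E}"
    then show "pmf ?P x = 0" using E by auto
  qed
  also have "\<dots> = pmf ?P (\<lambda>e. e \<in> E)" by (rule measure_pmf_single)
  also have "\<dots> = (\<Prod>e\<in>W. pmf (bernoulli_pmf p) (e \<in> E))" using E by (intro pmf_Pi'[OF W]) auto
  also have "\<dots> = (\<Prod>e\<in>W - E. pmf (bernoulli_pmf p) (e \<in> E)) * (\<Prod>e\<in>E. pmf (bernoulli_pmf p) (e \<in> E))"
    by (rule prod.subset_diff[OF E W])
  also have "\<dots> = wt p W E" using p by (simp add: wt_def mult.commute)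
  finally show ?thesis .
qed

lemma pmf_edge_indep_sum:
  assumes W: "finite W" and p: "0 \<le> p" "p \<le> 1"
  shows "pmf (edge_indep W p) w = (\<Sum>E | E \<subseteq> W \<and> degrees_of E = w. wt p W E)"
proof -
  define Q where "Q = map_pmf (\<lambda>x. {e \<in> W. x e}) (Pi_pmf W False (\<lambda>_. bernoulli_pmf p))"
  have Q0: "pmf Q E = 0" if "\<not> E \<subseteq> W" for E using that by (auto simp: Q_def set_pmf_iff[symmetric])
  have "edge_indep W p = map_pmf degrees_of Q" by (simp add: edge_indep_def Q_def map_pmf_comp)
  then have "pmf (edge_indep W p) w = measure_pmf.prob Q (degrees_of -` {w})" by (simp add: pmf_map)
  also have "\<dots> = measure_pmf.prob Q {E. E \<subseteq> W \<and> degrees_of E = w}"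
    by (rule measure_prob_cong_0) (auto intro!: Q0)
  also have "\<dots> = (\<Sum>E | E \<subseteq> W \<and> degrees_of E = w. pmf Q E)"
    by (rule measure_measure_pmf_finite) (rule finite_subset[of _ "Pow W"], use W in auto)
  also have "\<dots> = (\<Sum>E | E \<subseteq> W \<and> degrees_of E = w. wt p W E)"
    unfolding Q_def using pmf_edge_set[OF W p] by (intro sum.cong) auto
  finally show ?thesis .
qed

lemma pmf_edge_unif:
  assumes "finite W" "k \<le> card W"
  shows "pmf (edge_unif W k) w = real (card {E \<in> slice W k. degrees_of E = w}) / real (card W choose k)"
proof -
  have "finite (slice W k)" by (rule finite_subset[of _ "Pow W"]) (use assms in \<open>auto simp: slice_def\<close>)
  moreover have "card (slice W k) = card W choose k" using n_subsets[OF assms(1), of k] by (simp add: slice_def)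
  ultimately show ?thesis
    unfolding edge_unif_slice using slice_nonempty[OF assms] by (simp add: pmf_map_pmf_of_set)
qed

lemma edge_unif_support:
  assumes "k \<le> card (cells D m n)"
  shows "set_pmf (edge_unif (cells D m n) k) \<subseteq> {w \<in> deg_space m n. (\<Sum>i<m. fst w i) = k}"
proof -
  have "finite (slice (cells D m n) k)" by (rule finite_subset[of _ "Pow (cells D m n)"]) (auto simp: slice_def)
  then show ?thesis
    unfolding edge_unif_slice using slice_nonempty[OF finite_cells assms] deg_space_degrees
    by (auto simp: slice_def degrees_of_eq sum_rdeg)
qed

lemma pmf_edge_indep:
  fixes D :: bool and m n :: nat
  assumes p: "0 \<le> p" "p \<le> 1"
  defines "N \<equiv> card (cells D m n)"
  shows "pmf (edge_indep (cells D m n) p) w = (\<Sum>k\<le>N. bw N p k * pmf (edge_unif (cells D m n) k) w)"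
proof -
  let ?W = "cells D m n"
  let ?A = "{E. E \<subseteq> ?W \<and> degrees_of E = w}"
  have fin: "finite ?A" by (rule finite_subset[of _ "Pow ?W"]) auto
  have "pmf (edge_indep ?W p) w = (\<Sum>E\<in>?A. wt p ?W E)" by (rule pmf_edge_indep_sum[OF finite_cells p])
  also have "\<dots> = (\<Sum>k\<le>N. \<Sum>E | E \<in> ?A \<and> card E = k. wt p ?W E)"
    by (rule sum.group[symmetric]) (use fin card_mono[OF finite_cells] in \<open>auto simp: N_def\<close>)
  also have "\<dots> = (\<Sum>k\<le>N. bw N p k * pmf (edge_unif ?W k) w)"
  proof (rule sum.cong[OF refl])
    fix k assume "k \<in> {..N}"
    then have k: "k \<le> card ?W" by (simp add: N_def)
    have eq: "{E. E \<in> ?A \<and> card E = k} = {E \<in> slice ?W k. degrees_of E = w}" by (auto simp: slice_def)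
    have "(\<Sum>E | E \<in> ?A \<and> card E = k. wt p ?W E) = (\<Sum>E | E \<in> ?A \<and> card E = k. p ^ k * (1 - p) ^ (N - k))"
      by (intro sum.cong) (auto simp: wt_def N_def card_Diff_subset finite_subset[OF _ finite_cells])
    also have "\<dots> = real (card {E \<in> slice ?W k. degrees_of E = w}) * (p ^ k * (1 - p) ^ (N - k))" unfolding eq by simp
    also have "\<dots> = bw N p k * pmf (edge_unif ?W k) w"
      using k by (simp add: pmf_edge_unif bw_def N_def)
    finally show "(\<Sum>E | E \<in> ?A \<and> card E = k. wt p ?W E) = bw N p k * pmf (edge_unif ?W k) w" .
  qed
  finally show ?thesis .
qed

lemma Bk_support:
  assumes D: "D \<Longrightarrow> m = n" and k: "k \<le> card (cells D m n)"
  shows "set_pmf (Bk D m n k) \<subseteq> {w \<in> deg_space m n. (\<Sum>i<m. fst w i) = k \<and> (\<Sum>j<n. snd w j) = k}"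
proof
  fix w assume "w \<in> set_pmf (Bk D m n k)"
  then have "pmf (Bk D m n k) (fst w, snd w) \<noteq> 0" by (simp add: set_pmf_iff)
  moreover note pmf_Bk[of D m n k "fst w" "snd w", OF D k]
  ultimately show "w \<in> {w \<in> deg_space m n. (\<Sum>i<m. fst w i) = k \<and> (\<Sum>j<n. snd w j) = k}"
    by (auto split: if_splits)
qed

lemma prod_binomial_weights:
  assumes "(\<Sum>i<m. s i) = k"
  shows "(\<Prod>i<m. real (d choose s i) * x ^ s i * (1 - x) ^ (d - s i)) = real (\<Prod>i<m. d choose s i) * (x ^ k * (1 - x) ^ (m * d - k))"
proof (cases "\<forall>i<m. s i \<le> d")
  case True
  then have "(\<Sum>i<m. d - s i) = m * d - k"
    using sum_subtractf_nat[of "{..<m}" s "\<lambda>_. d"] assms by simp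
  then show ?thesis using assms by (simp add: prod.distrib power_sum[symmetric])
next
  case False
  then obtain i where i: "i < m" "d < s i" by (auto simp: not_le)
  then have "(\<Prod>i<m. d choose s i) = 0" "(\<Prod>i<m. real (d choose s i) * x ^ s i * (1 - x) ^ (d - s i)) = 0"
    by (auto intro!: prod_zero bexI[of _ i])
  then show ?thesis by (simp only: of_nat_0 mult_zero_left)
qed

text \<open>Rows and columns each contribute \<open>x ^ k * (1 - x) ^ (N - k)\<close>, whence the
  square of the binomial weight; what remains is the point probability of
  \<open>B_k\<close>.\<close>

lemma binom_indep_equal_sums:
  assumes D: "D \<Longrightarrow> m = n" and x: "x \<in> {0..1}" and w: "w \<in> equal_sums m n"
  defines "N \<equiv> card (cells D m n)"
  shows "pmf (binom_indep m (n - of_bool D) n (m - of_bool D) x) w = (\<Sum>k\<le>N. (bw N x k)\<^sup>2 * pmf (Bk D m n k) w)"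
proof -
  obtain s t where st: "w = (s, t)" by (cases w)
  define k where "k = (\<Sum>i<m. s i)"
  have tk: "(\<Sum>j<n. t j) = k" using w by (simp add: st k_def equal_sums_def)
  let ?d = "n - of_bool D" and ?e = "m - of_bool D"
  have N: "m * ?d = N" "n * ?e = N" using card_cells[of D m n] D by (auto simp: N_def)
  let ?I = "binom_indep m ?d n ?e x"
  have B0: "pmf (Bk D m n j) w = 0" if "j \<le> N" "j \<noteq> k \<or> w \<notin> deg_space m n" for j
  proof -
    have "set_pmf (Bk D m n j) \<subseteq> {w \<in> deg_space m n. (\<Sum>i<m. fst w i) = j \<and> (\<Sum>j<n. snd w j) = j}"
      by (rule Bk_support) (use D that in \<open>auto simp: N_def\<close>)
    then have "w \<notin> set_pmf (Bk D m n j)" using that by (auto simp: st k_def)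
    then show ?thesis by (simp add: set_pmf_iff)
  qed
  show ?thesis
  proof (cases "w \<in> deg_space m n")
    case False
    then have "pmf ?I w = 0" using set_binom_indep[OF x, of ?d n ?e m] by (auto simp: set_pmf_iff)
    then show ?thesis using B0 False by simp
  next
    case True
    then have z: "(\<forall>i\<ge>m. s i = 0) \<and> (\<forall>j\<ge>n. t j = 0)" by (auto simp: st deg_space_def PiE_dflt_def)
    have I: "pmf ?I w = (real (\<Prod>i<m. ?d choose s i) * (x ^ k * (1 - x) ^ (N - k))) * (real (\<Prod>j<n. ?e choose t j) * (x ^ k * (1 - x) ^ (N - k)))"
      unfolding st pmf_binom_indep[OF x] if_P[OF z] prod_binomial_weights[OF k_def[symmetric]] prod_binomial_weights[OF tk] N ..
    show ?thesis
    proof (cases "k \<le> N")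
      case kN: True
      have "(\<Sum>j\<le>N. (bw N x j)\<^sup>2 * pmf (Bk D m n j) w) = (\<Sum>j\<in>{k}. (bw N x j)\<^sup>2 * pmf (Bk D m n j) w)"
        using kN B0 by (intro sum.mono_neutral_right) auto
      also have "\<dots> = (bw N x k)\<^sup>2 * (real (\<Prod>i<m. ?d choose s i) * real (\<Prod>j<n. ?e choose t j) / real (N choose k) ^ 2)"
      proof -
        have "pmf (Bk D m n k) (s, t) = real (\<Prod>i<m. ?d choose s i) * real (\<Prod>j<n. ?e choose t j) / real (N choose k) ^ 2"
          using pmf_Bk[of D m n k s t, OF D] kN True tk unfolding N_def st k_def[symmetric] by (simp only: simp_thms if_True)
        then show ?thesis unfolding st by simp
      qed
      also have "\<dots> = pmf ?I w"
        unfolding I bw_def power_mult_distrib using kN by (simp add: power2_eq_square)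
      finally show ?thesis by simp
    next
      case False
      \<comment> \<open>For a sum beyond \<open>N\<close> some row exceeds its length, and a
        binomial coefficient makes the product vanish; no component of the mixture has this sum
        either.\<close>
      have "\<exists>i<m. ?d < s i"
      proof (rule ccontr)
        assume "\<not> ?thesis"
        then have "(\<Sum>i<m. s i) \<le> (\<Sum>i<m. ?d)" by (intro sum_mono) (meson lessThan_iff not_less)
        then show False using False N by (simp add: k_def)
      qed
      then have "(\<Prod>i<m. ?d choose s i) = 0" by (auto intro!: prod_zero)
      then have "pmf ?I w = 0" unfolding I by (simp only: of_nat_0 mult_zero_left)
      moreover have "(\<Sum>j\<le>N. (bw N x j)\<^sup>2 * pmf (Bk D m n j) w) = 0" using B0 False by (intro sum.neutral) auto
      ultimately show ?thesis by simp
    qed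
  qed
qed

lemma cond_binom_mixture:
  assumes D: "D \<Longrightarrow> m = n" and x: "x \<in> {0..1}"
  defines "N \<equiv> card (cells D m n)"
  shows "pmf (cond_pmf (binom_indep m (n - of_bool D) n (m - of_bool D) x) (equal_sums m n)) w
      = (\<Sum>k\<le>N. (bw N x k)\<^sup>2 / bsq N x * pmf (Bk D m n k) w)"
proof -
  let ?d = "n - of_bool D" and ?e = "m - of_bool D"
  let ?I = "binom_indep m ?d n ?e x" and ?A = "deg_space m n \<inter> equal_sums m n"
  have N: "m * ?d = n * ?e" using D by auto
  have supp: "set_pmf (Bk D m n k) \<subseteq> ?A" if "k \<le> N" for k
  proof -
    have "set_pmf (Bk D m n k) \<subseteq> {w \<in> deg_space m n. (\<Sum>i<m. fst w i) = k \<and> (\<Sum>j<n. snd w j) = k}"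
      by (rule Bk_support) (use D that in \<open>auto simp: N_def\<close>)
    then show ?thesis by (auto simp: equal_sums_def)
  qed
  have I: "pmf ?I w = (\<Sum>k\<le>N. (bw N x k)\<^sup>2 * pmf (Bk D m n k) w)" if "w \<in> equal_sums m n" for w
    unfolding N_def by (rule binom_indep_equal_sums[OF _ x that]) (rule D)
  have "measure_pmf.prob ?I (equal_sums m n) = measure_pmf.prob ?I ?A"
    by (rule measure_prob_cong_0) (use set_binom_indep[OF x, of ?d n ?e m] in \<open>auto simp: set_pmf_iff\<close>)
  also have "\<dots> = (\<Sum>w\<in>?A. pmf ?I w)" by (simp add: measure_measure_pmf_finite finite_deg_space)
  also have "\<dots> = (\<Sum>w\<in>?A. \<Sum>k\<le>N. (bw N x k)\<^sup>2 * pmf (Bk D m n k) w)"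
    by (intro sum.cong I) auto
  also have "\<dots> = (\<Sum>k\<le>N. (bw N x k)\<^sup>2 * (\<Sum>w\<in>?A. pmf (Bk D m n k) w))"
    unfolding sum_distrib_left by (rule sum.swap)
  also have "\<dots> = bsq N x"
    unfolding bsq_def using supp finite_deg_space by (intro sum.cong) (auto simp: sum_pmf_eq_1)
  finally have S: "measure_pmf.prob ?I (equal_sums m n) = bsq N x" .
  have "pmf (cond_pmf ?I (equal_sums m n)) w = (if w \<in> equal_sums m n then pmf ?I w / bsq N x else 0)"
    unfolding pmf_cond[OF equal_sums_possible[OF x N]] S ..
  also have "\<dots> = (\<Sum>k\<le>N. (bw N x k)\<^sup>2 / bsq N x * pmf (Bk D m n k) w)"
  proof (cases "w \<in> equal_sums m n")
    case True
    then show ?thesis by (simp only: I if_True) (simp add: sum_divide_distrib)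
  next
    case False
    then have "pmf (Bk D m n k) w = 0" if "k \<le> N" for k using supp[OF that] by (auto simp: set_pmf_iff)
    then show ?thesis using False by simp
  qed
  finally show ?thesis .
qed

definition Vp :: "bool \<Rightarrow> nat \<Rightarrow> nat \<Rightarrow> real \<Rightarrow> degrees pmf" where
  "Vp D m n p = (if D then V_p_dir n p else V_p m n p)"

text \<open>\<open>cond_binom_mixture\<close> writes the integrand as a finite sum over edge counts,
  so sum and integral are exchanged; the constant of \<open>K_p\<close> cancels.\<close>

lemma pmf_Vp:
  assumes D: "D \<Longrightarrow> m = n" and mix: "mix (card (cells D m n)) (m * n) p K"
  defines "N \<equiv> card (cells D m n)"
  shows "pmf (Vp D m n p) w = (\<Sum>k\<le>N. mix.w N (m * n) p k * pmf (Bk D m n k) w)"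
proof -
  interpret mix N "m * n" p K using mix by (simp add: N_def)
  have mn: "m > 0" "n > 0" using N_pos NL(1) by (cases m; cases n; simp)+
  define c where "c = sqrt (real (m * n) / (pi * p * (1 - p)))"
  have c: "c > 0" unfolding c_def using p01 mn by (auto intro!: divide_pos_pos mult_pos_pos)
  have Kp: "K_p m n p x = c * kern x" for x unfolding K_p_def c_def kern_def Lam_def by simp
  have Vn: "V_norm m n p = c * Vn" unfolding V_norm_def Vn_def Kp[abs_def] by simp
  let ?B = "\<lambda>x. cond_pmf (binom_indep m (n - of_bool D) n (m - of_bool D) x) (equal_sums m n)"
  have "pmf (Vp D m n p) w = inverse (V_norm m n p) * integral {0..1} (\<lambda>x. K_p m n p x * pmf (?B x) w)"
  proof (cases D)
    case True
    then show ?thesis using pmf_V_p_dir[OF p01 mn(2)] D by (simp add: Vp_def B_p_dir_def I_p_dir_def)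
  next
    case False
    then show ?thesis using pmf_V_p[OF p01 mn] by (simp add: Vp_def B_p_def I_p_def)
  qed
  also have "integral {0..1} (\<lambda>x. K_p m n p x * pmf (?B x) w) = integral {0..1} (\<lambda>x. c * (\<Sum>k\<le>N. pmf (Bk D m n k) w * F k x))"
  proof (rule Henstock_Kurzweil_Integration.integral_cong)
    fix x :: real assume x: "x \<in> {0..1}"
    show "K_p m n p x * pmf (?B x) w = c * (\<Sum>k\<le>N. pmf (Bk D m n k) w * F k x)"
    proof -
      have "pmf (?B x) w = (\<Sum>k\<le>N. (bw N x k)\<^sup>2 / bsq N x * pmf (Bk D m n k) w)"
        unfolding N_def by (rule cond_binom_mixture[OF _ x]) (rule D)
      then show ?thesis unfolding Kp by (simp only: F_def sum_distrib_left) (simp add: mult_ac)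
    qed
  qed
  also have "\<dots> = c * (\<Sum>k\<le>N. integral {0..1} (\<lambda>x. pmf (Bk D m n k) w * F k x))"
    unfolding integral_mult_right by (subst integral_sum) (auto intro!: integrable_on_mult_right int_F)
  also have "\<dots> = c * (\<Sum>k\<le>N. pmf (Bk D m n k) w * integral {0..1} (F k))" by simp
  finally show ?thesis using c Vn_lower(2) unfolding Vn w_def by (simp add: sum_distrib_left field_simps)
qed

lemma mixture_prob:
  assumes fin: "finite \<Omega>" and B: "B \<subseteq> \<Omega>" and P: "set_pmf P \<subseteq> \<Omega>"
    and mixP: "\<And>w. w \<in> \<Omega> \<Longrightarrow> pmf P w = (\<Sum>k\<le>N::nat. b k * pmf (Pk k) w)"
    and Pk: "\<And>k. k \<le> N \<Longrightarrow> set_pmf (Pk k) \<subseteq> \<Omega>"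
    and b: "\<And>k. k \<le> N \<Longrightarrow> 0 \<le> b k" "(\<Sum>k\<le>N. b k) = 1"
    and T: "T \<subseteq> {..N}" "(\<Sum>k\<in>{..N} - T. b k) \<le> r1" and r: "0 \<le> r2" "\<And>k. k \<in> T \<Longrightarrow> measure_pmf.prob (Pk k) B \<le> r2"
  shows "measure_pmf.prob P B \<le> r1 + r2"
proof -
  have "measure_pmf.prob P B = (\<Sum>w\<in>B. \<Sum>k\<le>N. b k * pmf (Pk k) w)"
    unfolding prob_finite_support[OF fin P B] using B mixP by (intro sum.cong) auto
  also have "\<dots> = (\<Sum>k\<le>N. b k * measure_pmf.prob (Pk k) B)"
    using prob_finite_support[OF fin Pk B] by (subst sum.swap) (simp add: sum_distrib_left)
  also have "\<dots> = (\<Sum>k\<in>{..N} - T. b k * measure_pmf.prob (Pk k) B) + (\<Sum>k\<in>T. b k * measure_pmf.prob (Pk k) B)"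
    using T by (intro sum.subset_diff) auto
  also have "(\<Sum>k\<in>{..N} - T. b k * measure_pmf.prob (Pk k) B) \<le> (\<Sum>k\<in>{..N} - T. b k * 1)"
    using b(1) by (intro sum_mono mult_left_mono) auto
  also have "(\<Sum>k\<in>T. b k * measure_pmf.prob (Pk k) B) \<le> (\<Sum>k\<in>T. b k * r2)"
    using b(1) T(1) r(2) by (intro sum_mono mult_left_mono) auto
  also have "\<dots> = (\<Sum>k\<in>T. b k) * r2" by (simp add: sum_distrib_right)
  also have "\<dots> \<le> 1 * r2"
  proof (rule mult_right_mono[OF _ r(1)])
    show "sum b T \<le> 1" unfolding b(2)[symmetric] using T(1) b(1) by (intro sum_mono2) auto
  qed
  finally show ?thesis using T(2) by simp
qed

text \<open>The statistic \<open>\<kappa>\<close>, in the application the number of edges,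
  identifies the component from which an outcome comes. Off the bad set each mixture therefore has a
  single term, and the relative errors of weight and component multiply.\<close>

lemma close_mixture:
  assumes fin: "finite \<Omega>" and supp: "set_pmf P \<subseteq> \<Omega>" "set_pmf Q \<subseteq> \<Omega>"
    and mixP: "\<And>w. w \<in> \<Omega> \<Longrightarrow> pmf P w = (\<Sum>k\<le>N::nat. b k * pmf (Pk k) w)"
    and mixQ: "\<And>w. w \<in> \<Omega> \<Longrightarrow> pmf Q w = (\<Sum>k\<le>N. c k * pmf (Qk k) w)"
    and Pk: "\<And>k. k \<le> N \<Longrightarrow> set_pmf (Pk k) \<subseteq> {w \<in> \<Omega>. \<kappa> w = k}"
    and Qk: "\<And>k. k \<le> N \<Longrightarrow> set_pmf (Qk k) \<subseteq> {w \<in> \<Omega>. \<kappa> w = k}"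
    and b: "\<And>k. k \<le> N \<Longrightarrow> 0 \<le> b k" "(\<Sum>k\<le>N. b k) = 1"
    and c: "\<And>k. k \<le> N \<Longrightarrow> 0 \<le> c k" "(\<Sum>k\<le>N. c k) = 1"
    and T: "T \<subseteq> {..N}" "(\<Sum>k\<in>{..N} - T. b k) \<le> r1" "(\<Sum>k\<in>{..N} - T. c k) \<le> r1"
    and bc: "\<And>k. k \<in> T \<Longrightarrow> \<bar>b k - c k\<bar> \<le> \<eta>1 * c k"
    and r: "0 \<le> r2" and cl: "\<And>k. k \<in> T \<Longrightarrow> close_pmf \<Omega> (Pk k) (Qk k) \<eta>2 r2" and \<eta>1: "0 \<le> \<eta>1"
  shows "close_pmf \<Omega> P Q (\<eta>1 + \<eta>2 + \<eta>1 * \<eta>2) (r1 + r2)"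
proof -
  from cl have "\<forall>k\<in>T. \<exists>B\<subseteq>\<Omega>. measure_pmf.prob (Pk k) B \<le> r2 \<and> measure_pmf.prob (Qk k) B \<le> r2 \<and>
        (\<forall>\<omega>\<in>\<Omega> - B. \<bar>pmf (Pk k) \<omega> - pmf (Qk k) \<omega>\<bar> \<le> \<eta>2 * pmf (Qk k) \<omega>)"
    unfolding close_pmf_def by blast
  then obtain BB where BB: "\<And>k. k \<in> T \<Longrightarrow> measure_pmf.prob (Pk k) (BB k) \<le> r2"
      "\<And>k. k \<in> T \<Longrightarrow> measure_pmf.prob (Qk k) (BB k) \<le> r2"
      "\<And>k \<omega>. k \<in> T \<Longrightarrow> \<omega> \<in> \<Omega> - BB k \<Longrightarrow> \<bar>pmf (Pk k) \<omega> - pmf (Qk k) \<omega>\<bar> \<le> \<eta>2 * pmf (Qk k) \<omega>"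
    by metis
  define B where "B = {w \<in> \<Omega>. \<kappa> w \<notin> T \<or> w \<in> BB (\<kappa> w)}"
  have B\<Omega>: "B \<subseteq> \<Omega>" by (auto simp: B_def)
  have le: "measure_pmf.prob R B \<le> measure_pmf.prob R (BB k)" if "k \<in> T" "set_pmf R \<subseteq> {w \<in> \<Omega>. \<kappa> w = k}" for R k
  proof -
    have "measure_pmf.prob R B = measure_pmf.prob R (B \<inter> set_pmf R)" by (simp add: measure_Int_set_pmf)
    also have "\<dots> \<le> measure_pmf.prob R (BB k)" using that by (intro measure_pmf.finite_measure_mono) (auto simp: B_def)
    finally show ?thesis .
  qed
  have "measure_pmf.prob P B \<le> r1 + r2"
  proof (rule mixture_prob[OF fin B\<Omega> supp(1) mixP _ b T(1,2) r])
    show "set_pmf (Pk k) \<subseteq> \<Omega>" if "k \<le> N" for k using Pk[OF that] by auto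
    show "measure_pmf.prob (Pk k) B \<le> r2" if "k \<in> T" for k
      using le[OF that Pk] BB(1)[OF that] T(1) that by fastforce
  qed
  moreover have "measure_pmf.prob Q B \<le> r1 + r2"
  proof (rule mixture_prob[OF fin B\<Omega> supp(2) mixQ _ c T(1,3) r])
    show "set_pmf (Qk k) \<subseteq> \<Omega>" if "k \<le> N" for k using Qk[OF that] by auto
    show "measure_pmf.prob (Qk k) B \<le> r2" if "k \<in> T" for k
      using le[OF that Qk] BB(2)[OF that] T(1) that by fastforce
  qed
  moreover have "\<bar>pmf P w - pmf Q w\<bar> \<le> (\<eta>1 + \<eta>2 + \<eta>1 * \<eta>2) * pmf Q w" if w: "w \<in> \<Omega> - B" for w
  proof -
    define k where "k = \<kappa> w"
    have k: "k \<in> T" "w \<in> \<Omega> - BB k" using w by (auto simp: B_def k_def)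
    have kN: "k \<le> N" using k T by auto
    have one: "(\<Sum>j\<le>N. f j * pmf (R j) w) = f k * pmf (R k) w"
      if "\<And>j. j \<le> N \<Longrightarrow> set_pmf (R j) \<subseteq> {w \<in> \<Omega>. \<kappa> w = j}" for f R
    proof -
      have "pmf (R j) w = 0" if "j \<le> N" "j \<noteq> k" for j using \<open>\<And>j. j \<le> N \<Longrightarrow> set_pmf (R j) \<subseteq> _\<close>[OF that(1)] that(2) by (auto simp: k_def set_pmf_iff)
      then have "(\<Sum>j\<le>N. f j * pmf (R j) w) = (\<Sum>j\<in>{k}. f j * pmf (R j) w)"
        using kN by (intro sum.mono_neutral_right) auto
      then show ?thesis by simp
    qed
    have pq: "pmf P w = b k * pmf (Pk k) w" "pmf Q w = c k * pmf (Qk k) w"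
      using mixP[of w] mixQ[of w] w one[OF Pk, of b] one[OF Qk, of c] by auto
    define x where "x = pmf (Pk k) w"
    define z where "z = pmf (Qk k) w"
    have x: "0 \<le> x" "0 \<le> z" "\<bar>x - z\<bar> \<le> \<eta>2 * z" using BB(3)[OF k] by (auto simp: x_def z_def)
    have "b k * x - c k * z = (b k - c k) * x + c k * (x - z)" by (simp add: algebra_simps)
    also have "\<bar>\<dots>\<bar> \<le> \<bar>(b k - c k) * x\<bar> + \<bar>c k * (x - z)\<bar>" by (rule abs_triangle_ineq)
    also have "\<bar>(b k - c k) * x\<bar> \<le> (\<eta>1 * c k) * ((1 + \<eta>2) * z)"
      using bc[OF k(1)] x by (intro abs_mult_le) (auto simp: algebra_simps abs_le_iff)
    also have "\<bar>c k * (x - z)\<bar> \<le> c k * (\<eta>2 * z)" using x c(1)[OF kN] by (intro abs_mult_le) auto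
    finally show ?thesis unfolding pq x_def[symmetric] z_def[symmetric] by (simp add: algebra_simps)
  qed
  ultimately show ?thesis unfolding close_pmf_def using supp B\<Omega> by blast
qed

lemma close_pmf_mono:
  assumes "close_pmf \<Omega> P Q \<eta> r" "\<eta> \<le> \<eta>'" "r \<le> r'"
  shows "close_pmf \<Omega> P Q \<eta>' r'"
proof -
  have "\<eta> * pmf Q w \<le> \<eta>' * pmf Q w" for w using assms(2) by (intro mult_right_mono) auto
  then show ?thesis using assms unfolding close_pmf_def by (meson order_trans)
qed


section \<open>Explicit error bounds for given sizes\<close>

context
  fixes D :: bool and m n :: nat and K :: real
  assumes D: "D \<Longrightarrow> m = n" and K: "K \<ge> 100" and nm: "real n \<le> K * real m" "real m \<le> K * real n"
    and big: "2 ^ 25 * K ^ 12 \<le> sqrt (real n)" and exp_small: "5000 * real n ^ 20 * exp (- (K / 32)) \<le> 1"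
begin

lemma K_le_n: "K \<le> real n" "1 \<le> real n" "2 \<le> n"
proof -
  have "1 \<le> K ^ 11" using K by (intro one_le_power) auto
  then have "K * 1 \<le> K * K ^ 11" using K by (intro mult_left_mono) auto
  also have "K * K ^ 11 = K ^ 12" by (simp flip: power_Suc)
  finally have "K \<le> sqrt (real n)" using big zero_le_power[of K 12] K by simp
  then have s: "100 \<le> sqrt (real n)" "K \<le> sqrt (real n)" using K by auto
  have "sqrt (real n) * 1 \<le> sqrt (real n) * sqrt (real n)" using s by (intro mult_left_mono; linarith)
  moreover have "sqrt (real n) * sqrt (real n) = real n" by simp
  ultimately have "sqrt (real n) \<le> real n" by (simp only: mult_1_right)
  then show "K \<le> real n" "1 \<le> real n" "2 \<le> n" using s by linarith+
qed

lemma exp_bound: "5000 * real n ^ i * exp (- (c * K)) \<le> 1" if "i \<le> 20" "1 / 32 \<le> c"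
proof -
  have "real n ^ i \<le> real n ^ 20" using K_le_n that by (intro power_increasing) auto
  moreover have "exp (- (c * K)) \<le> exp (- (K / 32))" using mult_right_mono[OF that(2), of K] K by simp
  ultimately have "(5000 * real n ^ i) * exp (- (c * K)) \<le> (5000 * real n ^ 20) * exp (- (K / 32))" by (intro mult_mono) auto
  then show ?thesis using exp_small by linarith
qed

text \<open>The factor \<open>c\<close> is room for the mixture: an edge count that is typical for
  \<open>p\<close> is guaranteed to have density away from 0 and 1 with \<open>4 * K\<close> in
  place of \<open>K\<close>. The constants are \<open>4 ^ 12 = 2 ^ 24\<close> and
  \<open>14 * 4 ^ 2 = 224\<close>.\<close>

lemma dense_intro:
  assumes "1 \<le> c" "c \<le> 4" "1 / (c * K) \<le> real k / (real m * real n)" "real k / (real m * real n) \<le> 1 - 1 / (c * K)"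
  shows "close_pmf (deg_space m n) (edge_unif (cells D m n) k) (Bk D m n k) (2 ^ 24 * K ^ 12 / sqrt (real n)) (224 * real n ^ 9 * exp (- (K / 32)))"
proof -
  have cK: "K \<le> c * K" "c * K \<le> 4 * K" using assms K by (auto simp: mult_right_mono)
  have p12: "(c * K) ^ 12 \<le> 2 ^ 24 * K ^ 12"
    using power_mono[OF cK(2), of 12] cK K by (simp add: power_mult_distrib)
  have "2 ^ 24 * K ^ 12 \<le> 2 ^ 25 * K ^ 12" using K by (intro mult_right_mono) auto
  then have le: "2 ^ 24 * K ^ 12 \<le> sqrt (real n)" using big by linarith
  interpret d: dense D m n k "c * K"
  proof
    show "m = n" if D by (rule D[OF that])
    show "100 \<le> c * K" using cK K by linarith
    show "real n \<le> c * K * real m" "real m \<le> c * K * real n"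
      using nm mult_right_mono[OF cK(1), of "real m"] mult_right_mono[OF cK(1), of "real n"] by linarith+
    have "1 \<le> c * K" using cK K by linarith
    then have "(c * K) ^ 10 \<le> (c * K) ^ 12" by (intro power_increasing) auto
    then show "(c * K) ^ 10 \<le> sqrt (real n)" using p12 le by linarith
  qed (use assms in auto)
  have y: "d.y = sqrt (real n)" by (simp add: d.y_def)
  have n4: "(c * K) ^ i \<le> 4 ^ i * real n ^ i" for i
    using power_mono[OF order_trans[OF cK(2) mult_left_mono[OF K_le_n(1), of 4]], of i] cK K by (simp add: power_mult_distrib)
  have "close_pmf (deg_space m n) (edge_unif (cells D m n) k) (Bk D m n k) d.eta d.rr"
  proof (rule d.close_fixed_edges)
    show "(c * K) ^ 12 \<le> d.y" unfolding y using p12 le by linarith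
    have "d.eps1 * real n ^ 6 = 16 * (c * K) ^ 4 * real n ^ 14 * exp (- (c / 16 * K))"
      unfolding d.eps1_def by (simp add: power_add[symmetric])
    also have "\<dots> \<le> 16 * (4 ^ 4 * real n ^ 4) * real n ^ 14 * exp (- (c / 16 * K))"
      using n4[of 4] by (intro mult_right_mono mult_left_mono) auto
    also have "\<dots> = 4096 * (real n ^ 18 * exp (- (c / 16 * K)))" by (simp add: power_add[symmetric])
    also have "\<dots> \<le> 5000 * (real n ^ 18 * exp (- (c / 16 * K)))" by (intro mult_right_mono) auto
    also have "\<dots> \<le> 1" using exp_bound[of 18 "c / 16"] assms by simp
    finally show "d.eps1 * real n ^ 6 \<le> 1" .
  qed
  moreover have "d.eta \<le> 2 ^ 24 * K ^ 12 / sqrt (real n)"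
    unfolding d.eta_def y using p12 by (intro divide_right_mono) auto
  moreover have "d.rr \<le> 224 * real n ^ 9 * exp (- (K / 32))"
  proof -
    have "d.rr \<le> 14 * (4\<^sup>2 * (real n)\<^sup>2) * real n ^ 7 * exp (- (K / 32))"
      unfolding d.rr_def using n4[of 2] cK by (intro mult_mono mult_left_mono) auto
    also have "\<dots> = 224 * real n ^ 9 * exp (- (K / 32))" by (simp add: power_add[symmetric])
    finally show ?thesis .
  qed
  ultimately show ?thesis by (rule close_pmf_mono)
qed

lemma close_edge_unif:
  assumes "1 / K \<le> real k / (real m * real n)" "real k / (real m * real n) \<le> 1 - 1 / K"
  shows "close_pmf (deg_space m n) (edge_unif (cells D m n) k) (Bk D m n k) (2 ^ 25 * K ^ 12 / sqrt (real n)) (250 * real n ^ 9 * exp (- (K / 32)))"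
proof (rule close_pmf_mono[OF dense_intro[of 1]])
  show "2 ^ 24 * K ^ 12 / sqrt (real n) \<le> 2 ^ 25 * K ^ 12 / sqrt (real n)"
    using K by (intro divide_right_mono mult_right_mono) auto
  show "224 * real n ^ 9 * exp (- (K / 32)) \<le> 250 * real n ^ 9 * exp (- (K / 32))" by (intro mult_right_mono) auto
qed (use assms in auto)

lemma cells_bounds:
  defines "N \<equiv> card (cells D m n)"
  shows "real n \<le> real N" "N \<le> m * n" "real (m * n) \<le> real N + 2 * sqrt (real N)" "real N + 1 \<le> 2 * real n ^ 3"
proof -
  have N: "N = m * (n - of_bool D)" unfolding N_def using D by (intro card_cells) auto
  have m1: "1 \<le> m" using nm(1) K_le_n by (cases m) auto
  show le: "N \<le> m * n" by (simp add: N)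
  show "real n \<le> real N"
  proof (cases D)
    case True
    then have "N = n * (n - 1)" using N D by simp
    moreover have "n * 1 \<le> n * (n - 1)" using K_le_n(3) by (intro mult_left_mono) auto
    ultimately have "n \<le> N" by (simp only: mult_1_right)
    then show ?thesis by simp
  next
    case False
    have "1 * n \<le> m * n" using m1 by (intro mult_right_mono) auto
    then have "n \<le> N" using False N by simp
    then show ?thesis by simp
  qed
  show "real (m * n) \<le> real N + 2 * sqrt (real N)"
  proof (cases D)
    case True
    then have mn: "real N = real n * (real n - 1)" "m = n" using N D K_le_n(3) by (auto simp: of_nat_diff)
    have "real n * real n \<le> real n * (4 * (real n - 1))" using K_le_n(3) by (intro mult_left_mono) auto
    then have "(real n / 2)\<^sup>2 \<le> real N" unfolding mn by (simp add: power2_eq_square algebra_simps)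
    then have "real n / 2 \<le> sqrt (real N)" by (rule real_le_rsqrt)
    moreover have "real (m * n) = real N + real n" unfolding mn by (simp add: algebra_simps)
    ultimately show ?thesis by linarith
  next
    case False
    then show ?thesis using N by simp
  qed
  have "real m * real n \<le> (real n * real n) * real n"
    using order_trans[OF nm(2) mult_right_mono[OF K_le_n(1), of "real n"]] by (intro mult_right_mono) auto
  moreover have "1 \<le> real n ^ 3" using K_le_n by (intro one_le_power)
  moreover have "real N \<le> real m * real n" using le by (metis of_nat_le_iff of_nat_mult)
  ultimately show "real N + 1 \<le> 2 * real n ^ 3" by (simp add: power3_eq_cube)
qed

text \<open>Doubling \<open>2 ^ 24\<close> and enlarging 224 to 250 makes room for the errors of the
  mixing weights.\<close>

lemma close_edge_indep:
  assumes p: "1 / K \<le> p" "p \<le> 1 - 1 / K"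
  shows "close_pmf (deg_space m n) (edge_indep (cells D m n) p) (Vp D m n p) (2 ^ 25 * K ^ 12 / sqrt (real n)) (250 * real n ^ 9 * exp (- (K / 32)))"
proof -
  define N where "N = card (cells D m n)"
  note Nb = cells_bounds[folded N_def]
  define y where "y = sqrt (real n)"
  have yN: "y \<le> sqrt (real N)" using Nb(1) by (simp add: y_def)
  define h where "h = K ^ 12 / y"
  have y0: "y > 0" using K_le_n by (simp add: y_def)
  have h: "0 \<le> h" "2 ^ 25 * h \<le> 1" using big y0 K by (auto simp: h_def y_def)
  have eN: "(real N + 1) ^ i \<le> 2 ^ i * real n ^ (3 * i)" for i
    using power_mono[OF Nb(4), of i] by (simp add: power_mult_distrib power_mult[symmetric])
  have mixN: "mix N (m * n) p K"
  proof
    have "K ^ 10 \<le> K ^ 12" using K by (intro power_increasing) auto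
    also have "\<dots> = 1 * K ^ 12" by simp
    also have "\<dots> \<le> 2 ^ 25 * K ^ 12" using K by (intro mult_right_mono) auto
    also have "\<dots> \<le> sqrt (real N)" using big yN unfolding y_def by linarith
    finally show "K ^ 10 \<le> sqrt (real N)" .
    have "(real N + 1) ^ 3 * exp (- K) \<le> (2 ^ 3 * real n ^ (3 * 3)) * exp (- K)" by (intro mult_right_mono eN) auto
    also have "\<dots> = 8 * (real n ^ 9 * exp (- K))" by simp
    also have "\<dots> \<le> 1 / 16" using exp_bound[of 9 1] by simp
    finally show "(real N + 1) ^ 3 * exp (- K) \<le> 1 / 16" .
  qed (use K p Nb in auto)
  interpret mx: mix N "m * n" p K by (rule mixN)
  have P: "pmf (edge_indep (cells D m n) p) w = (\<Sum>k\<le>N. bw N p k * pmf (edge_unif (cells D m n) k) w)" for w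
    unfolding N_def using mx.p01 by (intro pmf_edge_indep) auto
  have Q: "pmf (Vp D m n p) w = (\<Sum>k\<le>N. mx.w k * pmf (Bk D m n k) w)" for w
    unfolding N_def by (rule pmf_Vp[OF D mixN[unfolded N_def]])
  have sP: "set_pmf (edge_unif (cells D m n) k) \<subseteq> {w \<in> deg_space m n. (\<Sum>i<m. fst w i) = k}" if "k \<le> N" for k
    using that unfolding N_def by (rule edge_unif_support)
  have sQ: "set_pmf (Bk D m n k) \<subseteq> {w \<in> deg_space m n. (\<Sum>i<m. fst w i) = k}" if "k \<le> N" for k
  proof -
    have "set_pmf (Bk D m n k) \<subseteq> {w \<in> deg_space m n. (\<Sum>i<m. fst w i) = k \<and> (\<Sum>j<n. snd w j) = k}"
      by (rule Bk_support) (use D that in \<open>auto simp: N_def\<close>)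
    then show ?thesis by auto
  qed
  have sub: "set_pmf R \<subseteq> deg_space m n"
    if R: "\<And>w. pmf R w = (\<Sum>k\<le>N. f k * pmf (S k) w)" and S: "\<And>k. k \<le> N \<Longrightarrow> set_pmf (S k) \<subseteq> {w \<in> deg_space m n. (\<Sum>i<m. fst w i) = k}" for R f S
  proof
    fix w assume "w \<in> set_pmf R"
    then have "(\<Sum>k\<le>N. f k * pmf (S k) w) \<noteq> 0" using R by (simp add: set_pmf_iff)
    then obtain k where "k \<le> N" "pmf (S k) w \<noteq> 0" by (metis (no_types, lifting) atMost_iff mult_zero_right sum.neutral)
    then show "w \<in> deg_space m n" using S[of k] by (auto simp: set_pmf_iff)
  qed
  have cl: "close_pmf (deg_space m n) (edge_unif (cells D m n) k) (Bk D m n k) (2 ^ 24 * K ^ 12 / sqrt (real n)) (224 * real n ^ 9 * exp (- (K / 32)))"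
    if k: "k \<in> mx.Tgood" for k
  proof (rule dense_intro[of 4])
    have kT: "k \<in> mx.Tk" using k mx.weights_close(1) by auto
    define L where "L = real m * real n"
    have NL: "real N \<le> L" "L \<le> 2 * real N" "0 < L"
    proof -
      show "real N \<le> L" using Nb(2) unfolding L_def by (metis of_nat_le_iff of_nat_mult)
      then show "0 < L" using mx.N_pos by simp
      have "2 * mx.Y \<le> mx.Y * mx.Y" using mx.Y_big by (intro mult_right_mono) auto
      then have "2 * mx.Y \<le> real N" by (simp only: mx.N_eq power2_eq_square)
      then have "2 * sqrt (real N) \<le> real N" unfolding mx.Y_def .
      then show "L \<le> 2 * real N" using Nb(3) by (simp add: L_def)
    qed
    have N0: "0 < real N" using mx.N_pos by simp
    have "real N \<le> 2 * K * real k" using mx.Tk_inside(3)[OF kT] K N0 by (simp add: field_simps)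
    then have "L \<le> 4 * K * real k" using NL by linarith
    then show "1 / (4 * K) \<le> real k / (real m * real n)" using NL(3) K unfolding L_def[symmetric] by (simp add: field_simps)
    have "K * mx.Y \<le> real N / (4 * K)"
    proof -
      have "4 * K * (K * mx.Y) \<le> mx.Y * mx.Y" using mx.Y_big mult_right_mono[of "4 * K * K" mx.Y mx.Y] by (simp add: mult_ac)
      then show ?thesis using K by (simp add: mx.N_eq power2_eq_square field_simps)
    qed
    moreover have "real k \<le> real N * p + K * mx.Y" using kT by (auto simp: mx.Tk_def abs_le_iff)
    moreover have "real N * p \<le> real N - real N / K" using mult_left_mono[OF p(2), of "real N"] by (simp add: right_diff_distrib)
    moreover have "real N / K = 4 * (real N / (4 * K))" by simp
    moreover have "0 < real N / (4 * K)" using N0 K by simp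
    ultimately have "real k \<le> real N - real N / (4 * K)" by linarith
    also have "\<dots> = (1 - 1 / (4 * K)) * real N" by (simp add: algebra_simps)
    also have "\<dots> \<le> (1 - 1 / (4 * K)) * L" using NL K by (intro mult_left_mono) auto
    finally show "real k / (real m * real n) \<le> 1 - 1 / (4 * K)" unfolding L_def[symmetric] using NL(3) by (simp only: pos_divide_le_eq)
  qed auto
  have "close_pmf (deg_space m n) (edge_indep (cells D m n) p) (Vp D m n p)
      (4 * mx.E1 + 2 ^ 24 * K ^ 12 / sqrt (real n) + 4 * mx.E1 * (2 ^ 24 * K ^ 12 / sqrt (real n)))
      (6 * (real N + 1) * mx.far + 224 * real n ^ 9 * exp (- (K / 32)))"
  proof (rule close_mixture[where N = N and b = "bw N p" and c = mx.w and Pk = "edge_unif (cells D m n)" and Qk = "Bk D m n"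
        and \<kappa> = "\<lambda>w. \<Sum>i<m. fst w i" and T = mx.Tgood])
    show "set_pmf (edge_indep (cells D m n) p) \<subseteq> deg_space m n" by (rule sub[OF P sP])
    show "set_pmf (Vp D m n p) \<subseteq> deg_space m n" by (rule sub[OF Q sQ])
    show "mx.Tgood \<subseteq> {..N}" using mx.weights_close(1) mx.Tk_sub(1) by blast
    show "0 \<le> 4 * mx.E1" using mx.E1_bounds by simp
  qed (use P Q sP sQ cl finite_deg_space bw_nonneg mx.p01 mx.w_nonneg sum_bw mx.sum_w mx.weights_close in auto)
  moreover have "4 * mx.E1 + 2 ^ 24 * K ^ 12 / sqrt (real n) + 4 * mx.E1 * (2 ^ 24 * K ^ 12 / sqrt (real n)) \<le> 2 ^ 25 * K ^ 12 / sqrt (real n)"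
  proof -
    have "4 * mx.E1 = 12 * (K ^ 7 / mx.Y)" by (simp add: mx.E1_def)
    also have "\<dots> \<le> 12 * h"
    proof (rule mult_left_mono)
      have "K ^ 7 \<le> K ^ 12" using K by (intro power_increasing) auto
      then show "K ^ 7 / mx.Y \<le> h" unfolding h_def using yN y0 K by (intro frac_le) (auto simp: mx.Y_def)
    qed simp
    finally have E: "4 * mx.E1 \<le> 12 * h" .
    have "4 * mx.E1 * (2 ^ 24 * h) \<le> (12 * h) * 1" by (rule mult_mono[OF E]) (use h in auto)
    then have "4 * mx.E1 + 2 ^ 24 * h + 4 * mx.E1 * (2 ^ 24 * h) \<le> 2 ^ 25 * h"
    proof -
      have "24 * h \<le> 2 ^ 24 * h" using h by (intro mult_right_mono) auto
      moreover have "2 ^ 25 * h = 2 ^ 24 * h + 2 ^ 24 * h" by simp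
      moreover have "12 * h * 1 = 12 * h" by simp
      ultimately show ?thesis using E \<open>4 * mx.E1 * (2 ^ 24 * h) \<le> (12 * h) * 1\<close> by linarith
    qed
    then show ?thesis by (simp add: h_def y_def)
  qed
  moreover have "6 * (real N + 1) * mx.far + 224 * real n ^ 9 * exp (- (K / 32)) \<le> 250 * real n ^ 9 * exp (- (K / 32))"
  proof -
    have "6 * (real N + 1) * mx.far = 6 * (real N + 1)\<^sup>2 * exp (- K)" by (simp add: mx.far_def power2_eq_square)
    also have "\<dots> \<le> 6 * (2\<^sup>2 * real n ^ (3 * 2)) * exp (- (K / 32))" using eN[of 2] K by (intro mult_mono mult_left_mono) auto
    also have "\<dots> \<le> 6 * (2\<^sup>2 * real n ^ 9) * exp (- (K / 32))"
      using power_increasing[of 6 9 "real n"] K_le_n by (intro mult_right_mono mult_left_mono) auto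
    finally have "6 * (real N + 1) * mx.far \<le> 24 * (real n ^ 9 * exp (- (K / 32)))" by simp
    moreover have "0 \<le> real n ^ 9 * exp (- (K / 32))" by simp
    ultimately show ?thesis by (simp only: mult.assoc)
  qed
  ultimately show ?thesis by (rule close_pmf_mono)
qed

end

section \<open>Asymptotics\<close>

text \<open>The error is divided between the two terms in proportion to their bounds; a single
  factor \<open>\<theta>\<close> serves both.\<close>

lemma split_error:
  fixes d u v R r :: real
  assumes "\<bar>d\<bar> \<le> R * u + r * v" "0 \<le> u" "0 \<le> v" "0 \<le> R" "0 \<le> r"
  shows "\<exists>\<delta> \<eta>. \<bar>\<delta>\<bar> \<le> R \<and> \<bar>\<eta>\<bar> \<le> r \<and> d = \<delta> * u + \<eta> * v"
proof (cases "R * u + r * v = 0")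
  case True
  then have "d = 0" using assms(1) by simp
  then show ?thesis using assms by (intro exI[of _ 0]) auto
next
  case False
  moreover have "0 \<le> R * u + r * v" using assms by simp
  ultimately have S: "0 < R * u + r * v" by simp
  define \<theta> where "\<theta> = d / (R * u + r * v)"
  have t: "\<bar>\<theta>\<bar> \<le> 1" using assms(1) S by (simp add: \<theta>_def abs_divide)
  have d: "d = \<theta> * (R * u + r * v)" using S by (simp add: \<theta>_def)
  have "\<bar>\<theta> * R\<bar> \<le> 1 * R" "\<bar>\<theta> * r\<bar> \<le> 1 * r" unfolding abs_mult using t assms by (intro mult_mono; simp)+
  then show ?thesis using d by (intro exI[of _ "\<theta> * R"] exI[of _ "\<theta> * r"]) (simp add: algebra_simps)
qed

lemma tilde_o_cmult: "tilde_o n f \<Longrightarrow> c \<noteq> 0 \<Longrightarrow> tilde_o n (\<lambda>l. c * f l)"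
  unfolding tilde_o_def by simp

lemma tilde_o_mono:
  assumes "tilde_o n g" "\<forall>\<^sub>F l in sequentially. \<bar>f l\<bar> \<le> \<bar>g l\<bar>"
  shows "tilde_o n f"
proof -
  obtain c where c: "c > 0" "g \<in> O(\<lambda>l. exp (- (real (n l) powr c)))" using assms(1) by (auto simp: tilde_o_def)
  have "f \<in> O(g)" using assms(2) by (intro bigoI[of _ 1]) simp
  then have "f \<in> O(\<lambda>l. exp (- (real (n l) powr c)))" using c(2) by (rule landau_o.big_trans)
  then show ?thesis using c(1) by (auto simp: tilde_o_def)
qed

lemma conclusions_from_close_pmf:
  fixes m n :: "nat \<Rightarrow> nat" and D D' :: "nat \<Rightarrow> degrees pmf" and R r :: "nat \<Rightarrow> real"
  assumes cl: "\<forall>\<^sub>F l in sequentially. close_pmf (deg_space (m l) (n l)) (D l) (D' l) (R l) (r l)"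
    and R: "R \<in> O(\<lambda>l. real (n l) powr (- b))" and R01: "\<forall>\<^sub>F l in sequentially. 0 \<le> R l \<and> R l \<le> 1"
    and r: "tilde_o n r" "\<And>l. 0 \<le> r l"
  shows "(\<exists>B R. (\<forall>l. B l \<subseteq> deg_space (m l) (n l)) \<and>
        tilde_o n (\<lambda>l. measure_pmf.prob (D l) (B l)) \<and>
        R \<in> O(\<lambda>l. real (n l) powr (- b)) \<and>
        (\<forall>\<^sub>F l in sequentially. \<forall>\<omega> \<in> deg_space (m l) (n l) - B l.
           \<exists>\<delta>. \<bar>\<delta>\<bar> \<le> R l \<and> pmf (D l) \<omega> = (1 + \<delta>) * pmf (D' l) \<omega>)) \<and>
     (\<exists>R r. R \<in> O(\<lambda>l. real (n l) powr (- b)) \<and> tilde_o n r \<and>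
        (\<forall>\<^sub>F l in sequentially. \<forall>E \<subseteq> deg_space (m l) (n l).
           \<exists>\<delta> \<eta>. \<bar>\<delta>\<bar> \<le> R l \<and> \<bar>\<eta>\<bar> \<le> r l \<and>
             measure_pmf.prob (D l) E = (1 + \<delta>) * measure_pmf.prob (D' l) E + \<eta>)) \<and>
     (\<exists>R r. R \<in> O(\<lambda>l. real (n l) powr (- b)) \<and> tilde_o n r \<and>
        (\<forall>\<^sub>F l in sequentially. \<forall>X :: degrees \<Rightarrow> real.
           \<exists>\<delta> \<eta>. \<bar>\<delta>\<bar> \<le> R l \<and> \<bar>\<eta>\<bar> \<le> r l \<and>
             measure_pmf.expectation (D l) X =
               measure_pmf.expectation (D' l) X
               + \<delta> * measure_pmf.expectation (D' l) (\<lambda>\<omega>. \<bar>X \<omega>\<bar>)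
               + \<eta> * Max ((\<lambda>\<omega>. \<bar>X \<omega>\<bar>) ` deg_space (m l) (n l)))) \<and>
     (\<exists>R r. R \<in> O(\<lambda>l. real (n l) powr (- b)) \<and> tilde_o n r \<and>
        (\<forall>\<^sub>F l in sequentially. \<forall>X :: degrees \<Rightarrow> real.
           \<exists>\<delta> \<eta>. \<bar>\<delta>\<bar> \<le> R l \<and> \<bar>\<eta>\<bar> \<le> r l \<and>
             measure_pmf.variance (D l) X =
               (1 + \<delta>) * measure_pmf.variance (D' l) X
               + \<eta> * Max ((\<lambda>\<omega>. (X \<omega>) ^ 2) ` deg_space (m l) (n l))))"
proof -
  let ?\<Omega> = "\<lambda>l. deg_space (m l) (n l)"
  have good: "\<forall>\<^sub>F l in sequentially. close_pmf (?\<Omega> l) (D l) (D' l) (R l) (r l) \<and> 0 \<le> R l \<and> R l \<le> 1"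
    using cl R01 by eventually_elim simp
  have ne: "?\<Omega> l \<noteq> {}" if "close_pmf (?\<Omega> l) (D l) (D' l) (R l) (r l)" for l
    using that set_pmf_not_empty[of "D l"] by (auto simp: close_pmf_def)
  have Max0: "0 \<le> Max (f ` ?\<Omega> l)" if f0: "\<And>w. 0 \<le> f w" and ne0: "?\<Omega> l \<noteq> {}" for f :: "degrees \<Rightarrow> real" and l
  proof -
    obtain w where "w \<in> ?\<Omega> l" using ne0 by blast
    then have "f w \<le> Max (f ` ?\<Omega> l)" by (intro Max_ge finite_imageI finite_deg_space) auto
    then show ?thesis using f0[of w] by linarith
  qed
  define A where "A = (\<lambda>l B. measure_pmf.prob (D l) B \<le> r l \<and> (\<forall>\<omega>\<in>?\<Omega> l - B. \<bar>pmf (D l) \<omega> - pmf (D' l) \<omega>\<bar> \<le> R l * pmf (D' l) \<omega>))"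
  \<comment> \<open>The implication makes \<open>B\<close> a subset of the space at every index,
    also where closeness fails.\<close>
  have "\<exists>B\<subseteq>?\<Omega> l. close_pmf (?\<Omega> l) (D l) (D' l) (R l) (r l) \<longrightarrow> A l B" for l
    unfolding close_pmf_def A_def by blast
  then obtain B where B: "\<And>l. B l \<subseteq> ?\<Omega> l" "\<And>l. close_pmf (?\<Omega> l) (D l) (D' l) (R l) (r l) \<Longrightarrow> A l (B l)" by metis
  have 1: "tilde_o n (\<lambda>l. measure_pmf.prob (D l) (B l))"
  proof (rule tilde_o_mono[OF r(1)])
    show "\<forall>\<^sub>F l in sequentially. \<bar>measure_pmf.prob (D l) (B l)\<bar> \<le> \<bar>r l\<bar>"
      using cl by eventually_elim (use B(2) r(2) in \<open>auto simp: A_def\<close>)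
  qed
  have 2: "\<forall>\<^sub>F l in sequentially. \<forall>\<omega> \<in> ?\<Omega> l - B l. \<exists>\<delta>. \<bar>\<delta>\<bar> \<le> R l \<and> pmf (D l) \<omega> = (1 + \<delta>) * pmf (D' l) \<omega>"
    using good
  proof eventually_elim
    case (elim l)
    show ?case
    proof
      fix w assume "w \<in> ?\<Omega> l - B l"
      then have "\<bar>pmf (D l) w - pmf (D' l) w\<bar> \<le> R l * pmf (D' l) w + 0 * 0" using B(2)[of l] elim by (auto simp: A_def)
      from split_error[OF this] elim obtain \<delta> where "\<bar>\<delta>\<bar> \<le> R l" "pmf (D l) w - pmf (D' l) w = \<delta> * pmf (D' l) w" by auto
      then show "\<exists>\<delta>. \<bar>\<delta>\<bar> \<le> R l \<and> pmf (D l) w = (1 + \<delta>) * pmf (D' l) w" by (intro exI[of _ \<delta>]) (simp add: algebra_simps)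
    qed
  qed
  have 3: "\<forall>\<^sub>F l in sequentially. \<forall>E \<subseteq> ?\<Omega> l. \<exists>\<delta> \<eta>. \<bar>\<delta>\<bar> \<le> R l \<and> \<bar>\<eta>\<bar> \<le> 2 * r l \<and>
      measure_pmf.prob (D l) E = (1 + \<delta>) * measure_pmf.prob (D' l) E + \<eta>"
    using good
  proof eventually_elim
    case (elim l)
    show ?case
    proof (intro allI impI)
      fix E assume "E \<subseteq> ?\<Omega> l"
      then have "\<bar>measure_pmf.prob (D l) E - measure_pmf.prob (D' l) E\<bar> \<le> R l * measure_pmf.prob (D' l) E + (2 * r l) * 1"
        using close_event[OF finite_deg_space, of "m l" "n l" "D l" "D' l" "R l" "r l" E] elim by simp
      from split_error[OF this] elim r(2)[of l] obtain \<delta> \<eta> where "\<bar>\<delta>\<bar> \<le> R l" "\<bar>\<eta>\<bar> \<le> 2 * r l"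
        "measure_pmf.prob (D l) E - measure_pmf.prob (D' l) E = \<delta> * measure_pmf.prob (D' l) E + \<eta> * 1" by auto
      then show "\<exists>\<delta> \<eta>. \<bar>\<delta>\<bar> \<le> R l \<and> \<bar>\<eta>\<bar> \<le> 2 * r l \<and> measure_pmf.prob (D l) E = (1 + \<delta>) * measure_pmf.prob (D' l) E + \<eta>"
        by (intro exI[of _ \<delta>] exI[of _ \<eta>]) (simp add: algebra_simps)
    qed
  qed
  have 4: "\<forall>\<^sub>F l in sequentially. \<forall>X :: degrees \<Rightarrow> real. \<exists>\<delta> \<eta>. \<bar>\<delta>\<bar> \<le> R l \<and> \<bar>\<eta>\<bar> \<le> 2 * r l \<and>
      measure_pmf.expectation (D l) X = measure_pmf.expectation (D' l) X
        + \<delta> * measure_pmf.expectation (D' l) (\<lambda>\<omega>. \<bar>X \<omega>\<bar>) + \<eta> * Max ((\<lambda>\<omega>. \<bar>X \<omega>\<bar>) ` ?\<Omega> l)"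
    using good
  proof eventually_elim
    case (elim l)
    show ?case
    proof
      fix X :: "degrees \<Rightarrow> real"
      have "\<bar>measure_pmf.expectation (D l) X - measure_pmf.expectation (D' l) X\<bar> \<le>
          R l * measure_pmf.expectation (D' l) (\<lambda>\<omega>. \<bar>X \<omega>\<bar>) + (2 * r l) * Max ((\<lambda>\<omega>. \<bar>X \<omega>\<bar>) ` ?\<Omega> l)"
        using close_expectation[OF finite_deg_space ne] elim by blast
      moreover have "0 \<le> measure_pmf.expectation (D' l) (\<lambda>\<omega>. \<bar>X \<omega>\<bar>)" by (rule Bochner_Integration.integral_nonneg) simp
      moreover have "0 \<le> Max ((\<lambda>\<omega>. \<bar>X \<omega>\<bar>) ` ?\<Omega> l)" using ne elim by (intro Max0) auto
      ultimately obtain \<delta> \<eta> where "\<bar>\<delta>\<bar> \<le> R l" "\<bar>\<eta>\<bar> \<le> 2 * r l"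
        "measure_pmf.expectation (D l) X - measure_pmf.expectation (D' l) X
          = \<delta> * measure_pmf.expectation (D' l) (\<lambda>\<omega>. \<bar>X \<omega>\<bar>) + \<eta> * Max ((\<lambda>\<omega>. \<bar>X \<omega>\<bar>) ` ?\<Omega> l)"
        using split_error[of "measure_pmf.expectation (D l) X - measure_pmf.expectation (D' l) X" "R l"
            "measure_pmf.expectation (D' l) (\<lambda>\<omega>. \<bar>X \<omega>\<bar>)" "2 * r l" "Max ((\<lambda>\<omega>. \<bar>X \<omega>\<bar>) ` ?\<Omega> l)"] elim r(2)[of l] by auto
      then show "\<exists>\<delta> \<eta>. \<bar>\<delta>\<bar> \<le> R l \<and> \<bar>\<eta>\<bar> \<le> 2 * r l \<and>
        measure_pmf.expectation (D l) X = measure_pmf.expectation (D' l) X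
        + \<delta> * measure_pmf.expectation (D' l) (\<lambda>\<omega>. \<bar>X \<omega>\<bar>) + \<eta> * Max ((\<lambda>\<omega>. \<bar>X \<omega>\<bar>) ` ?\<Omega> l)"
        by (intro exI[of _ \<delta>] exI[of _ \<eta>]) (simp add: algebra_simps)
    qed
  qed
  have 5: "\<forall>\<^sub>F l in sequentially. \<forall>X :: degrees \<Rightarrow> real. \<exists>\<delta> \<eta>. \<bar>\<delta>\<bar> \<le> 3 * R l \<and> \<bar>\<eta>\<bar> \<le> 8 * r l \<and>
      measure_pmf.variance (D l) X = (1 + \<delta>) * measure_pmf.variance (D' l) X + \<eta> * Max ((\<lambda>\<omega>. (X \<omega>) ^ 2) ` ?\<Omega> l)"
    using good
  proof eventually_elim
    case (elim l)
    show ?case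
    proof
      fix X :: "degrees \<Rightarrow> real"
      define v where "v = measure_pmf.variance (D l) X"
      define v' where "v' = measure_pmf.variance (D' l) X"
      define M where "M = Max ((\<lambda>\<omega>. (X \<omega>) ^ 2) ` ?\<Omega> l)"
      have "\<bar>v - v'\<bar> \<le> (3 * R l) * v' + (8 * r l) * M"
        unfolding v_def v'_def M_def using close_variance[OF finite_deg_space ne] elim by blast
      moreover have "0 \<le> v'" unfolding v'_def by (rule Bochner_Integration.integral_nonneg) simp
      moreover have "0 \<le> M" unfolding M_def using ne elim by (intro Max0) auto
      ultimately obtain \<delta> \<eta> where "\<bar>\<delta>\<bar> \<le> 3 * R l" "\<bar>\<eta>\<bar> \<le> 8 * r l" "v - v' = \<delta> * v' + \<eta> * M"
        using split_error[of "v - v'" "3 * R l" v' "8 * r l" M] elim r(2)[of l] by auto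
      then have "\<exists>\<delta> \<eta>. \<bar>\<delta>\<bar> \<le> 3 * R l \<and> \<bar>\<eta>\<bar> \<le> 8 * r l \<and> v = (1 + \<delta>) * v' + \<eta> * M"
        by (intro exI[of _ \<delta>] exI[of _ \<eta>]) (simp add: algebra_simps)
      then show "\<exists>\<delta> \<eta>. \<bar>\<delta>\<bar> \<le> 3 * R l \<and> \<bar>\<eta>\<bar> \<le> 8 * r l \<and>
        measure_pmf.variance (D l) X = (1 + \<delta>) * measure_pmf.variance (D' l) X + \<eta> * Max ((\<lambda>\<omega>. (X \<omega>) ^ 2) ` ?\<Omega> l)"
        unfolding v_def v'_def M_def .
    qed
  qed
  have R3: "(\<lambda>l. 3 * R l) \<in> O(\<lambda>l. real (n l) powr (- b))" using R by simp
  show ?thesis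
  proof (intro conjI)
    show "\<exists>B R. (\<forall>l. B l \<subseteq> deg_space (m l) (n l)) \<and> tilde_o n (\<lambda>l. measure_pmf.prob (D l) (B l)) \<and>
        R \<in> O(\<lambda>l. real (n l) powr (- b)) \<and>
        (\<forall>\<^sub>F l in sequentially. \<forall>\<omega> \<in> deg_space (m l) (n l) - B l.
           \<exists>\<delta>. \<bar>\<delta>\<bar> \<le> R l \<and> pmf (D l) \<omega> = (1 + \<delta>) * pmf (D' l) \<omega>)"
      using B(1) 1 R 2 by (intro exI[of _ B] exI[of _ R] conjI allI)
  qed (rule exI, rule exI, rule conjI[OF R conjI[OF tilde_o_cmult[OF r(1), of 2] 3]], simp,
       rule exI, rule exI, rule conjI[OF R conjI[OF tilde_o_cmult[OF r(1), of 2] 4]], simp,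
       rule exI, rule exI, rule conjI[OF R3 conjI[OF tilde_o_cmult[OF r(1), of 8] 5]], simp)
qed

lemma eventually_powr_ge:
  fixes n :: "nat \<Rightarrow> nat" and C c :: real
  assumes "filterlim n at_top sequentially" "0 < c"
  shows "\<forall>\<^sub>F l in sequentially. C \<le> real (n l) powr c"
proof -
  define Z where "Z = max C 1"
  have "filterlim (\<lambda>l. real (n l)) at_top sequentially" by (rule filterlim_compose[OF filterlim_real_sequentially assms(1)])
  then have "\<forall>\<^sub>F l in sequentially. Z powr (1 / c) \<le> real (n l)" by (simp add: filterlim_at_top)
  then show ?thesis
  proof eventually_elim
    case (elim l)
    have "C \<le> Z" by (simp add: Z_def)
    also have "Z = (Z powr (1 / c)) powr c" using assms(2) by (simp add: powr_powr Z_def)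
    also have "\<dots> \<le> real (n l) powr c" using elim assms(2) by (intro powr_mono2) auto
    finally show ?case .
  qed
qed

text \<open>With \<open>K\<close> a small power of \<open>n\<close>, acceptability gives the size
  conditions on \<open>m\<close> and \<open>n\<close> and bounds \<open>1 / (x * (1 - x))\<close> by
  a multiple of \<open>ln n\<close> plus a constant, far below \<open>K\<close>. The condition
  \<open>24 * \<kappa> < 1\<close> keeps \<open>K ^ 12\<close> below \<open>sqrt n\<close> with room
  for \<open>2 ^ 25\<close>, and \<open>exp (- K / 32)\<close> beats every power of
  \<open>n\<close>.\<close>

lemma acceptable_setup:
  fixes m n :: "nat \<Rightarrow> nat" and x :: "nat \<Rightarrow> real"
  assumes acc: "acceptable a (\<kappa> / 4) m n x" and a: "0 < a" and \<kappa>: "0 < \<kappa>" "24 * \<kappa> < 1"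
  defines "K \<equiv> \<lambda>l. real (n l) powr \<kappa>"
  shows "\<forall>\<^sub>F l in sequentially. 100 \<le> K l \<and> real (n l) \<le> K l * real (m l) \<and> real (m l) \<le> K l * real (n l) \<and>
    2 ^ 25 * K l ^ 12 \<le> sqrt (real (n l)) \<and> 5000 * real (n l) ^ 20 * exp (- (K l / 32)) \<le> 1 \<and>
    1 / K l \<le> x l \<and> x l \<le> 1 - 1 / K l \<and> 250 * real (n l) ^ 9 * exp (- (K l / 32)) \<le> exp (- (real (n l) powr (\<kappa> / 2)))"
proof -
  have n_lim: "filterlim n at_top sequentially" and x01: "\<forall>\<^sub>F l in sequentially. 0 < x l \<and> x l < 1"
    and m_o: "(\<lambda>l. real (m l)) \<in> o(\<lambda>l. real (n l) powr (1 + \<kappa> / 4))"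
    and n_o: "(\<lambda>l. real (n l)) \<in> o(\<lambda>l. real (m l) powr (1 + \<kappa> / 4))"
    and ineq: "\<forall>\<^sub>F l in sequentially. (1 - 2 * x l) ^ 2 / (4 * x l * (1 - x l)) *
        (1 + 5 * real (m l) / (6 * real (n l)) + 5 * real (n l) / (6 * real (m l))) < a * ln (real (n l))"
    using acc unfolding acceptable_def by blast+
  have n_lim': "filterlim (\<lambda>l. real (n l)) at_top sequentially" by (rule filterlim_compose[OF filterlim_real_sequentially n_lim])
  have n1: "\<forall>\<^sub>F l in sequentially. 1 \<le> real (n l)" using n_lim' unfolding filterlim_at_top by blast
  have m_le: "\<forall>\<^sub>F l in sequentially. real (m l) \<le> real (n l) powr (1 + \<kappa> / 4)" using landau_o.smallD[OF m_o, of 1] by simp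
  have n_le: "\<forall>\<^sub>F l in sequentially. real (n l) \<le> real (m l) powr (1 + \<kappa> / 4)" using landau_o.smallD[OF n_o, of 1] by simp
  have K100: "\<forall>\<^sub>F l in sequentially. 100 \<le> K l" unfolding K_def by (rule eventually_powr_ge[OF n_lim \<kappa>(1)])
  \<comment> \<open>One threshold for two purposes, with \<open>U = n powr (\<kappa> / 2)\<close>
    and \<open>K = U * U\<close>: 64 for trading \<open>exp (- K / 64)\<close> against
    \<open>exp (- U)\<close>, and \<open>4 + 8 * a / \<kappa>\<close> for the bound on
    \<open>1 / v\<close> below.\<close>
  have u: "\<forall>\<^sub>F l in sequentially. 64 + 4 + 8 * a / \<kappa> \<le> real (n l) powr (\<kappa> / 2)" using \<kappa> by (intro eventually_powr_ge[OF n_lim]) auto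
  have sq: "\<forall>\<^sub>F l in sequentially. 2 ^ 25 \<le> real (n l) powr (1 / 2 - 12 * \<kappa>)" using \<kappa> by (intro eventually_powr_ge[OF n_lim]) auto
  \<comment> \<open>Chosen so that \<open>K ^ j\<close> is at least \<open>n ^ 20\<close>; one
    limit, of a power against \<open>exp\<close>, then settles all exponential conditions.\<close>
  define j where "j = nat \<lceil>20 / \<kappa>\<rceil>"
  have j: "20 \<le> real j * \<kappa>"
  proof -
    have "20 / \<kappa> \<le> real j" unfolding j_def by linarith
    then show ?thesis using \<kappa>(1) by (simp add: field_simps)
  qed
  have "filterlim (\<lambda>l. K l / 64) at_top sequentially"
    unfolding filterlim_at_top
  proof
    fix Z :: real
    have "\<forall>\<^sub>F l in sequentially. 64 * Z \<le> K l" unfolding K_def by (rule eventually_powr_ge[OF n_lim \<kappa>(1)])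
    then show "\<forall>\<^sub>F l in sequentially. Z \<le> K l / 64" by eventually_elim simp
  qed
  then have "((\<lambda>l. (K l / 64) ^ j / exp (K l / 64)) \<longlongrightarrow> 0) sequentially" by (rule filterlim_compose[OF tendsto_power_div_exp_0])
  then have ex: "\<forall>\<^sub>F l in sequentially. (K l / 64) ^ j / exp (K l / 64) < 1 / (5000 * 64 ^ j)" by (rule order_tendstoD) simp
  show ?thesis
    using n1 m_le n_le K100 u sq ex x01 ineq
  proof eventually_elim
    case (elim l)
    define N where "N = real (n l)"
    define U where "U = N powr (\<kappa> / 2)"
    have N1: "1 \<le> N" using elim by (simp add: N_def)
    have KU: "K l = U * U" unfolding K_def U_def N_def using N1 by (simp add: powr_add[symmetric])
    have U: "64 + 4 + 8 * a / \<kappa> \<le> U" using elim by (simp add: U_def N_def)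
    have ak: "0 \<le> 8 * a / \<kappa>" using a \<kappa> by simp
    have U64: "64 \<le> U" using U ak by linarith
    have K0: "0 < K l" using elim by linarith
    have mle: "real (m l) \<le> K l * N"
    proof -
      have "N powr (1 + \<kappa> / 4) = N * N powr (\<kappa> / 4)" using N1 by (simp add: powr_add)
      also have "\<dots> \<le> N * K l" unfolding K_def N_def[symmetric] using N1 \<kappa> by (intro mult_left_mono powr_mono) auto
      finally show ?thesis using elim by (simp add: N_def mult.commute)
    qed
    have nle: "N \<le> K l * real (m l)"
    proof -
      have m1: "1 \<le> real (m l)"
      proof (rule ccontr)
        assume "\<not> ?thesis"
        then have "m l = 0" by (cases "m l") auto
        then show False using elim by simp
      qed
      \<comment> \<open>The excess exponent on \<open>m\<close> is turned into one on
        \<open>n\<close> by the rough bound \<open>m \<le> n\<^sup>2\<close>.\<close>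
      have "real (m l) powr (\<kappa> / 4) \<le> (N powr 2) powr (\<kappa> / 4)"
      proof (rule powr_mono2)
        have "N powr (1 + \<kappa> / 4) \<le> N powr 2" using N1 \<kappa> by (intro powr_mono) auto
        then show "real (m l) \<le> N powr 2" using elim(2) unfolding N_def by linarith
      qed (use \<kappa> in auto)
      also have "\<dots> = N powr (\<kappa> / 2)" by (simp add: powr_powr)
      also have "\<dots> \<le> K l" unfolding K_def N_def[symmetric] using N1 \<kappa> by (intro powr_mono) auto
      finally have "real (m l) * real (m l) powr (\<kappa> / 4) \<le> real (m l) * K l" by (intro mult_left_mono) auto
      moreover have "real (m l) powr (1 + \<kappa> / 4) = real (m l) * real (m l) powr (\<kappa> / 4)" using m1 by (simp add: powr_add)
      ultimately have "real (m l) powr (1 + \<kappa> / 4) \<le> K l * real (m l)" by (simp only: mult.commute)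
      then show ?thesis using elim(3) unfolding N_def by linarith
    qed
    have sqrt: "2 ^ 25 * K l ^ 12 \<le> sqrt N"
    proof -
      have K12: "K l ^ 12 = N powr (12 * \<kappa>)" unfolding K_def N_def[symmetric] using N1 by (simp add: powr_power)
      have "2 ^ 25 * K l ^ 12 \<le> N powr (1 / 2 - 12 * \<kappa>) * K l ^ 12" using elim K0 by (intro mult_right_mono) (auto simp: N_def)
      also have "\<dots> = N powr (1 / 2)" unfolding K12 by (simp add: powr_add[symmetric])
      also have "\<dots> = sqrt N" using N1 by (intro powr_half_sqrt) auto
      finally show ?thesis .
    qed
    have e64: "5000 * N ^ 20 * exp (- (K l / 64)) \<le> 1"
    proof -
      have "N ^ 20 = N powr 20" using N1 by (simp add: powr_numeral)
      also have "\<dots> \<le> N powr (real j * \<kappa>)" using N1 j by (intro powr_mono) auto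
      also have "\<dots> = K l ^ j" unfolding K_def N_def[symmetric] using N1 by (simp add: powr_power)
      also have "\<dots> = 64 ^ j * (K l / 64) ^ j" by (simp add: power_divide)
      finally have "5000 * N ^ 20 * exp (- (K l / 64)) \<le> 5000 * (64 ^ j * (K l / 64) ^ j) * exp (- (K l / 64))"
        by (intro mult_right_mono mult_left_mono) auto
      also have "\<dots> = (5000 * 64 ^ j) * ((K l / 64) ^ j / exp (K l / 64))" by (simp only: exp_minus divide_inverse mult.assoc)
      also have "\<dots> \<le> (5000 * 64 ^ j) * (1 / (5000 * 64 ^ j))" by (rule mult_left_mono[OF less_imp_le[OF elim(7)]]) simp
      also have "\<dots> = 1" by simp
      finally show ?thesis .
    qed
    have half: "exp (- (K l / 32)) = exp (- (K l / 64)) * exp (- (K l / 64))" by (simp add: exp_add[symmetric])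
    have e1: "exp (- (K l / 64)) \<le> 1" using K0 by simp
    have e32: "5000 * N ^ 20 * exp (- (K l / 32)) \<le> 1"
    proof -
      have "5000 * N ^ 20 * exp (- (K l / 32)) = (5000 * N ^ 20 * exp (- (K l / 64))) * exp (- (K l / 64))" by (simp add: half)
      also have "\<dots> \<le> 1 * 1" by (rule mult_mono[OF e64 e1]) auto
      finally show ?thesis by simp
    qed
    have rU: "250 * N ^ 9 * exp (- (K l / 32)) \<le> exp (- U)"
    proof -
      have "250 * N ^ 9 \<le> 5000 * N ^ 20" using N1 power_increasing[of 9 20 N] by (intro mult_mono) auto
      then have "250 * N ^ 9 * exp (- (K l / 64)) \<le> 5000 * N ^ 20 * exp (- (K l / 64))" by (intro mult_right_mono) auto
      then have "250 * N ^ 9 * exp (- (K l / 64)) \<le> 1" using e64 by linarith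
      then have "(250 * N ^ 9 * exp (- (K l / 64))) * exp (- (K l / 64)) \<le> 1 * exp (- (K l / 64))" by (intro mult_right_mono) auto
      moreover have "64 * U \<le> U * U" using U64 by (intro mult_right_mono) auto
      then have "exp (- (K l / 64)) \<le> exp (- U)" unfolding KU by simp
      ultimately have "(250 * N ^ 9 * exp (- (K l / 64))) * exp (- (K l / 64)) \<le> exp (- U)" by linarith
      then show ?thesis by (simp only: half mult.assoc)
    qed
    have xb: "1 / K l \<le> x l \<and> x l \<le> 1 - 1 / K l"
    proof -
      define v where "v = x l * (1 - x l)"
      have v0: "0 < v" using elim(8) by (simp add: v_def)
      let ?t = "1 + 5 * real (m l) / (6 * real (n l)) + 5 * real (n l) / (6 * real (m l))"
      have t1: "1 \<le> ?t" by simp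
      have sq0: "0 \<le> (1 - 2 * x l) ^ 2 / (4 * x l * (1 - x l))" using elim(8) by (intro divide_nonneg_nonneg mult_nonneg_nonneg) auto
      have "(1 - 2 * x l) ^ 2 / (4 * x l * (1 - x l)) * 1 < a * ln N"
        using mult_left_mono[OF t1 sq0] elim(9) unfolding N_def by linarith
      \<comment> \<open>With \<open>v = x * (1 - x)\<close> the quotient in the acceptability
        condition is \<open>1 / (4 * v) - 1\<close>, and the bracket multiplying it is at least 1.
        So \<open>1 / v\<close> is below \<open>4 + 4 * a * ln n\<close>, and \<open>ln n\<close> is
        at most \<open>2 / \<kappa>\<close> times \<open>U\<close>.\<close>
      moreover have "(1 - 2 * x l) ^ 2 / (4 * x l * (1 - x l)) = 1 / (4 * v) - 1"
      proof -
        have "(1 - 2 * x l) ^ 2 = 1 - 4 * v" by (simp add: v_def power2_eq_square algebra_simps)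
        moreover have "4 * x l * (1 - x l) = 4 * v" by (simp add: v_def)
        ultimately show ?thesis using v0 by (simp add: diff_divide_distrib)
      qed
      ultimately have "1 / (4 * v) < 1 + a * ln N" by simp
      also have "\<dots> \<le> 1 + a * (U / (\<kappa> / 2))"
        unfolding U_def using ln_powr_bound[OF N1, of "\<kappa> / 2"] a \<kappa> by (intro add_left_mono mult_left_mono) auto
      finally have lt: "1 / (4 * v) < 1 + a * (U / (\<kappa> / 2))" .
      have "1 / v = 4 * (1 / (4 * v))" by simp
      also have "\<dots> \<le> 4 * (1 + a * (U / (\<kappa> / 2)))" by (rule mult_left_mono[OF less_imp_le[OF lt]]) simp
      also have "\<dots> = 4 + (8 * a / \<kappa>) * U" using \<kappa> by (simp add: field_simps)
      also have "\<dots> \<le> 4 * U + (8 * a / \<kappa>) * U" using U64 by simp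
      also have "\<dots> = (4 + 8 * a / \<kappa>) * U" by (simp only: distrib_right)
      also have "\<dots> \<le> U * U" using U U64 by (intro mult_right_mono) auto
      finally have "1 / v \<le> K l" by (simp only: KU)
      then have "1 / K l \<le> v" using v0 K0 by (simp add: field_simps)
      moreover have "v \<le> x l * 1" "v \<le> 1 * (1 - x l)" unfolding v_def using elim(8) by (intro mult_left_mono mult_right_mono; simp)+
      ultimately show ?thesis by simp
    qed
    show ?case using elim(4) mle nle sqrt e32 rU xb unfolding N_def U_def by blast
  qed
qed

theorem theorem1p5:
  fixes a b :: real
  assumes "a > 0" and "b > 0" and "a + b < 1 / 2"
  shows "\<exists>\<epsilon>>0. \<forall>(m :: nat \<Rightarrow> nat) (n :: nat \<Rightarrow> nat) (p :: nat \<Rightarrow> real) (k :: nat \<Rightarrow> nat)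
            (D :: nat \<Rightarrow> degrees pmf) (D' :: nat \<Rightarrow> degrees pmf).
     (acceptable a \<epsilon> m n p \<and>
        D = (\<lambda>l. G_p (m l) (n l) (p l)) \<and> D' = (\<lambda>l. V_p (m l) (n l) (p l)))
     \<or> (m = n \<and> acceptable a \<epsilon> n n p \<and>
        D = (\<lambda>l. G_p_dir (n l) (p l)) \<and> D' = (\<lambda>l. V_p_dir (n l) (p l)))
     \<or> (acceptable a \<epsilon> m n (\<lambda>l. real (k l) / (real (m l) * real (n l))) \<and>
        D = (\<lambda>l. G_k (m l) (n l) (k l)) \<and> D' = (\<lambda>l. B_k (m l) (n l) (k l)))
     \<or> (m = n \<and> acceptable a \<epsilon> n n (\<lambda>l. real (k l) / real (n l) ^ 2) \<and>
        D = (\<lambda>l. G_k_dir (n l) (k l)) \<and> D' = (\<lambda>l. B_k_dir (n l) (k l)))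
     \<longrightarrow>
     (\<exists>B R. (\<forall>l. B l \<subseteq> deg_space (m l) (n l)) \<and>
        tilde_o n (\<lambda>l. measure_pmf.prob (D l) (B l)) \<and>
        R \<in> O(\<lambda>l. real (n l) powr (- b)) \<and>
        (\<forall>\<^sub>F l in sequentially. \<forall>\<omega> \<in> deg_space (m l) (n l) - B l.
           \<exists>\<delta>. \<bar>\<delta>\<bar> \<le> R l \<and> pmf (D l) \<omega> = (1 + \<delta>) * pmf (D' l) \<omega>)) \<and>
     (\<exists>R r. R \<in> O(\<lambda>l. real (n l) powr (- b)) \<and> tilde_o n r \<and>
        (\<forall>\<^sub>F l in sequentially. \<forall>E \<subseteq> deg_space (m l) (n l).
           \<exists>\<delta> \<eta>. \<bar>\<delta>\<bar> \<le> R l \<and> \<bar>\<eta>\<bar> \<le> r l \<and>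
             measure_pmf.prob (D l) E = (1 + \<delta>) * measure_pmf.prob (D' l) E + \<eta>)) \<and>
     (\<exists>R r. R \<in> O(\<lambda>l. real (n l) powr (- b)) \<and> tilde_o n r \<and>
        (\<forall>\<^sub>F l in sequentially. \<forall>X :: degrees \<Rightarrow> real.
           \<exists>\<delta> \<eta>. \<bar>\<delta>\<bar> \<le> R l \<and> \<bar>\<eta>\<bar> \<le> r l \<and>
             measure_pmf.expectation (D l) X =
               measure_pmf.expectation (D' l) X
               + \<delta> * measure_pmf.expectation (D' l) (\<lambda>\<omega>. \<bar>X \<omega>\<bar>)
               + \<eta> * Max ((\<lambda>\<omega>. \<bar>X \<omega>\<bar>) ` deg_space (m l) (n l)))) \<and>
     (\<exists>R r. R \<in> O(\<lambda>l. real (n l) powr (- b)) \<and> tilde_o n r \<and>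
        (\<forall>\<^sub>F l in sequentially. \<forall>X :: degrees \<Rightarrow> real.
           \<exists>\<delta> \<eta>. \<bar>\<delta>\<bar> \<le> R l \<and> \<bar>\<eta>\<bar> \<le> r l \<and>
             measure_pmf.variance (D l) X =
               (1 + \<delta>) * measure_pmf.variance (D' l) X
               + \<eta> * Max ((\<lambda>\<omega>. (X \<omega>) ^ 2) ` deg_space (m l) (n l))))"
proof -
  \<comment> \<open>The error is a constant times \<open>n powr (12 * \<kappa> - 1 / 2)\<close>, so
    \<open>12 * \<kappa> - 1 / 2 \<le> - b\<close> is what is required; 26 is a convenient divisor
    above 12.\<close>
  define \<kappa> where "\<kappa> = (1 / 2 - b) / 26"
  have \<kappa>: "0 < \<kappa>" "24 * \<kappa> < 1" "12 * \<kappa> - 1 / 2 \<le> - b" using assms by (auto simp: \<kappa>_def field_simps)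
  let ?R = "\<lambda>n l. 2 ^ 25 * (real (n l) powr \<kappa>) ^ 12 / sqrt (real (n l))"
  let ?r = "\<lambda>n l. 250 * real (n l) ^ 9 * exp (- (real (n l) powr \<kappa> / 32))"
  have R: "?R n \<in> O(\<lambda>l. real (n l) powr (- b)) \<and> tilde_o n (?r n) \<and> (\<forall>\<^sub>F l in sequentially. 0 \<le> ?R n l \<and> ?R n l \<le> 1)"
    if acc: "acceptable a (\<kappa> / 4) m n x" for m n :: "nat \<Rightarrow> nat" and x
  proof (intro conjI)
    note ev = acceptable_setup[OF acc assms(1) \<kappa>(1,2)]
    have n1: "\<forall>\<^sub>F l in sequentially. 1 \<le> real (n l)"
      using filterlim_compose[OF filterlim_real_sequentially, of n sequentially] acc
      by (simp add: filterlim_at_top acceptable_def)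
    show "?R n \<in> O(\<lambda>l. real (n l) powr (- b))"
    proof (rule bigoI[of _ "2 ^ 25"])
      show "\<forall>\<^sub>F l in sequentially. norm (?R n l) \<le> 2 ^ 25 * norm (real (n l) powr (- b))"
        using n1
      proof eventually_elim
        case (elim l)
        have "(real (n l) powr \<kappa>) ^ 12 / sqrt (real (n l)) = real (n l) powr (12 * \<kappa>) / real (n l) powr (1 / 2)"
          using elim by (simp add: powr_power powr_half_sqrt)
        also have "\<dots> = real (n l) powr (12 * \<kappa> - 1 / 2)" by (simp add: powr_diff)
        also have "\<dots> \<le> real (n l) powr (- b)" using elim \<kappa>(3) by (intro powr_mono) auto
        finally show ?case by simp
      qed
    qed
    have "?r n \<in> O(\<lambda>l. exp (- (real (n l) powr (\<kappa> / 2))))"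
    proof (rule bigoI[of _ 1])
      show "\<forall>\<^sub>F l in sequentially. norm (?r n l) \<le> 1 * norm (exp (- (real (n l) powr (\<kappa> / 2))))"
        using ev by eventually_elim simp
    qed
    then show "tilde_o n (?r n)" unfolding tilde_o_def using \<kappa>(1) by (intro exI[of _ "\<kappa> / 2"]) simp
    show "\<forall>\<^sub>F l in sequentially. 0 \<le> ?R n l \<and> ?R n l \<le> 1"
      using ev n1 by eventually_elim (simp add: divide_le_eq)
  qed
  show ?thesis
  proof (rule exI[of _ "\<kappa> / 4"], intro conjI[OF _ allI] allI impI)
    show "0 < \<kappa> / 4" using \<kappa> by simp
    fix m n :: "nat \<Rightarrow> nat" and p :: "nat \<Rightarrow> real" and k :: "nat \<Rightarrow> nat" and D D' :: "nat \<Rightarrow> degrees pmf"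
    assume cases: "(acceptable a (\<kappa> / 4) m n p \<and>
        D = (\<lambda>l. G_p (m l) (n l) (p l)) \<and> D' = (\<lambda>l. V_p (m l) (n l) (p l)))
     \<or> (m = n \<and> acceptable a (\<kappa> / 4) n n p \<and>
        D = (\<lambda>l. G_p_dir (n l) (p l)) \<and> D' = (\<lambda>l. V_p_dir (n l) (p l)))
     \<or> (acceptable a (\<kappa> / 4) m n (\<lambda>l. real (k l) / (real (m l) * real (n l))) \<and>
        D = (\<lambda>l. G_k (m l) (n l) (k l)) \<and> D' = (\<lambda>l. B_k (m l) (n l) (k l)))
     \<or> (m = n \<and> acceptable a (\<kappa> / 4) n n (\<lambda>l. real (k l) / real (n l) ^ 2) \<and>
        D = (\<lambda>l. G_k_dir (n l) (k l)) \<and> D' = (\<lambda>l. B_k_dir (n l) (k l)))"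
    have "(\<forall>\<^sub>F l in sequentially. close_pmf (deg_space (m l) (n l)) (D l) (D' l) (?R n l) (?r n l)) \<and> (\<exists>x. acceptable a (\<kappa> / 4) m n x)"
      using cases
    proof (elim disjE conjE)
      assume acc: "acceptable a (\<kappa> / 4) m n p" and DD: "D = (\<lambda>l. G_p (m l) (n l) (p l))" "D' = (\<lambda>l. V_p (m l) (n l) (p l))"
      have "\<forall>\<^sub>F l in sequentially. close_pmf (deg_space (m l) (n l)) (D l) (D' l) (?R n l) (?r n l)"
        using acceptable_setup[OF acc assms(1) \<kappa>(1,2)]
      proof eventually_elim
        case (elim l)
        then show ?case using close_edge_indep[of False "m l" "n l" "real (n l) powr \<kappa>" "p l"] by (simp add: DD G_p_def Vp_def bip_cells)
      qed
      then show ?thesis using acc by blast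
    next
      assume mn: "m = n" and acc: "acceptable a (\<kappa> / 4) n n p" and DD: "D = (\<lambda>l. G_p_dir (n l) (p l))" "D' = (\<lambda>l. V_p_dir (n l) (p l))"
      have "\<forall>\<^sub>F l in sequentially. close_pmf (deg_space (m l) (n l)) (D l) (D' l) (?R n l) (?r n l)"
        using acceptable_setup[OF acc assms(1) \<kappa>(1,2)]
      proof eventually_elim
        case (elim l)
        then show ?case using close_edge_indep[of True "n l" "n l" "real (n l) powr \<kappa>" "p l"] by (simp add: mn DD G_p_dir_def Vp_def bip_cells)
      qed
      then show ?thesis using acc mn by blast
    next
      assume acc: "acceptable a (\<kappa> / 4) m n (\<lambda>l. real (k l) / (real (m l) * real (n l)))"
        and DD: "D = (\<lambda>l. G_k (m l) (n l) (k l))" "D' = (\<lambda>l. B_k (m l) (n l) (k l))"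
      have "\<forall>\<^sub>F l in sequentially. close_pmf (deg_space (m l) (n l)) (D l) (D' l) (?R n l) (?r n l)"
        using acceptable_setup[OF acc assms(1) \<kappa>(1,2)]
      proof eventually_elim
        case (elim l)
        then show ?case using close_edge_unif[of False "m l" "n l" "real (n l) powr \<kappa>" "k l"] by (simp add: DD G_k_def Bk_def bip_cells)
      qed
      then show ?thesis using acc by blast
    next
      assume mn: "m = n" and acc: "acceptable a (\<kappa> / 4) n n (\<lambda>l. real (k l) / real (n l) ^ 2)"
        and DD: "D = (\<lambda>l. G_k_dir (n l) (k l))" "D' = (\<lambda>l. B_k_dir (n l) (k l))"
      have "\<forall>\<^sub>F l in sequentially. close_pmf (deg_space (m l) (n l)) (D l) (D' l) (?R n l) (?r n l)"
        using acceptable_setup[OF acc assms(1) \<kappa>(1,2)]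
      proof eventually_elim
        case (elim l)
        then show ?case using close_edge_unif[of True "n l" "n l" "real (n l) powr \<kappa>" "k l"]
          by (simp add: mn DD G_k_dir_def Bk_def bip_cells power2_eq_square)
      qed
      then show ?thesis using acc mn by blast
    qed
    then obtain x where cl: "\<forall>\<^sub>F l in sequentially. close_pmf (deg_space (m l) (n l)) (D l) (D' l) (?R n l) (?r n l)"
      and acc: "acceptable a (\<kappa> / 4) m n x" by blast
    note Rr = R[OF acc]
    note goal = conclusions_from_close_pmf[OF cl conjunct1[OF Rr] conjunct2[OF conjunct2[OF Rr]] conjunct1[OF conjunct2[OF Rr]]]
    show "(\<exists>B R. (\<forall>l. B l \<subseteq> deg_space (m l) (n l)) \<and>
        tilde_o n (\<lambda>l. measure_pmf.prob (D l) (B l)) \<and>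
        R \<in> O(\<lambda>l. real (n l) powr (- b)) \<and>
        (\<forall>\<^sub>F l in sequentially. \<forall>\<omega> \<in> deg_space (m l) (n l) - B l.
           \<exists>\<delta>. \<bar>\<delta>\<bar> \<le> R l \<and> pmf (D l) \<omega> = (1 + \<delta>) * pmf (D' l) \<omega>)) \<and>
     (\<exists>R r. R \<in> O(\<lambda>l. real (n l) powr (- b)) \<and> tilde_o n r \<and>
        (\<forall>\<^sub>F l in sequentially. \<forall>E \<subseteq> deg_space (m l) (n l).
           \<exists>\<delta> \<eta>. \<bar>\<delta>\<bar> \<le> R l \<and> \<bar>\<eta>\<bar> \<le> r l \<and>
             measure_pmf.prob (D l) E = (1 + \<delta>) * measure_pmf.prob (D' l) E + \<eta>)) \<and>
     (\<exists>R r. R \<in> O(\<lambda>l. real (n l) powr (- b)) \<and> tilde_o n r \<and>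
        (\<forall>\<^sub>F l in sequentially. \<forall>X :: degrees \<Rightarrow> real.
           \<exists>\<delta> \<eta>. \<bar>\<delta>\<bar> \<le> R l \<and> \<bar>\<eta>\<bar> \<le> r l \<and>
             measure_pmf.expectation (D l) X =
               measure_pmf.expectation (D' l) X
               + \<delta> * measure_pmf.expectation (D' l) (\<lambda>\<omega>. \<bar>X \<omega>\<bar>)
               + \<eta> * Max ((\<lambda>\<omega>. \<bar>X \<omega>\<bar>) ` deg_space (m l) (n l)))) \<and>
     (\<exists>R r. R \<in> O(\<lambda>l. real (n l) powr (- b)) \<and> tilde_o n r \<and>
        (\<forall>\<^sub>F l in sequentially. \<forall>X :: degrees \<Rightarrow> real.
           \<exists>\<delta> \<eta>. \<bar>\<delta>\<bar> \<le> R l \<and> \<bar>\<eta>\<bar> \<le> r l \<and>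
             measure_pmf.variance (D l) X =
               (1 + \<delta>) * measure_pmf.variance (D' l) X
               + \<eta> * Max ((\<lambda>\<omega>. (X \<omega>) ^ 2) ` deg_space (m l) (n l))))"
      by (rule goal) simp
  qed
qed

end
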